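(* There is a constant $c>0$ such that for all $\varepsilon\in(0,1]$ and all $\gamma\in\mathbb R$ $$c\min\Big\{-\gamma^2,\ \frac1{c^2}\varepsilon^{2/3}-|\gamma|\Big\}\le\inf\{E_\varepsilon[u]-\gamma M'(u):u\in W^{1,2}(\Omega;\mathbb R^3)\}\le\frac1c\min\Big\{-\gamma^2,\ c^2\varepsilon^{2/3}-|\gamma|\Big\}.$$
   Context: Let $\Omega:=(-1,1)^3$. For $u\in W^{1,2}(\Omega;\mathbb R^3)$ let $e(u):=\frac12(Du+Du^T)$ with entries $e_{ij}(u)=\frac12(\partial_{x_j}u_i+\partial_{x_i}u_j)$. Elastic energy: $E_{\mathrm{el}}[u]:=\int_\Omega W(e(u))\,dx$, where for symmetric $\xi\in\mathbb R^{3\times3}$ $$W(\xi):=\begin{cases}\xi_{11}^2+\xi_{22}^2+\xi_{33}^2+2\xi_{12}^2+2\xi_{13}^2 & \text{if }|\xi_{23}|=1,\\ \infty&\text{otherwise.}\end{cases}$$ Surface energy: $E_{\mathrm{sur}}[u]:=\int_\Omega|D(e_{23}(u))|\,dx$, interpreted as the total variation of the measure $D(e_{23}(u))$ on $\Omega$ if $e_{23}(u)\in BV(\Omega)$, and as $\infty$ otherwise. Total energy: $E_\varepsilon[u]:=E_{\mathrm{el}}[u]+\varepsilon E_{\mathrm{sur}}[u]\in[0,\infty]$. The linear functional $M':W^{1,2}(\Omega;\mathbb R^3)\to\mathbb R$ is defined (using traces on the faces $x_3=\pm1$) by $$M'(u):=\int_{(-1,1)^2}x_2\,\big(u_1(x_1,x_2,1)-u_1(x_1,x_2,-1)\big)\,d\mathcal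 L^2(x_1,x_2).$$ *)

theory Defs
  imports "HOL-Analysis.Analysis"
begin

section \<open>Test functions\<close>

definition partial_deriv :: "'n \<Rightarrow> (real ^ 'n \<Rightarrow> real) \<Rightarrow> real ^ 'n \<Rightarrow> real" where
  "partial_deriv i f x = frechet_derivative f (at x) (axis i 1)"

text \<open>\<open>C1_compact S\<close> is the space \<open>C\<^sub>c\<^sup>1(S)\<close> for open \<open>S\<close>; its elements are extended
  by zero to the whole space.\<close>

definition C1_compact :: "(real ^ 'n) set \<Rightarrow> (real ^ 'n \<Rightarrow> real) set" where
  "C1_compact S =
    {\<phi>. (\<forall>x. \<phi> differentiable (at x)) \<and> (\<forall>i. continuous_on UNIV (partial_deriv i \<phi>)) \<and>
         compact (closure {x. \<phi> x \<noteq> 0}) \<and> closure {x. \<phi> x \<noteq> 0} \<subseteq> S}"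

section \<open>Sobolev functions\<close>

text \<open>Elements of \<open>L\<^sup>2\<close>, \<open>W\<^sup>1\<^sup>,\<^sup>2\<close> and so on are represented by functions rather than by classes
  of functions that agree almost everywhere; values outside \<open>S\<close> are irrelevant.\<close>

definition locally_integrable_on :: "('a :: euclidean_space \<Rightarrow> real) \<Rightarrow> 'a set \<Rightarrow> bool" where
  "locally_integrable_on f S \<longleftrightarrow> (\<forall>K. compact K \<and> K \<subseteq> S \<longrightarrow> integrable (lebesgue_on K) f)"

definition square_integrable_on :: "('a :: euclidean_space \<Rightarrow> real) \<Rightarrow> 'a set \<Rightarrow> bool" where
  "square_integrable_on f S \<longleftrightarrow>
    f \<in> borel_measurable (lebesgue_on S) \<and> integrable (lebesgue_on S) (\<lambda>x. (f x)\<^sup>2)"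

text \<open>Weak derivatives are tested with \<open>C\<^sub>c\<^sup>1\<close> functions, as in Evans and Gariepy.\<close>

definition has_weak_partial ::
    "(real ^ 'n) set \<Rightarrow> 'n \<Rightarrow> (real ^ 'n \<Rightarrow> real) \<Rightarrow> (real ^ 'n \<Rightarrow> real) \<Rightarrow> bool" where
  "has_weak_partial S i f g \<longleftrightarrow>
    locally_integrable_on f S \<and> locally_integrable_on g S \<and>
    (\<forall>\<phi> \<in> C1_compact S.
      (LINT x|lebesgue_on S. f x * partial_deriv i \<phi> x) = - (LINT x|lebesgue_on S. g x * \<phi> x))"

text \<open>The weak derivative is unique only up to null sets; this picks a representative.\<close>

definition weak_partial ::
    "(real ^ 'n) set \<Rightarrow> 'n \<Rightarrow> (real ^ 'n \<Rightarrow> real) \<Rightarrow> real ^ 'n \<Rightarrow> real" where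
  "weak_partial S i f = (SOME g. has_weak_partial S i f g)"

definition W12 :: "(real ^ 'n) set \<Rightarrow> (real ^ 'n \<Rightarrow> real) set" where
  "W12 S = {f. square_integrable_on f S \<and>
               (\<forall>i. \<exists>g. has_weak_partial S i f g \<and> square_integrable_on g S)}"

definition W12_norm :: "(real ^ 'n) set \<Rightarrow> (real ^ 'n \<Rightarrow> real) \<Rightarrow> real" where
  "W12_norm S f =
    sqrt ((LINT x|lebesgue_on S. (f x)\<^sup>2) +
          (\<Sum>i\<in>UNIV. LINT x|lebesgue_on S. (weak_partial S i f x)\<^sup>2))"

definition W12_vec :: "(real ^ 'n) set \<Rightarrow> (real ^ 'n \<Rightarrow> real ^ 'm) set" where
  "W12_vec S = {u. \<forall>i. (\<lambda>x. u x $ i) \<in> W12 S}"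

section \<open>Functions of bounded variation\<close>

definition divergence :: "(real ^ 'n \<Rightarrow> real ^ 'n) \<Rightarrow> real ^ 'n \<Rightarrow> real" where
  "divergence \<phi> x = (\<Sum>i\<in>UNIV. partial_deriv i (\<lambda>y. \<phi> y $ i) x)"

text \<open>The total variation of the distributional gradient of \<open>f\<close> over the open set \<open>S\<close>.
  Negative integrals are truncated to \<open>0\<close> by the coercion, which does not change the
  supremum because \<open>\<phi> = 0\<close> is admissible.\<close>

definition total_variation :: "(real ^ 'n) set \<Rightarrow> (real ^ 'n \<Rightarrow> real) \<Rightarrow> ennreal" where
  "total_variation S f =
    (SUP \<phi> \<in> {\<phi> :: real ^ 'n \<Rightarrow> real ^ 'n.
                 (\<forall>i. (\<lambda>x. \<phi> x $ i) \<in> C1_compact S) \<and> (\<forall>x. norm (\<phi> x) \<le> 1)}.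
       ennreal (LINT x|lebesgue_on S. f x * divergence \<phi> x))"

definition BV :: "(real ^ 'n) set \<Rightarrow> (real ^ 'n \<Rightarrow> real) set" where
  "BV S = {f. integrable (lebesgue_on S) f \<and> total_variation S f < \<infinity>}"

section \<open>The energy\<close>

definition Omega :: "(real ^ 3) set" where
  "Omega = {x. \<forall>i. - 1 < x $ i \<and> x $ i < 1}"

definition strain :: "(real ^ 3 \<Rightarrow> real ^ 3) \<Rightarrow> real ^ 3 \<Rightarrow> real ^ 3 ^ 3" where
  "strain u x =
    (\<chi> i j. (weak_partial Omega j (\<lambda>y. u y $ i) x + weak_partial Omega i (\<lambda>y. u y $ j) x) / 2)"

definition energy_density :: "real ^ 3 ^ 3 \<Rightarrow> ennreal" where
  "energy_density \<xi> =
    (if \<bar>\<xi> $ 2 $ 3\<bar> = 1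
     then ennreal ((\<xi> $ 1 $ 1)\<^sup>2 + (\<xi> $ 2 $ 2)\<^sup>2 + (\<xi> $ 3 $ 3)\<^sup>2 + 2 * (\<xi> $ 1 $ 2)\<^sup>2 + 2 * (\<xi> $ 1 $ 3)\<^sup>2)
     else \<infinity>)"

definition elastic_energy :: "(real ^ 3 \<Rightarrow> real ^ 3) \<Rightarrow> ennreal" where
  "elastic_energy u = (\<integral>\<^sup>+ x. energy_density (strain u x) \<partial>lebesgue_on Omega)"

definition surface_energy :: "(real ^ 3 \<Rightarrow> real ^ 3) \<Rightarrow> ennreal" where
  "surface_energy u =
    (if (\<lambda>x. strain u x $ 2 $ 3) \<in> BV Omega
     then total_variation Omega (\<lambda>x. strain u x $ 2 $ 3) else \<infinity>)"

definition total_energy :: "real \<Rightarrow> (real ^ 3 \<Rightarrow> real ^ 3) \<Rightarrow> ennreal" where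
  "total_energy \<epsilon> u = elastic_energy u + ennreal \<epsilon> * surface_energy u"

section \<open>Traces and the functional \<open>M'\<close>\<close>

definition face :: "(real ^ 2) set" where
  "face = {y. \<forall>i. - 1 < y $ i \<and> y $ i < 1}"

definition face_point :: "real \<Rightarrow> real ^ 2 \<Rightarrow> real ^ 3" where
  "face_point s y = vector [y $ 1, y $ 2, s]"

text \<open>The trace operator on the face \<open>x\<^sub>3 = s\<close> (for \<open>s = 1\<close> and \<open>s = -1\<close>) is the continuous
  extension of the restriction map from \<open>W\<^sup>1\<^sup>,\<^sup>2\<close> functions that are continuous up to the
  boundary, where \<open>L\<^sup>2\<close> convergence is used on the face. Its value is unique up to null sets of
  the face, and \<open>face_trace\<close> picks a representative.\<close>

definition has_face_trace :: "real \<Rightarrow> (real ^ 3 \<Rightarrow> real) \<Rightarrow> (real ^ 2 \<Rightarrow> real) \<Rightarrow> bool" where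
  "has_face_trace s f g \<longleftrightarrow>
    square_integrable_on g face \<and>
    (\<exists>v :: nat \<Rightarrow> real ^ 3 \<Rightarrow> real.
       (\<forall>n. v n \<in> W12 Omega \<and> continuous_on (closure Omega) (v n)) \<and>
       (\<lambda>n. W12_norm Omega (\<lambda>x. v n x - f x)) \<longlonglongrightarrow> 0 \<and>
       (\<lambda>n. LINT y|lebesgue_on face. (v n (face_point s y) - g y)\<^sup>2) \<longlonglongrightarrow> 0)"

definition face_trace :: "real \<Rightarrow> (real ^ 3 \<Rightarrow> real) \<Rightarrow> real ^ 2 \<Rightarrow> real" where
  "face_trace s f = (SOME g. has_face_trace s f g)"

definition M' :: "(real ^ 3 \<Rightarrow> real ^ 3) \<Rightarrow> real" where
  "M' u = (LINT y|lebesgue_on face.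
             y $ 2 * (face_trace 1 (\<lambda>x. u x $ 1) y - face_trace (- 1) (\<lambda>x. u x $ 1) y))"

end

theory Submission
  imports Defs
begin

text \<open>Lower bound. Integrating by parts against an explicit product kernel, \<open>M' u\<close> differs from
  \<open>\<integral> (\<partial>\<^sub>3 u\<^sub>2 + \<partial>\<^sub>2 u\<^sub>3) kap\<close> by at most a multiple of the \<open>L\<^sup>2\<close> norm \<open>S\<close> of the five controlled
  strain components, so with the phase function \<open>\<chi> = e\<^sub>2\<^sub>3 = \<plusminus>1\<close> only the \<open>L\<^sup>1\<close> norm of an \<open>x\<^sub>1\<close>-difference
  of \<open>\<chi>\<close> has to be estimated. Linear elasticity makes \<open>u\<^sub>2\<close> and \<open>u\<^sub>3\<close> almost affine in \<open>x\<^sub>1\<close>: their second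
  \<open>x\<^sub>1\<close>-differences are \<open>O(S)\<close> in \<open>L\<^sup>2\<close>. After mollification at scale \<open>h\<close>, the second difference of \<open>\<chi>\<close>
  is therefore \<open>O(S / h)\<close> in \<open>L\<^sup>2\<close>, up to an \<open>L\<^sup>1\<close> error \<open>h |D \<chi>|\<close>. Since \<open>\<chi>\<close> takes the values \<open>\<plusminus>1\<close> only,
  its first difference is bounded by the square of its second difference, and hence
  \<open>|M' u| \<le> C (S + S\<^sup>2 / h\<^sup>2 + h |D \<chi>|)\<close>. The choice \<open>h = \<epsilon>\<^sup>1\<^sup>/\<^sup>3 / 4\<close> gives
  \<open>|M' u| \<le> C (E\<^sup>1\<^sup>/\<^sup>2 + \<epsilon>\<^sup>-\<^sup>2\<^sup>/\<^sup>3 E)\<close>; Young's inequality does the rest.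

  Upper bound. The map \<open>(t x\<^sub>2 x\<^sub>3, x\<^sub>3, x\<^sub>2)\<close> gives the quadratic term. For the linear one, take
  \<open>\<plusminus>(x\<^sub>2 x\<^sub>3, - x\<^sub>1 x\<^sub>3, - x\<^sub>1 x\<^sub>2) / 2\<close> and correct the third component by a fine laminate in \<open>x\<^sub>2\<close> with about
  \<open>\<epsilon>\<^sup>-\<^sup>1\<^sup>/\<^sup>3\<close> layers, whose volume fraction depends on \<open>x\<^sub>1\<close>.\<close>

text \<open>Two of Saint-Venant's compatibility relations carry the lower bound. Up to derivatives
  of the five strains in the energy, \<partial>_2 \<partial>_3 u_1 equals - \<partial>_1 \<chi>, and
  \<partial>_1^2 \<chi> vanishes. \<open>M' u\<close> is a weighted mean of \<partial>_3 u_1, so the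
  first relation turns it into an x_1-difference of \<chi>; the second makes \<chi> nearly affine in
  x_1. The obstacle is that both hold only in negative norms: every derivative must be moved to a
  kernel that vanishes at the boundary or has mean zero. The weight x_2 does neither, hence the
  special treatment of the edges and the one-dimensional profiles with prescribed moments. The
  length h balances S^2 / h^2 against h |D \<chi>|, where S^2 <= C E and |D \<chi>| <= E /
  \<epsilon>; this gives h of order \<epsilon>^(1/3). The resulting bound is too weak once
  |\<gamma>| exceeds a multiple of \<epsilon>^(2/3), so the cruder |M' u| <= C (1 + E^(1/2)) is
  carried along. Both bounds on the infimum are proved for every sufficiently large c, because the
  theorem asks for one c on both sides.\<close>

lemmas LI_add = Bochner_Integration.integrable_add
lemmas LI_bound = Bochner_Integration.integrable_bound
lemmas LI_diff = Bochner_Integration.integrable_diff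
lemmas LINT_add = Bochner_Integration.integral_add
lemmas LINT_cong = Bochner_Integration.integral_cong
lemmas LINT_diff = Bochner_Integration.integral_diff
lemmas LINT_nonneg = Bochner_Integration.integral_nonneg
lemmas LINT_norm_bound = Bochner_Integration.integral_norm_bound_integral
lemmas LINT_sum = Bochner_Integration.integral_sum
lemmas LI_sum = Bochner_Integration.integrable_sum

abbreviation borelf :: "('a :: topological_space \<Rightarrow> 'b :: topological_space) set" where "borelf \<equiv> borel_measurable borel"

section \<open>Slicing the cube\<close>

text \<open>The x_i-lines of the cube are \<open>ins i y t\<close> with \<open>y\<close> in the
  face, and \<open>del i\<close> projects along them. Keeping \<open>i\<close> a parameter gives
  Fubini in all three directions at once.\<close>

definition ins :: "3 \<Rightarrow> real ^ 2 \<Rightarrow> real \<Rightarrow> real ^ 3" where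
	"ins i y t = (\<chi> j. if j = i then t else if j = (if i = 1 then 2 else 1) then y $ 1 else y $ 2)"

definition upd :: "real ^ 3 \<Rightarrow> 3 \<Rightarrow> real \<Rightarrow> real ^ 3" where
	"upd x i t = (\<chi> j. if j = i then t else x $ j)"

definition del :: "3 \<Rightarrow> real ^ 3 \<Rightarrow> real ^ 2" where
	"del i x = (\<chi> k. if k = 1 then x $ (if i = 1 then 2 else 1) else x $ (if i = 3 then 2 else 3))"

lemma ins_nth_same [simp]: "ins i y t $ i = t"
	by (simp add: ins_def)

lemma upd_nth [simp]: "upd x i t $ j = (if j = i then t else x $ j)"
	by (simp add: upd_def)

lemma upd_ins [simp]: "upd (ins i y t) i r = ins i y r"
	by (simp add: upd_def ins_def vec_eq_iff)

lemma upd_upd [simp]: "upd (upd x i t) i r = upd x i r"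
	by (simp add: upd_def vec_eq_iff)

lemma upd_same [simp]: "upd x i (x $ i) = x"
	by (simp add: upd_def vec_eq_iff)

lemma upd_commute: "i \<noteq> j ==> upd (upd x i t) j r = upd (upd x j r) i t"
	by (auto simp: upd_def vec_eq_iff)

lemma face_point_eq_ins: "face_point s y = ins 3 y s"
	by (simp add: face_point_def ins_def vec_eq_iff forall_3)

lemma continuous_on_ins [continuous_intros]:
	assumes "continuous_on S f" "continuous_on S g"
	shows "continuous_on S (%x. ins i (f x) (g x))"
	unfolding ins_def
	by (rule continuous_on_vec_lambda, rename_tac j, case_tac "j = i"; case_tac "i = 1"; case_tac "j = 1"; case_tac "j = 2")
		(simp_all add: assms continuous_intros)

lemma continuous_on_upd [continuous_intros]:
	assumes "continuous_on S f" "continuous_on S g"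
	shows "continuous_on S (%x. upd (f x) i (g x))"
	unfolding upd_def
	by (rule continuous_on_vec_lambda, rename_tac j, case_tac "j = i") (simp_all add: assms continuous_intros)

lemma borel_measurable_continuous2:
	fixes h :: "'b :: euclidean_space \<Rightarrow> 'c :: euclidean_space \<Rightarrow> 'd :: topological_space"
	assumes h: "continuous_on UNIV (%p. h (fst p) (snd p))"
		and "f \<in> borel_measurable M" "g \<in> borel_measurable M"
	shows "(%x. h (f x) (g x)) \<in> borel_measurable M"
proof -
	have "(%p. h (fst p) (snd p)) \<in> borelf"
		by (rule borel_measurable_continuous_onI[OF h])
	from measurable_compose[OF borel_measurable_Pair[OF assms(2,3)] this] show ?thesis by simp
qed

lemma borel_measurable_ins [measurable (raw)]:
	assumes "f \<in> borel_measurable M" "g \<in> borel_measurable M"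
	shows "(%x. ins i (f x) (g x)) \<in> borel_measurable M"
	by (rule borel_measurable_continuous2[OF _ assms]) (intro continuous_intros)

lemma borel_measurable_upd [measurable (raw)]:
	assumes "f \<in> borel_measurable M" "g \<in> borel_measurable M"
	shows "(%x. upd (f x) i (g x)) \<in> borel_measurable M"
	by (rule borel_measurable_continuous2[OF _ assms]) (intro continuous_intros)

lemma borel_measurable_vec_nth' [measurable (raw)]:
	fixes f :: "'a \<Rightarrow> real ^ 'n"
	assumes "f \<in> borel_measurable M"
	shows "(%x. f x $ i) \<in> borel_measurable M"
	by (rule measurable_compose[OF assms borel_measurable_continuous_onI]) (intro continuous_intros)

lemma prod_Basis_vec: "(\<Prod>b\<in>Basis. (x :: real ^ 'n) \<bullet> b) = (\<Prod>i\<in>UNIV. x $ i)"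
	by (simp add: Basis_vec_def cart_eq_inner_axis axis_eq_axis prod.UNION_disjoint)

lemma prod_UNIV_3: "(\<Prod>i\<in>UNIV. f i) = f (1 :: 3) * f 2 * (f 3 :: real)"
	unfolding UNIV_3 by simp

lemma prod_UNIV_2: "(\<Prod>i\<in>UNIV. f i) = f (1 :: 2) * (f 2 :: real)"
	unfolding UNIV_2 by simp

text \<open>Checked on boxes: the preimage of a box is its projection times its i-th side, and the
  volumes multiply. All slicing below rests on this.\<close>

lemma lborel_ins: "(lborel :: (real ^ 3) measure) = distr (lborel \<Otimes>\<^sub>M lborel) borel (%(y, t). ins i y t)"
proof (rule lborel_eqI)
	fix l u :: "real ^ 3"
	assume "\<And>b. b \<in> Basis ==> l \<bullet> b <= u \<bullet> b"
	then have lu: "l $ j <= u $ j" for j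
		by (auto simp: Basis_vec_def cart_eq_inner_axis)
	have eq: "(%(y, t). ins i y t) -` box l u = box (del i l) (del i u) \<times> box (l $ i) (u $ i)"
		using exhaust_3[of i] by (auto simp: mem_box_cart forall_3 forall_2 ins_def del_def)
	have m: "(%(y, t). ins i y t) \<in> borel_measurable (lborel \<Otimes>\<^sub>M lborel)"
		unfolding split_beta by measurable
	have "emeasure (distr (lborel \<Otimes>\<^sub>M lborel) borel (%(y, t). ins i y t)) (box l u)
			= emeasure (lborel \<Otimes>\<^sub>M lborel) (box (del i l) (del i u) \<times> box (l $ i) (u $ i))"
		using m by (subst emeasure_distr) (auto simp: eq space_pair_measure)
	also have "... = emeasure lborel (box (del i l) (del i u)) * emeasure lborel (box (l $ i) (u $ i))"
		by (intro lborel.emeasure_pair_measure_Times) auto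
	also have "... = ennreal (\<Prod>j\<in>UNIV. del i u $ j - del i l $ j) * ennreal (u $ i - l $ i)"
	proof -
		have "emeasure lborel (box (del i l) (del i u)) = ennreal (\<Prod>b\<in>Basis. (del i u - del i l) \<bullet> b)"
			by (rule emeasure_lborel_box) (auto simp: Basis_vec_def cart_eq_inner_axis[symmetric] inner_commute[of "axis _ _"] lu del_def inner_axis)
		moreover have "emeasure lborel (box (l $ i) (u $ i)) = ennreal (u $ i - l $ i)"
			using lu[of i] by (subst emeasure_lborel_box) auto
		ultimately show ?thesis by (simp add: prod_Basis_vec)
	qed
	also have "... = ennreal (\<Prod>j\<in>UNIV. u $ j - l $ j)"
		using exhaust_3[of i] lu
		by (auto simp: prod_UNIV_3 prod_UNIV_2 del_def ennreal_mult'' [symmetric] mult_ac)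
	finally show "emeasure (distr (lborel \<Otimes>\<^sub>M lborel) borel (%(y, t). ins i y t)) (box l u)
			= (\<Prod>b\<in>Basis. (u - l) \<bullet> b)"
		by (simp add: prod_Basis_vec)
qed simp

section \<open>Lebesgue measure on the cube, the line and the face, and Fubini along coordinate
  lines\<close>

abbreviation Q :: "(real ^ 3) measure" where "Q \<equiv> restrict_space lborel Omega"
abbreviation J :: "real measure" where "J \<equiv> restrict_space lborel {-1<..<1}"
abbreviation Qf :: "(real ^ 2) measure" where "Qf \<equiv> restrict_space lborel face"

lemma Omega_box: "Omega = box (\<chi> i. - 1) (\<chi> i. 1)"
	by (auto simp: Omega_def mem_box_cart)

lemma face_box: "face = box (\<chi> i. - 1) (\<chi> i. 1)"
	by (auto simp: face_def mem_box_cart)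

lemma sets_Omega [measurable]: "Omega \<in> sets borel"
	by (simp add: Omega_box)

lemma sets_face [measurable]: "face \<in> sets borel"
	by (simp add: face_box)

lemma ins_in_Omega [simp]: "ins i y t \<in> Omega \<longleftrightarrow> y \<in> face \<and> - 1 < t \<and> t < 1"
	using exhaust_3[of i] by (auto simp: Omega_def face_def ins_def forall_3 forall_2)

lemma upd_in_Omega [simp]: "x \<in> Omega ==> upd x i t \<in> Omega \<longleftrightarrow> - 1 < t \<and> t < 1"
	by (auto simp: Omega_def)

lemma space_Q [simp]: "space Q = Omega" by (simp add: space_restrict_space)
lemma space_J [simp]: "space J = {-1<..<1}" by (simp add: space_restrict_space)
lemma space_Qf [simp]: "space Qf = face" by (simp add: space_restrict_space)

lemma finite_measure_Q: "finite_measure Q"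
	by (rule finite_measureI) (use emeasure_lborel_box_finite in \<open>simp add: emeasure_restrict_space Omega_box top.not_eq_extremum\<close>)

lemma finite_measure_J: "finite_measure J"
	by (rule finite_measureI) (simp add: emeasure_restrict_space)

lemma finite_measure_Qf: "finite_measure Qf"
	by (rule finite_measureI) (use emeasure_lborel_box_finite in \<open>simp add: emeasure_restrict_space face_box top.not_eq_extremum\<close>)

interpretation Q: finite_measure Q by (rule finite_measure_Q)
interpretation J: finite_measure J by (rule finite_measure_J)
interpretation Qf: finite_measure Qf by (rule finite_measure_Qf)
interpretation QfJ: pair_sigma_finite Qf J ..
interpretation QJ: pair_sigma_finite Q J ..

lemma borel_measurable_Q: "f \<in> borelf ==> f \<in> borel_measurable Q"
	by (rule measurable_restrict_space1) simp

lemma measurable_J_lborel: "(%x. x) \<in> borel_measurable J"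
	by (rule measurable_restrict_space1) simp
lemma measurable_Qf_lborel: "(%x. x) \<in> borel_measurable Qf"
	by (rule measurable_restrict_space1) simp

lemma measurable_ins_QfJ: "(%(y, t). ins i y t) \<in> measurable (Qf \<Otimes>\<^sub>M J) Q"
proof (rule measurable_restrict_space2)
	show "(%(y, t). ins i y t) \<in> space (Qf \<Otimes>\<^sub>M J) \<rightarrow> Omega"
		by (auto simp: space_pair_measure)
	show "(%(y, t). ins i y t) \<in> measurable (Qf \<Otimes>\<^sub>M J) lborel"
		unfolding split_beta measurable_lborel1
		by (intro borel_measurable_ins measurable_compose[OF measurable_fst measurable_Qf_lborel]
					measurable_compose[OF measurable_snd measurable_J_lborel])
qed

lemma nn_integral_ins_lborel:
	fixes F :: "real ^ 3 \<Rightarrow> ennreal"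
	assumes [measurable]: "F \<in> borelf"
	shows "(\<integral>\<^sup>+x. F x \<partial>lborel) = (\<integral>\<^sup>+y. \<integral>\<^sup>+t. F (ins i y t) \<partial>lborel \<partial>lborel)"
proof -
	have m: "(%(y, t). ins i y t) \<in> borel_measurable (lborel \<Otimes>\<^sub>M lborel)"
		unfolding split_beta by measurable
	have "(\<integral>\<^sup>+x. F x \<partial>lborel) = (\<integral>\<^sup>+p. F (ins i (fst p) (snd p)) \<partial>(lborel \<Otimes>\<^sub>M lborel))"
		by (subst lborel_ins[of i], subst nn_integral_distr[OF m]) (auto simp: split_beta)
	also have "... = (\<integral>\<^sup>+y. \<integral>\<^sup>+t. F (ins i y t) \<partial>lborel \<partial>lborel)"
		by (subst lborel.nn_integral_fst[symmetric]) auto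
	finally show ?thesis .
qed

lemma nn_integral_Q:
	fixes F :: "real ^ 3 \<Rightarrow> ennreal"
	assumes [measurable]: "F \<in> borelf"
	shows "(\<integral>\<^sup>+x. F x \<partial>Q) = (\<integral>\<^sup>+y. \<integral>\<^sup>+t. F (ins i y t) \<partial>J \<partial>Qf)"
proof -
	have "(\<integral>\<^sup>+x. F x \<partial>Q) = (\<integral>\<^sup>+x. F x * indicator Omega x \<partial>lborel)"
		by (subst nn_integral_restrict_space) auto
	also have "... = (\<integral>\<^sup>+y. \<integral>\<^sup>+t. F (ins i y t) * indicator Omega (ins i y t) \<partial>lborel \<partial>lborel)"
		by (rule nn_integral_ins_lborel) auto
	also have "... = (\<integral>\<^sup>+y. (\<integral>\<^sup>+t. F (ins i y t) * indicator {-1<..<1} t \<partial>lborel) * indicator face y \<partial>lborel)"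
		by (intro nn_integral_cong, subst nn_integral_multc[symmetric])
			(auto intro!: nn_integral_cong simp: indicator_def)
	finally show ?thesis
		by (simp add: nn_integral_restrict_space)
qed

text \<open>Exhibiting \<open>Q\<close> as an image measure transfers integrability and signed
  integrals to slices, not only integrals of nonnegative functions.\<close>

lemma distr_ins_Q: "distr (Qf \<Otimes>\<^sub>M J) Q (%(y, t). ins i y t) = Q"
proof (rule measure_eqI)
	fix A assume "A \<in> sets (distr (Qf \<Otimes>\<^sub>M J) Q (%(y, t). ins i y t))"
	then have AQ: "A \<in> sets Q" by simp
	then have A: "A \<in> sets borel" "A \<subseteq> Omega" by (auto simp: sets_restrict_space)
	have "emeasure (distr (Qf \<Otimes>\<^sub>M J) Q (%(y, t). ins i y t)) A
			= (\<integral>\<^sup>+x. indicator A x \<partial>(distr (Qf \<Otimes>\<^sub>M J) Q (%(y, t). ins i y t)))"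
		using AQ by simp
	also have "... = (\<integral>\<^sup>+p. indicator A (ins i (fst p) (snd p)) \<partial>(Qf \<Otimes>\<^sub>M J))"
		using AQ by (subst nn_integral_distr[OF measurable_ins_QfJ]) (auto simp: split_beta)
	also have "... = (\<integral>\<^sup>+y. \<integral>\<^sup>+t. indicator A (ins i y t) \<partial>J \<partial>Qf)"
		using measurable_compose[OF measurable_ins_QfJ borel_measurable_indicator[OF AQ], of i]
		by (subst J.nn_integral_fst[symmetric]) (auto simp: split_beta)
	also have "... = (\<integral>\<^sup>+x. indicator A x \<partial>Q)"
		using A by (intro nn_integral_Q[symmetric]) auto
	finally show "emeasure (distr (Qf \<Otimes>\<^sub>M J) Q (%(y, t). ins i y t)) A = emeasure Q A"
		using AQ by simp
qed simp

lemma integral_Q: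
	fixes F :: "real ^ 3 \<Rightarrow> real"
	assumes "integrable Q F"
	shows "(LINT x|Q. F x) = (LINT y|Qf. LINT t|J. F (ins i y t))"
		and "integrable Qf (%y. LINT t|J. F (ins i y t))"
		and "AE y in Qf. integrable J (%t. F (ins i y t))"
proof -
	have FM: "F \<in> borel_measurable Q" using assms by simp
	have int: "integrable (Qf \<Otimes>\<^sub>M J) (%(y, t). F (ins i y t))"
		using integrable_distr[OF measurable_ins_QfJ[of i], of F] assms
		unfolding distr_ins_Q by (simp add: split_beta')
	have "(LINT x|Q. F x) = (LINT p|(Qf \<Otimes>\<^sub>M J). F (ins i (fst p) (snd p)))"
		using integral_distr[OF measurable_ins_QfJ[of i] FM] unfolding distr_ins_Q by (simp add: split_beta')
	also have "... = (LINT y|Qf. LINT t|J. F (ins i y t))"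
		using QfJ.integral_fst'[OF int] by (simp add: split_beta')
	finally show "(LINT x|Q. F x) = (LINT y|Qf. LINT t|J. F (ins i y t))" .
	show "integrable Qf (%y. LINT t|J. F (ins i y t))"
		using QfJ.integrable_fst'[OF int] by simp
	show "AE y in Qf. integrable J (%t. F (ins i y t))"
		using QfJ.AE_integrable_fst'[OF int] by simp
qed

section \<open>Cauchy-Schwarz and the passage from L^2 to L^1\<close>

lemma cauchy_schwarz_integral:
	fixes f g :: "'a \<Rightarrow> real"
	assumes [measurable]: "f \<in> borel_measurable M" "g \<in> borel_measurable M"
		and f: "integrable M (%x. (f x)\<^sup>2)" and g: "integrable M (%x. (g x)\<^sup>2)"
	shows "integrable M (%x. f x * g x)"
		and "(LINT x|M. f x * g x)\<^sup>2 <= (LINT x|M. (f x)\<^sup>2) * (LINT x|M. (g x)\<^sup>2)"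
proof -
	have "2 * \<bar>a * b\<bar> <= a\<^sup>2 + b\<^sup>2" for a b :: real
		using sum_squares_bound[of "\<bar>a\<bar>" "\<bar>b\<bar>"] by (simp add: abs_mult)
	then have "norm (f x * g x) <= norm ((f x)\<^sup>2 + (g x)\<^sup>2)" for x
		using abs_ge_zero[of "f x * g x"] by (smt (verit) real_norm_def)
	then show fg: "integrable M (%x. f x * g x)"
		by (intro LI_bound[OF LI_add[OF f g]]) auto
	let ?A = "LINT x|M. (f x)\<^sup>2" and ?B = "LINT x|M. (g x)\<^sup>2" and ?C = "LINT x|M. f x * g x"
	\<comment> \<open>Discriminant argument; when \<open>?B = 0\<close> the polynomial is affine in t,
	  and being bounded below it has slope 0.\<close>
	have q: "0 <= ?A - 2 * t * ?C + t\<^sup>2 * ?B" for t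
	proof -
		have "0 <= (LINT x|M. (f x - t * g x)\<^sup>2)" by simp
		also have "(%x. (f x - t * g x)\<^sup>2) = (%x. (f x)\<^sup>2 - 2 * t * (f x * g x) + t\<^sup>2 * (g x)\<^sup>2)"
			by (auto simp: power2_eq_square algebra_simps)
		also have "(LINT x|M. ... x) = ?A - 2 * t * ?C + t\<^sup>2 * ?B"
			using f g fg by simp
		finally show ?thesis .
	qed
	have B0: "0 <= ?B" by simp
	show "?C\<^sup>2 <= ?A * ?B"
	proof (cases "?B = 0")
		case True
		have "?C = 0"
		proof (rule ccontr)
			assume "?C \<noteq> 0"
			then have "2 * ((?A + 1) / (2 * ?C)) * ?C = ?A + 1" by (simp add: field_simps)
			with q[of "(?A + 1) / (2 * ?C)"] True show False by simp
		qed
		then show ?thesis using True by simp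
	next
		case False
		with B0 have "0 < ?B" by linarith
		with q[of "?C / ?B"] show ?thesis
			by (simp add: field_simps power2_eq_square)
	qed
qed

lemma (in finite_measure) L2_imp_L1:
	fixes f :: "'a \<Rightarrow> real"
	assumes "f \<in> borel_measurable M" "integrable M (%x. (f x)\<^sup>2)"
	shows "integrable M f"
		and "(LINT x|M. f x)\<^sup>2 <= measure M (space M) * (LINT x|M. (f x)\<^sup>2)"
		and "(LINT x|M. \<bar>f x\<bar>)\<^sup>2 <= measure M (space M) * (LINT x|M. (f x)\<^sup>2)"
	using cauchy_schwarz_integral[of f M "%_. 1"] cauchy_schwarz_integral[of "%x. \<bar>f x\<bar>" M "%_. 1"] assms
	by (simp_all add: mult.commute)

lemma measure_J [simp]: "measure J {-1<..<1} = 2"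
	by (simp add: measure_restrict_space)

text \<open>Smooth functions and integration kernels all lie in this class. It is closed under
  algebra and line integrals, so integrability over \<open>Q\<close> and over slices becomes a
  syntactic check.\<close>

definition bB :: "(real ^ 3 \<Rightarrow> real) \<Rightarrow> bool" where
	"bB F \<longleftrightarrow> F \<in> borelf \<and> (\<exists>B. \<forall>x\<in>Omega. \<bar>F x\<bar> <= B)"

lemma bB_measurable [measurable_dest]: "bB F ==> F \<in> borelf"
	by (simp add: bB_def)

lemma bB_measurable_Q: "bB F ==> F \<in> borel_measurable Q"
	by (simp add: bB_def borel_measurable_Q)

lemma bB_bound: "bB F ==> \<exists>B>0. \<forall>x\<in>Omega. \<bar>F x\<bar> <= B"
	unfolding bB_def
proof (elim conjE exE)
	fix B assume "\<forall>x\<in>Omega. \<bar>F x\<bar> <= B"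
	then have "\<forall>x\<in>Omega. \<bar>F x\<bar> <= \<bar>B\<bar> + 1" by force
	then show "\<exists>B>0. \<forall>x\<in>Omega. \<bar>F x\<bar> <= B" by (intro exI[of _ "\<bar>B\<bar> + 1"]) auto
qed

lemma bB_const: "bB (%x. c)"
	by (auto simp: bB_def)

lemma bB_add:
	assumes "bB F" "bB G" shows "bB (%x. F x + G x)"
proof -
	obtain B C where "\<forall>x\<in>Omega. \<bar>F x\<bar> <= B" "\<forall>x\<in>Omega. \<bar>G x\<bar> <= C"
		using assms by (auto simp: bB_def)
	then have "\<forall>x\<in>Omega. \<bar>F x + G x\<bar> <= B + C"
		by (auto intro: order_trans[OF abs_triangle_ineq] add_mono)
	then show ?thesis using assms by (auto simp: bB_def)
qed

lemma bB_mult: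
	assumes "bB F" "bB G" shows "bB (%x. F x * G x)"
proof -
	obtain B C where "B > 0" "C > 0" "\<forall>x\<in>Omega. \<bar>F x\<bar> <= B" "\<forall>x\<in>Omega. \<bar>G x\<bar> <= C"
		using bB_bound assms by metis
	then have "\<forall>x\<in>Omega. \<bar>F x * G x\<bar> <= B * C"
		by (auto simp: abs_mult intro!: mult_mono)
	then show ?thesis using assms by (auto simp: bB_def)
qed

lemma bB_uminus: "bB F ==> bB (%x. - F x)"
	by (auto simp: bB_def)

lemma bB_diff: "bB F ==> bB G ==> bB (%x. F x - G x)"
	using bB_add[of F "%x. - G x"] bB_uminus[of G] by simp

lemma bB_power: "bB F ==> bB (%x. (F x)\<^sup>2)"
	unfolding power2_eq_square by (rule bB_mult)

lemma bB_abs: "bB F ==> bB (%x. \<bar>F x\<bar>)"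
	by (auto simp: bB_def)

lemma bB_cont: assumes "continuous_on UNIV F" shows "bB F"
proof -
	have "compact (F ` cbox (\<chi> i. - 1) (\<chi> i. 1))"
		by (intro compact_continuous_image continuous_on_subset[OF assms]) auto
	then obtain B where "\<forall>y\<in>F ` cbox (\<chi> i. - 1) (\<chi> i. 1). norm y <= B"
		using compact_imp_bounded bounded_iff by metis
	then have "\<forall>x\<in>Omega. \<bar>F x\<bar> <= B"
		using box_subset_cbox by (auto simp: Omega_box)
	with assms show ?thesis by (auto simp: bB_def intro!: borel_measurable_continuous_onI)
qed

lemma bB_coord:
	assumes "b \<in> borelf" "\<And>t. - 1 < t ==> t < 1 ==> \<bar>b t\<bar> <= B"
	shows "bB (%x. b (x $ i))"
proof -
	have "(%x :: real ^ 3. b (x $ i)) \<in> borelf"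
		by (intro measurable_compose[OF borel_measurable_vec_nth' assms(1)]) simp
	then show ?thesis using assms(2) by (auto simp: bB_def Omega_def)
qed

lemma bB_nth: "bB (%x. x $ i)"
	by (intro bB_cont continuous_intros)

lemmas bB_intros = bB_const bB_add bB_mult bB_uminus bB_diff bB_power bB_abs bB_nth

lemma bB_integrable: assumes "bB F" shows "integrable Q F"
proof -
	obtain B where "\<forall>x\<in>Omega. \<bar>F x\<bar> <= B" using bB_bound[OF assms] by auto
	then show ?thesis using assms
		by (intro Q.integrable_const_bound[of _ B] bB_measurable_Q) (auto intro!: AE_I2)
qed

lemma bB_section: assumes "bB F" "x \<in> Omega"
	shows "(%r. F (upd x i r)) \<in> borelf" "\<exists>B. \<forall>r\<in>{-1<..<1}. \<bar>F (upd x i r)\<bar> <= B"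
		"integrable J (%r. F (upd x i r))"
proof -
	show m: "(%r. F (upd x i r)) \<in> borelf"
		by (rule measurable_compose[OF _ bB_measurable[OF assms(1)]]) measurable
	obtain B where B: "\<forall>x\<in>Omega. \<bar>F x\<bar> <= B" using bB_bound[OF assms(1)] by auto
	then show "\<exists>B. \<forall>r\<in>{-1<..<1}. \<bar>F (upd x i r)\<bar> <= B" using assms(2) by (intro exI[of _ B]) auto
	show "integrable J (%r. F (upd x i r))"
		using B assms(2) m by (intro J.integrable_const_bound[of _ B])
		(auto intro!: AE_I2 measurable_restrict_space1)
qed

lemma measurable_snd_J: "(%p. snd p) \<in> measurable (M \<Otimes>\<^sub>M J) borel"
	by (rule measurable_compose[OF measurable_snd measurable_J_lborel])

lemma measurable_fst_J: "(%p. fst p) \<in> measurable (J \<Otimes>\<^sub>M M) borel"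
	by (rule measurable_compose[OF measurable_fst measurable_J_lborel])

text \<open>The weight \<open>k\<close> covers both the full line integral (\<open>k\<close>
  constant 1) and the primitive (\<open>k\<close> an indicator), so measurability in the parameter
  is proved once.\<close>

lemma bB_line_integral:
	assumes F: "bB F" and k: "(%(s, r). k s r) \<in> borel_measurable (borel \<Otimes>\<^sub>M borel)"
		"\<And>s r. \<bar>k s r\<bar> <= (1 :: real)"
	shows "bB (%x. LINT r|J. k (x $ i) r * F (upd x i r))"
proof -
	have kk: "(%p. k ((fst p :: real ^ 3) $ i) (snd p)) \<in> borel_measurable (borel \<Otimes>\<^sub>M J)"
	proof -
		have "(%p. ((fst p :: real ^ 3) $ i, snd p)) \<in> measurable (borel \<Otimes>\<^sub>M J) (borel \<Otimes>\<^sub>M borel)"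
			by (intro measurable_Pair borel_measurable_vec_nth' measurable_snd_J measurable_fst)
		from measurable_compose[OF this k(1)] show ?thesis by simp
	qed
	have "(%p. F (upd (fst p) i (snd p))) \<in> borel_measurable (borel \<Otimes>\<^sub>M J)"
		by (rule measurable_compose[OF borel_measurable_upd[OF measurable_fst measurable_snd_J] bB_measurable[OF F]])
	with kk have m: "(%x. LINT r|J. k (x $ i) r * F (upd x i r)) \<in> borelf"
		by (intro J.borel_measurable_lebesgue_integral) (auto simp: split_beta')
	obtain B where B: "B > 0" "\<forall>x\<in>Omega. \<bar>F x\<bar> <= B" using bB_bound[OF F] by auto
	have "\<bar>LINT r|J. k (x $ i) r * F (upd x i r)\<bar> <= 2 * B" if "x \<in> Omega" for x
	proof -
		have "norm (LINT r|J. k (x $ i) r * F (upd x i r)) <= (LINT r|J. B)"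
		proof (rule LINT_norm_bound)
			show bound: "norm (k (x $ i) r * F (upd x i r)) <= B" if "r \<in> space J" for r
				using that \<open>x \<in> Omega\<close> B k(2)[of "x $ i" r] mult_mono[of "\<bar>k (x $ i) r\<bar>" 1 "\<bar>F (upd x i r)\<bar>" B]
				by (auto simp: abs_mult)
			have "(%r. k (x $ i) r) \<in> borelf"
				using measurable_compose[OF _ k(1), of "%r. (x $ i, r)" borel] by simp
			then show "integrable J (%r. k (x $ i) r * F (upd x i r))"
				using bB_section(1)[OF F that] bound
				by (intro J.integrable_const_bound[of _ B]) (auto intro!: AE_I2 measurable_restrict_space1)
		qed simp
		then show ?thesis by simp
	qed
	with m show ?thesis by (auto simp: bB_def)
qed

text \<open>The primitive along x_i-lines starting at x_i = -1. Its end value at x_i = 1 is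
  \<open>line_int i F\<close>, so the vanishing of the latter gives zero boundary values at both
  ends.\<close>

definition prim :: "3 \<Rightarrow> (real ^ 3 \<Rightarrow> real) \<Rightarrow> real ^ 3 \<Rightarrow> real" where
	"prim i F x = (LINT r|J. indicator {..x $ i} r * F (upd x i r))"

definition line_int :: "3 \<Rightarrow> (real ^ 3 \<Rightarrow> real) \<Rightarrow> real ^ 3 \<Rightarrow> real" where
	"line_int i F x = (LINT r|J. F (upd x i r))"

lemma measurable_indicator_le: "(%(s, r). indicator {..s} r :: real) \<in> borel_measurable (borel \<Otimes>\<^sub>M (borel :: real measure))"
proof -
	have eq: "(%(s, r). indicator {..s} r :: real) = (%p. if snd p <= fst p then 1 else 0)"
		by (auto simp: indicator_def)
	show ?thesis unfolding eq by measurable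
qed

lemma bB_prim: "bB F ==> bB (prim i F)"
	unfolding prim_def[abs_def] by (rule bB_line_integral[OF _ measurable_indicator_le]) (auto simp: indicator_def)

lemma bB_line_int: "bB F ==> bB (line_int i F)"
	unfolding line_int_def[abs_def] using bB_line_integral[of F "%_ _. 1"] by simp

lemma integral_line_int:
	assumes "bB F" shows "(LINT x|Q. line_int i F x) = 2 * (LINT x|Q. F x)"
	unfolding line_int_def
	using integral_Q(1)[OF bB_integrable[OF bB_line_int[OF assms]], of i i]
		integral_Q(1)[OF bB_integrable[OF assms], of i]
	by (simp add: line_int_def)

lemma line_int_bound:
	assumes F: "bB F" and k: "k \<in> borelf" "\<And>r. \<bar>k r\<bar> <= (1 :: real)" and x: "x \<in> Omega"
	shows "(LINT r|J. k r * F (upd x i r))\<^sup>2 <= 2 * line_int i (%x. (F x)\<^sup>2) x"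
proof -
	obtain B where B: "\<forall>x\<in>Omega. \<bar>F x\<bar> <= B" using bB_bound[OF F] by auto
	have mk: "k \<in> borel_measurable J" and mF: "(%r. F (upd x i r)) \<in> borel_measurable J"
		using k bB_section(1)[OF F x] by (auto intro!: measurable_restrict_space1)
	have k1: "(k r * a)\<^sup>2 <= a\<^sup>2" for r a
		using k(2)[of r] mult_right_mono[of "(k r)\<^sup>2" 1 "a\<^sup>2"] by (simp add: power_mult_distrib abs_square_le_1)
	have i1: "integrable J (%r. (F (upd x i r))\<^sup>2)"
		using bB_section(3)[OF bB_power[OF F] x] .
	have i2: "integrable J (%r. (k r * F (upd x i r))\<^sup>2)"
		using mk mF k1 by (intro LI_bound[OF i1]) auto
	have "(LINT r|J. k r * F (upd x i r))\<^sup>2 <= 2 * (LINT r|J. (k r * F (upd x i r))\<^sup>2)"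
		using J.L2_imp_L1(2)[of "%r. k r * F (upd x i r)"] mk mF i2 by simp
	also have "... <= 2 * (LINT r|J. (F (upd x i r))\<^sup>2)"
		using i1 i2 k1 by (intro mult_left_mono integral_mono) auto
	finally show ?thesis by (simp add: line_int_def)
qed

text \<open>Cauchy-Schwarz on a line of length 2 and the integration over x_i each cost a factor
  2.\<close>

lemma integral_prim_square:
	assumes F: "bB F" shows "(LINT x|Q. (prim i F x)\<^sup>2) <= 4 * (LINT x|Q. (F x)\<^sup>2)"
proof -
	have "(LINT x|Q. (prim i F x)\<^sup>2) <= (LINT x|Q. 2 * line_int i (%x. (F x)\<^sup>2) x)"
	proof (rule integral_mono)
		show "(prim i F x)\<^sup>2 <= 2 * line_int i (%x. (F x)\<^sup>2) x" if "x \<in> space Q" for x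
			using that unfolding prim_def by (intro line_int_bound[OF F]) (auto simp: indicator_def)
	qed (intro bB_integrable bB_intros bB_prim bB_line_int F)+
	also have "... = 4 * (LINT x|Q. (F x)\<^sup>2)"
		using integral_line_int[OF bB_power[OF F]] by simp
	finally show ?thesis .
qed

lemma integral_line_int_square:
	assumes F: "bB F" shows "(LINT x|Q. (line_int i F x)\<^sup>2) <= 4 * (LINT x|Q. (F x)\<^sup>2)"
proof -
	have "(LINT x|Q. (line_int i F x)\<^sup>2) <= (LINT x|Q. 2 * line_int i (%x. (F x)\<^sup>2) x)"
	proof (rule integral_mono)
		show "(line_int i F x)\<^sup>2 <= 2 * line_int i (%x. (F x)\<^sup>2) x" if "x \<in> space Q" for x
			using that line_int_bound[OF F, of "%_. 1"] unfolding line_int_def by simp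
	qed (intro bB_integrable bB_intros bB_line_int F)+
	also have "... = 4 * (LINT x|Q. (F x)\<^sup>2)"
		using integral_line_int[OF bB_power[OF F]] by simp
	finally show ?thesis .
qed

section \<open>C^1 functions and integration by parts on the cube\<close>

definition C1fun :: "(real ^ 3 \<Rightarrow> real) \<Rightarrow> bool" where
	"C1fun v \<longleftrightarrow> (\<forall>x. v differentiable (at x)) \<and> (\<forall>i. continuous_on UNIV (partial_deriv i v))"

lemma C1fun_continuous: "C1fun v ==> continuous_on UNIV v"
	unfolding C1fun_def by (meson differentiable_imp_continuous_on differentiable_on_def differentiable_at_withinI)

lemma C1fun_continuous_deriv: "C1fun v ==> continuous_on UNIV (partial_deriv i v)"
	by (simp add: C1fun_def)

lemma C1fun_bB: "C1fun v ==> bB v" "C1fun v ==> bB (partial_deriv i v)"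
	using C1fun_continuous by (auto intro!: bB_cont simp: C1fun_def)

lemma differentiable_line:
	fixes v :: "real ^ 3 \<Rightarrow> real"
	assumes "v differentiable (at (upd x i r))"
	shows "((%r. v (upd x i r)) has_real_derivative partial_deriv i v (upd x i r)) (at r)"
proof -
	have eq: "upd x i = (%s. upd x i r + (s - r) *\<^sub>R axis i 1)"
		by (simp add: fun_eq_iff vec_eq_iff axis_def)
	have "((%s. upd x i r + (s - r) *\<^sub>R axis i 1) has_derivative (%h. h *\<^sub>R axis i 1)) (at r)"
		by (auto intro!: derivative_eq_intros)
	then have 1: "(upd x i has_derivative (%h. h *\<^sub>R axis i 1)) (at r)"
		by (simp only: eq[symmetric])
	have "(v has_derivative frechet_derivative v (at (upd x i r))) (at (upd x i r))"
		using assms frechet_derivative_works by blast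
	from has_derivative_compose[OF 1 this]
	have "((%s. v (upd x i s)) has_derivative (%h. frechet_derivative v (at (upd x i r)) (h *\<^sub>R axis i 1))) (at r)" .
	moreover have "frechet_derivative v (at (upd x i r)) (h *\<^sub>R axis i 1) = h * partial_deriv i v (upd x i r)" for h
		using linear_frechet_derivative[OF assms] by (simp add: linear_cmul partial_deriv_def)
	ultimately show ?thesis by (simp add: has_field_derivative_def mult.commute[of _ "partial_deriv i v (upd x i r)"])
qed

lemma C1fun_line:
	"C1fun v ==> ((%r. v (upd x i r)) has_real_derivative partial_deriv i v (upd x i r)) (at r)"
	by (rule differentiable_line) (simp add: C1fun_def)

lemma integral_J_FTC:
	assumes w: "\<And>t. (w has_real_derivative w' t) (at t)" "continuous_on UNIV w'" and t: "- 1 < t" "t < 1"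
	shows "(LINT r|J. indicator {t..} r * w' r) = w 1 - w t"
proof -
	have [measurable]: "w' \<in> borelf" by (rule borel_measurable_continuous_onI[OF w(2)])
	have "(LINT r|J. indicator {t..} r * w' r) = (LINT r|lborel. indicator {-1<..<1} r *\<^sub>R (indicator {t..} r * w' r))"
		by (subst integral_restrict_space) auto
	also have "... = (LINT r|lborel. w' r * indicator {t..1} r)"
	proof (rule integral_cong_AE)
		show "AE r in lborel. indicator {-1<..<1} r *\<^sub>R (indicator {t..} r * w' r) = w' r * indicator {t..1} r"
			using AE_lborel_singleton[of 1] by eventually_elim (use t in \<open>auto simp: indicator_def\<close>)
	qed measurable
	also have "... = w 1 - w t"
		using t w by (intro integral_FTC_Icc_real) (auto simp: continuous_on_eq_continuous_at)
	finally show ?thesis .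
qed

text \<open>Here \<open>f\<close> is only bounded and measurable, so its primitive may fail to be
  differentiable. The formula comes instead from writing w 1 - w t as the integral of w' over (t,1),
  and from Fubini on the triangle t <= r.\<close>

lemma integral_J_by_parts:
	assumes w: "\<And>t. (w has_real_derivative w' t) (at t)" "continuous_on UNIV w'"
		and f: "f \<in> borelf" "\<And>t. - 1 < t ==> t < 1 ==> \<bar>f t\<bar> <= B"
	shows "(LINT t|J. w t * f t) = w 1 * (LINT t|J. f t) - (LINT r|J. w' r * (LINT t|J. indicator {..r} t * f t))"
proof -
	have [measurable]: "w' \<in> borelf" by (rule borel_measurable_continuous_onI[OF w(2)])
	have "continuous_on UNIV w" using w(1) by (meson DERIV_continuous_on has_field_derivative_at_within)
	then have [measurable]: "w \<in> borelf" by (rule borel_measurable_continuous_onI)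
	note f(1)[measurable]
	have "compact (w' ` {-1..1})" "compact (w ` {-1..1})"
		by (intro compact_continuous_image continuous_on_subset[OF w(2)] continuous_on_subset[OF \<open>continuous_on UNIV w\<close>]; simp)+
	then obtain C D where C: "\<And>t. t \<in> {-1..1} ==> \<bar>w' t\<bar> <= C" and D: "\<And>t. t \<in> {-1..1} ==> \<bar>w t\<bar> <= D"
		by (metis bounded_iff compact_imp_bounded image_eqI real_norm_def)
	have B0: "0 <= B" using f(2)[of 0] by auto
	have C0: "0 <= C" using C[of 0] by auto
	have D0: "0 <= D" using D[of 0] by auto
	have mi: "(%(t, r). indicator {..r} t :: real) \<in> borel_measurable (J \<Otimes>\<^sub>M J)"
	proof -
		have eq: "(%(t, r). indicator {..r} t :: real) = (%p. if fst p <= (snd p :: real) then 1 else 0)"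
			by (auto simp: indicator_def)
		show ?thesis unfolding eq
			by (intro measurable_If borel_measurable_le measurable_fst_J measurable_snd_J) simp_all
	qed
	interpret JJ: pair_sigma_finite J J ..
	interpret PJ: finite_measure "J \<Otimes>\<^sub>M J"
		by (rule finite_measure_pair_measure) unfold_locales
	have int: "integrable (J \<Otimes>\<^sub>M J) (%(t, r). w' r * (indicator {..r} t * f t))"
	proof (rule PJ.integrable_const_bound[of _ "C * B"])
		have "\<bar>w' r * (indicator {..r} t * f t)\<bar> <= C * B" if "t \<in> {-1<..<1}" "r \<in> {-1<..<1}" for t r
			using that C[of r] f(2)[of t] B0 C0 by (auto simp: abs_mult indicator_def intro!: mult_mono)
		then show "AE p in J \<Otimes>\<^sub>M J. norm (case p of (t, r) \<Rightarrow> w' r * (indicator {..r} t * f t)) <= C * B"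
			by (intro AE_I2) (auto simp: space_pair_measure)
		show "(%(t, r). w' r * (indicator {..r} t * f t)) \<in> borel_measurable (J \<Otimes>\<^sub>M J)"
			using mi unfolding split_beta'
			by (intro borel_measurable_times measurable_compose[OF measurable_fst_J f(1)]
					measurable_compose[OF measurable_snd_J \<open>w' \<in> borelf\<close>])
	qed
	have if': "integrable J f"
		using f by (intro J.integrable_const_bound[of _ B]) (auto intro!: AE_I2 measurable_restrict_space1)
	have iwf: "integrable J (%t. w t * f t)"
	proof (rule J.integrable_const_bound[of _ "D * B"])
		show "AE x in J. norm (w x * f x) <= D * B"
		proof (rule AE_I2)
			fix x assume "x \<in> space J"
			then have "\<bar>w x\<bar> <= D" "\<bar>f x\<bar> <= B" using f D[of x] by auto
			then show "norm (w x * f x) <= D * B" by (auto simp: abs_mult intro!: mult_mono)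
		qed
	qed (auto intro!: measurable_restrict_space1)
	have "(LINT r|J. w' r * (LINT t|J. indicator {..r} t * f t)) = (LINT r|J. LINT t|J. w' r * (indicator {..r} t * f t))"
		by simp
	also have "... = (LINT t|J. LINT r|J. w' r * (indicator {..r} t * f t))"
		using JJ.Fubini_integral[OF int] by simp
	also have "... = (LINT t|J. f t * (w 1 - w t))"
	proof (rule LINT_cong[OF refl])
		fix t assume "t \<in> space J"
		then have t: "- 1 < t" "t < 1" by auto
		have "(LINT r|J. w' r * (indicator {..r} t * f t)) = (LINT r|J. f t * (indicator {t..} r * w' r))"
			by (intro LINT_cong) (auto simp: indicator_def)
		also have "... = f t * (w 1 - w t)"
			using integral_J_FTC[OF w t] by simp
		finally show "(LINT r|J. w' r * (indicator {..r} t * f t)) = f t * (w 1 - w t)" .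
	qed
	also have "... = w 1 * (LINT t|J. f t) - (LINT t|J. w t * f t)"
		using if' iwf by (simp add: algebra_simps)
	finally show ?thesis by simp
qed

text \<open>Mean zero of \<open>F\<close> on each line removes the boundary term at x_i = 1,
  whatever the boundary values of \<open>v\<close> are. The later kernels are designed to meet this
  condition.\<close>

lemma integral_Q_by_parts:
	assumes v: "C1fun v" and F: "bB F" and z: "\<And>x. x \<in> Omega ==> line_int i F x = 0"
	shows "(LINT x|Q. v x * F x) = - (LINT x|Q. partial_deriv i v x * prim i F x)"
proof -
	have "(LINT x|Q. v x * F x) = (LINT y|Qf. LINT t|J. v (ins i y t) * F (ins i y t))"
		by (intro integral_Q bB_integrable bB_intros C1fun_bB v F)
	also have "... = (LINT y|Qf. - (LINT t|J. partial_deriv i v (ins i y t) * prim i F (ins i y t)))"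
	proof (rule LINT_cong[OF refl])
		fix y assume "y \<in> space Qf"
		then have x: "ins i y 0 \<in> Omega" by simp
		obtain B where "\<forall>r\<in>{-1<..<1}. \<bar>F (ins i y r)\<bar> <= B" using bB_section(2)[OF F x, of i] by auto
		moreover have "(%r. F (ins i y r)) \<in> borelf"
			using bB_section(1)[OF F x, of i] by simp
		moreover have "((%r. v (ins i y r)) has_real_derivative partial_deriv i v (ins i y r)) (at r)" for r
			using C1fun_line[OF v, of "ins i y 0" i r] by simp
		moreover have "continuous_on UNIV (%r. partial_deriv i v (ins i y r))"
			by (rule continuous_on_compose2[OF C1fun_continuous_deriv[OF v] _ subset_UNIV])
				(intro continuous_on_ins continuous_on_const continuous_on_id)
		ultimately show "(LINT t|J. v (ins i y t) * F (ins i y t)) = - (LINT t|J. partial_deriv i v (ins i y t) * prim i F (ins i y t))"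
			using z[OF x]
			by (subst integral_J_by_parts[of "%r. v (ins i y r)" "%r. partial_deriv i v (ins i y r)" "%r. F (ins i y r)" B])
				(simp_all add: prim_def line_int_def)
	qed
	also have "... = - (LINT x|Q. partial_deriv i v x * prim i F x)"
		by (subst integral_Q(1)[of "%x. partial_deriv i v x * prim i F x" i])
			(auto intro!: bB_integrable bB_mult C1fun_bB(2) v bB_prim F)
	finally show ?thesis .
qed

text \<open>Absolutely continuous profiles with zero boundary values and bounded derivative. The
  finite exceptional set admits the kinks of piecewise polynomials and, later, of the laminate
  corrector.\<close>

definition acz :: "(real \<Rightarrow> real) \<Rightarrow> (real \<Rightarrow> real) \<Rightarrow> bool" where
	"acz a b \<longleftrightarrow> continuous_on {-1..1} a \<and> a (- 1) = 0 \<and> a 1 = 0 \<and> b \<in> borelf \<and>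
		(\<exists>B. \<forall>t. - 1 < t \<and> t < 1 \<longrightarrow> \<bar>b t\<bar> <= B) \<and>
		(\<exists>S. finite S \<and> (\<forall>t. - 1 < t \<and> t < 1 \<and> t \<notin> S \<longrightarrow> (a has_real_derivative b t) (at t)))"

lemma acz_integral:
	assumes "acz a b" "- 1 <= t" "t <= 1"
	shows "(LINT r|J. indicator {..t} r * b r) = a t"
proof -
	obtain B S where B: "\<And>t. - 1 < t ==> t < 1 ==> \<bar>b t\<bar> <= B" and S: "finite S"
		"\<And>t. - 1 < t ==> t < 1 ==> t \<notin> S ==> (a has_real_derivative b t) (at t)"
		and a: "continuous_on {-1..1} a" "a (- 1) = 0" and [measurable]: "b \<in> borelf"
		using assms(1) by (auto simp: acz_def)
	define f where "f r = indicator {-1<..<1} r * (indicator {..t} r * b r)" for r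
	have fi: "integrable lborel f"
	proof (rule integrableI_bounded_set[of "{-1<..<1}" _ _ B])
		show "AE x in lborel. x \<in> {- 1<..<1} \<longrightarrow> norm (f x) <= B"
			using B by (intro AE_I2) (force simp: f_def indicator_def)
	qed (auto simp: f_def[abs_def])
	have "(b has_integral (a t - a (- 1))) {- 1..t}"
		using assms(2,3)
		by (intro fundamental_theorem_of_calculus_interior_strong[OF S(1)] continuous_on_subset[OF a(1)])
			(auto intro!: S(2) simp: has_real_derivative_iff_has_vector_derivative[symmetric])
	then have "(f has_integral (a t - a (- 1))) {- 1..t}"
		by (rule has_integral_spike_finite[of "{-1, t, 1}", rotated 2])
			(use assms(2,3) in \<open>auto simp: f_def indicator_def\<close>)
	then have "((%r. if r \<in> {- 1..t} then f r else 0) has_integral a t) UNIV"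
		by (simp only: has_integral_restrict_UNIV a(2) diff_zero)
	moreover have "(%r. if r \<in> {- 1..t} then f r else 0) = f"
		using assms(2,3) by (force simp: f_def indicator_def)
	ultimately have 1: "(f has_integral a t) UNIV" by simp
	have "(LINT r|J. indicator {..t} r * b r) = (LINT r|lborel. f r)"
		by (subst integral_restrict_space) (auto simp: f_def[abs_def])
	also have "... = a t"
		using has_integral_unique[OF has_integral_integral_lborel[OF fi] 1] .
	finally show ?thesis .
qed

lemma acz_bB: assumes "acz a b" shows "bB (%x. b (x $ i))"
	using assms by (auto simp: acz_def intro!: bB_coord)

text \<open>When \<open>G\<close> is constant along x_i-lines, the primitive of
  \<open>b (x $ i) * G x\<close> is \<open>a (x $ i) * G x\<close>, and the zero boundary values of
  \<open>a\<close> supply the mean-zero condition.\<close>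

lemma integral_Q_by_parts_product:
	assumes v: "C1fun v" and G: "bB G" and ab: "acz a b" and ind: "\<And>x r. G (upd x i r) = G x"
	shows "(LINT x|Q. v x * (b (x $ i) * G x)) = - (LINT x|Q. partial_deriv i v x * (a (x $ i) * G x))"
proof -
	let ?F = "%x. b (x $ i) * G x"
	have p: "prim i ?F x = a (x $ i) * G x" if "x \<in> Omega" for x
	proof -
		have "prim i ?F x = (LINT r|J. (indicator {..x $ i} r * b r) * G x)"
			unfolding prim_def by (intro LINT_cong) (auto simp: ind)
		also have "... = a (x $ i) * G x"
			using that by (subst integral_mult_left_zero, subst acz_integral[OF ab]) (auto simp: Omega_def less_imp_le)
		finally show ?thesis .
	qed
	have "line_int i ?F x = 0" for x
	proof -
		have "line_int i ?F x = (LINT r|J. (indicator {..1} r * b r) * G x)"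
			unfolding line_int_def by (intro LINT_cong) (auto simp: ind)
		also have "... = 0"
			using ab by (subst integral_mult_left_zero, subst acz_integral[OF ab]) (auto simp: acz_def)
		finally show ?thesis .
	qed
	then have "(LINT x|Q. v x * ?F x) = - (LINT x|Q. partial_deriv i v x * prim i ?F x)"
		by (intro integral_Q_by_parts v bB_intros acz_bB[OF ab] G) auto
	also have "(LINT x|Q. partial_deriv i v x * prim i ?F x) = (LINT x|Q. partial_deriv i v x * (a (x $ i) * G x))"
		by (intro LINT_cong) (auto simp: p)
	finally show ?thesis .
qed

section \<open>Mollification\<close>

lemma norm_real3_le: "norm (x :: real ^ 3) <= \<bar>x $ 1\<bar> + \<bar>x $ 2\<bar> + \<bar>x $ 3\<bar>"
	using norm_le_l1_cart[of x] by (simp add: sum_3)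

text \<open>The mollifier will be the normalised square of \<open>bump\<close>. It has a Lipschitz
  gradient and lives on the unit ball; this regularity is enough, as weak derivatives and variations
  are tested with C^1 functions.\<close>

definition bump :: "real ^ 3 \<Rightarrow> real" where
	"bump z = max 0 (1 - z \<bullet> z)"

lemma bump_bounds: "0 <= bump z" "bump z <= 1"
	by (auto simp: bump_def)

lemma bump_eq_0: "1 <= norm z ==> bump z = 0"
	using power_mono[of 1 "norm z" 2] by (simp add: bump_def power2_norm_eq_inner)

lemma bump_eq: "norm z < 1 ==> bump z = 1 - (norm z)\<^sup>2"
	using power_le_one[of "norm z" 2] by (simp add: bump_def power2_norm_eq_inner[symmetric])

lemma bump_lipschitz: "\<bar>bump a - bump b\<bar> <= 2 * norm (a - b)"
proof -
	have main: "bump a - bump b <= 2 * norm (a - b)" for a b :: "real ^ 3"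
	proof (cases "norm a < 1")
		case False
		then have "bump a = 0" by (simp add: bump_eq_0)
		then show ?thesis using bump_bounds(1)[of b] norm_ge_zero[of "a - b"] by linarith
	next
		case True
		show ?thesis
		proof (cases "norm b < 1")
			case b: True
			have "bump a - bump b = (norm b - norm a) * (norm b + norm a)"
				using True b by (simp add: bump_eq power2_eq_square algebra_simps)
			also have "... <= \<bar>norm b - norm a\<bar> * 2"
				using True b by (intro mult_mono) auto
			also have "... <= 2 * norm (a - b)"
				using norm_triangle_ineq3[of b a] by (simp add: norm_minus_commute)
			finally show ?thesis .
		next
			case b: False
			have "bump a = (1 - norm a) * (1 + norm a)"
				using True by (simp add: bump_eq power2_eq_square algebra_simps)
			also have "... <= (norm b - norm a) * 2"
				using True b by (intro mult_mono) auto
			also have "... <= 2 * norm (a - b)"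
				using norm_triangle_ineq3[of b a] by (simp add: norm_minus_commute)
			finally show ?thesis using bump_bounds(1)[of b] by simp
		qed
	qed
	show ?thesis using main[of a b] main[of b a] by (simp add: norm_minus_commute abs_le_iff)
qed

definition eta0 :: "real ^ 3 \<Rightarrow> real" where "eta0 z = (bump z)\<^sup>2"
definition deta0 :: "3 \<Rightarrow> real ^ 3 \<Rightarrow> real" where "deta0 i z = - 4 * z $ i * bump z"

lemma continuous_on_bump [continuous_intros]: "continuous_on S bump"
	unfolding bump_def[abs_def] by (intro continuous_intros)

lemma continuous_on_eta0: "continuous_on S eta0" "continuous_on S (deta0 i)"
	unfolding eta0_def[abs_def] deta0_def[abs_def] by (intro continuous_intros)+

lemma deta0_bound: "\<bar>deta0 i z\<bar> <= 4"
proof (cases "norm z < 1")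
	case True
	then have "\<bar>z $ i\<bar> <= 1" using component_le_norm_cart[of z i] by simp
	then have "\<bar>z $ i\<bar> * bump z <= 1 * 1" using bump_bounds[of z] by (intro mult_mono) auto
	then show ?thesis using bump_bounds[of z] by (simp add: deta0_def abs_mult)
qed (simp add: deta0_def bump_eq_0)

text \<open>12 = 4 * (1 + 2): on the unit ball both factors z_i and \<open>bump\<close> are at most
  1 in modulus, with Lipschitz constants 1 and 2.\<close>

lemma deta0_lipschitz: "\<bar>deta0 i a - deta0 i b\<bar> <= 12 * norm (a - b)"
proof -
	have main: "\<bar>a $ i * bump a - b $ i * bump b\<bar> <= 3 * norm (a - b)" if "norm a < 1" for a b :: "real ^ 3"
	proof -
		have "a $ i * bump a - b $ i * bump b = a $ i * (bump a - bump b) + (a - b) $ i * bump b"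
			by (simp add: algebra_simps)
		also have "\<bar>...\<bar> <= \<bar>a $ i\<bar> * \<bar>bump a - bump b\<bar> + \<bar>(a - b) $ i\<bar> * \<bar>bump b\<bar>"
			using abs_triangle_ineq by (simp add: abs_mult[symmetric])
		also have "... <= 1 * (2 * norm (a - b)) + norm (a - b) * 1"
			using component_le_norm_cart[of a i] that component_le_norm_cart[of "a - b" i] bump_bounds[of b]
				bump_lipschitz[of a b]
			by (intro add_mono mult_mono) auto
		finally show ?thesis by simp
	qed
	have "\<bar>a $ i * bump a - b $ i * bump b\<bar> <= 3 * norm (a - b)"
	proof (cases "norm a < 1")
		case False
		then show ?thesis
			using main[of b a] by (cases "norm b < 1") (auto simp: bump_eq_0 norm_minus_commute abs_minus_commute)
	qed (rule main)
	then show ?thesis by (simp add: deta0_def abs_le_iff algebra_simps)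
qed

lemma has_derivative_max0_square: "((%t. (max 0 t)\<^sup>2) has_real_derivative 2 * max 0 t) (at (t :: real))"
proof (cases "t = 0")
	case False
	show ?thesis
	proof (cases "t < 0")
		case True
		have "((%t. 0) has_real_derivative 0) (at t)" by simp
		then show ?thesis using True
			by (rule_tac has_field_derivative_transform_within_open[where S = "{..<0}" and f = "%t. 0"]) auto
	next
		case f: False
		have "((%t. t\<^sup>2) has_real_derivative 2 * t) (at t)" by (auto intro!: derivative_eq_intros)
		then show ?thesis using f False
			by (rule_tac has_field_derivative_transform_within_open[where S = "{0<..}" and f = "%t. t\<^sup>2"]) auto
	qed
next
	case True
	have "((%h. ((max 0 (0 + h))\<^sup>2 - (max 0 (0::real))\<^sup>2) / h) \<longlongrightarrow> 0) (at 0)"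
	proof (rule Lim_null_comparison)
		show "\<forall>\<^sub>F h in at 0. norm (((max 0 (0 + h))\<^sup>2 - (max 0 (0::real))\<^sup>2) / h) <= \<bar>h\<bar>"
			by (intro always_eventually allI) (auto simp: max_def power2_eq_square)
		show "((%h. \<bar>h\<bar>) \<longlongrightarrow> (0 :: real)) (at 0)" by (rule tendsto_rabs_zero) (rule tendsto_ident_at)
	qed
	then show ?thesis using True by (simp add: DERIV_def)
qed

lemma eta0_has_derivative: "(eta0 has_derivative (%h. \<Sum>i\<in>UNIV. deta0 i z * h $ i)) (at z)"
proof -
	have 1: "((%z :: real ^ 3. 1 - z \<bullet> z) has_derivative (%h. - 2 * (z \<bullet> h))) (at z)"
		by (auto intro!: derivative_eq_intros simp: inner_commute)
	have 2: "((%t. (max 0 t)\<^sup>2) has_derivative (%s. 2 * max 0 (1 - z \<bullet> z) * s)) (at (1 - z \<bullet> z))"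
		using has_derivative_max0_square[of "1 - z \<bullet> z"] by (simp add: has_field_derivative_def)
	have "(eta0 has_derivative (%h. 2 * max 0 (1 - z \<bullet> z) * (- 2 * (z \<bullet> h)))) (at z)"
		using has_derivative_compose[OF 1 2] by (simp add: eta0_def[abs_def] bump_def)
	also have "(%h. 2 * max 0 (1 - z \<bullet> z) * (- 2 * (z \<bullet> h))) = (%h. \<Sum>i\<in>UNIV. deta0 i z * h $ i)"
		by (auto simp: fun_eq_iff inner_vec_def deta0_def bump_def sum_distrib_left intro!: sum.cong)
	finally show ?thesis .
qed

text \<open>Three partial derivatives with Lipschitz constant 12 give 36. A uniform quadratic
  remainder survives integration against any integrable function, so convolutions are differentiated
  without a limit theorem.\<close>

lemma eta0_taylor: "\<bar>eta0 (a + k) - eta0 a - (\<Sum>i\<in>UNIV. deta0 i a * k $ i)\<bar> <= 36 * (norm k)\<^sup>2"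
proof -
	have "norm (eta0 (a + k) - eta0 a - (\<Sum>i\<in>UNIV. deta0 i a * ((a + k) - a) $ i)) <= norm ((a + k) - a) * (36 * norm k)"
	proof (rule differentiable_bound_linearization[where S = "cball a (norm k)" and f' = "%x h. \<Sum>i\<in>UNIV. deta0 i x * h $ i" and f = eta0 and ?x0.0 = a and a = a])
		fix x assume x: "x \<in> cball a (norm k)"
		show "onorm ((%h. \<Sum>i\<in>UNIV. deta0 i x * h $ i) - (%h. \<Sum>i\<in>UNIV. deta0 i a * h $ i)) <= 36 * norm k"
			unfolding fun_diff_def
		proof (rule onorm_le)
			fix h :: "real ^ 3"
			have "norm ((\<Sum>i\<in>UNIV. deta0 i x * h $ i) - (\<Sum>i\<in>UNIV. deta0 i a * h $ i))
					= \<bar>\<Sum>i\<in>UNIV. (deta0 i x - deta0 i a) * h $ i\<bar>"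
				by (simp add: sum_subtractf left_diff_distrib)
			also have "... <= (\<Sum>i\<in>(UNIV :: 3 set). 12 * norm k * norm h)"
			proof (intro order_trans[OF sum_abs] sum_mono)
				fix i
				have "\<bar>deta0 i x - deta0 i a\<bar> <= 12 * norm k"
					using deta0_lipschitz[of i x a] x by (simp add: dist_norm norm_minus_commute)
				then show "\<bar>(deta0 i x - deta0 i a) * h $ i\<bar> <= 12 * norm k * norm h"
					using component_le_norm_cart[of h i] by (auto simp: abs_mult intro!: mult_mono)
			qed
			finally show "norm ((\<Sum>i\<in>UNIV. deta0 i x * h $ i) - (\<Sum>i\<in>UNIV. deta0 i a * h $ i)) <= 36 * norm k * norm h"
				by simp
		qed
	next
		fix t :: real assume "t \<in> {0..1}"
		then show "a + t *\<^sub>R ((a + k) - a) \<in> cball a (norm k)"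
			by (simp add: dist_norm mult_left_le_one_le)
	qed (auto intro: has_derivative_at_withinI eta0_has_derivative)
	then show ?thesis by (simp add: power2_eq_square)
qed

text \<open>Common to \<open>eta\<close> and every \<open>deta i\<close>, so one set of convolution
  estimates serves a mollified function and its gradient.\<close>

definition kern :: "(real ^ 3 \<Rightarrow> real) \<Rightarrow> bool" where
	"kern k \<longleftrightarrow> k \<in> borelf \<and> (\<exists>B. \<forall>z. \<bar>k z\<bar> <= B) \<and> (\<forall>z. 1 <= norm z \<longrightarrow> k z = 0)"

lemma kern_measurable: "kern k ==> k \<in> borelf"
	by (simp add: kern_def)

lemma kern_integrable: assumes "kern k" shows "integrable lborel k"
proof -
	obtain B where "\<forall>z. \<bar>k z\<bar> <= B" using assms by (auto simp: kern_def)
	moreover have "z \<in> cball 0 1" if "k z \<noteq> 0" for z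
		using assms that by (force simp: kern_def)
	ultimately show ?thesis using assms
		by (intro integrableI_bounded_set[of "cball 0 1" _ _ B])
			(auto simp: kern_def intro!: AE_I2 emeasure_bounded_finite[unfolded infinity_ennreal_def])
qed

lemma kern_eta0: "kern eta0" "kern (deta0 i)"
proof -
	have "\<bar>eta0 z\<bar> <= 1" for z
		using bump_bounds[of z] by (simp add: eta0_def power_le_one)
	then show "kern eta0"
		by (auto simp: kern_def eta0_def bump_eq_0 intro!: borel_measurable_continuous_onI continuous_on_eta0)
	show "kern (deta0 i)"
		using deta0_bound[of i] unfolding kern_def
		by (auto intro!: borel_measurable_continuous_onI continuous_on_eta0) (simp add: deta0_def bump_eq_0)
qed

lemma kern_scale: assumes "kern k" shows "kern (%z. c * k z)"
proof -
	obtain B where "\<forall>z. \<bar>k z\<bar> <= B" using assms by (auto simp: kern_def)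
	then have "\<forall>z. \<bar>c * k z\<bar> <= \<bar>c\<bar> * B" by (auto simp: abs_mult intro: mult_left_mono)
	then show ?thesis using assms by (auto simp: kern_def)
qed

lemma integral_eta0_pos: "0 < (LINT z|lborel. eta0 z)"
proof -
	have "0 < (LINT z|lborel. indicator (ball (0 :: real ^ 3) (1/2)) z * (1/4) :: real)"
	proof -
		have "0 < measure lborel (ball (0 :: real ^ 3) (1/2))"
			using content_ball_pos[of "1/2" "0 :: real ^ 3"] by simp
		then show ?thesis by simp
	qed
	also have "... <= (LINT z|lborel. eta0 z)"
	proof (rule integral_mono)
		show "integrable lborel eta0" by (rule kern_integrable[OF kern_eta0(1)])
		show "integrable lborel (%z. indicator (ball (0 :: real ^ 3) (1/2)) z * (1/4) :: real)"
			by (intro integrable_mult_left integrable_real_indicator) (auto intro!: emeasure_bounded_finite[unfolded infinity_ennreal_def])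
		fix z :: "real ^ 3"
		show "indicator (ball 0 (1/2)) z * (1/4) <= eta0 z"
		proof (cases "norm z < 1/2")
			case True
			then have "(norm z)\<^sup>2 <= (1/2)\<^sup>2" by (intro power_mono) auto
			then have "1/2 <= bump z" by (simp add: bump_def power2_norm_eq_inner[symmetric] power2_eq_square)
			then have "(1/2)\<^sup>2 <= (bump z)\<^sup>2" by (intro power_mono) auto
			then show ?thesis using True by (simp add: eta0_def power2_eq_square)
		qed (simp add: eta0_def)
	qed
	finally show ?thesis .
qed

section \<open>The normalised mollifier, convolution and its L^2 bounds\<close>

definition ceta :: real where "ceta = 1 / (LINT z|lborel. eta0 z)"
definition eta :: "real ^ 3 \<Rightarrow> real" where "eta z = ceta * eta0 z"
definition deta :: "3 \<Rightarrow> real ^ 3 \<Rightarrow> real" where "deta i z = ceta * deta0 i z"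

lemma ceta_pos: "0 < ceta" using integral_eta0_pos by (simp add: ceta_def)

lemma eta_nonneg: "0 <= eta z" using ceta_pos by (simp add: eta_def eta0_def)

lemma integral_eta: "(LINT z|lborel. eta z) = 1"
	using integral_eta0_pos by (simp add: eta_def ceta_def)

lemma kern_eta: "kern eta" "kern (deta i)"
	using kern_scale[OF kern_eta0(1)] kern_scale[OF kern_eta0(2)] by (simp_all add: eta_def[abs_def] deta_def[abs_def])

lemma eta_minus: "eta (- z) = eta z" "deta i (- z) = - deta i z"
	by (simp_all add: eta_def deta_def eta0_def deta0_def bump_def)

lemma eta_taylor: "\<bar>eta (a + k) - eta a - (\<Sum>i\<in>UNIV. deta i a * k $ i)\<bar> <= 36 * ceta * (norm k)\<^sup>2"
proof -
	have "eta (a + k) - eta a - (\<Sum>i\<in>UNIV. deta i a * k $ i) = ceta * (eta0 (a + k) - eta0 a - (\<Sum>i\<in>UNIV. deta0 i a * k $ i))"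
		by (simp add: eta_def deta_def right_diff_distrib sum_distrib_left mult.assoc)
	then show ?thesis
		using mult_left_mono[OF eta0_taylor[of a k], of ceta] ceta_pos by (simp add: abs_mult mult_ac)
qed

lemma deta_lipschitz: "\<bar>deta i a - deta i b\<bar> <= 12 * ceta * norm (a - b)"
proof -
	have "deta i a - deta i b = ceta * (deta0 i a - deta0 i b)" by (simp add: deta_def right_diff_distrib)
	then show ?thesis
		using mult_left_mono[OF deta0_lipschitz[of i a b], of ceta] ceta_pos by (simp add: abs_mult mult_ac)
qed

text \<open>The factor \<open>d ^ 3\<close> keeps the mass of the kernel independent of
  \<open>d\<close>; each derivative of \<open>conv d eta f\<close> then costs exactly one factor 1 /
  d.\<close>

definition conv :: "real \<Rightarrow> (real ^ 3 \<Rightarrow> real) \<Rightarrow> (real ^ 3 \<Rightarrow> real) \<Rightarrow> real ^ 3 \<Rightarrow> real" where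
	"conv d k f x = (LINT y|lborel. f y * (k ((x - y) /\<^sub>R d) / d ^ 3))"

lemma kern_shift_measurable:
	assumes "kern k" shows "(%y. k ((x - y) /\<^sub>R d) / d ^ 3) \<in> borelf"
	by (intro borel_measurable_divide measurable_compose[OF _ kern_measurable[OF assms]]) measurable

lemma conv_integrable:
	assumes "kern k" "integrable lborel f"
	shows "integrable lborel (%y. f y * (k ((x - y) /\<^sub>R d) / d ^ 3))"
proof -
	obtain B where B: "\<forall>z. \<bar>k z\<bar> <= B" using assms by (auto simp: kern_def)
	show ?thesis
	proof (rule LI_bound)
		show "integrable lborel (%y. f y * (B / \<bar>d\<bar> ^ 3))" using assms(2) by simp
		show "AE y in lborel. norm (f y * (k ((x - y) /\<^sub>R d) / d ^ 3)) <= norm (f y * (B / \<bar>d\<bar> ^ 3))"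
		proof (rule AE_I2)
			fix y
			have "\<bar>k ((x - y) /\<^sub>R d) / d ^ 3\<bar> <= \<bar>B / \<bar>d\<bar> ^ 3\<bar>"
				unfolding abs_divide power_abs abs_abs using B by (intro divide_right_mono order_trans[OF _ abs_ge_self]) auto
			then show "norm (f y * (k ((x - y) /\<^sub>R d) / d ^ 3)) <= norm (f y * (B / \<bar>d\<bar> ^ 3))"
				unfolding real_norm_def abs_mult by (rule mult_left_mono) simp
		qed
		show "(%y. f y * (k ((x - y) /\<^sub>R d) / d ^ 3)) \<in> borel_measurable lborel"
			by (rule borel_measurable_times[OF borel_measurable_integrable[OF assms(2)]])
				(simp only: measurable_lborel1 measurable_lborel2 kern_shift_measurable[OF assms(1)])
	qed
qed

lemma has_derivative_quadratic:
	fixes f :: "'a :: real_normed_vector \<Rightarrow> real"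
	assumes "bounded_linear D" and q: "\<And>h. \<bar>f (x + h) - f x - D h\<bar> <= C * (norm h)\<^sup>2"
	shows "(f has_derivative D) (at x)"
	unfolding has_derivative_at
proof
	have "((%h. norm (f (x + h) - f x - D h) / norm h) \<longlongrightarrow> 0) (at 0)"
	proof (rule Lim_null_comparison)
		show "\<forall>\<^sub>F h in at 0. norm (norm (f (x + h) - f x - D h) / norm h) <= C * norm h"
			using q by (intro always_eventually allI) (auto simp: divide_simps power2_eq_square mult.assoc)
		show "((%h :: 'a. C * norm h) \<longlongrightarrow> 0) (at 0)"
			by (intro tendsto_mult_right_zero tendsto_norm_zero tendsto_ident_at)
	qed
	then show "((%h. norm (f (x + h) - f x - D h) / norm h) \<longlongrightarrow> 0) (at 0)" .
qed fact

lemma conv_has_derivative: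
	assumes f: "integrable lborel f" and d: "0 < d"
	shows "(conv d eta f has_derivative (%h. \<Sum>i\<in>UNIV. (conv d (deta i) f x / d) * h $ i)) (at x)"
proof (rule has_derivative_quadratic)
	show "bounded_linear (%h :: real ^ 3. \<Sum>i\<in>UNIV. (conv d (deta i) f x / d) * h $ i)"
		by (intro bounded_linear_sum bounded_linear_const_mult bounded_linear_vec_nth)
	fix h :: "real ^ 3"
	let ?C = "36 * ceta * (norm h)\<^sup>2 / (d ^ 2 * d ^ 3)"
	note ci = conv_integrable[OF kern_eta(1) f] conv_integrable[OF kern_eta(2) f]
	let ?R = "%y. f y * ((eta ((x + h - y) /\<^sub>R d) - eta ((x - y) /\<^sub>R d) - (\<Sum>i\<in>UNIV. deta i ((x - y) /\<^sub>R d) * (h /\<^sub>R d) $ i)) / d ^ 3)"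
	define A where "A z y = f y * (eta ((z - y) /\<^sub>R d) / d ^ 3)" for z y
	define B where "B i y = f y * (deta i ((x - y) /\<^sub>R d) / d ^ 3)" for i y
	have iA: "integrable lborel (A z)" and iB: "integrable lborel (B i)" for z i
		using ci unfolding A_def[abs_def] B_def[abs_def] by blast+
	have R: "?R = (%y. A (x + h) y - A x y - (\<Sum>i\<in>UNIV. B i y * (h $ i / d)))"
		unfolding A_def B_def using d by (simp add: fun_eq_iff diff_divide_distrib right_diff_distrib sum_divide_distrib sum_distrib_left divide_inverse mult_ac)
	have e1: "conv d eta f (x + h) - conv d eta f x - (\<Sum>i\<in>UNIV. (conv d (deta i) f x / d) * h $ i) = (LINT y|lborel. ?R y)"
		unfolding R conv_def A_def[symmetric] B_def[symmetric]
		using iA iB by (simp add: LINT_sum)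
		have e2: "norm (LINT y|lborel. ?R y) <= (LINT y|lborel. \<bar>f y\<bar> * ?C)"
		proof (rule LINT_norm_bound)
			show "integrable lborel ?R" unfolding R by (intro LI_diff LI_sum integrable_mult_left iA iB)
			show "integrable lborel (%y. \<bar>f y\<bar> * ?C)" using f by (intro integrable_mult_left) auto
			fix y
			have "x + h - y = (x - y) + h" by simp
			then have e: "(x + h - y) /\<^sub>R d = (x - y) /\<^sub>R d + h /\<^sub>R d" by (simp only: scaleR_right_distrib)
			have "\<bar>(eta ((x + h - y) /\<^sub>R d) - eta ((x - y) /\<^sub>R d) - (\<Sum>i\<in>UNIV. deta i ((x - y) /\<^sub>R d) * (h /\<^sub>R d) $ i)) / d ^ 3\<bar>
					<= 36 * ceta * (norm (h /\<^sub>R d))\<^sup>2 / d ^ 3"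
				unfolding e using eta_taylor[of "(x - y) /\<^sub>R d" "h /\<^sub>R d"] d by (simp add: abs_divide divide_right_mono)
			also have "... = ?C" using d by (simp add: power_mult_distrib field_simps)
			finally show "norm (?R y) <= \<bar>f y\<bar> * ?C" unfolding real_norm_def abs_mult by (rule mult_left_mono) simp
		qed
	have e3: "(LINT y|lborel. \<bar>f y\<bar> * ?C) = (LINT y|lborel. \<bar>f y\<bar>) * (36 * ceta / (d ^ 2 * d ^ 3)) * (norm h)\<^sup>2"
		by (subst integral_mult_left_zero) simp
	show "\<bar>conv d eta f (x + h) - conv d eta f x - (\<Sum>i\<in>UNIV. (conv d (deta i) f x / d) * h $ i)\<bar>
			<= (LINT y|lborel. \<bar>f y\<bar>) * (36 * ceta / (d ^ 2 * d ^ 3)) * (norm h)\<^sup>2"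
		using e2 unfolding e1 e3[symmetric] real_norm_def .
qed

lemma has_derivative_imp_partial_deriv:
	assumes "(f has_derivative (%h. \<Sum>i\<in>UNIV. g i * h $ i)) (at x)"
	shows "partial_deriv i f x = (g i :: real)"
proof -
	have "frechet_derivative f (at x) = (%h. \<Sum>i\<in>UNIV. g i * h $ i)"
		using frechet_derivative_at[OF assms] by simp
	then show ?thesis by (simp add: partial_deriv_def axis_def if_distrib cong: if_cong)
qed

lemma partial_deriv_conv:
	assumes "integrable lborel f" "0 < d"
	shows "partial_deriv i (conv d eta f) x = conv d (deta i) f x / d"
	by (rule has_derivative_imp_partial_deriv[OF conv_has_derivative[OF assms]])

lemma conv_deta_lipschitz:
	assumes f: "integrable lborel f" and d: "0 < d"
	shows "\<bar>conv d (deta i) f x - conv d (deta i) f x'\<bar> <= (LINT y|lborel. \<bar>f y\<bar>) * (12 * ceta / d ^ 4) * norm (x - x')"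
proof -
	note ci = conv_integrable[OF kern_eta(2) f]
	have e1: "conv d (deta i) f x - conv d (deta i) f x'
		= (LINT y|lborel. f y * (deta i ((x - y) /\<^sub>R d) / d ^ 3) - f y * (deta i ((x' - y) /\<^sub>R d) / d ^ 3))"
		unfolding conv_def by (rule LINT_diff[symmetric]) (rule ci)+
		have e2: "norm (LINT y|lborel. f y * (deta i ((x - y) /\<^sub>R d) / d ^ 3) - f y * (deta i ((x' - y) /\<^sub>R d) / d ^ 3))
				<= (LINT y|lborel. \<bar>f y\<bar> * ((12 * ceta / d ^ 4) * norm (x - x')))"
		proof (rule LINT_norm_bound)
			fix y
			have "\<bar>deta i ((x - y) /\<^sub>R d) - deta i ((x' - y) /\<^sub>R d)\<bar> <= 12 * ceta * (norm (x - x') / d)"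
				using deta_lipschitz[of i "(x - y) /\<^sub>R d" "(x' - y) /\<^sub>R d"] d
				by (simp add: scaleR_right_diff_distrib[symmetric] divide_inverse mult_ac)
			then have "\<bar>deta i ((x - y) /\<^sub>R d) - deta i ((x' - y) /\<^sub>R d)\<bar> / d ^ 3 <= 12 * ceta * (norm (x - x') / d) / d ^ 3"
				using d by (intro divide_right_mono) auto
			also have "... = (12 * ceta / d ^ 4) * norm (x - x')"
				by (simp add: power_eq_if)
			finally have "\<bar>f y\<bar> * (\<bar>deta i ((x - y) /\<^sub>R d) - deta i ((x' - y) /\<^sub>R d)\<bar> / d ^ 3) <= \<bar>f y\<bar> * ((12 * ceta / d ^ 4) * norm (x - x'))"
				by (rule mult_left_mono) simp
			moreover have "norm (f y * (deta i ((x - y) /\<^sub>R d) / d ^ 3) - f y * (deta i ((x' - y) /\<^sub>R d) / d ^ 3))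
				= \<bar>f y\<bar> * (\<bar>deta i ((x - y) /\<^sub>R d) - deta i ((x' - y) /\<^sub>R d)\<bar> / d ^ 3)"
				using d by (simp add: right_diff_distrib[symmetric] diff_divide_distrib[symmetric] abs_mult abs_divide)
			ultimately show "norm (f y * (deta i ((x - y) /\<^sub>R d) / d ^ 3) - f y * (deta i ((x' - y) /\<^sub>R d) / d ^ 3))
				<= \<bar>f y\<bar> * ((12 * ceta / d ^ 4) * norm (x - x'))" by simp
		qed (use f in \<open>intro LI_diff ci integrable_mult_left, auto\<close>)
	show ?thesis using e2 unfolding e1 real_norm_def integral_mult_left_zero by (simp only: mult.assoc)
qed

lemma continuous_conv_deta:
	assumes "integrable lborel f" "0 < d"
	shows "continuous_on UNIV (conv d (deta i) f)"
proof -
	let ?L = "(LINT y|lborel. \<bar>f y\<bar>) * (12 * ceta / d ^ 4)"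
	have "0 <= ?L" using ceta_pos assms(2) by simp
	then have "?L-lipschitz_on UNIV (conv d (deta i) f)"
		using conv_deta_lipschitz[OF assms, of i] by (intro lipschitz_onI) (auto simp: dist_norm)
	then show ?thesis by (rule lipschitz_on_continuous_on)
qed

lemma C1fun_conv:
	assumes "integrable lborel f" "0 < d"
	shows "C1fun (conv d eta f)"
proof -
	have "partial_deriv i (conv d eta f) = (%x. conv d (deta i) f x / d)" for i
		using partial_deriv_conv[OF assms] by auto
	then show ?thesis
		using conv_has_derivative[OF assms] continuous_conv_deta[OF assms] assms(2)
		by (auto simp: C1fun_def differentiable_def intro!: continuous_on_divide)
qed

lemma nn_integral_affine:
	fixes h :: "real ^ 3 \<Rightarrow> ennreal"
	assumes [measurable]: "h \<in> borelf" and c: "c \<noteq> 0"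
	shows "(\<integral>\<^sup>+u. h u \<partial>lborel) = ennreal (\<bar>c\<bar> ^ 3) * (\<integral>\<^sup>+z. h (t + c *\<^sub>R z) \<partial>lborel)"
proof -
	have "(\<integral>\<^sup>+u. h u \<partial>lborel) = (\<integral>\<^sup>+u. h u \<partial>density (distr lborel borel (%x. t + c *\<^sub>R x)) (%_. ennreal (\<bar>c\<bar> ^ 3)))"
		using lborel_affine[OF c, of t] by simp
	then show ?thesis
		by (simp add: nn_integral_density nn_integral_distr nn_integral_cmult)
qed

lemma kern_abs_nn:
	assumes k: "kern k" and d: "0 < d"
	shows "(\<integral>\<^sup>+y. ennreal \<bar>k ((x - y) /\<^sub>R d) / d ^ 3\<bar> \<partial>lborel) = ennreal (LINT z|lborel. \<bar>k z\<bar>)"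
		and "(\<integral>\<^sup>+x. ennreal \<bar>k ((x - y) /\<^sub>R d) / d ^ 3\<bar> \<partial>lborel) = ennreal (LINT z|lborel. \<bar>k z\<bar>)"
		and "integrable lborel (%y. \<bar>k ((x - y) /\<^sub>R d) / d ^ 3\<bar>)"
		and "(LINT y|lborel. \<bar>k ((x - y) /\<^sub>R d) / d ^ 3\<bar>) = (LINT z|lborel. \<bar>k z\<bar>)"
proof -
	note km[measurable] = kern_measurable[OF k]
	have a: "(\<integral>\<^sup>+z. ennreal \<bar>k z / d ^ 3\<bar> \<partial>lborel) = ennreal (1 / d ^ 3) * ennreal (LINT z|lborel. \<bar>k z\<bar>)"
	proof -
		have "(\<integral>\<^sup>+z. ennreal \<bar>k z / d ^ 3\<bar> \<partial>lborel) = (\<integral>\<^sup>+z. ennreal (1 / d ^ 3) * ennreal \<bar>k z\<bar> \<partial>lborel)"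
			using d by (intro nn_integral_cong) (simp add: ennreal_mult''[symmetric] abs_divide)
		also have "... = ennreal (1 / d ^ 3) * (\<integral>\<^sup>+z. ennreal \<bar>k z\<bar> \<partial>lborel)"
			by (intro nn_integral_cmult) measurable
		also have "(\<integral>\<^sup>+z. ennreal \<bar>k z\<bar> \<partial>lborel) = ennreal (LINT z|lborel. \<bar>k z\<bar>)"
			using kern_integrable[OF k] by (intro nn_integral_eq_integral) auto
		finally show ?thesis .
	qed
	have m1: "(%y. ennreal \<bar>k ((x - y) /\<^sub>R d) / d ^ 3\<bar>) \<in> borelf" for x
		by measurable
	have m2: "(%x. ennreal \<bar>k ((x - y) /\<^sub>R d) / d ^ 3\<bar>) \<in> borelf" for y
		by measurable
	have e: "ennreal (d ^ 3) * (ennreal (1 / d ^ 3) * ennreal (LINT z|lborel. \<bar>k z\<bar>)) = ennreal (LINT z|lborel. \<bar>k z\<bar>)"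
		using d by (simp add: ennreal_mult''[symmetric])
	show 1: "(\<integral>\<^sup>+y. ennreal \<bar>k ((x - y) /\<^sub>R d) / d ^ 3\<bar> \<partial>lborel) = ennreal (LINT z|lborel. \<bar>k z\<bar>)" for x
	proof -
		have "(x - (x + (- d) *\<^sub>R z)) /\<^sub>R d = z" for z :: "real ^ 3" using d by simp
		from nn_integral_affine[OF m1[of x], of "- d" x, unfolded this a] show ?thesis using d e by simp
	qed
	show "(\<integral>\<^sup>+x. ennreal \<bar>k ((x - y) /\<^sub>R d) / d ^ 3\<bar> \<partial>lborel) = ennreal (LINT z|lborel. \<bar>k z\<bar>)"
	proof -
		have "((y + d *\<^sub>R z) - y) /\<^sub>R d = z" for z :: "real ^ 3" using d by simp
		from nn_integral_affine[OF m2[of y], of d y, unfolded this a] show ?thesis using d e by simp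
	qed
	show "integrable lborel (%y. \<bar>k ((x - y) /\<^sub>R d) / d ^ 3\<bar>)"
		using 1[of x] by (intro integrableI_nonneg) auto
	show "(LINT y|lborel. \<bar>k ((x - y) /\<^sub>R d) / d ^ 3\<bar>) = (LINT z|lborel. \<bar>k z\<bar>)"
		using 1[of x] by (subst integral_eq_nn_integral) auto
qed

lemma conv_joint_measurable:
	assumes k: "kern k" and f: "f \<in> borelf"
	shows "(%p. f (snd p) * (k ((fst p - snd p) /\<^sub>R d) / d ^ 3)) \<in> borel_measurable (lborel \<Otimes>\<^sub>M lborel)"
proof -
	note kern_measurable[OF k, measurable] f[measurable]
	show ?thesis by measurable
qed

lemma conv_measurable:
	assumes k: "kern k" and f: "f \<in> borelf"
	shows "conv d k f \<in> borelf"
proof -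
	have "(%x. LINT y|lborel. f y * (k ((x - y) /\<^sub>R d) / d ^ 3)) \<in> borel_measurable lborel"
		using conv_joint_measurable[OF assms, of d]
		by (intro lborel.borel_measurable_lebesgue_integral) (simp add: split_beta')
	then show ?thesis by (simp add: conv_def[abs_def])
qed

text \<open>Cauchy-Schwarz after splitting the kernel as \<open>sqrt \<bar>K y\<bar>\<close> times
  \<open>sgn (K y) * sqrt \<bar>K y\<bar>\<close>. Integrating in x yields Young's
  inequality.\<close>

lemma conv_square_le:
	assumes k: "kern k" and f: "f \<in> borelf" "integrable lborel (%x. (f x)\<^sup>2)" and d: "0 < d"
	shows "ennreal ((conv d k f x)\<^sup>2) <= ennreal (LINT z|lborel. \<bar>k z\<bar>) * (\<integral>\<^sup>+y. ennreal ((f y)\<^sup>2) * ennreal \<bar>k ((x - y) /\<^sub>R d) / d ^ 3\<bar> \<partial>lborel)"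
proof -
	define K where "K y = k ((x - y) /\<^sub>R d) / d ^ 3" for y
	have [measurable]: "K \<in> borelf"
		unfolding K_def[abs_def] by (rule kern_shift_measurable[OF k])
	note f(1)[measurable]
	obtain B where B: "\<forall>z. \<bar>k z\<bar> <= B" using k by (auto simp: kern_def)
	have fK: "integrable lborel (%y. (f y)\<^sup>2 * \<bar>K y\<bar>)"
	proof (rule LI_bound)
		show "integrable lborel (%y. (f y)\<^sup>2 * (B / d ^ 3))" using f(2) by simp
		have KB: "\<bar>K y\<bar> <= \<bar>B / d ^ 3\<bar>" for y
			unfolding K_def abs_divide using B d by (intro divide_right_mono order_trans[OF _ abs_ge_self]) auto
		show "AE y in lborel. norm ((f y)\<^sup>2 * \<bar>K y\<bar>) <= norm ((f y)\<^sup>2 * (B / d ^ 3))"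
			unfolding real_norm_def abs_mult abs_abs by (intro AE_I2 mult_left_mono KB) simp
	qed measurable
	have K: "integrable lborel (%y. \<bar>K y\<bar>)" "(LINT y|lborel. \<bar>K y\<bar>) = (LINT z|lborel. \<bar>k z\<bar>)"
		unfolding K_def by (rule kern_abs_nn[OF k d])+
	have e1: "(f y * sqrt \<bar>K y\<bar>)\<^sup>2 = (f y)\<^sup>2 * \<bar>K y\<bar>" "(sgn (K y) * sqrt \<bar>K y\<bar>)\<^sup>2 = \<bar>K y\<bar>"
		"(f y * sqrt \<bar>K y\<bar>) * (sgn (K y) * sqrt \<bar>K y\<bar>) = f y * K y" for y
	proof -
		show "(f y * sqrt \<bar>K y\<bar>)\<^sup>2 = (f y)\<^sup>2 * \<bar>K y\<bar>" by (simp add: power_mult_distrib)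
		show "(sgn (K y) * sqrt \<bar>K y\<bar>)\<^sup>2 = \<bar>K y\<bar>" by (cases "K y = 0") (auto simp: power_mult_distrib sgn_if)
		have "sqrt \<bar>K y\<bar> * (sgn (K y) * sqrt \<bar>K y\<bar>) = sgn (K y) * (sqrt \<bar>K y\<bar> * sqrt \<bar>K y\<bar>)" by (simp only: mult_ac)
		also have "... = K y" by (simp add: sgn_mult_abs)
		finally show "(f y * sqrt \<bar>K y\<bar>) * (sgn (K y) * sqrt \<bar>K y\<bar>) = f y * K y" by (simp only: mult.assoc)
	qed
	have "(LINT y|lborel. f y * K y)\<^sup>2 <= (LINT y|lborel. (f y)\<^sup>2 * \<bar>K y\<bar>) * (LINT y|lborel. \<bar>K y\<bar>)"
		using cauchy_schwarz_integral(2)[of "%y. f y * sqrt \<bar>K y\<bar>" lborel "%y. sgn (K y) * sqrt \<bar>K y\<bar>"] fK K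
		by (simp add: e1)
	then have "(conv d k f x)\<^sup>2 <= (LINT z|lborel. \<bar>k z\<bar>) * (LINT y|lborel. (f y)\<^sup>2 * \<bar>K y\<bar>)"
		by (simp add: conv_def K_def[symmetric] K(2) mult.commute)
	then have "ennreal ((conv d k f x)\<^sup>2) <= ennreal ((LINT z|lborel. \<bar>k z\<bar>) * (LINT y|lborel. (f y)\<^sup>2 * \<bar>K y\<bar>))"
		by (rule ennreal_leI)
	also have "... = ennreal (LINT z|lborel. \<bar>k z\<bar>) * ennreal (LINT y|lborel. (f y)\<^sup>2 * \<bar>K y\<bar>)"
		by (intro ennreal_mult') auto
	also have "ennreal (LINT y|lborel. (f y)\<^sup>2 * \<bar>K y\<bar>) = (\<integral>\<^sup>+y. ennreal ((f y)\<^sup>2 * \<bar>K y\<bar>) \<partial>lborel)"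
		using fK by (intro nn_integral_eq_integral[symmetric]) auto
	also have "... = (\<integral>\<^sup>+y. ennreal ((f y)\<^sup>2) * ennreal \<bar>K y\<bar> \<partial>lborel)"
		by (intro nn_integral_cong ennreal_mult) auto
	finally show ?thesis unfolding K_def .
qed

lemma conv_L2_bound:
	assumes k: "kern k" and f: "f \<in> borelf" "integrable lborel (%x. (f x)\<^sup>2)" and d: "0 < d"
	shows "integrable lborel (%x. (conv d k f x)\<^sup>2)"
		and "(LINT x|lborel. (conv d k f x)\<^sup>2) <= (LINT z|lborel. \<bar>k z\<bar>)\<^sup>2 * (LINT x|lborel. (f x)\<^sup>2)"
proof -
	note [measurable] = kern_measurable[OF k] f(1) conv_measurable[OF k f(1)]
	let ?C = "LINT z|lborel. \<bar>k z\<bar>"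
	have "(\<integral>\<^sup>+x. ennreal ((conv d k f x)\<^sup>2) \<partial>lborel)
			<= (\<integral>\<^sup>+x. ennreal ?C * (\<integral>\<^sup>+y. ennreal ((f y)\<^sup>2) * ennreal \<bar>k ((x - y) /\<^sub>R d) / d ^ 3\<bar> \<partial>lborel) \<partial>lborel)"
		by (intro nn_integral_mono conv_square_le assms)
	also have "... = ennreal ?C * (\<integral>\<^sup>+x. \<integral>\<^sup>+y. ennreal ((f y)\<^sup>2) * ennreal \<bar>k ((x - y) /\<^sub>R d) / d ^ 3\<bar> \<partial>lborel \<partial>lborel)"
		by (intro nn_integral_cmult) measurable
	also have "(\<integral>\<^sup>+x. \<integral>\<^sup>+y. ennreal ((f y)\<^sup>2) * ennreal \<bar>k ((x - y) /\<^sub>R d) / d ^ 3\<bar> \<partial>lborel \<partial>lborel)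
			= (\<integral>\<^sup>+y. \<integral>\<^sup>+x. ennreal ((f y)\<^sup>2) * ennreal \<bar>k ((x - y) /\<^sub>R d) / d ^ 3\<bar> \<partial>lborel \<partial>lborel)"
		by (rule lborel_pair.Fubini'[symmetric]) measurable
	also have "... = (\<integral>\<^sup>+y. ennreal ((f y)\<^sup>2) * ennreal ?C \<partial>lborel)"
		by (intro nn_integral_cong, subst nn_integral_cmult) (measurable, simp only: kern_abs_nn(2)[OF k d])
	also have "... = ennreal (LINT x|lborel. (f x)\<^sup>2) * ennreal ?C"
		using f(2) by (subst nn_integral_multc) (auto simp: nn_integral_eq_integral)
	also have "ennreal ?C * (ennreal (LINT x|lborel. (f x)\<^sup>2) * ennreal ?C) = ennreal (?C\<^sup>2 * (LINT x|lborel. (f x)\<^sup>2))"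
		by (simp add: ennreal_mult'[symmetric] power2_eq_square mult_ac)
	finally have main: "(\<integral>\<^sup>+x. ennreal ((conv d k f x)\<^sup>2) \<partial>lborel) <= ennreal (?C\<^sup>2 * (LINT x|lborel. (f x)\<^sup>2))" .
	show i: "integrable lborel (%x. (conv d k f x)\<^sup>2)"
		using main by (intro integrableI_nonneg) (auto simp: ennreal_less_top top.not_eq_extremum intro: le_less_trans)
	show "(LINT x|lborel. (conv d k f x)\<^sup>2) <= ?C\<^sup>2 * (LINT x|lborel. (f x)\<^sup>2)"
		using main i by (subst (asm) nn_integral_eq_integral) (auto simp: ennreal_le_iff)
qed

text \<open>\<open>eta\<close> is a probability density on the unit ball, so the mollified value is
  an average of \<open>f\<close> over the ball of radius \<open>d\<close>.\<close>

lemma conv_diff_const: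
	assumes f: "integrable lborel f" and d: "0 < d"
		and e: "\<And>y. norm (x - y) < d ==> \<bar>f y - c\<bar> <= e"
	shows "\<bar>conv d eta f x - c\<bar> <= e"
proof -
	let ?K = "%y. eta ((x - y) /\<^sub>R d) / d ^ 3"
	have Kpos: "0 <= ?K y" for y using eta_nonneg d by simp
	have K: "integrable lborel ?K" "(LINT y|lborel. ?K y) = 1"
		using kern_abs_nn(3,4)[OF kern_eta(1) d, of x]
		unfolding abs_of_nonneg[OF Kpos] abs_of_nonneg[OF eta_nonneg] integral_eta by blast+
	note ci = conv_integrable[OF kern_eta(1) f, of d x]
	have e1: "(LINT y|lborel. (f y - c) * ?K y) = conv d eta f x - c"
	proof -
		have "(%y. (f y - c) * ?K y) = (%y. f y * ?K y - c * ?K y)" by (simp only: left_diff_distrib)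
		then have "(LINT y|lborel. (f y - c) * ?K y) = (LINT y|lborel. f y * ?K y) - c * (LINT y|lborel. ?K y)"
			using ci K(1) by (simp only: LINT_diff[OF ci integrable_mult_right[OF K(1)]] integral_mult_right_zero)
		then show ?thesis using K(2) by (simp only: conv_def mult_1_right)
	qed
	have "norm (LINT y|lborel. (f y - c) * ?K y) <= (LINT y|lborel. e * ?K y)"
	proof (rule LINT_norm_bound)
		have "(%y. (f y - c) * ?K y) = (%y. f y * ?K y - c * ?K y)" by (simp only: left_diff_distrib)
		then show "integrable lborel (%y. (f y - c) * ?K y)"
			using LI_diff[OF ci integrable_mult_right[OF K(1), of c]] by simp
		show "integrable lborel (%y. e * ?K y)" using K(1) by (rule integrable_mult_right)
		fix y
		show "norm ((f y - c) * ?K y) <= e * ?K y"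
		proof (cases "norm (x - y) < d")
			case True
			then show ?thesis unfolding real_norm_def abs_mult abs_of_nonneg[OF Kpos]
				by (intro mult_right_mono e Kpos)
		next
			case False
			then have "1 <= norm ((x - y) /\<^sub>R d)" using d by (simp add: divide_simps)
			then have "?K y = 0" using kern_eta(1) by (simp add: kern_def)
			then show ?thesis by (simp only: mult_zero_right norm_zero order_refl)
		qed
	qed
	also have "(LINT y|lborel. e * ?K y) = e" using K(2) by (simp only: integral_mult_right_zero mult_1_right)
	finally show ?thesis by (simp only: e1 real_norm_def)
qed

lemma conv_diff:
	assumes "kern k" "integrable lborel f" "integrable lborel g"
	shows "conv d k (%x. f x - g x) x = conv d k f x - conv d k g x"
	unfolding conv_def left_diff_distrib
	by (rule LINT_diff) (rule conv_integrable assms)+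

text \<open>Truncate first. Then \<open>measurable_on\<close> supplies continuous functions
  converging almost everywhere, and truncating these as well provides a constant dominating
  function.\<close>

lemma L2_dense_continuous:
	assumes f: "f \<in> borelf" "integrable Q (%x. (f x)\<^sup>2)" and e: "0 < e"
	shows "\<exists>w. continuous_on UNIV w \<and> (\<exists>B. \<forall>x. \<bar>w x\<bar> <= B) \<and> (LINT x|Q. (f x - w x)\<^sup>2) < (e :: real)"
proof -
	note f(1)[measurable]
	define T where "T n t = max (- real n) (min (real n) t)" for n t
	have T_bound: "\<bar>T n t\<bar> <= real n" for n t by (auto simp: T_def)
	have T_cont: "continuous_on UNIV (T n)" for n unfolding T_def[abs_def] by (intro continuous_intros)
	note [measurable] = borel_measurable_continuous_onI[OF T_cont]
	have T_le: "\<bar>t - T n t\<bar> <= \<bar>t\<bar>" for n t by (auto simp: T_def)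
	have "(%n. LINT x|Q. (f x - T n (f x))\<^sup>2) \<longlonglongrightarrow> (LINT x|Q. 0)"
	proof (rule integral_dominated_convergence[where w = "%x. (f x)\<^sup>2"])
		show "AE x in Q. (%n. (f x - T n (f x))\<^sup>2) \<longlonglongrightarrow> 0"
		proof (rule AE_I2)
			fix x
			obtain N where N: "\<bar>f x\<bar> <= real N" using real_arch_simple by blast
			have "\<forall>\<^sub>F n in sequentially. (f x - T n (f x))\<^sup>2 = 0"
				using eventually_ge_at_top[of N] by eventually_elim (use N in \<open>auto simp: T_def max_def min_def\<close>)
			then show "(%n. (f x - T n (f x))\<^sup>2) \<longlonglongrightarrow> 0" by (rule tendsto_eventually)
		qed
		show "AE x in Q. norm ((f x - T n (f x))\<^sup>2) <= (f x)\<^sup>2" for n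
			using T_le by (intro AE_I2) (simp add: abs_le_square_iff[symmetric])
	qed (use f(2) in \<open>auto intro!: borel_measurable_Q\<close>)
	then have "(%n. LINT x|Q. (f x - T n (f x))\<^sup>2) \<longlonglongrightarrow> 0" by simp
	then have "\<forall>\<^sub>F n in sequentially. (LINT x|Q. (f x - T n (f x))\<^sup>2) < e / 4"
		using e by (intro order_tendstoD(2)) auto
	then obtain n where n: "(LINT x|Q. (f x - T n (f x))\<^sup>2) < e / 4"
		by (blast dest: eventually_happens'[OF sequentially_bot])
	have "f \<in> borel_measurable lebesgue" using f(1) by (simp add: measurable_completion)
	then have "f measurable_on Omega"
		using sets_Omega by (intro lebesgue_measurable_imp_measurable_on) auto
	then obtain N g where N: "negligible N" and g: "\<And>m. continuous_on UNIV (g m)"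
		and lim: "\<And>x. x \<notin> N ==> (%m. g m x) \<longlonglongrightarrow> (if x \<in> Omega then f x else 0)"
		by (auto simp: measurable_on_def)
	note [measurable] = borel_measurable_continuous_onI[OF g]
	have "N \<in> null_sets lebesgue" using N by (simp add: negligible_iff_null_sets)
	then have "AE x in lebesgue. x \<notin> N" by (rule AE_not_in)
	then have AEN: "AE x in Q. x \<notin> N"
		by (simp add: AE_completion_iff AE_restrict_space_iff eventually_mono)
	have "(%m. LINT x|Q. (T n (f x) - T n (g m x))\<^sup>2) \<longlonglongrightarrow> (LINT x|Q. 0)"
	proof (rule integral_dominated_convergence[where w = "%x. (2 * real n)\<^sup>2"])
		show "AE x in Q. (%m. (T n (f x) - T n (g m x))\<^sup>2) \<longlonglongrightarrow> 0"
			using AEN AE_space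
		proof eventually_elim
			fix x assume x: "x \<notin> N" "x \<in> space Q"
			then have "(%m. T n (g m x)) \<longlonglongrightarrow> T n (f x)"
				using lim[OF x(1)] T_cont[of n] by (auto simp: continuous_on_eq_continuous_at intro!: isCont_tendsto_compose[where g = "T n"])
			then have "(%m. (T n (f x) - T n (g m x))\<^sup>2) \<longlonglongrightarrow> (T n (f x) - T n (f x))\<^sup>2"
				by (intro tendsto_intros)
			then show "(%m. (T n (f x) - T n (g m x))\<^sup>2) \<longlonglongrightarrow> 0" by simp
		qed
		show "AE x in Q. norm ((T n (f x) - T n (g m x))\<^sup>2) <= (2 * real n)\<^sup>2" for m
		proof (rule AE_I2)
			fix x
			have "\<bar>T n (f x) - T n (g m x)\<bar> <= 2 * real n" using T_bound[of n "f x"] T_bound[of n "g m x"] by linarith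
			then show "norm ((T n (f x) - T n (g m x))\<^sup>2) <= (2 * real n)\<^sup>2"
				using power_mono[of "\<bar>T n (f x) - T n (g m x)\<bar>" "2 * real n" 2] by simp
		qed
	qed (auto intro!: borel_measurable_Q)
	then have "(%m. LINT x|Q. (T n (f x) - T n (g m x))\<^sup>2) \<longlonglongrightarrow> 0" by simp
	then have "\<forall>\<^sub>F m in sequentially. (LINT x|Q. (T n (f x) - T n (g m x))\<^sup>2) < e / 4"
		using e by (intro order_tendstoD(2)) auto
	then obtain m where m: "(LINT x|Q. (T n (f x) - T n (g m x))\<^sup>2) < e / 4"
		by (blast dest: eventually_happens'[OF sequentially_bot])
	let ?w = "%x. T n (g m x)"
	have i1: "integrable Q (%x. (f x - T n (f x))\<^sup>2)"
		using T_le by (intro LI_bound[OF f(2)]) (auto intro!: borel_measurable_Q simp: abs_le_square_iff[symmetric])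
	have i2: "integrable Q (%x. (T n (f x) - T n (g m x))\<^sup>2)"
	proof (rule Q.integrable_const_bound[of _ "(2 * real n)\<^sup>2"])
		show "AE x in Q. norm ((T n (f x) - T n (g m x))\<^sup>2) <= (2 * real n)\<^sup>2"
		proof (rule AE_I2)
			fix x
			have "\<bar>T n (f x) - T n (g m x)\<bar> <= 2 * real n" using T_bound[of n "f x"] T_bound[of n "g m x"] by linarith
			then show "norm ((T n (f x) - T n (g m x))\<^sup>2) <= (2 * real n)\<^sup>2"
				using power_mono[of "\<bar>T n (f x) - T n (g m x)\<bar>" "2 * real n" 2] by simp
		qed
	qed (auto intro!: borel_measurable_Q)
	have sq: "(a + b)\<^sup>2 <= 2 * a\<^sup>2 + 2 * b\<^sup>2" for a b :: real
		using sum_squares_bound[of a b] by (simp add: power2_sum)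
	have "(LINT x|Q. (f x - ?w x)\<^sup>2) <= (LINT x|Q. 2 * (f x - T n (f x))\<^sup>2 + 2 * (T n (f x) - ?w x)\<^sup>2)"
	proof (rule integral_mono_AE')
		show "AE x in Q. (f x - ?w x)\<^sup>2 <= 2 * (f x - T n (f x))\<^sup>2 + 2 * (T n (f x) - ?w x)\<^sup>2"
			using sq[of "f x - T n (f x)" "T n (f x) - ?w x" for x] by (intro AE_I2) simp
	qed (use i1 i2 in auto)
	also have "... = 2 * (LINT x|Q. (f x - T n (f x))\<^sup>2) + 2 * (LINT x|Q. (T n (f x) - ?w x)\<^sup>2)"
		using i1 i2 by simp
	also have "... < e" using m n by simp
	finally have "(LINT x|Q. (f x - ?w x)\<^sup>2) < e" .
	moreover have "continuous_on UNIV ?w"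
		by (rule continuous_on_compose2[OF T_cont g]) simp
	ultimately show ?thesis using T_bound by (intro exI[of _ ?w] conjI) auto
qed

section \<open>Lebesgue versus Borel measure on the cube, and Borel representatives\<close>

lemma Q_lborel:
	fixes g :: "real ^ 3 \<Rightarrow> real"
	assumes "\<And>x. x \<notin> Omega ==> g x = 0"
	shows "integrable Q g \<longleftrightarrow> integrable lborel g" "(LINT x|Q. g x) = (LINT x|lborel. g x)"
proof -
	have "(%x. indicator Omega x *\<^sub>R g x) = g"
		by (rule ext, case_tac "x \<in> Omega") (simp_all add: assms)
	then show "integrable Q g \<longleftrightarrow> integrable lborel g" "(LINT x|Q. g x) = (LINT x|lborel. g x)"
		by (simp_all add: integrable_restrict_space integral_restrict_space set_integrable_def)
qed

lemma Q_indicator: "(LINT x|Q. g x) = (LINT x|lborel. indicator Omega x * g x :: real)"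
	by (simp add: integral_restrict_space)

lemma AE_Q_iff: "(AE x in Q. P x) \<longleftrightarrow> (AE x in lborel. x \<in> Omega \<longrightarrow> P x)"
	by (rule AE_restrict_space_iff) simp

lemma AE_lebesgue_on_Omega: "(AE x in lebesgue_on Omega. P x) \<longleftrightarrow> (AE x in Q. P x)"
proof -
	have "Omega \<inter> space lebesgue \<in> sets lebesgue" by (simp add: sets_completionI_sets)
	then show ?thesis by (simp add: AE_restrict_space_iff AE_completion_iff AE_Q_iff)
qed

lemma lebesgue_on_Omega_Q:
	fixes h :: "real ^ 3 \<Rightarrow> real"
	assumes h: "h \<in> borelf"
	shows "integrable (lebesgue_on Omega) h \<longleftrightarrow> integrable Q h" "(LINT x|lebesgue_on Omega. h x) = (LINT x|Q. h x)"
proof -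
	have "Omega \<in> sets lebesgue" by (simp add: sets_completionI_sets)
	moreover have "(%x. indicator Omega x *\<^sub>R h x) \<in> borel_measurable lborel" using h by measurable
	ultimately show "integrable (lebesgue_on Omega) h \<longleftrightarrow> integrable Q h"
		"(LINT x|lebesgue_on Omega. h x) = (LINT x|Q. h x)"
		by (simp_all add: integrable_restrict_space integral_restrict_space set_integrable_def
				integrable_completion integral_completion)
qed

lemma lebesgue_on_borel_rep:
	fixes f :: "real ^ 3 \<Rightarrow> real"
	assumes "f \<in> borel_measurable (lebesgue_on Omega)"
	obtains f' where "f' \<in> borelf" "\<And>x. x \<notin> Omega ==> f' x = 0" "AE x in Q. f x = f' x"
proof -
	have "(%x. indicator Omega x *\<^sub>R f x) \<in> borel_measurable lebesgue"
		using assms by (subst (asm) borel_measurable_restrict_space_iff) (auto simp: sets_completionI_sets)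
	then obtain g where g: "g \<in> borel_measurable lborel" "AE x in lborel. indicator Omega x *\<^sub>R f x = g x"
		using completion_ex_borel_measurable_real by blast
	show thesis
	proof
		show "(%x. indicator Omega x * g x) \<in> borelf" using g(1) by measurable
		show "AE x in Q. f x = indicator Omega x * g x"
			unfolding AE_Q_iff using g(2) by eventually_elim auto
	qed auto
qed

text \<open>Extension by zero lets convolutions run over the whole space, and makes integrals over
  \<open>Q\<close> and over \<open>lborel\<close> coincide.\<close>

definition L2z :: "(real ^ 3 \<Rightarrow> real) \<Rightarrow> bool" where
	"L2z f \<longleftrightarrow> f \<in> borelf \<and> integrable Q (%x. (f x)\<^sup>2) \<and> (\<forall>x. x \<notin> Omega \<longrightarrow> f x = 0)"

lemma L2zD:
	assumes "L2z f"
	shows "f \<in> borelf" "integrable Q (%x. (f x)\<^sup>2)" "x \<notin> Omega ==> f x = 0"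
		"integrable lborel (%x. (f x)\<^sup>2)" "(LINT x|lborel. (f x)\<^sup>2) = (LINT x|Q. (f x)\<^sup>2)"
		"integrable Q f" "integrable lborel f"
proof -
	have f: "f \<in> borelf" "integrable Q (%x. (f x)\<^sup>2)" and z: "\<And>x. x \<notin> Omega ==> f x = 0"
		using assms unfolding L2z_def by blast+
	show "f \<in> borelf" "integrable Q (%x. (f x)\<^sup>2)" by fact+
	show "f x = 0" if "x \<notin> Omega" by (rule z[OF that])
	have z2: "(f y)\<^sup>2 = 0" if "y \<notin> Omega" for y by (simp only: z[OF that] zero_power2)
	show "integrable lborel (%x. (f x)\<^sup>2)" by (rule iffD1[OF Q_lborel(1)[OF z2] f(2)])
	show "(LINT x|lborel. (f x)\<^sup>2) = (LINT x|Q. (f x)\<^sup>2)" by (rule Q_lborel(2)[OF z2, symmetric])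
	show i: "integrable Q f" by (rule Q.L2_imp_L1(1)[OF borel_measurable_Q[OF f(1)] f(2)])
	show "integrable lborel f" by (rule iffD1[OF Q_lborel(1)[OF z] i])
qed

lemma square_sum_le: "(a + b)\<^sup>2 <= 2 * a\<^sup>2 + 2 * (b :: real)\<^sup>2"
	using sum_squares_bound[of a b] by (simp add: power2_sum)

lemma square_sum3_le: "(a + b + c)\<^sup>2 <= 3 * a\<^sup>2 + 3 * b\<^sup>2 + 3 * (c :: real)\<^sup>2"
	using sum_squares_bound[of a b] sum_squares_bound[of a c] sum_squares_bound[of b c]
	by (simp add: power2_eq_square algebra_simps)

lemma L2z_diff: assumes "L2z f" "L2z g" shows "L2z (%x. f x - g x)"
proof -
	note L2zD(1)[OF assms(1), measurable] L2zD(1)[OF assms(2), measurable]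
	have "integrable Q (%x. (f x - g x)\<^sup>2)"
	proof (rule LI_bound)
		show "integrable Q (%x. 2 * (f x)\<^sup>2 + 2 * (g x)\<^sup>2)" using L2zD(2)[OF assms(1)] L2zD(2)[OF assms(2)] by simp
		show "AE x in Q. norm ((f x - g x)\<^sup>2) <= norm (2 * (f x)\<^sup>2 + 2 * (g x)\<^sup>2)"
			using square_sum_le[of "f x" "- g x" for x] by (intro AE_I2) simp
	qed (auto intro!: borel_measurable_Q)
	then show ?thesis using assms by (auto simp: L2z_def)
qed

lemma L2z_bB: assumes "bB F" shows "L2z (%x. indicator Omega x * F x)"
proof -
	have "bB (%x. indicator Omega x * F x)"
		using assms bB_bound[OF assms] by (auto simp: bB_def indicator_def)
	then show ?thesis by (auto simp: L2z_def intro!: bB_integrable bB_power bB_measurable)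
qed

text \<open>The factor 8 = 2^3 is the largest Jacobian of the dilation when \<open>l\<close> is at
  least 1/2.\<close>

lemma conv_scaled_L2:
	assumes f: "L2z f" and k: "kern k" and d: "0 < d" and l: "1 / 2 <= l"
	shows "integrable lborel (%x. (conv d k f (l *\<^sub>R x))\<^sup>2)"
		and "(LINT x|lborel. (conv d k f (l *\<^sub>R x))\<^sup>2) <= 8 * (LINT z|lborel. \<bar>k z\<bar>)\<^sup>2 * (LINT x|Q. (f x)\<^sup>2)"
proof -
	note b = conv_L2_bound[OF k L2zD(1,4)[OF f] d]
	have m[measurable]: "conv d k f \<in> borelf" by (rule conv_measurable[OF k L2zD(1)[OF f]])
	have "(\<integral>\<^sup>+x. ennreal ((conv d k f x)\<^sup>2) \<partial>lborel) = ennreal (\<bar>l\<bar> ^ 3) * (\<integral>\<^sup>+z. ennreal ((conv d k f (l *\<^sub>R z))\<^sup>2) \<partial>lborel)"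
		using nn_integral_affine[of "%x. ennreal ((conv d k f x)\<^sup>2)" l 0] l by simp
	moreover have "ennreal (1 / 8) <= ennreal (\<bar>l\<bar> ^ 3)"
		using power_mono[OF l, of 3] l by (intro ennreal_leI) (simp add: power_divide)
	ultimately have "ennreal (1 / 8) * (\<integral>\<^sup>+z. ennreal ((conv d k f (l *\<^sub>R z))\<^sup>2) \<partial>lborel) <= (\<integral>\<^sup>+x. ennreal ((conv d k f x)\<^sup>2) \<partial>lborel)"
		by (simp add: mult_right_mono)
	then have "ennreal 8 * (ennreal (1 / 8) * (\<integral>\<^sup>+z. ennreal ((conv d k f (l *\<^sub>R z))\<^sup>2) \<partial>lborel))
			<= ennreal 8 * (\<integral>\<^sup>+x. ennreal ((conv d k f x)\<^sup>2) \<partial>lborel)"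
		by (rule mult_left_mono) simp
	also have "ennreal 8 * (ennreal (1 / 8) * (\<integral>\<^sup>+z. ennreal ((conv d k f (l *\<^sub>R z))\<^sup>2) \<partial>lborel))
			= (\<integral>\<^sup>+z. ennreal ((conv d k f (l *\<^sub>R z))\<^sup>2) \<partial>lborel)"
		by (simp add: mult.assoc[symmetric] ennreal_mult''[symmetric] del: ennreal_numeral)
	also have "(\<integral>\<^sup>+x. ennreal ((conv d k f x)\<^sup>2) \<partial>lborel) = ennreal (LINT x|lborel. (conv d k f x)\<^sup>2)"
		using b(1) by (intro nn_integral_eq_integral) auto
	also have "ennreal 8 * ennreal (LINT x|lborel. (conv d k f x)\<^sup>2) = ennreal (8 * (LINT x|lborel. (conv d k f x)\<^sup>2))"
		by (simp add: ennreal_mult' del: ennreal_numeral)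
	also have "... <= ennreal (8 * (LINT z|lborel. \<bar>k z\<bar>)\<^sup>2 * (LINT x|Q. (f x)\<^sup>2))"
		using b(2) L2zD(5)[OF f] by (intro ennreal_leI) simp
	finally have main: "(\<integral>\<^sup>+z. ennreal ((conv d k f (l *\<^sub>R z))\<^sup>2) \<partial>lborel) <= ennreal (8 * (LINT z|lborel. \<bar>k z\<bar>)\<^sup>2 * (LINT x|Q. (f x)\<^sup>2))" .
	show i: "integrable lborel (%x. (conv d k f (l *\<^sub>R x))\<^sup>2)"
		using main by (intro integrableI_nonneg) (auto simp: top.not_eq_extremum ennreal_less_top intro: le_less_trans)
	show "(LINT x|lborel. (conv d k f (l *\<^sub>R x))\<^sup>2) <= 8 * (LINT z|lborel. \<bar>k z\<bar>)\<^sup>2 * (LINT x|Q. (f x)\<^sup>2)"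
		using main i by (subst (asm) nn_integral_eq_integral) (auto simp: ennreal_le_iff)
qed

lemma measure_Omega [simp]: "measure Q Omega = 8"
proof -
	have "\<forall>b\<in>Basis. ((\<chi> i. - 1) :: real ^ 3) \<bullet> b <= (\<chi> i. 1) \<bullet> b"
		by (auto simp: Basis_vec_def inner_axis)
	then show ?thesis
		by (simp add: measure_restrict_space Omega_box measure_lborel_box_eq prod_Basis_vec prod_UNIV_3)
qed

text \<open>\<open>w\<close> is continuous only on the closed cube. Contracting by
  \<open>l n\<close> before mollifying keeps the kernel inside the cube, which gives uniform
  convergence up to the boundary; the number 3 bounds the norm of a point of the closed
  cube.\<close>

lemma conv_uniform:
	assumes w: "continuous_on (cbox (\<chi> i. - 1) (\<chi> i. 1)) w" and wi: "integrable lborel (%x. indicator Omega x * w x)" and e: "0 < (e :: real)"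
		and d: "\<And>n. 0 < d n" "d \<longlonglongrightarrow> 0" and l: "\<And>n. l n <= 1" "l \<longlonglongrightarrow> 1"
		and A: "A \<subseteq> cbox (\<chi> i. - 1) (\<chi> i. 1)" "\<And>n x y. x \<in> A ==> norm (l n *\<^sub>R x - y) < d n ==> y \<in> Omega"
	shows "\<forall>\<^sub>F n in sequentially. \<forall>x\<in>A. \<bar>conv (d n) eta (%x. indicator Omega x * w x) (l n *\<^sub>R x) - w x\<bar> <= e"
proof -
	let ?C = "cbox (\<chi> i. - 1) (\<chi> i. 1) :: (real ^ 3) set"
	have "uniformly_continuous_on ?C w" by (intro compact_uniformly_continuous w) auto
	then obtain r where r: "r > 0" "\<And>a b. a \<in> ?C ==> b \<in> ?C ==> dist a b < r ==> dist (w a) (w b) < e"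
		using e unfolding uniformly_continuous_on_def by metis
	have "(%n. d n + 3 * (1 - l n)) \<longlonglongrightarrow> 0 + 3 * (1 - 1)" by (intro tendsto_intros d l)
	then have "\<forall>\<^sub>F n in sequentially. d n + 3 * (1 - l n) < r" using r(1) by (intro order_tendstoD(2)) auto
	then show ?thesis
	proof eventually_elim
		fix n assume n: "d n + 3 * (1 - l n) < r"
		show "\<forall>x\<in>A. \<bar>conv (d n) eta (%x. indicator Omega x * w x) (l n *\<^sub>R x) - w x\<bar> <= e"
		proof
			fix x assume x: "x \<in> A"
			have "norm x <= 3"
			proof -
				have "\<bar>x $ i\<bar> <= 1" for i using x A(1) by (auto simp: mem_box_cart abs_le_iff subset_eq minus_le_iff)
				from this[of 1] this[of 2] this[of 3] show ?thesis using norm_real3_le[of x] by linarith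
			qed
			show "\<bar>conv (d n) eta (%x. indicator Omega x * w x) (l n *\<^sub>R x) - w x\<bar> <= e"
			proof (rule conv_diff_const[OF wi d(1)])
				fix y assume y: "norm (l n *\<^sub>R x - y) < d n"
				then have yO: "y \<in> Omega" using A(2) x by blast
				then have yC: "y \<in> ?C" using box_subset_cbox by (auto simp: Omega_box)
				have "y - x = (y - l n *\<^sub>R x) - (1 - l n) *\<^sub>R x" by (simp add: algebra_simps)
				then have "norm (y - x) = norm ((y - l n *\<^sub>R x) - (1 - l n) *\<^sub>R x)" by (rule arg_cong)
				also have "... <= norm (y - l n *\<^sub>R x) + norm ((1 - l n) *\<^sub>R x)" by (rule norm_triangle_ineq4)
				also have "norm (y - l n *\<^sub>R x) = norm (l n *\<^sub>R x - y)" by (rule norm_minus_commute)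
				also have "norm (l n *\<^sub>R x - y) + norm ((1 - l n) *\<^sub>R x) <= d n + 3 * (1 - l n)"
					using y l(1)[of n] mult_left_mono[OF \<open>norm x <= 3\<close>, of "1 - l n"] by simp
				also note n
				finally have "dist y x < r" by (simp add: dist_norm)
				then have "dist (w y) (w x) < e" using r(2) yC x A(1) by blast
				then show "\<bar>indicator Omega y * w y - w x\<bar> <= e" using yO by (simp add: dist_real_def)
			qed
		qed
	qed
qed

text \<open>Density argument: the operators are bounded on L^2 uniformly in n, and on continuous
  functions they converge uniformly on \<open>A\<close>.\<close>

lemma conv_L2_tendsto:
	assumes f: "L2z f" and d: "\<And>n. 0 < d n" "d \<longlonglongrightarrow> 0" and l: "\<And>n. 1 / 2 <= l n" "\<And>n. l n <= 1" "l \<longlonglongrightarrow> 1"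
		and Am: "A \<in> sets borel" and A: "A \<subseteq> Omega" "\<And>n x y. x \<in> A ==> norm (l n *\<^sub>R x - y) < d n ==> y \<in> Omega"
	shows "(%n. LINT x|Q. indicator A x * (conv (d n) eta f (l n *\<^sub>R x) - f x)\<^sup>2) \<longlonglongrightarrow> 0"
proof (rule LIMSEQ_I)
	fix r :: real assume r: "0 < r"
	\<comment> \<open>The final bound is 27 times this error plus 24 s^2, where 27 = 3 * 8 + 3 and 24
	  is 3 times the volume of the cube; indeed 27/60 + 24/100 < 1.\<close>
	obtain w where w: "continuous_on UNIV w" "(LINT x|Q. (f x - w x)\<^sup>2) < r / 60"
		using L2_dense_continuous[OF L2zD(1,2)[OF f], of "r / 60"] r by auto
	define w1 where "w1 x = indicator Omega x * w x" for x
	have w1: "L2z w1" unfolding w1_def[abs_def] by (intro L2z_bB bB_cont w)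
	define F where "F x = f x - w1 x" for x
	have F: "L2z F" unfolding F_def[abs_def] by (intro L2z_diff f w1)
	have FQ: "(LINT x|Q. (F x)\<^sup>2) = (LINT x|Q. (f x - w x)\<^sup>2)"
		by (intro LINT_cong) (auto simp: F_def w1_def)
	note [measurable] = conv_measurable[OF kern_eta(1) L2zD(1)[OF f]] conv_measurable[OF kern_eta(1) L2zD(1)[OF F]]
		Am L2zD(1)[OF f] L2zD(1)[OF F]
	define s where "s = sqrt (r / 100)"
	have s: "0 < s" "s\<^sup>2 = r / 100" using r by (auto simp: s_def)
	have "\<forall>\<^sub>F n in sequentially. \<forall>x\<in>A. \<bar>conv (d n) eta (%x. indicator Omega x * w x) (l n *\<^sub>R x) - w x\<bar> <= s"
	proof (rule conv_uniform[OF _ _ s(1) d l(2,3) _ A(2)])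
		show "continuous_on (cbox (\<chi> i. - 1) (\<chi> i. 1)) w" using w(1) by (rule continuous_on_subset) simp
		show "integrable lborel (%x. indicator Omega x * w x)" using L2zD(7)[OF w1] by (simp add: w1_def[abs_def])
		show "A \<subseteq> cbox (\<chi> i. - 1) (\<chi> i. 1)" using A(1) box_subset_cbox by (auto simp: Omega_box)
	qed
	then have ev: "\<forall>\<^sub>F n in sequentially. \<forall>x\<in>A. \<bar>conv (d n) eta w1 (l n *\<^sub>R x) - w x\<bar> <= s"
		by (simp add: w1_def[abs_def])
	show "\<exists>n0. \<forall>n\<ge>n0. norm ((LINT x|Q. indicator A x * (conv (d n) eta f (l n *\<^sub>R x) - f x)\<^sup>2) - 0) < r"
	proof -
		obtain n0 where n0: "\<And>n x. n \<ge> n0 ==> x \<in> A ==> \<bar>conv (d n) eta w1 (l n *\<^sub>R x) - w x\<bar> <= s"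
			using ev by (auto simp: eventually_sequentially)
		have "norm ((LINT x|Q. indicator A x * (conv (d n) eta f (l n *\<^sub>R x) - f x)\<^sup>2) - 0) < r" if n: "n \<ge> n0" for n
		proof -
			have cF: "integrable lborel (%x. (conv (d n) eta F (l n *\<^sub>R x))\<^sup>2)"
				"(LINT x|lborel. (conv (d n) eta F (l n *\<^sub>R x))\<^sup>2) <= 8 * (LINT x|Q. (F x)\<^sup>2)"
				using conv_scaled_L2[OF F kern_eta(1) d(1) l(1), of n n] integral_eta eta_nonneg by simp_all
			have cFQ: "integrable Q (%x. (conv (d n) eta F (l n *\<^sub>R x))\<^sup>2)"
				"(LINT x|Q. (conv (d n) eta F (l n *\<^sub>R x))\<^sup>2) <= (LINT x|lborel. (conv (d n) eta F (l n *\<^sub>R x))\<^sup>2)"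
			proof -
				have ii: "integrable lborel (%x. indicator Omega x * (conv (d n) eta F (l n *\<^sub>R x))\<^sup>2)"
					using integrable_mult_indicator[OF _ cF(1), of Omega] by simp
				then show "integrable Q (%x. (conv (d n) eta F (l n *\<^sub>R x))\<^sup>2)"
					by (simp add: integrable_restrict_space set_integrable_def)
				show "(LINT x|Q. (conv (d n) eta F (l n *\<^sub>R x))\<^sup>2) <= (LINT x|lborel. (conv (d n) eta F (l n *\<^sub>R x))\<^sup>2)"
					unfolding Q_indicator by (intro integral_mono ii cF(1)) (auto simp: indicator_def)
			qed
			have iF: "integrable Q (%x. (F x)\<^sup>2)" by (rule L2zD(2)[OF F])
			have pt: "indicator A x * (conv (d n) eta f (l n *\<^sub>R x) - f x)\<^sup>2
					<= 3 * (conv (d n) eta F (l n *\<^sub>R x))\<^sup>2 + 3 * s\<^sup>2 + 3 * (F x)\<^sup>2" if x: "x \<in> Omega" for x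
			proof (cases "x \<in> A")
				case True
				have "conv (d n) eta F (l n *\<^sub>R x) = conv (d n) eta f (l n *\<^sub>R x) - conv (d n) eta w1 (l n *\<^sub>R x)"
					unfolding F_def[abs_def] by (rule conv_diff[OF kern_eta(1) L2zD(7)[OF f] L2zD(7)[OF w1]])
				then have "conv (d n) eta f (l n *\<^sub>R x) - f x
						= conv (d n) eta F (l n *\<^sub>R x) + (conv (d n) eta w1 (l n *\<^sub>R x) - w x) + (- F x)"
					using x by (simp add: F_def w1_def)
				then have "(conv (d n) eta f (l n *\<^sub>R x) - f x)\<^sup>2
						<= 3 * (conv (d n) eta F (l n *\<^sub>R x))\<^sup>2 + 3 * (conv (d n) eta w1 (l n *\<^sub>R x) - w x)\<^sup>2 + 3 * (F x)\<^sup>2"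
					using square_sum3_le[of "conv (d n) eta F (l n *\<^sub>R x)" "conv (d n) eta w1 (l n *\<^sub>R x) - w x" "- F x"] by simp
				moreover have "(conv (d n) eta w1 (l n *\<^sub>R x) - w x)\<^sup>2 <= s\<^sup>2"
					using n0[OF n True] s(1) by (simp add: abs_le_square_iff[symmetric])
				ultimately show ?thesis using True by simp
			qed simp
			have "(LINT x|Q. indicator A x * (conv (d n) eta f (l n *\<^sub>R x) - f x)\<^sup>2)
					<= (LINT x|Q. 3 * (conv (d n) eta F (l n *\<^sub>R x))\<^sup>2 + 3 * s\<^sup>2 + 3 * (F x)\<^sup>2)"
				using cFQ(1) iF pt by (intro integral_mono_AE') (auto intro!: AE_I2)
			also have "... = 3 * (LINT x|Q. (conv (d n) eta F (l n *\<^sub>R x))\<^sup>2) + 24 * s\<^sup>2 + 3 * (LINT x|Q. (F x)\<^sup>2)"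
				using cFQ(1) iF by simp
			also have "... <= 27 * (LINT x|Q. (F x)\<^sup>2) + 24 * s\<^sup>2"
				using cF(2) cFQ(2) by simp
			also have "... < r" using w(2) s(2) r unfolding FQ by simp
			finally have "(LINT x|Q. indicator A x * (conv (d n) eta f (l n *\<^sub>R x) - f x)\<^sup>2) < r" .
			moreover have "0 <= (LINT x|Q. indicator A x * (conv (d n) eta f (l n *\<^sub>R x) - f x)\<^sup>2)"
				by (intro LINT_nonneg) auto
			ultimately show ?thesis by simp
		qed
		then show ?thesis by blast
	qed
qed

section \<open>Sobolev functions and smooth approximation\<close>

definition cube :: "real \<Rightarrow> (real ^ 3) set" where
	"cube r = {x. \<forall>i. \<bar>x $ i\<bar> <= r}"

lemma cube_cbox: "cube r = cbox (\<chi> i. - r) (\<chi> i. r)"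
	by (auto simp: cube_def mem_box_cart abs_le_iff minus_le_iff)

lemma compact_cube: "compact (cube r)" by (simp add: cube_cbox)
lemma sets_cube [measurable]: "cube r \<in> sets borel" by (simp add: cube_cbox)
lemma cube_Omega: "r < 1 ==> cube r \<subseteq> Omega"
	unfolding cube_def Omega_def
proof clarify
	fix x :: "real ^ 3" and i assume "r < 1" "\<forall>i. \<bar>x $ i\<bar> <= r"
	then have "\<bar>x $ i\<bar> < 1" using le_less_trans by blast
	then show "- 1 < x $ i \<and> x $ i < 1" by (simp add: abs_less_iff minus_less_iff)
qed

lemma cube_mono: "r <= r' ==> x \<in> cube r ==> x \<in> cube r'"
	unfolding cube_def by (auto intro: order_trans)

lemma cube_near: "x \<in> cube r ==> norm (x - y) <= d ==> y \<in> cube (r + d)"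
proof -
	assume a: "x \<in> cube r" "norm (x - y) <= d"
	have "\<bar>y $ i\<bar> <= r + d" for i
		using component_le_norm_cart[of "x - y" i] a by (auto simp: cube_def dest!: spec[of _ i])
	then show ?thesis by (simp add: cube_def)
qed

lemma conv_outside:
	assumes s: "\<And>y. y \<notin> cube r ==> s y = 0" and d: "0 < d" and k: "kern k" and x: "x \<notin> cube (r + d)"
	shows "conv d k s x = 0"
proof -
	have "s y * (k ((x - y) /\<^sub>R d) / d ^ 3) = 0" for y
	proof (cases "y \<in> cube r")
		case True
		then have "\<not> norm (y - x) <= d" using cube_near x by blast
		then have "1 <= norm ((x - y) /\<^sub>R d)" using d by (simp add: divide_simps norm_minus_commute)
		then show ?thesis using k by (simp add: kern_def)
	qed (simp add: s)
	then show ?thesis by (simp only: conv_def Bochner_Integration.integral_zero)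
qed

lemma C1_compact_C1fun:
	assumes "C1fun f" "\<And>x. x \<notin> cube r ==> f x = 0" "r < 1"
	shows "f \<in> C1_compact Omega"
proof -
	have "{x. f x \<noteq> 0} \<subseteq> cube r" using assms(2) by auto
	then have c: "closure {x. f x \<noteq> 0} \<subseteq> cube r"
		using compact_imp_closed[OF compact_cube] by (rule closure_minimal)
	then have "compact (closure {x. f x \<noteq> 0})"
		using compact_Int_closed[OF compact_cube closed_closure, of r "{x. f x \<noteq> 0}"] by (simp add: Int_absorb1)
	then show ?thesis using assms(1) c cube_Omega[OF assms(3)] by (auto simp: C1_compact_def C1fun_def)
qed

lemma conv_bound:
	assumes "integrable lborel s" "0 < d" "\<And>x. \<bar>s x\<bar> <= B"
	shows "\<bar>conv d eta s x\<bar> <= B"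
	using conv_diff_const[OF assms(1,2), of x 0 B] assms(3) by simp

lemma C1_compactD:
	assumes "\<phi> \<in> C1_compact Omega"
	shows "C1fun \<phi>" "bB \<phi>" "bB (partial_deriv i \<phi>)" "x \<notin> Omega ==> \<phi> x = 0"
proof -
	show 1: "C1fun \<phi>" using assms by (auto simp: C1_compact_def C1fun_def)
	show "bB \<phi>" "bB (partial_deriv i \<phi>)" using C1fun_bB[OF 1] by auto
	show "x \<notin> Omega ==> \<phi> x = 0" using assms closure_subset[of "{x. \<phi> x \<noteq> 0}"] by (auto simp: C1_compact_def)
qed

lemma L2z_bounded:
	assumes "s \<in> borelf" "\<And>x. \<bar>s x\<bar> <= B" "\<And>y. y \<notin> Omega ==> s y = 0"
	shows "L2z s"
proof -
	have "bB s" using assms by (auto simp: bB_def)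
	then show ?thesis using assms by (auto simp: L2z_def intro!: bB_integrable bB_power)
qed

text \<open>Testing with the mollified sign of \<open>G\<close> on the inner cube produces in the
  limit the L^1 norm of \<open>G\<close> there. The test functions stay bounded by 1, so almost
  everywhere convergence along a subsequence is enough.\<close>

lemma fundamental_lemma_cube:
	fixes G :: "real ^ 3 \<Rightarrow> real"
	assumes G: "integrable lborel G" and r: "0 < r" "r < 1"
		and z: "\<And>\<phi>. \<phi> \<in> C1_compact Omega ==> (\<And>x. x \<notin> cube ((1 + r) / 2) ==> \<phi> x = 0) ==> (LINT x|lborel. G x * \<phi> x) = 0"
	shows "AE x in lborel. x \<in> cube r \<longrightarrow> G x = 0"
proof -
	define s where "s x = indicator (cube r) x * sgn (G x)" for x
	have [measurable]: "G \<in> borelf" using borel_measurable_integrable[OF G] by simp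
	have [measurable]: "s \<in> borelf" unfolding s_def[abs_def] by measurable
	have s1: "\<bar>s x\<bar> <= 1" for x by (auto simp: s_def indicator_def sgn_if)
	have s0: "s x = 0" if "x \<notin> cube r" for x using that by (simp add: s_def)
	have L: "L2z s" using s1 s0 cube_Omega[OF r(2)] by (intro L2z_bounded[of _ 1]) auto
	define d where "d n = (1 - r) / 4 * (1 / real (Suc n))" for n
	have d: "0 < d n" for n using r by (simp add: d_def)
	have d2: "d n <= (1 - r) / 4" for n
	proof -
		have "1 / real (Suc n) <= 1" by simp
		from mult_left_mono[OF this, of "(1 - r) / 4"] show ?thesis using r by (simp add: d_def)
	qed
	have "(%n. 1 / real (Suc n)) \<longlonglongrightarrow> 0" using LIMSEQ_inverse_real_of_nat by (simp add: inverse_eq_divide)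
	from tendsto_mult_right_zero[OF this, of "(1 - r) / 4"] have d0: "d \<longlonglongrightarrow> 0" by (simp only: d_def[abs_def])
	define \<phi> where "\<phi> n = conv (d n) eta s" for n
	let ?A = "cube ((1 + r) / 2)"
	have \<phi>0: "\<phi> n x = 0" if "x \<notin> ?A" for n x
	proof -
		have "r + d n <= (1 + r) / 2" using d2[of n] r by (simp add: field_simps)
		then have "x \<notin> cube (r + d n)" using that cube_mono by blast
		then show ?thesis unfolding \<phi>_def by (intro conv_outside[of r] s0 d kern_eta)
	qed
	have A: "?A \<subseteq> Omega" using r by (intro cube_Omega) simp
	have \<phi>C: "\<phi> n \<in> C1_compact Omega" for n
		using r by (intro C1_compact_C1fun[of _ "(1 + r) / 2"] \<phi>0) (auto simp: \<phi>_def intro!: C1fun_conv L2zD(7)[OF L] d)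
	have \<phi>1: "\<bar>\<phi> n x\<bar> <= 1" for n x
		unfolding \<phi>_def by (intro conv_bound L2zD(7)[OF L] d s1)
	have [measurable]: "\<phi> n \<in> borelf" for n
		using C1_compactD(2)[OF \<phi>C] by (rule bB_measurable)
	have lim: "(%n. LINT x|Q. indicator ?A x * (conv (d n) eta s (1 *\<^sub>R x) - s x)\<^sup>2) \<longlonglongrightarrow> 0"
	proof (rule conv_L2_tendsto[OF L d d0])
		fix n x y assume "x \<in> ?A" "norm (1 *\<^sub>R x - y) < d n"
		then have "y \<in> cube ((1 + r) / 2 + d n)" using cube_near[of x "(1 + r) / 2" y "d n"] by simp
		then show "y \<in> Omega" using cube_Omega[of "(1 + r) / 2 + d n"] d2[of n] r by (auto simp: field_simps)
	qed (use A in auto)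
	have s0A: "s x = 0" if "x \<notin> ?A" for x
		using that r cube_mono[of r "(1 + r) / 2" x] by (intro s0) auto
	have ind: "indicator ?A x * (conv (d n) eta s (1 *\<^sub>R x) - s x)\<^sup>2 = (\<phi> n x - s x)\<^sup>2" for n x
		using \<phi>0[of x n] s0A[of x] by (cases "x \<in> ?A") (simp_all add: \<phi>_def)
	define u where "u n x = \<phi> n x - s x" for n x
	have bu: "bB (u n)" for n
		unfolding u_def[abs_def] using C1_compactD(2)[OF \<phi>C] s1 by (intro bB_diff) (auto simp: bB_def)
	have "(%n. LINT x|Q. (u n x)\<^sup>2) \<longlonglongrightarrow> 0" using lim unfolding ind u_def .
	then have "(%n. 8 * (LINT x|Q. (u n x)\<^sup>2)) \<longlonglongrightarrow> 0" by (rule tendsto_mult_right_zero)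
	then have "(%n. sqrt (8 * (LINT x|Q. (u n x)\<^sup>2))) \<longlonglongrightarrow> 0" using tendsto_real_sqrt by fastforce
	then have "(%n. LINT x|Q. norm (u n x)) \<longlonglongrightarrow> 0"
	proof (rule Lim_null_comparison[rotated], intro always_eventually allI)
		fix n
		have "(LINT x|Q. \<bar>u n x\<bar>)\<^sup>2 <= 8 * (LINT x|Q. (u n x)\<^sup>2)"
			using Q.L2_imp_L1(3)[OF bB_measurable_Q[OF bu] bB_integrable[OF bB_power[OF bu]], of n] by simp
		then show "norm (LINT x|Q. norm (u n x)) <= sqrt (8 * (LINT x|Q. (u n x)\<^sup>2))"
			using real_le_rsqrt by auto
	qed
	from tendsto_L1_AE_subseq[OF bB_integrable[OF bu] this]
	obtain \<rho> where \<rho>: "AE x in Q. (%n. u (\<rho> n) x) \<longlonglongrightarrow> 0" by blast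
	have ae: "AE x in lborel. (%n. \<phi> (\<rho> n) x) \<longlonglongrightarrow> s x"
		using \<rho> unfolding AE_Q_iff
	proof eventually_elim
		fix x assume a: "x \<in> Omega \<longrightarrow> (%n. u (\<rho> n) x) \<longlonglongrightarrow> 0"
		show "(%n. \<phi> (\<rho> n) x) \<longlonglongrightarrow> s x"
		proof (cases "x \<in> Omega")
			case True
			with a have "(%n. u (\<rho> n) x + s x) \<longlonglongrightarrow> 0 + s x" by (intro tendsto_intros) auto
			then show ?thesis by (simp add: u_def)
		next
			case False
			then have "x \<notin> ?A" using A by blast
			then show ?thesis by (simp add: \<phi>0 s0A)
		qed
	qed
	have "(%n. LINT x|lborel. G x * \<phi> (\<rho> n) x) \<longlonglongrightarrow> (LINT x|lborel. G x * s x)"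
	proof (rule integral_dominated_convergence[where w = "%x. \<bar>G x\<bar>"])
		show "AE x in lborel. (%n. G x * \<phi> (\<rho> n) x) \<longlonglongrightarrow> G x * s x"
			using ae by eventually_elim (intro tendsto_intros)
		show "AE x in lborel. norm (G x * \<phi> (\<rho> n) x) <= \<bar>G x\<bar>" for n
			using \<phi>1 by (intro AE_I2) (simp add: abs_mult mult_left_le)
	qed (use G in auto)
	moreover have "(LINT x|lborel. G x * \<phi> (\<rho> n) x) = 0" for n
		using \<phi>C \<phi>0 by (intro z)
	ultimately have "(LINT x|lborel. G x * s x) = 0" by (simp add: LIMSEQ_const_iff)
	also have "(%x. G x * s x) = (%x. indicator (cube r) x * \<bar>G x\<bar>)"
		by (auto simp: s_def abs_sgn)
	finally have "AE x in lborel. indicator (cube r) x * \<bar>G x\<bar> = 0"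
		using integrable_mult_indicator[of "cube r" lborel "%x. \<bar>G x\<bar>"] G
		by (subst (asm) integral_nonneg_eq_0_iff_AE) auto
	then show ?thesis by eventually_elim auto
qed

text \<open>Weak derivatives are a priori only locally integrable. Cutting off to a smaller cube
  gives a globally integrable Borel function and leaves the integrals against test functions
  supported there unchanged.\<close>

lemma locally_integrable_rep:
	assumes g: "locally_integrable_on g Omega" and R: "R < 1"
	obtains G where "integrable lborel G" "AE x in lborel. x \<in> cube R \<longrightarrow> G x = g x"
		"\<And>\<phi>. \<phi> \<in> borelf ==> (\<And>x. x \<notin> cube R ==> \<phi> x = 0) ==> (LINT x|lebesgue_on Omega. g x * \<phi> x) = (LINT x|lborel. G x * \<phi> x)"
proof -
	have cl: "cube R \<in> sets lebesgue" "Omega \<in> sets lebesgue" by (simp_all add: sets_completionI_sets)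
	have "integrable (lebesgue_on (cube R)) g"
		using g compact_cube cube_Omega[OF R] by (auto simp: locally_integrable_on_def)
	then have gi: "integrable lebesgue (%x. indicator (cube R) x * g x)"
		using cl by (simp add: integrable_restrict_space set_integrable_def)
	then obtain G where G: "G \<in> borel_measurable lborel" "AE x in lborel. indicator (cube R) x * g x = G x"
		using completion_ex_borel_measurable_real[OF borel_measurable_integrable] by blast
	have aeG: "AE x in lebesgue. indicator (cube R) x * g x = G x" using G(2) by (rule AE_completion)
	have "integrable lebesgue G"
		by (rule iffD1[OF integrable_cong_AE[OF borel_measurable_integrable[OF gi] measurable_completion[OF G(1)] aeG] gi])
	then have Gi: "integrable lborel G" using G(1) by (simp add: integrable_completion)
	show thesis
	proof
		show "AE x in lborel. x \<in> cube R \<longrightarrow> G x = g x" using G(2) by eventually_elim auto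
		fix \<phi> :: "real ^ 3 \<Rightarrow> real" assume \<phi>: "\<phi> \<in> borelf" "\<And>x. x \<notin> cube R ==> \<phi> x = 0"
		have "(LINT x|lebesgue_on Omega. g x * \<phi> x) = (LINT x|lebesgue. indicator Omega x *\<^sub>R (g x * \<phi> x))"
			using cl by (simp add: integral_restrict_space)
		also have "... = (LINT x|lebesgue. (indicator (cube R) x * g x) * \<phi> x)"
		proof (rule LINT_cong[OF refl])
			fix x show "indicator Omega x *\<^sub>R (g x * \<phi> x) = (indicator (cube R) x * g x) * \<phi> x"
				using \<phi>(2)[of x] cube_Omega[OF R] by (cases "x \<in> cube R") auto
		qed
		also have "... = (LINT x|lebesgue. G x * \<phi> x)"
		proof (rule integral_cong_AE)
			have \<phi>': "\<phi> \<in> borel_measurable lebesgue" using \<phi>(1) by (simp add: measurable_completion)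
			show "(%x. (indicator (cube R) x * g x) * \<phi> x) \<in> borel_measurable lebesgue"
				by (rule borel_measurable_times[OF borel_measurable_integrable[OF gi] \<phi>'])
			show "(%x. G x * \<phi> x) \<in> borel_measurable lebesgue"
				by (rule borel_measurable_times[OF measurable_completion[OF G(1)] \<phi>'])
			show "AE x in lebesgue. (indicator (cube R) x * g x) * \<phi> x = G x * \<phi> x"
				using aeG by eventually_elim simp
		qed
		also have "... = (LINT x|lborel. G x * \<phi> x)"
			using G(1) \<phi>(1) by (intro integral_completion) simp
		finally show "(LINT x|lebesgue_on Omega. g x * \<phi> x) = (LINT x|lborel. G x * \<phi> x)" .
	qed fact
qed

text \<open>\<open>weak_partial\<close> is a choice, and uniqueness ties it to a known
  representative. The fundamental lemma is applied on the closed cubes of half side 1 - 1/(n+2), so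
  the exceptional set is a countable union of null sets.\<close>

lemma has_weak_partial_unique:
	assumes g: "has_weak_partial Omega i f g" "has_weak_partial Omega i f h"
	shows "AE x in Q. g x = h x"
proof -
	define r where "r n = 1 - 1 / real (n + 2)" for n
	have r: "0 < r n" "r n < 1" for n by (auto simp: r_def divide_simps)
	have "AE x in lborel. x \<in> cube (r n) \<longrightarrow> g x = h x" for n
	proof -
		let ?R = "(1 + r n) / 2"
		have R: "?R < 1" "r n <= ?R" using r[of n] by (simp_all add: field_simps)
		obtain G where G: "integrable lborel G" "AE x in lborel. x \<in> cube ?R \<longrightarrow> G x = g x"
			"\<And>\<phi>. \<phi> \<in> borelf ==> (\<And>x. x \<notin> cube ?R ==> \<phi> x = 0) ==> (LINT x|lebesgue_on Omega. g x * \<phi> x) = (LINT x|lborel. G x * \<phi> x)"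
			using locally_integrable_rep[OF _ R(1), of g] g(1) unfolding has_weak_partial_def by blast
		obtain H where H: "integrable lborel H" "AE x in lborel. x \<in> cube ?R \<longrightarrow> H x = h x"
			"\<And>\<phi>. \<phi> \<in> borelf ==> (\<And>x. x \<notin> cube ?R ==> \<phi> x = 0) ==> (LINT x|lebesgue_on Omega. h x * \<phi> x) = (LINT x|lborel. H x * \<phi> x)"
			using locally_integrable_rep[OF _ R(1), of h] g(2) unfolding has_weak_partial_def by blast
		have "AE x in lborel. x \<in> cube (r n) \<longrightarrow> G x - H x = 0"
		proof (rule fundamental_lemma_cube)
			show "integrable lborel (%x. G x - H x)" using G(1) H(1) by simp
			fix \<phi> assume \<phi>: "\<phi> \<in> C1_compact Omega" "\<And>x. x \<notin> cube ?R ==> \<phi> x = 0"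
			have m: "\<phi> \<in> borelf" using C1_compactD(2)[OF \<phi>(1)] by (rule bB_measurable)
			obtain B where B: "B > 0" "\<forall>x\<in>Omega. \<bar>\<phi> x\<bar> <= B" using bB_bound[OF C1_compactD(2)[OF \<phi>(1)]] by auto
			have B': "\<bar>\<phi> x\<bar> <= B" for x using B C1_compactD(4)[OF \<phi>(1), of x] by (cases "x \<in> Omega") auto
			have ii: "integrable lborel (%x. F x * \<phi> x)" if "integrable lborel F" for F
			proof (rule LI_bound)
				show "integrable lborel (%x. F x * B)" using that by simp
				show "AE x in lborel. norm (F x * \<phi> x) <= norm (F x * B)"
					using B' B(1) by (intro AE_I2) (auto simp: abs_mult intro!: mult_left_mono)
				show "(%x. F x * \<phi> x) \<in> borel_measurable lborel"
					using borel_measurable_integrable[OF that] m by simp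
			qed
			have "(LINT x|lborel. G x * \<phi> x) = (LINT x|lborel. H x * \<phi> x)"
				using g \<phi>(1) G(3)[OF m \<phi>(2)] H(3)[OF m \<phi>(2)] unfolding has_weak_partial_def by force
			then show "(LINT x|lborel. (G x - H x) * \<phi> x) = 0"
				using ii[OF G(1)] ii[OF H(1)] by (simp add: left_diff_distrib)
		qed (use r in auto)
		then show ?thesis using G(2) H(2)
		proof eventually_elim
			fix x assume a: "x \<in> cube (r n) \<longrightarrow> G x - H x = 0" "x \<in> cube ?R \<longrightarrow> G x = g x" "x \<in> cube ?R \<longrightarrow> H x = h x"
			have "x \<in> cube (r n) ==> x \<in> cube ?R" using cube_mono[OF R(2)] .
			then show "x \<in> cube (r n) \<longrightarrow> g x = h x" using a by auto
		qed
	qed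
	then have "AE x in lborel. \<forall>n. x \<in> cube (r n) \<longrightarrow> g x = h x" unfolding AE_all_countable by blast
	then show ?thesis unfolding AE_Q_iff
	proof eventually_elim
		fix x assume a: "\<forall>n. x \<in> cube (r n) \<longrightarrow> g x = h x"
		show "x \<in> Omega \<longrightarrow> g x = h x"
		proof
			assume x: "x \<in> Omega"
			define m where "m = Max (range (%i. \<bar>x $ i\<bar>))"
			have mi: "\<bar>x $ i\<bar> <= m" for i unfolding m_def by (intro Max_ge) auto
			have "m \<in> range (%i. \<bar>x $ i\<bar>)" unfolding m_def by (intro Max_in) auto
			then have "m < 1" using x by (auto simp: Omega_def abs_less_iff minus_less_iff)
			then obtain n where "inverse (real (Suc n)) < 1 - m" using reals_Archimedean[of "1 - m"] by auto
			moreover have "1 / real (n + 2) <= inverse (real (Suc n))" by (simp add: inverse_eq_divide divide_simps)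
			ultimately have "x \<in> cube (r n)" using mi by (force simp: cube_def r_def intro: order_trans)
			then show "g x = h x" using a by blast
		qed
	qed
qed

text \<open>The Borel core of the Sobolev space, in which all analysis is done; \<open>W\<close>
  only adds the passage to an arbitrary Lebesgue measurable representative.\<close>

definition H1 :: "(real ^ 3 \<Rightarrow> real) \<Rightarrow> (3 \<Rightarrow> real ^ 3 \<Rightarrow> real) \<Rightarrow> bool" where
	"H1 f p \<longleftrightarrow> L2z f \<and> (\<forall>i. L2z (p i)) \<and>
		(\<forall>i. \<forall>\<phi>\<in>C1_compact Omega. (LINT x|Q. f x * partial_deriv i \<phi> x) = - (LINT x|Q. p i x * \<phi> x))"

text \<open>\<open>W f p\<close>: a function of class \<open>W\<^sup>1\<^sup>,\<^sup>2\<close> together with Borel representatives of its weak derivatives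
	that vanish outside the cube.\<close>

definition W :: "(real ^ 3 \<Rightarrow> real) \<Rightarrow> (3 \<Rightarrow> real ^ 3 \<Rightarrow> real) \<Rightarrow> bool" where
	"W f p \<longleftrightarrow> f \<in> borel_measurable (lebesgue_on Omega) \<and> (\<exists>f'. H1 f' p \<and> (AE x in Q. f x = f' x))"

lemma integral_lebesgue_on_rep:
	fixes f f' h :: "real ^ 3 \<Rightarrow> real"
	assumes f: "f \<in> borel_measurable (lebesgue_on Omega)" "f' \<in> borelf" "AE x in Q. f x = f' x"
		and h: "h \<in> borelf"
	shows "(LINT x|lebesgue_on Omega. f x * h x) = (LINT x|Q. f' x * h x)"
proof -
	have m: "g \<in> borel_measurable (lebesgue_on Omega)" if "g \<in> borelf" for g :: "real ^ 3 \<Rightarrow> real"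
		using that by (intro measurable_restrict_space1 measurable_completion) simp
	have "(LINT x|lebesgue_on Omega. f x * h x) = (LINT x|lebesgue_on Omega. f' x * h x)"
	proof (rule integral_cong_AE)
		show "AE x in lebesgue_on Omega. f x * h x = f' x * h x"
			unfolding AE_lebesgue_on_Omega using f(3) by eventually_elim simp
	qed (rule borel_measurable_times[OF f(1) m[OF h]] borel_measurable_times[OF m[OF f(2)] m[OF h]])+
	also have "... = (LINT x|Q. f' x * h x)"
		using f(2) h by (intro lebesgue_on_Omega_Q) simp
	finally show ?thesis .
qed

lemma rep_square_integrable:
	fixes f f' :: "real ^ 3 \<Rightarrow> real"
	assumes f: "f \<in> borel_measurable (lebesgue_on Omega)" "f' \<in> borelf" "AE x in Q. f x = f' x"
	shows "integrable (lebesgue_on Omega) (%x. (f x)\<^sup>2) \<longleftrightarrow> integrable Q (%x. (f' x)\<^sup>2)"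
		and "(LINT x|lebesgue_on Omega. (f x)\<^sup>2) = (LINT x|Q. (f' x)\<^sup>2)"
proof -
	have m: "f' \<in> borel_measurable (lebesgue_on Omega)"
		using f(2) by (intro measurable_restrict_space1 measurable_completion) simp
	have ae: "AE x in lebesgue_on Omega. (f x)\<^sup>2 = (f' x)\<^sup>2"
		unfolding AE_lebesgue_on_Omega using f(3) by eventually_elim simp
	have b: "(%x. (f' x)\<^sup>2) \<in> borelf" by (rule borel_measurable_power[OF f(2)])
	have "integrable (lebesgue_on Omega) (%x. (f x)\<^sup>2) \<longleftrightarrow> integrable (lebesgue_on Omega) (%x. (f' x)\<^sup>2)"
		using ae f(1) m by (intro integrable_cong_AE) auto
	then show "integrable (lebesgue_on Omega) (%x. (f x)\<^sup>2) \<longleftrightarrow> integrable Q (%x. (f' x)\<^sup>2)"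
		using lebesgue_on_Omega_Q(1)[OF b] by simp
	have "(LINT x|lebesgue_on Omega. (f x)\<^sup>2) = (LINT x|lebesgue_on Omega. (f' x)\<^sup>2)"
		using ae f(1) m by (intro integral_cong_AE) auto
	then show "(LINT x|lebesgue_on Omega. (f x)\<^sup>2) = (LINT x|Q. (f' x)\<^sup>2)"
		using lebesgue_on_Omega_Q(2)[OF b] by simp
qed

lemma L2z_rep:
	assumes "square_integrable_on f Omega"
	obtains f' where "L2z f'" "AE x in Q. f x = f' x"
proof -
	have f: "f \<in> borel_measurable (lebesgue_on Omega)" using assms by (simp add: square_integrable_on_def)
	obtain f' where f': "f' \<in> borelf" "\<And>x. x \<notin> Omega ==> f' x = 0" "AE x in Q. f x = f' x"
		using lebesgue_on_borel_rep[OF f] by blast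
	have "L2z f'"
		using rep_square_integrable(1)[OF f f'(1,3)] f' assms by (simp add: L2z_def square_integrable_on_def)
	then show thesis using that f'(3) by blast
qed

lemma W12_imp_W:
	assumes "f \<in> W12 Omega" shows "\<exists>p. W f p"
proof -
	have f: "square_integrable_on f Omega" using assms by (simp add: W12_def)
	obtain f' where f': "L2z f'" "AE x in Q. f x = f' x" using L2z_rep[OF f] by blast
	have "\<exists>p. L2z p \<and> (\<forall>\<phi>\<in>C1_compact Omega. (LINT x|Q. f' x * partial_deriv i \<phi> x) = - (LINT x|Q. p x * \<phi> x))" for i
	proof -
		obtain g where g: "has_weak_partial Omega i f g" "square_integrable_on g Omega"
			using assms unfolding W12_def by blast
		obtain p where p: "L2z p" "AE x in Q. g x = p x" using L2z_rep[OF g(2)] by blast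
		have "(LINT x|Q. f' x * partial_deriv i \<phi> x) = - (LINT x|Q. p x * \<phi> x)" if \<phi>: "\<phi> \<in> C1_compact Omega" for \<phi>
			using integral_lebesgue_on_rep[OF _ L2zD(1)[OF f'(1)] f'(2) bB_measurable[OF C1_compactD(3)[OF \<phi>]], of i]
				integral_lebesgue_on_rep[OF _ L2zD(1)[OF p(1)] p(2) bB_measurable[OF C1_compactD(2)[OF \<phi>]]]
				f g \<phi> by (simp add: has_weak_partial_def square_integrable_on_def)
		with p(1) show ?thesis by blast
	qed
	then obtain p where "\<And>i. L2z (p i)" "\<And>i \<phi>. \<phi> \<in> C1_compact Omega ==> (LINT x|Q. f' x * partial_deriv i \<phi> x) = - (LINT x|Q. p i x * \<phi> x)"
		by metis
	then have "H1 f' p" using f'(1) by (simp add: H1_def)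
	then show ?thesis using f f'(2) by (auto simp: W_def square_integrable_on_def)
qed

lemma L2z_locally_integrable:
	assumes f: "f \<in> borel_measurable (lebesgue_on Omega)" "AE x in Q. f x = f' x" and f': "L2z f'"
	shows "locally_integrable_on f Omega"
	unfolding locally_integrable_on_def
proof (intro allI impI)
	fix K :: "(real ^ 3) set" assume K: "compact K \<and> K \<subseteq> Omega"
	have cl: "K \<in> sets lebesgue" "Omega \<in> sets lebesgue" using K by (simp_all add: sets_completionI_sets compact_imp_closed borel_closed)
	have "f' \<in> borel_measurable (lebesgue_on Omega)"
		using L2zD(1)[OF f'] by (intro measurable_restrict_space1 measurable_completion) simp
	then have "integrable (lebesgue_on Omega) f"
		using lebesgue_on_Omega_Q(1)[OF L2zD(1)[OF f']] L2zD(6)[OF f'] f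
		by (subst integrable_cong_AE[of _ _ f']) (auto simp: AE_lebesgue_on_Omega)
	then have "integrable lebesgue (%x. indicator Omega x *\<^sub>R f x)"
		using cl by (simp add: integrable_restrict_space set_integrable_def)
	from integrable_mult_indicator[OF cl(1) this]
	have "integrable lebesgue (%x. indicator K x *\<^sub>R (indicator Omega x *\<^sub>R f x))" .
	also have "(%x. indicator K x *\<^sub>R (indicator Omega x *\<^sub>R f x)) = (%x. indicator K x *\<^sub>R f x)"
		using K by (auto simp: indicator_def fun_eq_iff)
	finally show "integrable (lebesgue_on K) f"
		using cl by (simp add: integrable_restrict_space set_integrable_def)
qed

text \<open>The last claim is what makes \<open>strain\<close> computable: whatever derivative was
  chosen, it agrees almost everywhere with \<open>p\<close>.\<close>

lemma W_imp_W12: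
	assumes "W f p"
	shows "f \<in> W12 Omega" "has_weak_partial Omega i f (p i)" "AE x in Q. weak_partial Omega i f x = p i x"
proof -
	obtain f' where f: "f \<in> borel_measurable (lebesgue_on Omega)" and H: "H1 f' p" and ae: "AE x in Q. f x = f' x"
		using assms by (auto simp: W_def)
	have f': "L2z f'" and p: "L2z (p i)" for i using H by (auto simp: H1_def)
	have pm: "p i \<in> borel_measurable (lebesgue_on Omega)" for i
		using L2zD(1)[OF p] by (intro measurable_restrict_space1 measurable_completion) simp
	show hw: "has_weak_partial Omega i f (p i)" for i
		unfolding has_weak_partial_def
	proof (intro conjI ballI)
		show "locally_integrable_on f Omega" by (rule L2z_locally_integrable[OF f ae f'])
		show "locally_integrable_on (p i) Omega" by (rule L2z_locally_integrable[OF pm AE_I2[OF refl] p])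
		fix \<phi> assume \<phi>: "\<phi> \<in> C1_compact Omega"
		show "(LINT x|lebesgue_on Omega. f x * partial_deriv i \<phi> x) = - (LINT x|lebesgue_on Omega. p i x * \<phi> x)"
			using integral_lebesgue_on_rep[OF f L2zD(1)[OF f'] ae bB_measurable[OF C1_compactD(3)[OF \<phi>]], of i]
				integral_lebesgue_on_rep[OF pm[of i] L2zD(1)[OF p] AE_I2[OF refl] bB_measurable[OF C1_compactD(2)[OF \<phi>]]] H \<phi>
			by (simp add: H1_def)
	qed
	show "f \<in> W12 Omega"
		unfolding W12_def
	proof (intro CollectI conjI allI exI)
		show "square_integrable_on f Omega"
			using rep_square_integrable(1)[OF f L2zD(1)[OF f'] ae] L2zD(2)[OF f'] f by (simp add: square_integrable_on_def)
		show "has_weak_partial Omega i f (p i)" for i by (rule hw)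
		show "square_integrable_on (p i) Omega" for i
			using lebesgue_on_Omega_Q(1)[of "%x. (p i x)\<^sup>2"] L2zD(1,2)[OF p[of i]] pm[of i]
			by (simp add: square_integrable_on_def)
	qed
	have "has_weak_partial Omega i f (weak_partial Omega i f)"
		unfolding weak_partial_def by (rule someI[of "has_weak_partial Omega i f", OF hw])
	then show "AE x in Q. weak_partial Omega i f x = p i x"
		using hw by (rule has_weak_partial_unique)
qed

lemma C1fun_affine:
	assumes g: "C1fun g"
	shows "C1fun (%y. c * g (a + b *\<^sub>R y))" "partial_deriv i (%y. c * g (a + b *\<^sub>R y)) x = c * b * partial_deriv i g (a + b *\<^sub>R x)"
proof -
	have d: "((%y. c * g (a + b *\<^sub>R y)) has_derivative (%h. c * frechet_derivative g (at (a + b *\<^sub>R x)) (b *\<^sub>R h))) (at x)" for x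
	proof -
		have "g differentiable at (a + b *\<^sub>R x)" using g by (simp add: C1fun_def)
		then have 2: "(g has_derivative frechet_derivative g (at (a + b *\<^sub>R x))) (at (a + b *\<^sub>R x))"
			by (rule iffD1[OF frechet_derivative_works])
		have 1: "((%y. a + b *\<^sub>R y) has_derivative (%h. b *\<^sub>R h)) (at x)"
			by (auto intro!: derivative_eq_intros)
		show ?thesis by (rule has_derivative_mult_right[OF has_derivative_compose[OF 1 2]])
	qed
	show p: "partial_deriv i (%y. c * g (a + b *\<^sub>R y)) x = c * b * partial_deriv i g (a + b *\<^sub>R x)" for i x
	proof -
		have "g differentiable at (a + b *\<^sub>R x)" using g by (simp add: C1fun_def)
		then have "linear (frechet_derivative g (at (a + b *\<^sub>R x)))" by (rule linear_frechet_derivative)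
		then show ?thesis
			using fun_cong[OF frechet_derivative_at[OF d[of x]], of "axis i 1", symmetric]
			by (simp only: partial_deriv_def linear_cmul real_scaleR_def mult.assoc)
	qed
	have "partial_deriv i (%y. c * g (a + b *\<^sub>R y)) = (%x. c * b * partial_deriv i g (a + b *\<^sub>R x))" for i
		using p by auto
	moreover have "continuous_on UNIV (%x. c * b * partial_deriv i g (a + b *\<^sub>R x))" for i
		by (intro continuous_on_mult continuous_on_const continuous_on_compose2[OF C1fun_continuous_deriv[OF g] _ subset_UNIV] continuous_intros)
	ultimately show "C1fun (%y. c * g (a + b *\<^sub>R y))"
		using d by (auto simp: C1fun_def differentiable_def)
qed

lemma C1fun_eta: "C1fun eta" "partial_deriv i eta = deta i"
proof -
	have d: "(eta has_derivative (%h. \<Sum>i\<in>UNIV. deta i z * h $ i)) (at z)" for z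
		using has_derivative_mult_right[OF eta0_has_derivative[of z], of ceta]
		by (simp add: eta_def[abs_def] deta_def sum_distrib_left mult.assoc)
	then show p: "partial_deriv i eta = deta i" for i
		by (intro ext has_derivative_imp_partial_deriv)
	show "C1fun eta"
		unfolding C1fun_def p using d
		by (auto simp: differentiable_def deta_def[abs_def] intro!: continuous_on_mult continuous_on_const continuous_on_eta0)
qed

text \<open>The rescaled mollifier reflected about \<open>z\<close> is an admissible test function
  when its support lies in a smaller cube; inserting it in the definition of the weak derivative
  gives the claim.\<close>

lemma conv_weak_partial:
	assumes H: "H1 f p" and d: "0 < d" and z: "\<And>y. norm (z - y) < d ==> y \<in> cube r" and r: "r < 1"
	shows "conv d (deta i) f z / d = conv d eta (p i) z"
proof -
	have f: "L2z f" and p: "L2z (p i)" for i using H by (auto simp: H1_def)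
	define \<phi> where "\<phi> y = (1 / d ^ 3) * eta (z /\<^sub>R d + (- 1 / d) *\<^sub>R y)" for y
	have e: "z /\<^sub>R d + (- 1 / d) *\<^sub>R y = (z - y) /\<^sub>R d" for y
		by (simp add: scaleR_right_diff_distrib divide_inverse)
	have pd: "partial_deriv i \<phi> y = (1 / d ^ 3) * (- 1 / d) * deta i ((z - y) /\<^sub>R d)" for y
		using C1fun_affine(2)[OF C1fun_eta(1), where c = "1 / d ^ 3" and a = "z /\<^sub>R d" and b = "- 1 / d" and i = i and x = y]
		unfolding C1fun_eta(2) \<phi>_def[abs_def] e .
	have "\<phi> \<in> C1_compact Omega"
	proof (rule C1_compact_C1fun[OF _ _ r])
		show "C1fun \<phi>" unfolding \<phi>_def[abs_def] by (rule C1fun_affine(1)[OF C1fun_eta(1)])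
		fix y assume "y \<notin> cube r"
		then have "\<not> norm (z - y) < d" using z by blast
		then have "1 <= norm ((z - y) /\<^sub>R d)" using d by (simp add: divide_simps)
		then show "\<phi> y = 0" using kern_eta(1) unfolding \<phi>_def e by (simp add: kern_def)
	qed
	then have w: "(LINT y|Q. f y * partial_deriv i \<phi> y) = - (LINT y|Q. p i y * \<phi> y)" using H by (simp add: H1_def)
	have 1: "(LINT y|Q. f y * partial_deriv i \<phi> y) = - (conv d (deta i) f z / d)"
	proof -
		have "(LINT y|Q. f y * partial_deriv i \<phi> y) = (LINT y|lborel. f y * partial_deriv i \<phi> y)"
			by (rule Q_lborel(2)) (simp add: L2zD(3)[OF f])
		also have "... = (LINT y|lborel. (f y * (deta i ((z - y) /\<^sub>R d) / d ^ 3)) * (- 1 / d))"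
			unfolding pd by (intro LINT_cong) (simp_all add: field_simps)
		finally show ?thesis unfolding integral_mult_left_zero conv_def by simp
	qed
	have 2: "(LINT y|Q. p i y * \<phi> y) = conv d eta (p i) z"
	proof -
		have "(LINT y|Q. p i y * \<phi> y) = (LINT y|lborel. p i y * \<phi> y)"
			by (rule Q_lborel(2)) (simp add: L2zD(3)[OF p])
		then show ?thesis unfolding conv_def \<phi>_def e by simp
	qed
	show ?thesis using w unfolding 1 2 by simp
qed

text \<open>Mollify with radius d n, then evaluate at l n x with l n = 1 - 2 d n: even for x on the
  boundary the kernel stays at distance d n from the boundary. The last conclusion, uniform
  convergence for functions continuous up to the boundary, serves to identify traces.\<close>

lemma H1_approx:
	assumes H: "H1 f p"
	obtains v where "\<And>n. C1fun (v n)" "(%n. LINT x|Q. (v n x - f x)\<^sup>2) \<longlonglongrightarrow> 0"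
		"\<And>i. (%n. LINT x|Q. (partial_deriv i (v n) x - p i x)\<^sup>2) \<longlonglongrightarrow> 0"
		"\<And>w e. continuous_on (cbox (\<chi> i. - 1) (\<chi> i. 1)) w ==> (AE x in Q. w x = f x) ==> 0 < (e :: real) ==>
			\<forall>\<^sub>F n in sequentially. \<forall>x\<in>cbox (\<chi> i. - 1) (\<chi> i. 1). \<bar>v n x - w x\<bar> <= e"
proof -
	let ?C = "cbox (\<chi> i. - 1) (\<chi> i. 1) :: (real ^ 3) set"
	have f: "L2z f" and p: "L2z (p i)" for i using H by (auto simp: H1_def)
	define d where "d n = (1 / 4) * (1 / real (Suc n))" for n
	define l where "l n = 1 - 2 * d n" for n
	have d: "0 < d n" "d n <= 1 / 4" for n by (simp_all add: d_def divide_simps)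
	have "(%n. 1 / real (Suc n)) \<longlonglongrightarrow> 0" using LIMSEQ_inverse_real_of_nat by (simp add: inverse_eq_divide)
	from tendsto_mult_right_zero[OF this, of "1 / 4"] have d0: "d \<longlonglongrightarrow> 0" by (simp only: d_def[abs_def])
	have l: "1 / 2 <= l n" "l n <= 1" for n using d[of n] by (simp_all add: l_def)
	have "(%n. 1 - 2 * d n) \<longlonglongrightarrow> 1 - 2 * 0" by (intro tendsto_intros d0)
	then have l1: "l \<longlonglongrightarrow> 1" by (simp add: l_def[abs_def])
	have near: "y \<in> cube (1 - d n)" if "x \<in> ?C" "norm (l n *\<^sub>R x - y) < d n" for n x y
	proof -
		have "\<bar>x $ i\<bar> <= 1" for i using that(1) by (auto simp: mem_box_cart abs_le_iff minus_le_iff)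
		then have "\<bar>l n * x $ i\<bar> <= l n" for i using l(1)[of n] by (simp add: abs_mult mult_left_le)
		then have "l n *\<^sub>R x \<in> cube (l n)" by (simp add: cube_def)
		then show ?thesis using cube_near[of "l n *\<^sub>R x" "l n" y "d n"] that(2) by (simp add: l_def)
	qed
	have nearO: "y \<in> Omega" if "x \<in> ?C" "norm (l n *\<^sub>R x - y) < d n" for n x y
		using near[OF that] cube_Omega[of "1 - d n"] d(1)[of n] by auto
	have OC: "Omega \<subseteq> ?C" using box_subset_cbox by (auto simp: Omega_box)
	define v where "v n x = conv (d n) eta f (l n *\<^sub>R x)" for n x
	have C: "C1fun (conv (d n) eta f)" for n by (intro C1fun_conv L2zD(7)[OF f] d)
	have v_eq: "v n = (%x. 1 * conv (d n) eta f (0 + l n *\<^sub>R x))" for n by (simp add: v_def[abs_def])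
	have lim: "(%n. LINT x|Q. (conv (d n) eta g (l n *\<^sub>R x) - g x)\<^sup>2) \<longlonglongrightarrow> 0" if "L2z g" for g
	proof -
		have "(%n. LINT x|Q. indicator Omega x * (conv (d n) eta g (l n *\<^sub>R x) - g x)\<^sup>2) \<longlonglongrightarrow> 0"
			using OC by (intro conv_L2_tendsto that d(1) d0 l l1) (auto intro: nearO)
		also have "(%n. LINT x|Q. indicator Omega x * (conv (d n) eta g (l n *\<^sub>R x) - g x)\<^sup>2)
				= (%n. LINT x|Q. (conv (d n) eta g (l n *\<^sub>R x) - g x)\<^sup>2)"
			by (intro ext LINT_cong) auto
		finally show ?thesis .
	qed
	show thesis
	proof
		show "C1fun (v n)" for n unfolding v_eq by (rule C1fun_affine(1)[OF C])
		show "(%n. LINT x|Q. (v n x - f x)\<^sup>2) \<longlonglongrightarrow> 0" unfolding v_def by (rule lim[OF f])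
		fix i
		have pd: "partial_deriv i (v n) x = l n * conv (d n) eta (p i) (l n *\<^sub>R x)" if "x \<in> Omega" for n x
		proof -
			have "partial_deriv i (v n) x = l n * (conv (d n) (deta i) f (l n *\<^sub>R x) / d n)"
				unfolding v_eq C1fun_affine(2)[OF C] by (simp add: partial_deriv_conv[OF L2zD(7)[OF f] d(1)])
			also have "conv (d n) (deta i) f (l n *\<^sub>R x) / d n = conv (d n) eta (p i) (l n *\<^sub>R x)"
				using that OC d(1)[of n] by (intro conv_weak_partial[OF H, of _ _ "1 - d n"] near) auto
			finally show ?thesis .
		qed
		have m[measurable]: "conv (d n) eta (p i) \<in> borelf" for n by (intro conv_measurable kern_eta L2zD(1)[OF p])
		note L2zD(1)[OF p, measurable]
		have ic: "integrable Q (%x. (conv (d n) eta (p i) (l n *\<^sub>R x) - p i x)\<^sup>2)" for n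
		proof (rule LI_bound)
			have "integrable lborel (%x. indicator Omega x * (conv (d n) eta (p i) (l n *\<^sub>R x))\<^sup>2)"
				using integrable_mult_indicator[OF _ conv_scaled_L2(1)[OF p kern_eta(1) d(1) l(1)], of Omega] by simp
			then have "integrable Q (%x. (conv (d n) eta (p i) (l n *\<^sub>R x))\<^sup>2)"
				by (simp add: integrable_restrict_space set_integrable_def)
			then show "integrable Q (%x. 2 * (conv (d n) eta (p i) (l n *\<^sub>R x))\<^sup>2 + 2 * (p i x)\<^sup>2)"
				using L2zD(2)[OF p[of i]] by simp
			show "AE x in Q. norm ((conv (d n) eta (p i) (l n *\<^sub>R x) - p i x)\<^sup>2) <= norm (2 * (conv (d n) eta (p i) (l n *\<^sub>R x))\<^sup>2 + 2 * (p i x)\<^sup>2)"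
				using square_sum_le[of "conv (d n) eta (p i) (l n *\<^sub>R x)" "- p i x" for x] by (intro AE_I2) simp
		qed (auto intro!: borel_measurable_Q)
		show "(%n. LINT x|Q. (partial_deriv i (v n) x - p i x)\<^sup>2) \<longlonglongrightarrow> 0"
		proof (rule Lim_null_comparison)
			have "(%n. 2 * (LINT x|Q. (conv (d n) eta (p i) (l n *\<^sub>R x) - p i x)\<^sup>2) + 2 * (l n - 1)\<^sup>2 * (LINT x|Q. (p i x)\<^sup>2))
					\<longlonglongrightarrow> 2 * 0 + 2 * (1 - 1)\<^sup>2 * (LINT x|Q. (p i x)\<^sup>2)"
				by (intro tendsto_intros lim[OF p] l1)
			then show "(%n. 2 * (LINT x|Q. (conv (d n) eta (p i) (l n *\<^sub>R x) - p i x)\<^sup>2) + 2 * (l n - 1)\<^sup>2 * (LINT x|Q. (p i x)\<^sup>2)) \<longlonglongrightarrow> 0"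
				by simp
			show "\<forall>\<^sub>F n in sequentially. norm (LINT x|Q. (partial_deriv i (v n) x - p i x)\<^sup>2)
					<= 2 * (LINT x|Q. (conv (d n) eta (p i) (l n *\<^sub>R x) - p i x)\<^sup>2) + 2 * (l n - 1)\<^sup>2 * (LINT x|Q. (p i x)\<^sup>2)"
			proof (intro always_eventually allI)
				fix n
				have "(LINT x|Q. (partial_deriv i (v n) x - p i x)\<^sup>2)
					<= (LINT x|Q. 2 * (conv (d n) eta (p i) (l n *\<^sub>R x) - p i x)\<^sup>2 + 2 * (l n - 1)\<^sup>2 * (p i x)\<^sup>2)"
				proof (rule integral_mono_AE')
					show "integrable Q (%x. 2 * (conv (d n) eta (p i) (l n *\<^sub>R x) - p i x)\<^sup>2 + 2 * (l n - 1)\<^sup>2 * (p i x)\<^sup>2)"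
						using ic L2zD(2)[OF p[of i]] by simp
					show "AE x in Q. (partial_deriv i (v n) x - p i x)\<^sup>2 <= 2 * (conv (d n) eta (p i) (l n *\<^sub>R x) - p i x)\<^sup>2 + 2 * (l n - 1)\<^sup>2 * (p i x)\<^sup>2"
					proof (rule AE_I2)
						fix x assume "x \<in> space Q"
						then have "partial_deriv i (v n) x - p i x = l n * (conv (d n) eta (p i) (l n *\<^sub>R x) - p i x) + (l n - 1) * p i x"
							by (simp add: pd algebra_simps)
						then have "(partial_deriv i (v n) x - p i x)\<^sup>2 <= 2 * (l n * (conv (d n) eta (p i) (l n *\<^sub>R x) - p i x))\<^sup>2 + 2 * ((l n - 1) * p i x)\<^sup>2"
							using square_sum_le by metis
						moreover have "(l n)\<^sup>2 <= 1" using l[of n] by (simp add: power_le_one)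
						ultimately show "(partial_deriv i (v n) x - p i x)\<^sup>2 <= 2 * (conv (d n) eta (p i) (l n *\<^sub>R x) - p i x)\<^sup>2 + 2 * (l n - 1)\<^sup>2 * (p i x)\<^sup>2"
							using mult_right_mono[of "(l n)\<^sup>2" 1 "(conv (d n) eta (p i) (l n *\<^sub>R x) - p i x)\<^sup>2"]
							by (simp add: power_mult_distrib)
					qed
				qed auto
				also have "... = 2 * (LINT x|Q. (conv (d n) eta (p i) (l n *\<^sub>R x) - p i x)\<^sup>2) + 2 * (l n - 1)\<^sup>2 * (LINT x|Q. (p i x)\<^sup>2)"
					using ic L2zD(2)[OF p[of i]] by simp
				finally show "norm (LINT x|Q. (partial_deriv i (v n) x - p i x)\<^sup>2)
					<= 2 * (LINT x|Q. (conv (d n) eta (p i) (l n *\<^sub>R x) - p i x)\<^sup>2) + 2 * (l n - 1)\<^sup>2 * (LINT x|Q. (p i x)\<^sup>2)" by simp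
			qed
		qed
	next
		fix w and e :: real assume w: "continuous_on ?C w" "AE x in Q. w x = f x" and e: "0 < e"
		have ae: "AE x in lborel. indicator Omega x * w x = f x"
			using w(2) unfolding AE_Q_iff
		proof eventually_elim
			fix x assume "x \<in> Omega \<longrightarrow> w x = f x"
			then show "indicator Omega x * w x = f x" using L2zD(3)[OF f, of x] by (cases "x \<in> Omega") auto
		qed
		have "continuous_on Omega w" using w(1) OC by (rule continuous_on_subset)
		then have wm: "(%x. indicator Omega x * w x) \<in> borelf"
			using borel_measurable_continuous_on_indicator[of Omega w] by simp
		have wi: "integrable lborel (%x. indicator Omega x * w x)"
			using L2zD(7)[OF f] wm ae L2zD(1)[OF f] by (subst integrable_cong_AE[of _ _ f]) auto
		have "conv (d n) eta (%x. indicator Omega x * w x) z = conv (d n) eta f z" for n z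
			unfolding conv_def
		proof (rule integral_cong_AE)
			show "AE y in lborel. indicator Omega y * w y * (eta ((z - y) /\<^sub>R d n) / d n ^ 3) = f y * (eta ((z - y) /\<^sub>R d n) / d n ^ 3)"
				using ae by eventually_elim simp
		qed (use borel_measurable_integrable[OF conv_integrable[OF kern_eta(1) wi]] borel_measurable_integrable[OF conv_integrable[OF kern_eta(1) L2zD(7)[OF f]]] in auto)
		then show "\<forall>\<^sub>F n in sequentially. \<forall>x\<in>?C. \<bar>v n x - w x\<bar> <= e"
			using conv_uniform[OF w(1) wi e d(1) d0 l(2) l1 order_refl nearO] by (simp add: v_def)
	qed
qed

section \<open>Traces\<close>

lemma integral_J_derivative:
	assumes w: "\<And>t. (w has_real_derivative w' t) (at t)" "continuous_on UNIV w'"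
	shows "(LINT r|J. w' r) = w 1 - w (- 1)"
proof -
	have [measurable]: "w' \<in> borelf" by (rule borel_measurable_continuous_onI[OF w(2)])
	have "(LINT r|J. w' r) = (LINT r|lborel. indicator {-1<..<1} r *\<^sub>R w' r)"
		by (subst integral_restrict_space) auto
	also have "... = (LINT r|lborel. w' r * indicator {- 1..1} r)"
	proof (rule integral_cong_AE)
		show "AE r in lborel. indicator {-1<..<1} r *\<^sub>R w' r = w' r * indicator {- 1..1} r"
			using AE_lborel_singleton[of 1] AE_lborel_singleton[of "- 1"] by eventually_elim (auto simp: indicator_def)
	qed measurable
	also have "... = w 1 - w (- 1)"
		using w by (intro integral_FTC_Icc_real) (auto simp: continuous_on_eq_continuous_at)
	finally show ?thesis .
qed

text \<open>An explicit trace: the derivative of (t + s) f along a vertical line integrates to 2 f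
  at height s, since t + s vanishes at the opposite face. Only f and \<partial>_3 f in L^2 enter, so
  it is continuous in the W^{1,2} norm.\<close>

definition tr :: "real \<Rightarrow> (real ^ 3 \<Rightarrow> real) \<Rightarrow> (real ^ 3 \<Rightarrow> real) \<Rightarrow> real ^ 2 \<Rightarrow> real" where
	"tr s f p y = (LINT t|J. f (ins 3 y t) + (t + s) * p (ins 3 y t)) / 2"

lemma tr_C1fun:
	assumes v: "C1fun v" and s: "s = 1 \<or> s = - 1"
	shows "tr s v (partial_deriv 3 v) y = v (ins 3 y s)"
proof -
	have d: "((%t. v (ins 3 y t)) has_real_derivative partial_deriv 3 v (ins 3 y t)) (at t)" for t
		using C1fun_line[OF v, of "ins 3 y 0" 3 t] by simp
	have "((%t. (t + s) * v (ins 3 y t)) has_real_derivative v (ins 3 y t) + (t + s) * partial_deriv 3 v (ins 3 y t)) (at t)" for t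
		by (rule derivative_eq_intros d refl | simp)+
	moreover have "continuous_on UNIV (%t. v (ins 3 y t) + (t + s) * partial_deriv 3 v (ins 3 y t))"
		by (intro continuous_on_add continuous_on_mult continuous_on_id continuous_on_const
				continuous_on_compose2[OF C1fun_continuous_deriv[OF v] _ subset_UNIV]
				continuous_on_compose2[OF C1fun_continuous[OF v] _ subset_UNIV] continuous_on_ins)
	ultimately have "(LINT t|J. v (ins 3 y t) + (t + s) * partial_deriv 3 v (ins 3 y t)) = (1 + s) * v (ins 3 y 1) - (- 1 + s) * v (ins 3 y (- 1))"
		by (rule integral_J_derivative)
	then show ?thesis using s by (auto simp: tr_def)
qed

lemma section_measurable: "f \<in> borelf ==> (%t. f (ins i y t)) \<in> borelf"
	by (rule measurable_compose) measurable

lemma tr_measurable: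
	assumes "f \<in> borelf" "p \<in> borelf"
	shows "tr s f p \<in> borelf"
proof -
	have i: "(%q. ins 3 (fst q) (snd q)) \<in> borel_measurable (borel \<Otimes>\<^sub>M J)"
		by (intro borel_measurable_ins measurable_fst measurable_snd_J)
	have "(%q. f (ins 3 (fst q) (snd q)) + (snd q + s) * p (ins 3 (fst q) (snd q))) \<in> borel_measurable (borel \<Otimes>\<^sub>M J)"
		by (intro borel_measurable_add borel_measurable_times measurable_compose[OF i assms(1)] measurable_compose[OF i assms(2)]
				measurable_snd_J) simp
	then have "(%y. LINT t|J. f (ins 3 y t) + (t + s) * p (ins 3 y t)) \<in> borelf"
		by (intro J.borel_measurable_lebesgue_integral) (simp add: split_beta')
	then show ?thesis unfolding tr_def[abs_def] by simp
qed

definition LF :: "(real ^ 2) measure" where "LF = lebesgue_on face"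

lemma LF_Q:
	fixes h :: "real ^ 2 \<Rightarrow> real"
	assumes h: "h \<in> borelf"
	shows "integrable LF h \<longleftrightarrow> integrable Qf h" "(LINT x|LF. h x) = (LINT x|Qf. h x)" "h \<in> borel_measurable LF"
proof -
	have "face \<in> sets lebesgue" by (simp add: sets_completionI_sets)
	moreover have "(%x. indicator face x *\<^sub>R h x) \<in> borel_measurable lborel" using h by measurable
	ultimately show "integrable LF h \<longleftrightarrow> integrable Qf h" "(LINT x|LF. h x) = (LINT x|Qf. h x)"
		by (simp_all add: LF_def integrable_restrict_space integral_restrict_space set_integrable_def
				integrable_completion integral_completion)
	show "h \<in> borel_measurable LF" unfolding LF_def using h
		by (intro measurable_restrict_space1 measurable_completion) simp
qed

lemma space_LF [simp]: "space LF = face" by (simp add: LF_def space_restrict_space)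

lemma finite_measure_LF: "finite_measure LF"
proof (rule finite_measureI)
	have "face \<in> lmeasurable" unfolding face_box by simp
	from fmeasurableD2[OF this] show "emeasure LF (space LF) \<noteq> \<infinity>"
		unfolding LF_def using \<open>face \<in> lmeasurable\<close>
		by (subst emeasure_restrict_space) (auto simp: space_restrict_space fmeasurableD)
qed

lemma AE_LF: "(AE y in Qf. P y) ==> (AE y in LF. P y)"
proof -
	assume "AE y in Qf. P y"
	then have "AE y in lborel. y \<in> face \<longrightarrow> P y" by (simp add: AE_restrict_space_iff)
	moreover have "face \<inter> space lebesgue \<in> sets lebesgue" by (simp add: sets_completionI_sets)
	ultimately show ?thesis unfolding LF_def by (simp only: AE_restrict_space_iff AE_completion_iff)
qed

lemma measure_J_space [simp]: "measure J (space J) = 2" by simp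

lemma tr_bound:
	assumes f: "f \<in> borelf" "integrable Q (%x. (f x)\<^sup>2)"
		and p: "p \<in> borelf" "integrable Q (%x. (p x)\<^sup>2)" and s: "s = 1 \<or> s = - 1"
	shows "integrable LF (%y. (tr s f p y)\<^sup>2)"
		and "(LINT y|LF. (tr s f p y)\<^sup>2) <= (LINT x|Q. (f x)\<^sup>2) + 4 * (LINT x|Q. (p x)\<^sup>2)"
		and "AE y in Qf. integrable J (%t. f (ins 3 y t))" "AE y in Qf. integrable J (%t. p (ins 3 y t))"
proof -
	let ?h = "%x. (f x)\<^sup>2 + 4 * (p x)\<^sup>2"
	have h: "integrable Q ?h" using f p by simp
	have sec: "integrable J (%t. g (ins 3 y t))" if "g \<in> borelf" "integrable J (%t. (g (ins 3 y t))\<^sup>2)" for g :: "real ^ 3 \<Rightarrow> real" and y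
		using section_measurable[OF that(1), of 3 y]
		by (intro J.L2_imp_L1(1)[OF _ that(2)] measurable_restrict_space1) simp
	note aef = integral_Q(3)[OF f(2), of 3] and aep = integral_Q(3)[OF p(2), of 3]
	show "AE y in Qf. integrable J (%t. f (ins 3 y t))" using aef by eventually_elim (rule sec[OF f(1)])
	show "AE y in Qf. integrable J (%t. p (ins 3 y t))" using aep by eventually_elim (rule sec[OF p(1)])
	have le: "AE y in Qf. (tr s f p y)\<^sup>2 <= (LINT t|J. ?h (ins 3 y t))"
		using aef aep
	proof eventually_elim
		fix y assume i: "integrable J (%t. (f (ins 3 y t))\<^sup>2)" "integrable J (%t. (p (ins 3 y t))\<^sup>2)"
		let ?g = "%t. f (ins 3 y t) + (t + s) * p (ins 3 y t)"
		have gm: "?g \<in> borel_measurable J"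
			by (intro measurable_restrict_space1) (use section_measurable[OF f(1)] section_measurable[OF p(1)] in simp)
		have gle: "(?g t)\<^sup>2 <= 2 * ?h (ins 3 y t)" if "t \<in> space J" for t
		proof -
			have "\<bar>t + s\<bar> <= 2" using that s by auto
			then have "(t + s)\<^sup>2 <= 4" using abs_le_square_iff[of "t + s" 2] by simp
			then have "((t + s) * p (ins 3 y t))\<^sup>2 <= 4 * (p (ins 3 y t))\<^sup>2"
				unfolding power_mult_distrib by (rule mult_right_mono) simp
			then show ?thesis using square_sum_le[of "f (ins 3 y t)" "(t + s) * p (ins 3 y t)"] by simp
		qed
		have ih: "integrable J (%t. 2 * ?h (ins 3 y t))" using i by simp
		have ig: "integrable J (%t. (?g t)\<^sup>2)"
			using gle gm by (intro LI_bound[OF ih]) (auto intro!: AE_I2)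
		have "(LINT t|J. ?g t)\<^sup>2 <= 2 * (LINT t|J. (?g t)\<^sup>2)"
			using J.L2_imp_L1(2)[OF gm ig] by simp
		also have "... <= 2 * (LINT t|J. 2 * ?h (ins 3 y t))"
			using gle by (intro mult_left_mono integral_mono ig ih) auto
		also have "2 * (LINT t|J. 2 * ?h (ins 3 y t)) = 4 * (LINT t|J. ?h (ins 3 y t))"
			by (subst integral_mult_right_zero) simp
		finally show "(tr s f p y)\<^sup>2 <= (LINT t|J. ?h (ins 3 y t))"
			unfolding tr_def power_divide by (simp only: power2_eq_square[of "2 :: real"])
	qed
	have m: "(%y. (tr s f p y)\<^sup>2) \<in> borelf" using tr_measurable[OF f(1) p(1)] by simp
	have iq: "integrable Qf (%y. (tr s f p y)\<^sup>2)"
		using le by (intro LI_bound[OF integral_Q(2)[OF h, of 3]])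
			(use m in \<open>auto intro: measurable_restrict_space1 order_trans[OF _ abs_ge_self] elim: eventually_mono\<close>)
	then show "integrable LF (%y. (tr s f p y)\<^sup>2)" using LF_Q(1)[OF m] by simp
	have "(LINT y|LF. (tr s f p y)\<^sup>2) = (LINT y|Qf. (tr s f p y)\<^sup>2)" by (rule LF_Q(2)[OF m])
	also have "... <= (LINT y|Qf. LINT t|J. ?h (ins 3 y t))"
		by (intro integral_mono_AE iq integral_Q(2)[OF h] le)
	also have "... = (LINT x|Q. ?h x)" by (rule integral_Q(1)[OF h, symmetric])
	finally show "(LINT y|LF. (tr s f p y)\<^sup>2) <= (LINT x|Q. (f x)\<^sup>2) + 4 * (LINT x|Q. (p x)\<^sup>2)" using f p by simp
qed

lemma tr_diff:
	assumes "integrable J (%t. f (ins 3 y t))" "integrable J (%t. p (ins 3 y t))"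
		"integrable J (%t. g (ins 3 y t))" "integrable J (%t. q (ins 3 y t))"
	shows "tr s (%x. f x - g x) (%x. p x - q x) y = tr s f p y - tr s g q y"
proof -
	have w: "integrable J (%t. (t + s) * k t)" if "integrable J k" for k :: "real \<Rightarrow> real"
	proof (rule LI_bound)
		show "integrable J (%t. (1 + \<bar>s\<bar>) * k t)" using that by simp
		have "\<bar>t + s\<bar> <= \<bar>1 + \<bar>s\<bar>\<bar>" if "t \<in> space J" for t using that by auto
		then show "AE t in J. norm ((t + s) * k t) <= norm ((1 + \<bar>s\<bar>) * k t)"
			unfolding real_norm_def abs_mult by (intro AE_I2 mult_right_mono) auto
		show "(%t. (t + s) * k t) \<in> borel_measurable J"
			using that by (intro borel_measurable_times borel_measurable_add measurable_J_lborel) auto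
	qed
	show ?thesis
		using assms w[OF assms(2)] w[OF assms(4)]
		by (simp add: tr_def right_diff_distrib diff_divide_distrib[symmetric] LINT_diff[symmetric] del: LINT_diff LINT_add)
			(intro LINT_cong, auto)
qed

lemma W_diff:
	assumes "W f p" "W g q" shows "W (%x. f x - g x) (%i x. p i x - q i x)"
proof -
	obtain f' g' where f: "f \<in> borel_measurable (lebesgue_on Omega)" "H1 f' p" "AE x in Q. f x = f' x"
		and g: "g \<in> borel_measurable (lebesgue_on Omega)" "H1 g' q" "AE x in Q. g x = g' x" using assms by (auto simp: W_def)
	have L: "L2z f'" "L2z g'" "L2z (p i)" "L2z (q i)" for i using f(2) g(2) by (auto simp: H1_def)
	have ib: "integrable Q (%x. h x * k x)" if "L2z h" "bB k" for h k
		using that by (intro cauchy_schwarz_integral(1) L2zD(2) bB_integrable bB_power bB_measurable_Q borel_measurable_Q L2zD(1))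
	have "H1 (%x. f' x - g' x) (%i x. p i x - q i x)"
		using f(2) g(2) unfolding H1_def
		by (simp add: L2z_diff left_diff_distrib LINT_diff ib L C1_compactD)
	moreover have "AE x in Q. f x - g x = f' x - g' x" using f(3) g(3) by eventually_elim simp
	ultimately show ?thesis using f(1) g(1) by (auto simp: W_def)
qed

text \<open>The criterion of absolute continuity on lines. The product of \<open>f\<close> with a
  test function vanishes at both ends of each line, so the integral of its derivative is 0, and
  Fubini gives the weak derivative.\<close>

lemma line_acz_imp_W:
	assumes f: "bB f" and p: "\<And>i. bB (p i)"
		and line: "\<And>i x. x \<in> Omega ==> continuous_on {- 1..1} (%t. f (upd x i t)) \<and>
			(\<exists>S. finite S \<and> (\<forall>t. - 1 < t \<and> t < 1 \<and> t \<notin> S \<longrightarrow> ((%t. f (upd x i t)) has_real_derivative p i (upd x i t)) (at t)))"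
	shows "W f (%i x. indicator Omega x * p i x)"
proof -
	let ?f = "%x. indicator Omega x * f x" and ?p = "%i x. indicator Omega x * p i x"
	have "H1 ?f ?p"
		unfolding H1_def
	proof (intro conjI allI ballI L2z_bB f p)
		fix i \<phi> assume \<phi>: "\<phi> \<in> C1_compact Omega"
		note b = C1_compactD(1-3)[OF \<phi>]
		have z: "(LINT x|Q. f x * partial_deriv i \<phi> x + p i x * \<phi> x) = 0"
		proof -
			have "(LINT x|Q. f x * partial_deriv i \<phi> x + p i x * \<phi> x)
				= (LINT y|Qf. LINT t|J. f (ins i y t) * partial_deriv i \<phi> (ins i y t) + p i (ins i y t) * \<phi> (ins i y t))"
				by (intro integral_Q bB_integrable bB_add bB_mult f p b)
			also have "... = (LINT y|Qf. 0)"
			proof (rule LINT_cong[OF refl])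
				fix y assume "y \<in> space Qf"
				then have x: "ins i y 0 \<in> Omega" by simp
				let ?b = "%t. f (ins i y t) * partial_deriv i \<phi> (ins i y t) + p i (ins i y t) * \<phi> (ins i y t)"
				have "acz (%t. f (ins i y t) * \<phi> (ins i y t)) ?b"
					unfolding acz_def
				proof (intro conjI)
					show "continuous_on {- 1..1} (%t. f (ins i y t) * \<phi> (ins i y t))"
						using line[OF x, of i] continuous_on_subset[OF continuous_on_compose2[OF C1fun_continuous[OF b(1)] _ subset_UNIV]]
						by (intro continuous_on_mult continuous_on_compose2[OF C1fun_continuous[OF b(1)] _ subset_UNIV] continuous_on_ins continuous_on_const continuous_on_id) auto
					show "f (ins i y (- 1)) * \<phi> (ins i y (- 1)) = 0" "f (ins i y 1) * \<phi> (ins i y 1) = 0"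
						using C1_compactD(4)[OF \<phi>, of "ins i y 1"] C1_compactD(4)[OF \<phi>, of "ins i y (- 1)"] by auto
					have bb: "bB (%x. f x * partial_deriv i \<phi> x + p i x * \<phi> x)" by (intro bB_add bB_mult f p b)
					show "?b \<in> borelf" using bB_section(1)[OF bb x, of i] by simp
					show "\<exists>B. \<forall>t. - 1 < t \<and> t < 1 \<longrightarrow> \<bar>?b t\<bar> <= B" using bB_section(2)[OF bb x, of i] by (auto simp: Ball_def)
					obtain S where S: "finite S" "\<And>t. - 1 < t ==> t < 1 ==> t \<notin> S ==> ((%t. f (ins i y t)) has_real_derivative p i (ins i y t)) (at t)"
						using line[OF x, of i] by auto
					show "\<exists>S. finite S \<and> (\<forall>t. - 1 < t \<and> t < 1 \<and> t \<notin> S \<longrightarrow> ((%t. f (ins i y t) * \<phi> (ins i y t)) has_real_derivative ?b t) (at t))"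
					proof (intro exI[of _ S] conjI allI impI S(1))
						fix t assume t: "- 1 < t \<and> t < 1 \<and> t \<notin> S"
						have "((%t. \<phi> (ins i y t)) has_real_derivative partial_deriv i \<phi> (ins i y t)) (at t)"
							using C1fun_line[OF b(1), of "ins i y 0" i t] by simp
						from DERIV_mult[OF S(2) this] t
						show "((%t. f (ins i y t) * \<phi> (ins i y t)) has_real_derivative ?b t) (at t)" by (simp add: add.commute mult.commute)
					qed
				qed
				from acz_integral[OF this, of 1] have "(LINT r|J. indicator {..1} r * ?b r) = 0"
					using C1_compactD(4)[OF \<phi>, of "ins i y 1"] by simp
				moreover have "(LINT r|J. indicator {..1} r * ?b r) = (LINT r|J. ?b r)"
					by (intro LINT_cong) auto
				ultimately show "(LINT t|J. ?b t) = 0" by simp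
			qed
			finally show ?thesis by simp
		qed
		have "(LINT x|Q. f x * partial_deriv i \<phi> x) + (LINT x|Q. p i x * \<phi> x) = 0"
			using z by (subst (asm) LINT_add) (intro bB_integrable bB_mult f p b)+
		moreover have "(LINT x|Q. ?f x * g x) = (LINT x|Q. f x * g x)" "(LINT x|Q. ?p i x * g x) = (LINT x|Q. p i x * g x)" for g
			by (intro LINT_cong, auto)+
		ultimately show "(LINT x|Q. ?f x * partial_deriv i \<phi> x) = - (LINT x|Q. ?p i x * \<phi> x)" by simp
	qed
	moreover have "f \<in> borel_measurable (lebesgue_on Omega)"
		using bB_measurable[OF f] by (intro measurable_restrict_space1 measurable_completion) simp
	moreover have "AE x in Q. f x = ?f x" by (rule AE_I2) simp
	ultimately show ?thesis unfolding W_def by blast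
qed

lemma C1fun_W: assumes v: "C1fun v" shows "W v (%i x. indicator Omega x * partial_deriv i v x)"
proof (rule line_acz_imp_W)
	fix i and x :: "real ^ 3"
	show "continuous_on {- 1..1} (%t. v (upd x i t)) \<and>
			(\<exists>S. finite S \<and> (\<forall>t. - 1 < t \<and> t < 1 \<and> t \<notin> S \<longrightarrow> ((%t. v (upd x i t)) has_real_derivative partial_deriv i v (upd x i t)) (at t)))"
		using C1fun_line[OF v]
		by (intro conjI exI[of _ "{}"] continuous_on_compose2[OF C1fun_continuous[OF v] _ subset_UNIV] continuous_on_upd continuous_on_const continuous_on_id) auto
qed (intro C1fun_bB v)+

text \<open>The chosen derivative is measurable by completeness of Lebesgue measure, since it agrees
  almost everywhere with a Borel function.\<close>

lemma weak_partial_square: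
	assumes "W f p"
	shows "(LINT x|lebesgue_on Omega. (weak_partial Omega i f x)\<^sup>2) = (LINT x|Q. (p i x)\<^sup>2)"
proof -
	obtain f' where "H1 f' p" using assms by (auto simp: W_def)
	then have p: "L2z (p i)" by (simp add: H1_def)
	have "AE x in lebesgue_on Omega. p i x = weak_partial Omega i f x"
		unfolding AE_lebesgue_on_Omega using W_imp_W12(3)[OF assms, of i] by eventually_elim simp
	then have "AE x in lebesgue. x \<in> Omega \<longrightarrow> p i x = weak_partial Omega i f x"
		by (subst (asm) AE_restrict_space_iff) (auto simp: sets_completionI_sets)
	then have "AE x in lebesgue. indicator Omega x *\<^sub>R p i x = indicator Omega x *\<^sub>R weak_partial Omega i f x"
		by eventually_elim (auto simp: indicator_def)
	moreover have "(%x. indicator Omega x *\<^sub>R p i x) \<in> borel_measurable lebesgue"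
		using L2zD(1)[OF p] by (intro measurable_completion) simp
	ultimately have "(%x. indicator Omega x *\<^sub>R weak_partial Omega i f x) \<in> borel_measurable lebesgue"
		by (rule borel_measurable_AE[rotated])
	then have m: "weak_partial Omega i f \<in> borel_measurable (lebesgue_on Omega)"
		by (subst borel_measurable_restrict_space_iff) (auto simp: sets_completionI_sets)
	show ?thesis
		by (rule rep_square_integrable(2)[OF m L2zD(1)[OF p] W_imp_W12(3)[OF assms]])
qed

lemma W12_norm_W:
	assumes "W f p" "f' \<in> borelf" "AE x in Q. f x = f' x"
	shows "W12_norm Omega f = sqrt ((LINT x|Q. (f' x)\<^sup>2) + (\<Sum>i\<in>UNIV. LINT x|Q. (p i x)\<^sup>2))"
proof -
	have "f \<in> borel_measurable (lebesgue_on Omega)" using assms(1) by (simp add: W_def)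
	from rep_square_integrable(2)[OF this assms(2,3)] show ?thesis
		by (simp add: W12_norm_def weak_partial_square[OF assms(1)])
qed

lemma closure_Omega: "closure Omega = cbox (\<chi> i. - 1) (\<chi> i. 1)"
proof -
	have "0 \<in> box ((\<chi> i. - 1) :: real ^ 3) (\<chi> i. 1)" by (simp add: mem_box_cart)
	then show ?thesis unfolding Omega_box by (intro closure_box) auto
qed

lemma ins_cbox: "y \<in> face ==> - 1 <= t ==> t <= 1 ==> ins i y t \<in> cbox (\<chi> i. - 1) (\<chi> i. 1)"
	using exhaust_3[of i] by (auto simp: mem_box_cart forall_3 face_def forall_2 ins_def less_imp_le)

lemma cont_face_measurable:
	assumes v: "continuous_on (cbox (\<chi> i. - 1) (\<chi> i. 1)) v" and s: "s = 1 \<or> s = (- 1 :: real)"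
	shows "(%y. v (ins 3 y s) :: real) \<in> borel_measurable LF" "integrable LF (%y. (v (ins 3 y s))\<^sup>2)"
proof -
	have "continuous_on face (%y. v (ins 3 y s))"
		using s by (intro continuous_on_compose2[OF v] continuous_on_ins continuous_on_id continuous_on_const) (auto intro!: ins_cbox)
	then have "(%y. v (ins 3 y s)) \<in> borel_measurable (lebesgue_on face)"
		by (intro continuous_imp_measurable_on_sets_lebesgue) (auto simp: sets_completionI_sets)
	then show m: "(%y. v (ins 3 y s)) \<in> borel_measurable LF" by (simp add: LF_def)
	have "compact (v ` cbox (\<chi> i. - 1) (\<chi> i. 1))" by (intro compact_continuous_image v) auto
	then obtain B where B: "\<And>x. x \<in> cbox (\<chi> i. - 1) (\<chi> i. 1) ==> \<bar>v x\<bar> <= B"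
		by (metis bounded_iff compact_imp_bounded image_eqI real_norm_def)
	show "integrable LF (%y. (v (ins 3 y s))\<^sup>2)"
	proof (rule finite_measure.integrable_const_bound[OF finite_measure_LF, of _ "B\<^sup>2"])
		show "AE y in LF. norm ((v (ins 3 y s))\<^sup>2) <= B\<^sup>2"
		proof (rule AE_I2)
			fix y assume "y \<in> space LF"
			then have "\<bar>v (ins 3 y s)\<bar> <= B" using s by (intro B ins_cbox) auto
			then show "norm ((v (ins 3 y s))\<^sup>2) <= B\<^sup>2" using power_mono[of "\<bar>v (ins 3 y s)\<bar>" B 2] by simp
		qed
	qed (use m in measurable)
qed

lemma integrable_square_diff:
	assumes "f \<in> borel_measurable M" "g \<in> borel_measurable M" "integrable M (%x. (f x)\<^sup>2)" "integrable M (%x. (g x)\<^sup>2 :: real)"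
	shows "integrable M (%x. (f x - g x)\<^sup>2)"
proof (rule LI_bound)
	show "integrable M (%x. 2 * (f x)\<^sup>2 + 2 * (g x)\<^sup>2)" using assms by simp
	show "AE x in M. norm ((f x - g x)\<^sup>2) <= norm (2 * (f x)\<^sup>2 + 2 * (g x)\<^sup>2)"
		using square_sum_le[of "f x" "- g x" for x] by (intro AE_I2) simp
qed (use assms in auto)

lemma tr_diff_bound:
	assumes f: "f \<in> borelf" "integrable Q (%x. (f x)\<^sup>2)" and p: "p \<in> borelf" "integrable Q (%x. (p x)\<^sup>2)"
		and g: "g \<in> borelf" "integrable Q (%x. (g x)\<^sup>2)" and q: "q \<in> borelf" "integrable Q (%x. (q x)\<^sup>2)"
		and s: "s = 1 \<or> s = - 1"
	shows "integrable LF (%y. (tr s f p y - tr s g q y)\<^sup>2)"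
		and "(LINT y|LF. (tr s f p y - tr s g q y)\<^sup>2) <= (LINT x|Q. (f x - g x)\<^sup>2) + 4 * (LINT x|Q. (p x - q x)\<^sup>2)"
proof -
	have i: "integrable Q (%x. (f x - g x)\<^sup>2)" "integrable Q (%x. (p x - q x)\<^sup>2)"
		by (intro integrable_square_diff borel_measurable_Q f p g q)+
	have m: "(%x. f x - g x) \<in> borelf" "(%x. p x - q x) \<in> borelf"
		using f p g q by simp_all
	note b = tr_bound(1,2)[OF m(1) i(1) m(2) i(2) s]
	have ae: "AE y in Qf. tr s (%x. f x - g x) (%x. p x - q x) y = tr s f p y - tr s g q y"
		using tr_bound(3,4)[OF f p s] tr_bound(3,4)[OF g q s] by eventually_elim (rule tr_diff)
	have ae2: "AE y in LF. (tr s (%x. f x - g x) (%x. p x - q x) y)\<^sup>2 = (tr s f p y - tr s g q y)\<^sup>2"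
		using AE_LF[OF ae] by eventually_elim simp
	have mm: "(%y. (tr s (%x. f x - g x) (%x. p x - q x) y)\<^sup>2) \<in> borel_measurable LF"
		"(%y. (tr s f p y - tr s g q y)\<^sup>2) \<in> borel_measurable LF"
		using tr_measurable[OF m, of s] tr_measurable[OF f(1) p(1), of s] tr_measurable[OF g(1) q(1), of s]
		by (auto intro!: LF_Q(3))
	show "integrable LF (%y. (tr s f p y - tr s g q y)\<^sup>2)"
		using integrable_cong_AE[OF mm ae2] b(1) by simp
	show "(LINT y|LF. (tr s f p y - tr s g q y)\<^sup>2) <= (LINT x|Q. (f x - g x)\<^sup>2) + 4 * (LINT x|Q. (p x - q x)\<^sup>2)"
		using integral_cong_AE[OF mm ae2] b(2) by simp
qed

text \<open>Along the smooth approximations, Sobolev convergence controls \<open>tr\<close> and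
  uniform convergence controls the restriction to the face, so both limits agree in L^2 of the
  face.\<close>

lemma trace_continuous:
	assumes v: "W v q" "continuous_on (cbox (\<chi> i. - 1) (\<chi> i. 1)) v" and v': "L2z v'" "H1 v' q" "AE x in Q. v x = v' x"
		and s: "s = 1 \<or> s = - 1"
	shows "AE y in LF. v (ins 3 y s) = tr s v' (q 3) y"
proof -
	obtain w where w: "\<And>n. C1fun (w n)" "(%n. LINT x|Q. (w n x - v' x)\<^sup>2) \<longlonglongrightarrow> 0"
		"\<And>i. (%n. LINT x|Q. (partial_deriv i (w n) x - q i x)\<^sup>2) \<longlonglongrightarrow> 0"
		"\<And>z e. continuous_on (cbox (\<chi> i. - 1) (\<chi> i. 1)) z ==> (AE x in Q. z x = v' x) ==> 0 < (e :: real) ==>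
			\<forall>\<^sub>F n in sequentially. \<forall>x\<in>cbox (\<chi> i. - 1) (\<chi> i. 1). \<bar>w n x - z x\<bar> <= e"
		by (rule H1_approx[OF v'(2)]) blast
	have q: "L2z (q 3)" using v'(2) by (simp add: H1_def)
	note cm = cont_face_measurable[OF v(2) s]
	have tm: "tr s v' (q 3) \<in> borel_measurable LF" by (intro LF_Q(3) tr_measurable L2zD(1)[OF v'(1)] L2zD(1)[OF q])
	note tb = tr_bound(1)[OF L2zD(1,2)[OF v'(1)] L2zD(1,2)[OF q] s]
	let ?D = "LINT y|LF. (v (ins 3 y s) - tr s v' (q 3) y)\<^sup>2"
	have iD: "integrable LF (%y. (v (ins 3 y s) - tr s v' (q 3) y)\<^sup>2)" by (intro integrable_square_diff cm tm tb)
	have main: "?D <= 2 * e\<^sup>2 * measure LF (space LF) + 2 * e" if e: "0 < e" for e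
	proof -
		have "(%n. (LINT x|Q. (w n x - v' x)\<^sup>2) + 4 * (LINT x|Q. (partial_deriv 3 (w n) x - q 3 x)\<^sup>2)) \<longlonglongrightarrow> 0 + 4 * 0"
			by (intro tendsto_intros w)
		then have "\<forall>\<^sub>F n in sequentially. (LINT x|Q. (w n x - v' x)\<^sup>2) + 4 * (LINT x|Q. (partial_deriv 3 (w n) x - q 3 x)\<^sup>2) < e"
			using e by (intro order_tendstoD(2)) auto
		with w(4)[OF v(2) v'(3) e] obtain n where n: "\<And>x. x \<in> cbox (\<chi> i. - 1) (\<chi> i. 1) ==> \<bar>w n x - v x\<bar> <= e"
			"(LINT x|Q. (w n x - v' x)\<^sup>2) + 4 * (LINT x|Q. (partial_deriv 3 (w n) x - q 3 x)\<^sup>2) < e"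
			using eventually_happens'[OF sequentially_bot eventually_conj] by blast
		note wb = C1fun_bB[OF w(1)]
		note td = tr_diff_bound[OF bB_measurable[OF wb(1)] bB_integrable[OF bB_power[OF wb(1)]]
				bB_measurable[OF wb(2)] bB_integrable[OF bB_power[OF wb(2)]] L2zD(1,2)[OF v'(1)] L2zD(1,2)[OF q] s]
		have "?D <= (LINT y|LF. 2 * e\<^sup>2 + 2 * (tr s (w n) (partial_deriv 3 (w n)) y - tr s v' (q 3) y)\<^sup>2)"
		proof (rule integral_mono)
			show "integrable LF (%y. 2 * e\<^sup>2 + 2 * (tr s (w n) (partial_deriv 3 (w n)) y - tr s v' (q 3) y)\<^sup>2)"
				by (intro LI_add integrable_mult_right td(1) finite_measure.integrable_const[OF finite_measure_LF])
			fix y assume y: "y \<in> space LF"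
			have "\<bar>v (ins 3 y s) - tr s (w n) (partial_deriv 3 (w n)) y\<bar> <= e"
				unfolding tr_C1fun[OF w(1) s] using n(1)[OF ins_cbox[of y s 3]] y s by (auto simp: abs_minus_commute)
			then have "(v (ins 3 y s) - tr s (w n) (partial_deriv 3 (w n)) y)\<^sup>2 <= e\<^sup>2"
				using e by (simp add: abs_le_square_iff[symmetric])
			then show "(v (ins 3 y s) - tr s v' (q 3) y)\<^sup>2 <= 2 * e\<^sup>2 + 2 * (tr s (w n) (partial_deriv 3 (w n)) y - tr s v' (q 3) y)\<^sup>2"
				using square_sum_le[of "v (ins 3 y s) - tr s (w n) (partial_deriv 3 (w n)) y" "tr s (w n) (partial_deriv 3 (w n)) y - tr s v' (q 3) y"] by simp
		qed (rule iD)
		also have "... = 2 * e\<^sup>2 * measure LF (space LF) + 2 * (LINT y|LF. (tr s (w n) (partial_deriv 3 (w n)) y - tr s v' (q 3) y)\<^sup>2)"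
			using td(1)[of n 3 n] finite_measure.integrable_const[OF finite_measure_LF, of "2 * e\<^sup>2"] by simp
		also have "... <= 2 * e\<^sup>2 * measure LF (space LF) + 2 * e" using td(2)[of n 3 n] n(2) by linarith
		finally show ?thesis .
	qed
	have "?D <= 0"
	proof (rule tendsto_lowerbound)
		show "((%e. 2 * e\<^sup>2 * measure LF (space LF) + 2 * e) \<longlongrightarrow> 0) (at_right 0)"
			by (rule tendsto_eq_intros refl | simp)+
		show "\<forall>\<^sub>F e in at_right 0. ?D <= 2 * e\<^sup>2 * measure LF (space LF) + 2 * e"
			using main by (auto simp: eventually_at_right_less intro: eventually_at_rightI[of 0 1])
	qed simp
	then have "?D = 0" by (simp add: antisym)
	then have "AE y in LF. (v (ins 3 y s) - tr s v' (q 3) y)\<^sup>2 = 0"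
		using iD by (subst (asm) integral_nonneg_eq_0_iff_AE) auto
	then show ?thesis by eventually_elim simp
qed

text \<open>A trace is an L^2 limit of restrictions of continuous functions. Those restrictions
  equal \<open>tr\<close>, and \<open>tr\<close> passes to the limit by its continuity in the
  W^{1,2} norm.\<close>

lemma trace_unique:
	assumes u: "H1 u' p" "u \<in> borel_measurable (lebesgue_on Omega)" "AE x in Q. u x = u' x" and s: "s = 1 \<or> s = - 1"
		and g: "has_face_trace s u g"
	shows "AE y in LF. g y = tr s u' (p 3) y" "g \<in> borel_measurable LF"
proof -
	have U: "W u p" using u by (auto simp: W_def)
	have u': "L2z u'" "L2z (p 3)" using u by (auto simp: H1_def)
	have gm: "g \<in> borel_measurable LF" and gi: "integrable LF (%y. (g y)\<^sup>2)"
		using g by (auto simp: has_face_trace_def square_integrable_on_def LF_def)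
	show "g \<in> borel_measurable LF" by (rule gm)
	obtain v where v: "\<And>n. v n \<in> W12 Omega" "\<And>n. continuous_on (closure Omega) (v n)"
		"(%n. W12_norm Omega (%x. v n x - u x)) \<longlonglongrightarrow> 0" "(%n. LINT y|LF. (v n (face_point s y) - g y)\<^sup>2) \<longlonglongrightarrow> 0"
		using g by (auto simp: has_face_trace_def LF_def)
	have "\<forall>n. \<exists>q v'. W (v n) q \<and> H1 v' q \<and> (AE x in Q. v n x = v' x)"
		using W12_imp_W[OF v(1)] unfolding W_def by blast
	then obtain q v' where q: "\<And>n. W (v n) (q n)" "\<And>n. H1 (v' n) (q n)" "\<And>n. AE x in Q. v n x = v' n x" by metis
	have L: "L2z (v' n)" "L2z (q n i)" for n i using q(2)[of n] by (auto simp: H1_def)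
	let ?N = "%n. (LINT x|Q. (v' n x - u' x)\<^sup>2) + (\<Sum>i\<in>UNIV. LINT x|Q. (q n i x - p i x)\<^sup>2)"
	have N: "W12_norm Omega (%x. v n x - u x) = sqrt (?N n)" for n
	proof (rule W12_norm_W[OF W_diff[OF q(1) U]])
		show "(%x. v' n x - u' x) \<in> borelf" using L2zD(1)[OF L(1)] L2zD(1)[OF u'(1)] by simp
		show "AE x in Q. v n x - u x = v' n x - u' x" using q(3)[of n] u(3) by eventually_elim simp
	qed
	have N0: "?N \<longlonglongrightarrow> 0"
	proof -
		have "(%n. (W12_norm Omega (%x. v n x - u x))\<^sup>2) \<longlonglongrightarrow> 0\<^sup>2" by (intro tendsto_power v(3))
		then show ?thesis unfolding N by (simp add: sum_nonneg add_nonneg_nonneg)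
	qed
	note td = tr_diff_bound[OF L2zD(1,2)[OF L(1)] L2zD(1,2)[OF L(2)] L2zD(1,2)[OF u'(1)] L2zD(1,2)[OF u'(2)] s]
	have tm: "tr s u' (p 3) \<in> borel_measurable LF" by (intro LF_Q(3) tr_measurable L2zD(1)[OF u'(1)] L2zD(1)[OF u'(2)])
	note tb = tr_bound(1)[OF L2zD(1,2)[OF u'(1)] L2zD(1,2)[OF u'(2)] s]
	let ?D = "LINT y|LF. (g y - tr s u' (p 3) y)\<^sup>2"
	have iD: "integrable LF (%y. (g y - tr s u' (p 3) y)\<^sup>2)" by (intro integrable_square_diff gm gi tm tb)
	have main: "?D <= 2 * (LINT y|LF. (v n (face_point s y) - g y)\<^sup>2) + 8 * ?N n" for n
	proof -
		note cm = cont_face_measurable[OF v(2)[of n, unfolded closure_Omega] s]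
		have i1: "integrable LF (%y. (v n (ins 3 y s) - g y)\<^sup>2)" by (intro integrable_square_diff cm gm gi)
		have "?D <= (LINT y|LF. 2 * (v n (ins 3 y s) - g y)\<^sup>2 + 2 * (tr s (v' n) (q n 3) y - tr s u' (p 3) y)\<^sup>2)"
		proof (rule integral_mono_AE)
			show "integrable LF (%y. 2 * (v n (ins 3 y s) - g y)\<^sup>2 + 2 * (tr s (v' n) (q n 3) y - tr s u' (p 3) y)\<^sup>2)"
				using i1 td(1) by simp
			show "AE y in LF. (g y - tr s u' (p 3) y)\<^sup>2 <= 2 * (v n (ins 3 y s) - g y)\<^sup>2 + 2 * (tr s (v' n) (q n 3) y - tr s u' (p 3) y)\<^sup>2"
				using trace_continuous[OF q(1) v(2)[of n, unfolded closure_Omega] L(1) q(2,3) s]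
			proof eventually_elim
				fix y assume "v n (ins 3 y s) = tr s (v' n) (q n 3) y"
				then show "(g y - tr s u' (p 3) y)\<^sup>2 <= 2 * (v n (ins 3 y s) - g y)\<^sup>2 + 2 * (tr s (v' n) (q n 3) y - tr s u' (p 3) y)\<^sup>2"
					using square_sum_le[of "g y - v n (ins 3 y s)" "tr s (v' n) (q n 3) y - tr s u' (p 3) y"] by (simp add: power2_commute)
			qed
		qed (rule iD)
		also have "... = 2 * (LINT y|LF. (v n (ins 3 y s) - g y)\<^sup>2) + 2 * (LINT y|LF. (tr s (v' n) (q n 3) y - tr s u' (p 3) y)\<^sup>2)"
			using i1 td(1) by simp
		also have "... <= 2 * (LINT y|LF. (v n (face_point s y) - g y)\<^sup>2) + 8 * ?N n"
		proof -
			have "(LINT x|Q. (q n 3 x - p 3 x)\<^sup>2) <= (\<Sum>i\<in>UNIV. LINT x|Q. (q n i x - p i x)\<^sup>2)"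
				by (intro member_le_sum) auto
			moreover have "0 <= (LINT x|Q. (v' n x - u' x)\<^sup>2)" by simp
			moreover have "P <= S ==> 0 <= V ==> T <= V + 4 * P ==> 2 * G + 2 * T <= 2 * G + 8 * (V + S)" for P S V T G :: real
				by argo
			ultimately show ?thesis using td(2)[of n n 3] unfolding face_point_eq_ins by blast
		qed
		finally show ?thesis .
	qed
	have "(%n. 2 * (LINT y|LF. (v n (face_point s y) - g y)\<^sup>2) + 8 * ?N n) \<longlonglongrightarrow> 2 * 0 + 8 * 0"
		by (intro tendsto_intros v(4) N0)
	then have "?D <= 0" using main by (intro LIMSEQ_le_const) auto
	then have "?D = 0" by (simp add: antisym)
	then have "AE y in LF. (g y - tr s u' (p 3) y)\<^sup>2 = 0"
		using iD by (subst (asm) integral_nonneg_eq_0_iff_AE) auto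
	then show "AE y in LF. g y = tr s u' (p 3) y" by eventually_elim simp
qed

text \<open>Without existence the choice in \<open>face_trace\<close> would carry no
  information.\<close>

lemma trace_exists:
	assumes u: "H1 u' p" "u \<in> borel_measurable (lebesgue_on Omega)" "AE x in Q. u x = u' x" and s: "s = 1 \<or> s = - 1"
	shows "has_face_trace s u (tr s u' (p 3))"
proof -
	have U: "W u p" using u by (auto simp: W_def)
	have u': "L2z u'" "L2z (p i)" for i using u by (auto simp: H1_def)
	obtain w where w: "\<And>n. C1fun (w n)" "(%n. LINT x|Q. (w n x - u' x)\<^sup>2) \<longlonglongrightarrow> 0"
		"\<And>i. (%n. LINT x|Q. (partial_deriv i (w n) x - p i x)\<^sup>2) \<longlonglongrightarrow> 0"
		"\<And>z e. continuous_on (cbox (\<chi> i. - 1) (\<chi> i. 1)) z ==> (AE x in Q. z x = u' x) ==> 0 < (e :: real) ==>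
			\<forall>\<^sub>F n in sequentially. \<forall>x\<in>cbox (\<chi> i. - 1) (\<chi> i. 1). \<bar>w n x - z x\<bar> <= e"
		by (rule H1_approx[OF u(1)]) blast
	have N: "W12_norm Omega (%x. w n x - u x) = sqrt ((LINT x|Q. (w n x - u' x)\<^sup>2) + (\<Sum>i\<in>UNIV. LINT x|Q. (partial_deriv i (w n) x - p i x)\<^sup>2))" for n
	proof -
		have "W12_norm Omega (%x. w n x - u x) = sqrt ((LINT x|Q. (w n x - u' x)\<^sup>2) + (\<Sum>i\<in>UNIV. LINT x|Q. (indicator Omega x * partial_deriv i (w n) x - p i x)\<^sup>2))"
		proof (rule W12_norm_W[OF W_diff[OF C1fun_W[OF w(1)] U]])
			show "(%x. w n x - u' x) \<in> borelf" using bB_measurable[OF C1fun_bB(1)[OF w(1)]] L2zD(1)[OF u'(1)] by simp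
			show "AE x in Q. w n x - u x = w n x - u' x" using u(3) by eventually_elim simp
		qed
		moreover have "(LINT x|Q. (indicator Omega x * partial_deriv i (w n) x - p i x)\<^sup>2) = (LINT x|Q. (partial_deriv i (w n) x - p i x)\<^sup>2)" for i
			by (intro LINT_cong) auto
		ultimately show ?thesis by simp
	qed
	note wb = C1fun_bB[OF w(1)]
	note td = tr_diff_bound[OF bB_measurable[OF wb(1)] bB_integrable[OF bB_power[OF wb(1)]]
				bB_measurable[OF wb(2)] bB_integrable[OF bB_power[OF wb(2)]] L2zD(1,2)[OF u'(1)] L2zD(1,2)[OF u'(2)] s]
	show ?thesis
		unfolding has_face_trace_def LF_def[symmetric]
	proof (intro conjI exI[of _ w] allI)
		show "square_integrable_on (tr s u' (p 3)) face"
			unfolding square_integrable_on_def LF_def[symmetric]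
			using tr_bound(1)[OF L2zD(1,2)[OF u'(1)] L2zD(1,2)[OF u'(2)] s]
			by (intro conjI LF_Q(3) tr_measurable L2zD(1)[OF u'(1)] L2zD(1)[OF u'(2)]) auto
		show "w n \<in> W12 Omega" for n by (rule W_imp_W12(1)[OF C1fun_W[OF w(1)]])
		show "continuous_on (closure Omega) (w n)" for n by (rule continuous_on_subset[OF C1fun_continuous[OF w(1)]]) simp
		have "(%n. sqrt ((LINT x|Q. (w n x - u' x)\<^sup>2) + (\<Sum>i\<in>UNIV. LINT x|Q. (partial_deriv i (w n) x - p i x)\<^sup>2))) \<longlonglongrightarrow> sqrt (0 + (\<Sum>i\<in>(UNIV :: 3 set). 0))"
			by (intro tendsto_intros w)
		then show "(%n. W12_norm Omega (%x. w n x - u x)) \<longlonglongrightarrow> 0" unfolding N by simp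
		show "(%n. LINT y|LF. (w n (face_point s y) - tr s u' (p 3) y)\<^sup>2) \<longlonglongrightarrow> 0"
		proof (rule Lim_null_comparison)
			have "(%n. (LINT x|Q. (w n x - u' x)\<^sup>2) + 4 * (LINT x|Q. (partial_deriv 3 (w n) x - p 3 x)\<^sup>2)) \<longlonglongrightarrow> 0 + 4 * 0"
				by (intro tendsto_intros w)
			then show "(%n. (LINT x|Q. (w n x - u' x)\<^sup>2) + 4 * (LINT x|Q. (partial_deriv 3 (w n) x - p 3 x)\<^sup>2)) \<longlonglongrightarrow> 0" by simp
			show "\<forall>\<^sub>F n in sequentially. norm (LINT y|LF. (w n (face_point s y) - tr s u' (p 3) y)\<^sup>2)
					<= (LINT x|Q. (w n x - u' x)\<^sup>2) + 4 * (LINT x|Q. (partial_deriv 3 (w n) x - p 3 x)\<^sup>2)"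
			proof (intro always_eventually allI)
				fix n
				show "norm (LINT y|LF. (w n (face_point s y) - tr s u' (p 3) y)\<^sup>2)
					<= (LINT x|Q. (w n x - u' x)\<^sup>2) + 4 * (LINT x|Q. (partial_deriv 3 (w n) x - p 3 x)\<^sup>2)"
					using td(2)[of n 3 n 3] by (simp add: face_point_eq_ins tr_C1fun[OF w(1) s])
			qed
		qed
	qed
qed

text \<open>In the difference of the two explicit traces the terms without derivative cancel, and
  the weights t + 1 and t - 1 leave the line integral of \<partial>_3 u_1. This removes traces from
  the remaining argument.\<close>

lemma M'_eq:
	assumes "W (%x. u x $ 1) p"
	shows "M' u = (LINT x|Q. x $ 2 * p 3 x)"
proof -
	obtain u' where u: "(%x. u x $ 1) \<in> borel_measurable (lebesgue_on Omega)" "H1 u' p" "AE x in Q. u x $ 1 = u' x"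
		using assms by (auto simp: W_def)
	have u': "L2z u'" "L2z (p 3)" using u by (auto simp: H1_def)
	have ft: "has_face_trace s (%x. u x $ 1) (face_trace s (%x. u x $ 1))" if "s = 1 \<or> s = - 1" for s
		unfolding face_trace_def by (rule someI[of "has_face_trace s (%x. u x $ 1)", OF trace_exists[OF u(2,1,3) that]])
	note t1 = trace_unique[OF u(2,1,3) _ ft, of 1, simplified] and t2 = trace_unique[OF u(2,1,3) _ ft, of "- 1", simplified]
	have tm: "tr s u' (p 3) \<in> borelf" for s by (intro tr_measurable L2zD(1)[OF u'(1)] L2zD(1)[OF u'(2)])
	have bm: "(%y :: real ^ 2. y $ 2 * (tr 1 u' (p 3) y - tr (- 1) u' (p 3) y)) \<in> borelf"
		using tm by (intro borel_measurable_times borel_measurable_diff borel_measurable_vec_nth') auto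
	have "M' u = (LINT y|LF. y $ 2 * (tr 1 u' (p 3) y - tr (- 1) u' (p 3) y))"
		unfolding M'_def LF_def[symmetric]
	proof (rule integral_cong_AE)
		have n: "(%y :: real ^ 2. y $ 2) \<in> borel_measurable LF" by (intro LF_Q(3)) (intro borel_measurable_vec_nth' measurable_ident_sets refl)
		show "(%y. y $ 2 * (face_trace 1 (%x. u x $ 1) y - face_trace (- 1) (%x. u x $ 1) y)) \<in> borel_measurable LF"
			by (intro borel_measurable_times borel_measurable_diff n t1(2) t2(2))
		show "AE y in LF. y $ 2 * (face_trace 1 (%x. u x $ 1) y - face_trace (- 1) (%x. u x $ 1) y) = y $ 2 * (tr 1 u' (p 3) y - tr (- 1) u' (p 3) y)"
			using t1(1) t2(1) by eventually_elim simp
	qed (rule LF_Q(3)[OF bm])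
	also have "... = (LINT y|Qf. y $ 2 * (tr 1 u' (p 3) y - tr (- 1) u' (p 3) y))" by (rule LF_Q(2)[OF bm])
	also have "... = (LINT y|Qf. LINT t|J. ins 3 y t $ 2 * p 3 (ins 3 y t))"
	proof (rule integral_cong_AE)
		have ip: "integrable Q (%x. x $ 2 * p 3 x)"
			by (intro cauchy_schwarz_integral(1) bB_measurable_Q bB_nth borel_measurable_Q L2zD(1)[OF u'(2)] L2zD(2)[OF u'(2)] bB_integrable bB_power)
		show "(%y. LINT t|J. ins 3 y t $ 2 * p 3 (ins 3 y t)) \<in> borel_measurable Qf"
			using integral_Q(2)[OF ip, of 3] by simp
		show "AE y in Qf. y $ 2 * (tr 1 u' (p 3) y - tr (- 1) u' (p 3) y) = (LINT t|J. ins 3 y t $ 2 * p 3 (ins 3 y t))"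
			using tr_bound(3,4)[OF L2zD(1,2)[OF u'(1)] L2zD(1,2)[OF u'(2)], of 1, simplified]
		proof eventually_elim
			fix y assume i: "integrable J (%t. u' (ins 3 y t))" "integrable J (%t. p 3 (ins 3 y t))"
			have it: "integrable J (%t. t * p 3 (ins 3 y t))"
			proof (rule LI_bound[OF i(2)])
				show "AE t in J. norm (t * p 3 (ins 3 y t)) <= norm (p 3 (ins 3 y t))"
					by (intro AE_I2) (auto simp: abs_mult intro!: mult_left_le_one_le)
			qed (use i(2) in \<open>intro borel_measurable_times measurable_J_lborel, auto\<close>)
			have "tr 1 u' (p 3) y - tr (- 1) u' (p 3) y = (LINT t|J. p 3 (ins 3 y t))"
				using i it by (simp add: tr_def algebra_simps add_divide_distrib[symmetric] diff_divide_distrib[symmetric])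
			moreover have "ins 3 y t $ 2 = y $ 2" for t by (simp add: ins_def)
			ultimately show "y $ 2 * (tr 1 u' (p 3) y - tr (- 1) u' (p 3) y) = (LINT t|J. ins 3 y t $ 2 * p 3 (ins 3 y t))"
				by simp
		qed
	qed (use bm in \<open>auto intro!: measurable_restrict_space1\<close>)
	also have "... = (LINT x|Q. x $ 2 * p 3 x)"
		by (rule integral_Q(1)[symmetric])
			(intro cauchy_schwarz_integral(1) bB_measurable_Q bB_nth borel_measurable_Q L2zD(1)[OF u'(2)] L2zD(2)[OF u'(2)] bB_integrable bB_power)
	finally show ?thesis .
qed

section \<open>The linear estimate for the boundary functional\<close>

lemma nn_integral_translate:
	fixes h :: "'a :: euclidean_space \<Rightarrow> ennreal"
	assumes "h \<in> borelf"
	shows "(\<integral>\<^sup>+y. h (y + c) \<partial>lborel) = (\<integral>\<^sup>+y. h y \<partial>lborel)"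
proof -
	have "(\<integral>\<^sup>+y. h y \<partial>lborel) = (\<integral>\<^sup>+y. h y \<partial>distr lborel borel ((+) c))" by (simp add: lborel_distr_plus)
	also have "... = (\<integral>\<^sup>+y. h (c + y) \<partial>lborel)" by (rule nn_integral_distr) (use assms in auto)
	finally show ?thesis by (simp add: add.commute)
qed

lemma integral_translate:
	fixes h :: "'a :: euclidean_space \<Rightarrow> real"
	assumes "h \<in> borelf"
	shows "(LINT y|lborel. h (y + c)) = (LINT y|lborel. h y)" "integrable lborel (%y. h (y + c)) \<longleftrightarrow> integrable lborel h"
proof -
	have "(LINT y|lborel. h y) = (LINT y|distr lborel borel ((+) c). h y)" by (simp add: lborel_distr_plus)
	also have "... = (LINT y|lborel. h (c + y))" by (rule integral_distr) (use assms in auto)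
	finally show "(LINT y|lborel. h (y + c)) = (LINT y|lborel. h y)" by (simp add: add.commute)
	have "integrable lborel h \<longleftrightarrow> integrable (distr lborel borel ((+) c)) h" by (simp add: lborel_distr_plus)
	also have "... \<longleftrightarrow> integrable lborel (%y. h (c + y))" by (rule integrable_distr_eq) (use assms in auto)
	finally show "integrable lborel (%y. h (y + c)) \<longleftrightarrow> integrable lborel h" by (simp add: add.commute)
qed

lemma C1fun_direction:
	assumes v: "C1fun v"
	shows "((%t. v (p + t *\<^sub>R \<nu>)) has_real_derivative (\<Sum>i\<in>UNIV. \<nu> $ i * partial_deriv i v (p + t *\<^sub>R \<nu>))) (at t)"
proof -
	let ?D = "frechet_derivative v (at (p + t *\<^sub>R \<nu>))"
	have dv: "v differentiable (at (p + t *\<^sub>R \<nu>))" using v by (simp add: C1fun_def)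
	have 1: "((%t. p + t *\<^sub>R \<nu>) has_derivative (%h. h *\<^sub>R \<nu>)) (at t)" by (auto intro!: derivative_eq_intros)
	have lin: "linear ?D" by (rule linear_frechet_derivative[OF dv])
	have "(\<Sum>i\<in>UNIV. \<nu> $ i *\<^sub>R axis i 1) = \<nu>"
		using basis_expansion[of \<nu>] by (simp only: scalar_mult_eq_scaleR)
	then have "?D \<nu> = ?D (\<Sum>i\<in>UNIV. \<nu> $ i *\<^sub>R axis i 1)" by (rule arg_cong[OF sym])
	also have "... = (\<Sum>i\<in>UNIV. \<nu> $ i * partial_deriv i v (p + t *\<^sub>R \<nu>))"
		by (simp add: linear_sum[OF lin] linear_cmul[OF lin] partial_deriv_def)
	finally have "?D (h *\<^sub>R \<nu>) = h * (\<Sum>i\<in>UNIV. \<nu> $ i * partial_deriv i v (p + t *\<^sub>R \<nu>))" for h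
		by (simp add: linear_cmul[OF lin])
	then show ?thesis
		using has_derivative_compose[OF 1 iffD1[OF frechet_derivative_works dv]]
		by (simp add: has_field_derivative_def mult.commute[of _ "\<Sum>i\<in>UNIV. \<nu> $ i * partial_deriv i v (p + t *\<^sub>R \<nu>)"])
qed

lemma FTC_bound:
	assumes w: "\<And>t. (w has_real_derivative w' t) (at t)" "continuous_on UNIV w'" and F: "F \<in> borelf"
		and le: "\<And>t. t \<in> {a..b} ==> \<bar>w' t\<bar> <= F t" and ab: "- 1 <= a" "a <= b" "b <= 1" and B: "\<And>t. t \<in> {- 1..1} ==> 0 <= F t \<and> F t <= B"
	shows "\<bar>w b - w a\<bar> <= (LINT t|J. indicator {a..b} t * F t)"
proof -
	note [measurable] = borel_measurable_continuous_onI[OF w(2)] F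
	have "(LINT t|lborel. w' t * indicator {a..b} t) = w b - w a"
		using w ab by (intro integral_FTC_Icc_real) (auto simp: continuous_on_eq_continuous_at)
	moreover have "(LINT t|lborel. w' t * indicator {a..b} t) = (LINT t|lborel. indicator {-1<..<1} t *\<^sub>R (indicator {a..b} t * w' t))"
	proof (rule integral_cong_AE)
		show "AE t in lborel. w' t * indicator {a..b} t = indicator {-1<..<1} t *\<^sub>R (indicator {a..b} t * w' t)"
			using AE_lborel_singleton[of 1] AE_lborel_singleton[of "- 1"] by eventually_elim (use ab in \<open>auto simp: indicator_def\<close>)
	qed measurable
	ultimately have eq: "w b - w a = (LINT t|J. indicator {a..b} t * w' t)" by (subst integral_restrict_space) auto
	have "norm (LINT t|J. indicator {a..b} t * w' t) <= (LINT t|J. indicator {a..b} t * F t)"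
	proof (rule LINT_norm_bound)
		have B0: "0 <= B" using B[of 0] by auto
		have bd: "norm (indicator {a..b} t * w' t) <= B" "norm (indicator {a..b} t * F t) <= B" if "t \<in> space J" for t
			using B[of t] le[of t] that B0 by (auto simp: indicator_def)
		show "integrable J (%t. indicator {a..b} t * w' t)" "integrable J (%t. indicator {a..b} t * F t)"
			using bd by (auto intro!: J.integrable_const_bound[of _ B] AE_I2 measurable_restrict_space1)
		show "norm (indicator {a..b} t * w' t) <= indicator {a..b} t * F t" for t
			using le[of t] by (auto simp: indicator_def)
	qed
	then show ?thesis by (simp add: eq)
qed

lemma integrable_J_continuous:
	assumes "continuous_on UNIV (g :: real \<Rightarrow> real)" shows "integrable J g"
proof -
	have "compact (g ` {- 1..1})" by (intro compact_continuous_image continuous_on_subset[OF assms]) auto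
	then obtain B where B: "\<And>t. t \<in> {- 1..1} ==> \<bar>g t\<bar> <= B"
		by (metis bounded_iff compact_imp_bounded image_eqI real_norm_def)
	then show ?thesis using borel_measurable_continuous_onI[OF assms]
		by (intro J.integrable_const_bound[of _ B]) (auto intro!: AE_I2 measurable_restrict_space1)
qed

lemma cube2_bound:
	assumes "continuous_on UNIV (F :: real ^ 3 \<Rightarrow> real)"
	obtains B where "0 < B" "\<And>x. x \<in> cube 2 ==> \<bar>F x\<bar> <= B"
proof -
	have "compact (F ` cube 2)" by (intro compact_continuous_image continuous_on_subset[OF assms] compact_cube) auto
	then obtain B where "\<And>x. x \<in> cube 2 ==> \<bar>F x\<bar> <= B"
		by (metis bounded_iff compact_imp_bounded image_eqI real_norm_def)
	then have "\<And>x. x \<in> cube 2 ==> \<bar>F x\<bar> <= \<bar>B\<bar> + 1" by fastforce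
	then show thesis by (intro that[of "\<bar>B\<bar> + 1"]) auto
qed

lemma AE_nth_neq: "AE y in lborel. (y :: real ^ 2) $ i \<noteq> c"
proof -
	have "negligible {y :: real ^ 2. y $ i = c}"
	proof -
		have "axis i 1 \<in> (Basis :: (real ^ 2) set)" by (auto simp: Basis_vec_def)
		from negligible_standard_hyperplane[OF this, of c] show ?thesis by (simp add: inner_axis)
	qed
	then have "AE y in lebesgue. y \<notin> {y :: real ^ 2. y $ i = c}" by (intro AE_not_in) (simp add: negligible_iff_null_sets)
	then show ?thesis by (simp add: AE_completion_iff)
qed

text \<open>On \<open>half a\<close> the nearer vertical edge is x_1 = a. Translation by - a in x_1
  maps \<open>half a\<close> onto the other half, which is what keeps the oblique lines below inside
  the cube.\<close>

definition half :: "real \<Rightarrow> (real ^ 2) set" where "half a = {y \<in> face. 0 < a * y $ 1}"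

lemma sets_half [measurable]: "half a \<in> sets borel"
proof -
	have "(%y :: real ^ 2. a * y $ 1) \<in> borelf" by (intro borel_measurable_times borel_measurable_vec_nth') auto
	then have "{y \<in> space borel. 0 < a * (y :: real ^ 2) $ 1} \<in> sets borel" by measurable
	then have "face \<inter> {y. 0 < a * y $ 1} \<in> sets borel" by (intro sets.Int sets_face) simp
	moreover have "half a = face \<inter> {y. 0 < a * y $ 1}" by (auto simp: half_def)
	ultimately show ?thesis by (simp only:)
qed

lemma half_shift: "a = 1 \<or> a = - 1 ==> y + a *\<^sub>R axis 1 1 \<in> half a \<longleftrightarrow> y \<in> half (- a)"
	by (auto simp: half_def face_def axis_def forall_2)

lemma half_near: "a = 1 \<or> a = - 1 ==> y + (a * (1 - \<bar>t\<bar>)) *\<^sub>R axis 1 1 \<in> half a ==> - 1 < t ==> t < 1 ==> y \<in> face"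
	by (auto simp: half_def face_def axis_def forall_2)

lemma split_half:
	assumes "integrable Qf (h :: real ^ 2 \<Rightarrow> real)" "h \<in> borelf"
	shows "integrable lborel (%y. indicator (half a) y * h y)"
		"(LINT y|Qf. h y) = (LINT y|lborel. indicator (half 1) y * h y) + (LINT y|lborel. indicator (half (- 1)) y * h y)"
proof -
	have i: "integrable lborel (%y. indicator face y * h y)"
		using assms by (simp add: integrable_restrict_space set_integrable_def)
	show ih: "integrable lborel (%y. indicator (half a) y * h y)" for a
	proof (rule LI_bound[OF i])
		show "AE y in lborel. norm (indicator (half a) y * h y) <= norm (indicator face y * h y)"
			by (intro AE_I2) (auto simp: indicator_def half_def)
	qed (use assms(2) in measurable)
	have "(LINT y|Qf. h y) = (LINT y|lborel. indicator face y * h y)" by (simp add: integral_restrict_space)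
	also have "... = (LINT y|lborel. indicator (half 1) y * h y + indicator (half (- 1)) y * h y)"
	proof (rule integral_cong_AE)
		show "AE y in lborel. indicator face y * h y = indicator (half 1) y * h y + indicator (half (- 1)) y * h y"
			using AE_nth_neq[of 1 0] by eventually_elim (auto simp: indicator_def half_def)
	qed (use assms(2) in measurable)
	finally show "(LINT y|Qf. h y) = (LINT y|lborel. indicator (half 1) y * h y) + (LINT y|lborel. indicator (half (- 1)) y * h y)"
		using ih by simp
qed

text \<open>Near the edges where the face \<open>x\<^sub>3 = \<plusminus>1\<close> meets \<open>x\<^sub>1 = \<plusminus>1\<close> the trace is transported to the
	interior along the lines of direction \<open>(\<plusminus>1,0,1)\<close>, along which \<open>\<plusminus>v\<^sub>1 + v\<^sub>3\<close> varies only through the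
	controlled strains.\<close>

lemma corner_pointwise:
	assumes v: "C1fun v1" "C1fun v3" and Z: "continuous_on UNIV Z" "\<And>t. 0 <= Z t" "(LINT t|J. Z t) = 1" and a: "a = 1 \<or> a = - 1" and y: "y \<in> half a"
		and F: "F = (%x. \<bar>partial_deriv 1 v1 x\<bar> + \<bar>partial_deriv 3 v1 x + partial_deriv 1 v3 x\<bar> + \<bar>partial_deriv 3 v3 x\<bar>)"
		and A: "A = (%y. LINT t|J. Z t * v3 (ins 3 y t))"
	shows "\<bar>a * (v1 (ins 3 y 1) - v1 (ins 3 y (- 1))) - (2 * A (y - a *\<^sub>R axis 1 1) - 2 * A y)\<bar>
		<= (LINT t|J. F (ins 3 (y - (a * (1 - \<bar>t\<bar>)) *\<^sub>R axis 1 1) t)) + 2 * (LINT t|J. F (ins 3 y t))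
			+ 2 * (LINT t|J. F (ins 3 (y - a *\<^sub>R axis 1 1) t))"
proof -
	\<comment> \<open>The common point at height 0 of two oblique segments: direction (a,0,1) leads
	  from it up to (y,1), and direction (-a,0,1) leads from (y,-1) up to it.\<close>
	define p where "p = ins 3 (y - a *\<^sub>R axis 1 1) 0"
	define \<nu> where "\<nu> s = (\<chi> i. if i = 1 then s * a else if i = 3 then 1 else 0 :: real ^ 3)" for s :: real
	have Fc: "continuous_on UNIV F" unfolding F by (intro continuous_intros C1fun_continuous_deriv v)
	have Fm: "F \<in> borelf" by (rule borel_measurable_continuous_onI[OF Fc])
	have F0: "0 <= F x" for x unfolding F by simp
	obtain B where B: "0 < B" "\<And>x. x \<in> cube 2 ==> \<bar>F x\<bar> <= B" using cube2_bound[OF Fc] by blast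
	have yb: "\<bar>y $ 1\<bar> < 1" "\<bar>y $ 2\<bar> < 1" "\<bar>y $ 1 - a\<bar> < 1" using y a by (auto simp: half_def face_def forall_2)
	have pn: "p + t *\<^sub>R \<nu> s = ins 3 (y - (a * (1 - s * t)) *\<^sub>R axis 1 1) t" for s t
		by (simp add: p_def \<nu>_def vec_eq_iff forall_3 ins_def axis_def algebra_simps)
	have line: "ins 3 y' t \<in> cube 2" if "\<bar>y' $ 1\<bar> <= 2" "\<bar>y' $ 2\<bar> <= 2" "\<bar>t\<bar> <= 2" for y' t
		using that by (simp add: cube_def forall_3 ins_def)
	define \<gamma> where "\<gamma> t = ins 3 (y - (a * (1 - \<bar>t\<bar>)) *\<^sub>R axis 1 1) t" for t
	have \<gamma>c: "continuous_on UNIV \<gamma>" unfolding \<gamma>_def[abs_def] by (intro continuous_on_ins continuous_intros)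
	have \<gamma>2: "\<gamma> t \<in> cube 2" if "t \<in> {- 1..1}" for t
		unfolding \<gamma>_def using that yb a by (intro line) (auto simp: axis_def abs_if split: if_splits)
	have F\<gamma>: "(%t. F (\<gamma> t)) \<in> borelf"
		by (intro borel_measurable_continuous_onI continuous_on_compose2[OF Fc \<gamma>c]) auto
	have FB: "0 <= F (\<gamma> t) \<and> F (\<gamma> t) <= B" if "t \<in> {- 1..1}" for t using F0 B(2)[OF \<gamma>2[OF that]] by auto
	have path: "\<bar>(s * a * v1 (p + t2 *\<^sub>R \<nu> s) + v3 (p + t2 *\<^sub>R \<nu> s)) - (s * a * v1 (p + t1 *\<^sub>R \<nu> s) + v3 (p + t1 *\<^sub>R \<nu> s))\<bar>
			<= (LINT t|J. indicator {t1..t2} t * F (\<gamma> t))"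
		if t: "(s = 1 \<and> t1 = 0 \<and> t2 = 1) \<or> (s = - 1 \<and> t1 = - 1 \<and> t2 = 0)" for s t1 t2 :: real
	proof -
		let ?x = "%t. p + t *\<^sub>R \<nu> s"
		let ?w' = "%t. s * a * (\<Sum>i\<in>UNIV. \<nu> s $ i * partial_deriv i v1 (?x t)) + (\<Sum>i\<in>UNIV. \<nu> s $ i * partial_deriv i v3 (?x t))"
		have sa: "s * a = 1 \<or> s * a = - 1" using t a by auto
		\<comment> \<open>As (s a)^2 = 1, differentiating s a v_1 + v_3 in direction (s a, 0, 1) produces
		  only the strain components e_11, e_13 and e_33.\<close>
		have w'eq: "?w' t = partial_deriv 1 v1 (?x t) + s * a * (partial_deriv 3 v1 (?x t) + partial_deriv 1 v3 (?x t)) + partial_deriv 3 v3 (?x t)" for t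
			using sa by (elim disjE) (simp_all add: sum_3 \<nu>_def algebra_simps)
		have xc: "continuous_on UNIV ?x" by (intro continuous_intros)
		show ?thesis
		proof (rule FTC_bound[where w' = ?w' and B = B])
			show "((%t. s * a * v1 (?x t) + v3 (?x t)) has_real_derivative ?w' t) (at t)" for t
				by (intro DERIV_add DERIV_cmult C1fun_direction v)
			show "continuous_on UNIV ?w'"
				by (intro continuous_intros continuous_on_compose2[OF C1fun_continuous_deriv[OF v(1)] xc] continuous_on_compose2[OF C1fun_continuous_deriv[OF v(2)] xc]) auto
			fix t' assume t': "t' \<in> {t1..t2}"
			have "s * t' = \<bar>t'\<bar>" using t t' by auto
			then have x\<gamma>: "?x t' = \<gamma> t'" by (simp add: pn \<gamma>_def)
			show "\<bar>?w' t'\<bar> <= F (\<gamma> t')"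
			proof -
				have aux: "\<bar>p1 + \<sigma> * q + r\<bar> <= \<bar>p1\<bar> + \<bar>q\<bar> + \<bar>r\<bar>" if "\<sigma> = 1 \<or> \<sigma> = - 1" for p1 q r \<sigma> :: real
					using that by (elim disjE; simp; linarith)
				have "\<bar>?w' t'\<bar> = \<bar>partial_deriv 1 v1 (?x t') + s * a * (partial_deriv 3 v1 (?x t') + partial_deriv 1 v3 (?x t')) + partial_deriv 3 v3 (?x t')\<bar>"
					by (simp only: w'eq)
				also have "... <= F (?x t')" unfolding F by (rule aux[OF sa])
				finally show ?thesis by (simp only: x\<gamma>)
			qed
		qed (use F\<gamma> FB t in auto)
	qed
	let ?P = "LINT t|J. F (\<gamma> t)"
	have iF: "integrable J (%t. k t * F (\<gamma> t))" if "k \<in> borelf" "\<And>t. \<bar>k t\<bar> <= 1" for k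
	proof (rule J.integrable_const_bound[of _ B])
		show "AE t in J. norm (k t * F (\<gamma> t)) <= B"
		proof (rule AE_I2)
			fix t assume "t \<in> space J"
			then have "\<bar>F (\<gamma> t)\<bar> <= B" using FB[of t] by auto
			then show "norm (k t * F (\<gamma> t)) <= B" using mult_mono[OF that(2)[of t], of "\<bar>F (\<gamma> t)\<bar>" B] B(1) by (simp add: abs_mult)
		qed
	qed (use F\<gamma> that in \<open>auto intro!: measurable_restrict_space1\<close>)
	have P: "(LINT t|J. indicator {0..1} t * F (\<gamma> t)) + (LINT t|J. indicator {- 1..0} t * F (\<gamma> t)) = ?P"
	proof -
		have "(LINT t|J. indicator {0..1} t * F (\<gamma> t)) + (LINT t|J. indicator {- 1..0} t * F (\<gamma> t))
				= (LINT t|J. indicator {0..1} t * F (\<gamma> t) + indicator {- 1..0} t * F (\<gamma> t))"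
			by (intro LINT_add[symmetric] iF) auto
		also have "... = ?P"
		proof (rule integral_cong_AE)
			have "AE t in lborel. t \<in> {-1<..<1} \<longrightarrow> t \<noteq> (0 :: real)"
				using AE_lborel_singleton[of "0 :: real"] by eventually_elim simp
			then have "AE t in J. t \<noteq> (0 :: real)" by (subst AE_restrict_space_iff) auto
			then show "AE t in J. indicator {0..1} t * F (\<gamma> t) + indicator {- 1..0} t * F (\<gamma> t) = F (\<gamma> t)"
				using AE_space by eventually_elim (auto simp: indicator_def)
		qed (use F\<gamma> in \<open>auto intro!: measurable_restrict_space1\<close>)
		finally show ?thesis .
	qed
	have p0: "p + 0 *\<^sub>R \<nu> s = ins 3 (y - a *\<^sub>R axis 1 1) 0" "p + 1 *\<^sub>R \<nu> 1 = ins 3 y 1" "p + (- 1) *\<^sub>R \<nu> (- 1) = ins 3 y (- 1)" for s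
		unfolding pn by simp_all
	have est1: "\<bar>(a * v1 (ins 3 y 1) + v3 (ins 3 y 1)) - (a * v1 (ins 3 (y - a *\<^sub>R axis 1 1) 0) + v3 (ins 3 (y - a *\<^sub>R axis 1 1) 0))\<bar>
			<= (LINT t|J. indicator {0..1} t * F (\<gamma> t))"
		using path[of 1 0 1] unfolding p0 by simp
	have est2: "\<bar>(- a * v1 (ins 3 (y - a *\<^sub>R axis 1 1) 0) + v3 (ins 3 (y - a *\<^sub>R axis 1 1) 0)) - (- a * v1 (ins 3 y (- 1)) + v3 (ins 3 y (- 1)))\<bar>
			<= (LINT t|J. indicator {- 1..0} t * F (\<gamma> t))"
		using path[of "- 1" "- 1" 0] unfolding p0 by simp
	\<comment> \<open>\<open>Z\<close> is a probability density on the line, so replacing v_3 at a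
	  single height by its weighted mean costs only the integral of |\<partial>_3 v_3|.\<close>
	have avg: "\<bar>v3 (ins 3 y' \<tau>) - A y'\<bar> <= (LINT t|J. F (ins 3 y' t))" if y': "\<bar>y' $ 1\<bar> <= 2" "\<bar>y' $ 2\<bar> <= 2" and \<tau>: "- 1 <= \<tau>" "\<tau> <= 1" for y' \<tau>
	proof -
		have Fl: "(%t. F (ins 3 y' t)) \<in> borelf" by (rule section_measurable[OF Fm])
		have Fb: "0 <= F (ins 3 y' t) \<and> F (ins 3 y' t) <= B" if "t \<in> {- 1..1}" for t
			using F0 B(2)[OF line[OF y', of t]] that by auto
		have der: "((%t. v3 (ins 3 y' t)) has_real_derivative partial_deriv 3 v3 (ins 3 y' t)) (at t)" for t
			using C1fun_line[OF v(2), of "ins 3 y' 0" 3 t] by simp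
		have cont: "continuous_on UNIV (%t. partial_deriv 3 v3 (ins 3 y' t))" "continuous_on UNIV (%t. v3 (ins 3 y' t))"
			by (intro continuous_on_compose2[OF C1fun_continuous_deriv[OF v(2)]] continuous_on_compose2[OF C1fun_continuous[OF v(2)]] continuous_on_ins continuous_on_const continuous_on_id; auto)+
		let ?R = "LINT t|J. F (ins 3 y' t)"
		have iR: "integrable J (%t. indicator S t * F (ins 3 y' t))" if "S \<in> sets borel" for S
		proof (rule J.integrable_const_bound[of _ B])
			show "AE t in J. norm (indicator S t * F (ins 3 y' t)) <= B" using Fb B(1) by (intro AE_I2) (auto simp: indicator_def)
		qed (use Fl that in \<open>auto intro!: measurable_restrict_space1\<close>)
		have mono: "(LINT t|J. indicator {b..c} t * F (ins 3 y' t)) <= ?R" for b c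
			using iR[of UNIV] by (intro integral_mono iR) (auto simp: indicator_def F0)
		have diff: "\<bar>v3 (ins 3 y' \<tau>) - v3 (ins 3 y' t)\<bar> <= ?R" if t: "- 1 <= t" "t <= 1" for t
		proof (cases "t <= \<tau>")
			case True
			have "\<bar>v3 (ins 3 y' \<tau>) - v3 (ins 3 y' t)\<bar> <= (LINT r|J. indicator {t..\<tau>} r * F (ins 3 y' r))"
				by (rule FTC_bound[OF der cont(1) Fl _ _ _ _ Fb]) (use True t \<tau> in \<open>auto simp: F\<close>)
			then show ?thesis using mono order_trans by blast
		next
			case False
			have "\<bar>v3 (ins 3 y' t) - v3 (ins 3 y' \<tau>)\<bar> <= (LINT r|J. indicator {\<tau>..t} r * F (ins 3 y' r))"
				by (rule FTC_bound[OF der cont(1) Fl _ _ _ _ Fb]) (use False t \<tau> in \<open>auto simp: F\<close>)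
			then show ?thesis using mono order_trans unfolding abs_minus_commute[of "v3 (ins 3 y' \<tau>)"] by blast
		qed
		have iZ: "integrable J Z" using Z(3) not_integrable_integral_eq by fastforce
		have iZv: "integrable J (%t. Z t * v3 (ins 3 y' t))"
			by (intro integrable_J_continuous continuous_on_mult Z(1) cont(2))
		have "v3 (ins 3 y' \<tau>) - A y' = (LINT t|J. v3 (ins 3 y' \<tau>) * Z t - Z t * v3 (ins 3 y' t))"
			using iZ iZv Z(3) by (simp add: A)
		also have "... = (LINT t|J. Z t * (v3 (ins 3 y' \<tau>) - v3 (ins 3 y' t)))" by (simp add: algebra_simps)
		finally have e: "v3 (ins 3 y' \<tau>) - A y' = (LINT t|J. Z t * (v3 (ins 3 y' \<tau>) - v3 (ins 3 y' t)))" .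
		have "norm (LINT t|J. Z t * (v3 (ins 3 y' \<tau>) - v3 (ins 3 y' t))) <= (LINT t|J. Z t * ?R)"
		proof (rule LINT_norm_bound)
			have "(%t. Z t * (v3 (ins 3 y' \<tau>) - v3 (ins 3 y' t))) = (%t. v3 (ins 3 y' \<tau>) * Z t - Z t * v3 (ins 3 y' t))" by (simp add: fun_eq_iff algebra_simps)
			then show "integrable J (%t. Z t * (v3 (ins 3 y' \<tau>) - v3 (ins 3 y' t)))" using iZ iZv by simp
			show "integrable J (%t. Z t * ?R)" using iZ by simp
			show "norm (Z t * (v3 (ins 3 y' \<tau>) - v3 (ins 3 y' t))) <= Z t * ?R" if "t \<in> space J" for t
				using diff[of t] that Z(2)[of t] by (auto simp: abs_mult intro!: mult_left_mono)
		qed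
		then show ?thesis using Z(3) unfolding e by simp
	qed
	have y2: "\<bar>(y - a *\<^sub>R axis 1 1) $ 1\<bar> <= 2" "\<bar>(y - a *\<^sub>R axis 1 1) $ 2\<bar> <= 2" using yb by (simp_all add: axis_def)
	have est3: "\<bar>v3 (ins 3 y 1) - A y\<bar> <= (LINT t|J. F (ins 3 y t))" "\<bar>v3 (ins 3 y (- 1)) - A y\<bar> <= (LINT t|J. F (ins 3 y t))"
		"\<bar>v3 (ins 3 (y - a *\<^sub>R axis 1 1) 0) - A (y - a *\<^sub>R axis 1 1)\<bar> <= (LINT t|J. F (ins 3 (y - a *\<^sub>R axis 1 1) t))"
		using yb y2 by (intro avg; simp)+
	\<comment> \<open>Subtracting the two path estimates cancels \<open>p0\<close>, the uncontrolled
	  value of v_1 at the common point, and doubles the value \<open>q0\<close> of v_3 there.\<close>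
	have aux: "\<bar>(a * p1 + q1) - (a * p0 + q0)\<bar> <= I1 ==> \<bar>(- a * p0 + q0) - (- a * pm + qm)\<bar> <= I2 ==> \<bar>q1 - Ay\<bar> <= Ry ==> \<bar>qm - Ay\<bar> <= Ry ==> \<bar>q0 - A0\<bar> <= R0
		==> \<bar>a * (p1 - pm) - (2 * A0 - 2 * Ay)\<bar> <= (I1 + I2) + 2 * Ry + 2 * R0" for p1 q1 p0 q0 pm qm I1 I2 Ay Ry A0 R0 :: real
		unfolding abs_le_iff by (simp only: right_diff_distrib) argo
	show ?thesis
		using aux[OF est1 est2 est3] unfolding P unfolding \<gamma>_def .
qed

text \<open>Each horizontal slice is translated by its own amount \<open>\<kappa> t\<close>, which
  preserves measure. The condition \<open>near\<close> keeps the translated slice in the face, so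
  the integral over the cube dominates.\<close>

lemma shift_bound:
	assumes F: "F \<in> borelf" "bB F" "\<And>x. 0 <= F x" and \<kappa>: "\<kappa> \<in> borelf"
		and near: "\<And>y t. y + \<kappa> t *\<^sub>R axis 1 1 \<in> half a ==> - 1 < t ==> t < 1 ==> y \<in> face"
	shows "integrable lborel (%y. indicator (half a) y * (LINT t|J. F (ins 3 (y - \<kappa> t *\<^sub>R axis 1 1) t)))"
		and "(LINT y|lborel. indicator (half a) y * (LINT t|J. F (ins 3 (y - \<kappa> t *\<^sub>R axis 1 1) t))) <= (LINT x|Q. F x)"
proof -
	let ?e = "axis 1 1 :: real ^ 2"
	note [measurable] = F(1) \<kappa>
	define G where "G y = (LINT t|J. F (ins 3 (y - \<kappa> t *\<^sub>R ?e) t))" for y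
	define H where "H y t = indicator (half a) y * (indicator {-1<..<1} t * ennreal (F (ins 3 (y - \<kappa> t *\<^sub>R ?e) t)))" for y t
	have Fm: "(%q. F (ins 3 (fst q - \<kappa> (snd q) *\<^sub>R ?e) (snd q))) \<in> borel_measurable (borel \<Otimes>\<^sub>M borel)"
		by measurable
	have "(%q. F (ins 3 (fst q - \<kappa> (snd q) *\<^sub>R ?e) (snd q))) \<in> borel_measurable (borel \<Otimes>\<^sub>M J)"
		using measurable_compose[OF measurable_Pair[OF measurable_fst measurable_snd_J] Fm] by simp
	then have Gm: "G \<in> borelf" unfolding G_def[abs_def]
		by (intro J.borel_measurable_lebesgue_integral) (simp add: split_beta')
	have G0: "0 <= G y" for y unfolding G_def by (intro LINT_nonneg F)
	have Hm: "(%q. H (fst q) (snd q)) \<in> borel_measurable (borel \<Otimes>\<^sub>M borel)"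
		unfolding H_def using Fm by measurable
	have GH: "ennreal (indicator (half a) y * G y) <= (\<integral>\<^sup>+t. H y t \<partial>lborel)" for y
	proof -
		have sm: "(%t. F (ins 3 (y - \<kappa> t *\<^sub>R ?e) t)) \<in> borelf" by measurable
		have "ennreal (G y) <= (\<integral>\<^sup>+t. ennreal (F (ins 3 (y - \<kappa> t *\<^sub>R ?e) t)) \<partial>J)"
			unfolding G_def using sm F(3) by (subst integral_eq_nn_integral) (auto intro!: measurable_restrict_space1 simp: ennreal_enn2real_if)
		also have "... = (\<integral>\<^sup>+t. indicator {-1<..<1} t * ennreal (F (ins 3 (y - \<kappa> t *\<^sub>R ?e) t)) \<partial>lborel)"
			by (subst nn_integral_restrict_space) (auto simp: mult.commute)
		finally show ?thesis
			by (cases "y \<in> half a") (simp_all add: H_def)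
	qed
	have "(\<integral>\<^sup>+y. ennreal (indicator (half a) y * G y) \<partial>lborel) <= (\<integral>\<^sup>+y. \<integral>\<^sup>+t. H y t \<partial>lborel \<partial>lborel)"
		by (intro nn_integral_mono GH)
	also have "... = (\<integral>\<^sup>+t. \<integral>\<^sup>+y. H y t \<partial>lborel \<partial>lborel)"
		using Hm by (intro lborel_pair.Fubini'[symmetric]) (simp add: split_beta')
	also have "... <= (\<integral>\<^sup>+t. \<integral>\<^sup>+y. indicator face y * (indicator {-1<..<1} t * ennreal (F (ins 3 y t))) \<partial>lborel \<partial>lborel)"
	proof (rule nn_integral_mono)
		fix t
		have "(\<integral>\<^sup>+y. H y t \<partial>lborel) = (\<integral>\<^sup>+y. H (y + \<kappa> t *\<^sub>R ?e) t \<partial>lborel)"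
			by (rule nn_integral_translate[symmetric]) (use measurable_compose[OF _ Hm, of "%y. (y, t)" borel] in simp)
		also have "... <= (\<integral>\<^sup>+y. indicator face y * (indicator {-1<..<1} t * ennreal (F (ins 3 y t))) \<partial>lborel)"
			using near[of _ t] by (intro nn_integral_mono) (auto simp: H_def indicator_def)
		finally show "(\<integral>\<^sup>+y. H y t \<partial>lborel) <= (\<integral>\<^sup>+y. indicator face y * (indicator {-1<..<1} t * ennreal (F (ins 3 y t))) \<partial>lborel)" .
	qed
	also have "... = (\<integral>\<^sup>+y. \<integral>\<^sup>+t. indicator face y * (indicator {-1<..<1} t * ennreal (F (ins 3 y t))) \<partial>lborel \<partial>lborel)"
		by (rule lborel_pair.Fubini') measurable
	also have "... = (\<integral>\<^sup>+y. \<integral>\<^sup>+t. ennreal (F (ins 3 y t)) \<partial>J \<partial>Qf)"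
	proof -
		have "(\<integral>\<^sup>+t. indicator face y * (indicator {-1<..<1} t * ennreal (F (ins 3 y t))) \<partial>lborel)
			= (\<integral>\<^sup>+t. ennreal (F (ins 3 y t)) \<partial>J) * indicator face y" for y
			by (subst nn_integral_cmult) (measurable, auto simp: nn_integral_restrict_space mult.commute)
		then show ?thesis by (simp add: nn_integral_restrict_space)
	qed
	also have "... = (\<integral>\<^sup>+x. ennreal (F x) \<partial>Q)" by (rule nn_integral_Q[symmetric]) measurable
	also have "... = ennreal (LINT x|Q. F x)"
		using bB_integrable[OF F(2)] F(3) by (intro nn_integral_eq_integral) auto
	finally have main: "(\<integral>\<^sup>+y. ennreal (indicator (half a) y * G y) \<partial>lborel) <= ennreal (LINT x|Q. F x)" .
	show i: "integrable lborel (%y. indicator (half a) y * (LINT t|J. F (ins 3 (y - \<kappa> t *\<^sub>R ?e) t)))"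
		unfolding G_def[symmetric] using main Gm G0
		by (intro integrableI_nonneg) (auto simp: top.not_eq_extremum ennreal_less_top intro: le_less_trans)
	show "(LINT y|lborel. indicator (half a) y * (LINT t|J. F (ins 3 (y - \<kappa> t *\<^sub>R ?e) t))) <= (LINT x|Q. F x)"
		using main i G0 F(3) unfolding G_def[symmetric]
		by (subst (asm) nn_integral_eq_integral) (auto simp: ennreal_le_iff intro!: LINT_nonneg)
qed

text \<open>The two halves enter with opposite \<open>a\<close>, so the weighted means of v_3 add up
  to 4 (M (-1) - M 1), which is an integral against a sign function of x_1. Each half costs 1 + 2 +
  2 times the norm of \<open>F\<close>, as |x_2| <= 1.\<close>

lemma corner_estimate:
	assumes v: "C1fun v1" "C1fun v3" and Z: "continuous_on UNIV Z" "\<And>t. 0 <= Z t" "(LINT t|J. Z t) = 1"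
		and F: "F = (%x. \<bar>partial_deriv 1 v1 x\<bar> + \<bar>partial_deriv 3 v1 x + partial_deriv 1 v3 x\<bar> + \<bar>partial_deriv 3 v3 x\<bar>)"
	shows "\<bar>(LINT x|Q. x $ 2 * partial_deriv 3 v1 x) - 4 * (LINT x|Q. (if x $ 1 < 0 then 1 else - 1) * (x $ 2 * (Z (x $ 3) * v3 x)))\<bar>
		<= 10 * (LINT x|Q. F x)"
proof -
	let ?e = "axis 1 1 :: real ^ 2"
	define A where "A = (%y. LINT t|J. Z t * v3 (ins 3 y t))"
	define D where "D y = v1 (ins 3 y 1) - v1 (ins 3 y (- 1))" for y
	define sg where "sg t = (if t < 0 then 1 else - 1 :: real)" for t :: real
	have Fc: "continuous_on UNIV F" unfolding F by (intro continuous_intros C1fun_continuous_deriv v)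
	have FB: "F \<in> borelf" "bB F" "\<And>x. 0 <= F x"
		by (rule borel_measurable_continuous_onI[OF Fc], rule bB_cont[OF Fc], simp add: F)
	have Zb: "bB (%x. Z (x $ 3))"
		by (intro bB_cont continuous_on_compose2[OF Z(1)] continuous_intros) auto
	have sgm: "sg \<in> borelf" unfolding sg_def[abs_def] by measurable
	have sgb: "bB (%x. sg (x $ 1))" by (rule bB_coord[of _ 1]) (use sgm in \<open>auto simp: sg_def\<close>)
	have n2: "ins 3 y t $ 2 = y $ 2" "ins 3 y t $ 1 = y $ 1" for y t by (simp_all add: ins_def)
	have b1: "bB (%x. x $ 2 * partial_deriv 3 v1 x)" by (intro bB_mult bB_nth C1fun_bB v)
	have b2: "bB (%x. x $ 2 * (Z (x $ 3) * v3 x))" by (intro bB_mult bB_nth C1fun_bB v Zb)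
	have DJ: "(LINT t|J. partial_deriv 3 v1 (ins 3 y t)) = D y" for y
		unfolding D_def
	proof (rule integral_J_derivative)
		show "((%t. v1 (ins 3 y t)) has_real_derivative partial_deriv 3 v1 (ins 3 y t)) (at t)" for t
			using C1fun_line[OF v(1), of "ins 3 y 0" 3 t] by simp
		show "continuous_on UNIV (%t. partial_deriv 3 v1 (ins 3 y t))"
			by (intro continuous_on_compose2[OF C1fun_continuous_deriv[OF v(1)]] continuous_on_ins continuous_on_const continuous_on_id) auto
	qed
	have eD: "(LINT t|J. ins 3 y t $ 2 * partial_deriv 3 v1 (ins 3 y t)) = y $ 2 * D y" for y by (simp add: n2 DJ)
	have eA: "(LINT t|J. ins 3 y t $ 2 * (Z (ins 3 y t $ 3) * v3 (ins 3 y t))) = y $ 2 * A y" for y by (simp add: n2 A_def)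
	have L: "(LINT x|Q. x $ 2 * partial_deriv 3 v1 x) = (LINT y|Qf. y $ 2 * D y)" and iD: "integrable Qf (%y. y $ 2 * D y)"
		using integral_Q(1,2)[OF bB_integrable[OF b1], of 3] by (simp_all only: eD)
	have iA: "integrable Qf (%y. y $ 2 * A y)"
		using integral_Q(2)[OF bB_integrable[OF b2], of 3] by (simp only: eA)
	have m2: "(%y :: real ^ 2. y $ k) \<in> borelf" for k by (rule borel_measurable_vec_nth') simp
	have Dm: "D \<in> borelf" unfolding D_def[abs_def]
		by (intro borel_measurable_diff borel_measurable_continuous_onI continuous_on_compose2[OF C1fun_continuous[OF v(1)]] continuous_on_ins continuous_on_const continuous_on_id) auto
	have Am: "A \<in> borelf" unfolding A_def
	proof (intro J.borel_measurable_lebesgue_integral)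
		have "(%q. ins 3 (fst q) (snd q)) \<in> borel_measurable (borel \<Otimes>\<^sub>M J)"
			by (intro borel_measurable_ins measurable_fst measurable_snd_J)
		then show "(%(y, t). Z t * v3 (ins 3 y t)) \<in> borel_measurable (borel \<Otimes>\<^sub>M J)"
			unfolding split_beta'
			by (intro borel_measurable_times measurable_compose[OF measurable_snd_J borel_measurable_continuous_onI[OF Z(1)]]
					measurable_compose[OF _ borel_measurable_continuous_onI[OF C1fun_continuous[OF v(2)]]])
	qed
	have hDm: "(%y. y $ 2 * D y) \<in> borelf" by (intro borel_measurable_times m2 Dm)
	have hAm: "(%y. y $ 2 * A y) \<in> borelf" by (intro borel_measurable_times m2 Am)
	note sD = split_half[OF iD hDm] and sA = split_half[OF iA hAm]
	define M where "M a = (LINT y|lborel. indicator (half a) y * (y $ 2 * A y))" for a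
	define LL where "LL a = (LINT y|lborel. indicator (half a) y * (y $ 2 * D y))" for a
	have N0: "0 <= (LINT x|Q. F x)" using FB(3) by (intro LINT_nonneg) auto
	have est: "\<bar>a * LL a - (2 * M (- a) - 2 * M a)\<bar> <= 5 * (LINT x|Q. F x)" if a: "a = 1 \<or> a = - 1" for a
	proof -
		let ?G = "%\<kappa> y. indicator (half a) y * (LINT t|J. F (ins 3 (y - \<kappa> t *\<^sub>R ?e) t))"
		have sh: "(LINT y|lborel. indicator (half a) y * (y $ 2 * A (y - a *\<^sub>R ?e))) = M (- a)"
			"integrable lborel (%y. indicator (half a) y * (y $ 2 * A (y - a *\<^sub>R ?e)))"
		proof -
			let ?h = "%y. indicator (half a) y * (y $ 2 * A (y - a *\<^sub>R ?e)) :: real"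
			have hm: "?h \<in> borelf"
				by (intro borel_measurable_times borel_measurable_indicator sets_half m2 measurable_compose[OF _ Am]) simp
			have e: "(%y. ?h (y + a *\<^sub>R ?e)) = (%y. indicator (half (- a)) y * (y $ 2 * A y))"
			proof
				fix y
				have "(y + a *\<^sub>R ?e) $ 2 = y $ 2" by (simp add: axis_def)
				then show "?h (y + a *\<^sub>R ?e) = indicator (half (- a)) y * (y $ 2 * A y)"
					using half_shift[OF a, of y] by (simp add: indicator_def)
			qed
			show "integrable lborel ?h" using integral_translate(2)[OF hm, of "a *\<^sub>R ?e"] sA(1)[of "- a"] unfolding e by simp
			show "(LINT y|lborel. ?h y) = M (- a)" using integral_translate(1)[OF hm, of "a *\<^sub>R ?e"] unfolding e M_def by simp
		qed
		have k1: "integrable lborel (?G (%t. a * (1 - \<bar>t\<bar>)))" "(LINT y|lborel. ?G (%t. a * (1 - \<bar>t\<bar>)) y) <= (LINT x|Q. F x)"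
			using half_near[OF a] by (intro shift_bound FB; simp)+
		have k2: "integrable lborel (?G (%t. 0))" "(LINT y|lborel. ?G (%t. 0) y) <= (LINT x|Q. F x)"
			by (intro shift_bound FB; simp add: half_def)+
		have k3: "integrable lborel (?G (%t. a))" "(LINT y|lborel. ?G (%t. a) y) <= (LINT x|Q. F x)"
			using half_shift[OF a] by (intro shift_bound FB; simp add: half_def)+
		have e1: "a * LL a - (2 * M (- a) - 2 * M a) = (LINT y|lborel. a * (indicator (half a) y * (y $ 2 * D y))
				- (2 * (indicator (half a) y * (y $ 2 * A (y - a *\<^sub>R ?e))) - 2 * (indicator (half a) y * (y $ 2 * A y))))"
			unfolding sh(1)[symmetric] unfolding LL_def M_def using sD(1)[of a] sA(1)[of a] sh(2) by simp
		have "\<bar>a * LL a - (2 * M (- a) - 2 * M a)\<bar> = norm (LINT y|lborel. a * (indicator (half a) y * (y $ 2 * D y))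
				- (2 * (indicator (half a) y * (y $ 2 * A (y - a *\<^sub>R ?e))) - 2 * (indicator (half a) y * (y $ 2 * A y))))"
			unfolding e1 real_norm_def ..
		also have "... <= (LINT y|lborel. ?G (%t. a * (1 - \<bar>t\<bar>)) y + 2 * ?G (%t. 0) y + 2 * ?G (%t. a) y)"
		proof (rule LINT_norm_bound)
			fix y
			show "norm (a * (indicator (half a) y * (y $ 2 * D y)) - (2 * (indicator (half a) y * (y $ 2 * A (y - a *\<^sub>R ?e))) - 2 * (indicator (half a) y * (y $ 2 * A y))))
				<= ?G (%t. a * (1 - \<bar>t\<bar>)) y + 2 * ?G (%t. 0) y + 2 * ?G (%t. a) y"
			proof (cases "y \<in> half a")
				case True
				have "\<bar>y $ 2\<bar> <= 1" using True by (simp add: half_def face_def forall_2 abs_le_iff)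
				have "norm (a * (y $ 2 * D y) - (2 * (y $ 2 * A (y - a *\<^sub>R ?e)) - 2 * (y $ 2 * A y)))
					= \<bar>y $ 2\<bar> * \<bar>a * D y - (2 * A (y - a *\<^sub>R ?e) - 2 * A y)\<bar>"
					unfolding abs_mult[symmetric] real_norm_def by (simp add: algebra_simps)
				also have "... <= \<bar>a * D y - (2 * A (y - a *\<^sub>R ?e) - 2 * A y)\<bar>"
					using \<open>\<bar>y $ 2\<bar> <= 1\<close> by (intro mult_left_le_one_le) auto
				also have "... <= (LINT t|J. F (ins 3 (y - (a * (1 - \<bar>t\<bar>)) *\<^sub>R ?e) t)) + 2 * (LINT t|J. F (ins 3 y t))
						+ 2 * (LINT t|J. F (ins 3 (y - a *\<^sub>R ?e) t))"
					unfolding D_def by (rule corner_pointwise[OF v Z a True F A_def])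
				finally show ?thesis using True by simp
			qed simp
		qed (rule sD(1) sA(1) sh(2) k1(1) k2(1) k3(1) LI_add LI_diff integrable_mult_right)+
		also have "... = (LINT y|lborel. ?G (%t. a * (1 - \<bar>t\<bar>)) y) + 2 * (LINT y|lborel. ?G (%t. 0) y) + 2 * (LINT y|lborel. ?G (%t. a) y)"
			using k1(1) k2(1) k3(1) by (simp only: LINT_add LI_add integrable_mult_right integral_mult_right_zero)
		also have "... <= 5 * (LINT x|Q. F x)" using k1(2) k2(2) k3(2) by linarith
		finally show ?thesis .
	qed
	have M: "M (- 1) - M 1 = (LINT x|Q. sg (x $ 1) * (x $ 2 * (Z (x $ 3) * v3 x)))"
	proof -
		have b3: "bB (%x. sg (x $ 1) * (x $ 2 * (Z (x $ 3) * v3 x)))" by (intro bB_mult sgb b2)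
		have e: "(LINT t|J. sg (ins 3 y t $ 1) * (ins 3 y t $ 2 * (Z (ins 3 y t $ 3) * v3 (ins 3 y t)))) = sg (y $ 1) * (y $ 2 * A y)" for y
			by (simp add: n2 A_def)
		have 1: "(LINT x|Q. sg (x $ 1) * (x $ 2 * (Z (x $ 3) * v3 x))) = (LINT y|Qf. sg (y $ 1) * (y $ 2 * A y))"
			and 2: "integrable Qf (%y. sg (y $ 1) * (y $ 2 * A y))"
			using integral_Q(1,2)[OF bB_integrable[OF b3], of 3] by (simp_all only: e)
		have m: "(%y. sg (y $ 1) * (y $ 2 * A y)) \<in> borelf"
			by (intro borel_measurable_times measurable_compose[OF m2 sgm] m2 Am)
		have h: "indicator (half 1) y * (sg (y $ 1) * (y $ 2 * A y)) = - (indicator (half 1) y * (y $ 2 * A y))"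
			"indicator (half (- 1)) y * (sg (y $ 1) * (y $ 2 * A y)) = indicator (half (- 1)) y * (y $ 2 * A y)" for y
			by (auto simp: indicator_def half_def sg_def)
		show ?thesis unfolding 1 split_half(2)[OF 2 m] h by (simp add: M_def)
	qed
	have "(LINT x|Q. x $ 2 * partial_deriv 3 v1 x) = LL 1 + LL (- 1)" unfolding L sD(2) LL_def ..
	then show ?thesis
		using est[of 1] est[of "- 1"] M unfolding sg_def by (simp add: abs_le_iff)
qed

section \<open>Piecewise polynomial profiles for the integration kernels\<close>

definition rr :: "real \<Rightarrow> real" where "rr t = max (- 1) (min 1 (4 * t))"
definition dr :: "real \<Rightarrow> real" where "dr t = (if \<bar>t\<bar> < 1 / 4 then 4 else 0)"
text \<open>The factor 15/4 gives mass 1 on [-1/4, 1/4]. \<open>dZ\<close> is its derivative,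
  \<open>BZ\<close> and \<open>BBZ\<close> are its first and second primitives.\<close>

definition ZZ :: "real \<Rightarrow> real" where "ZZ t = 15 / 4 * (1 - (rr t)\<^sup>2)\<^sup>2"
definition dZ :: "real \<Rightarrow> real" where "dZ t = - 15 * (1 - (rr t)\<^sup>2) * rr t * dr t"
definition BZ :: "real \<Rightarrow> real" where "BZ t = 1 / 2 + 15 / 16 * (rr t - 2 / 3 * (rr t) ^ 3 + (rr t) ^ 5 / 5)"
text \<open>The constant 5/128 makes it vanish to the left of -1/4; the \<open>max\<close> term
  makes it equal to t to the right of 1/4, where \<open>BZ\<close> is 1.\<close>

definition BBZ :: "real \<Rightarrow> real" where
	"BBZ t = (rr t / 2 + 15 / 16 * ((rr t)\<^sup>2 / 2 - (rr t) ^ 4 / 6 + (rr t) ^ 6 / 30)) / 4 + 5 / 128 + max 0 (t - 1 / 4)"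

lemma rr_bounds: "\<bar>rr t\<bar> <= 1" by (auto simp: rr_def)

lemma rr_simps: "t <= - (1 / 4) ==> rr t = - 1" "1 / 4 <= t ==> rr t = 1" "\<bar>t\<bar> < 1 / 4 ==> rr t = 4 * t"
	by (auto simp: rr_def)

lemma continuous_on_rr [continuous_intros]: "continuous_on S g ==> continuous_on S (%x. rr (g x))"
	unfolding rr_def by (intro continuous_intros)

lemma rr_deriv:
	assumes "t \<noteq> 1 / 4" "t \<noteq> - (1 / 4)"
	shows "(rr has_real_derivative dr t) (at t)"
proof -
	consider "t < - (1 / 4)" | "\<bar>t\<bar> < 1 / 4" | "1 / 4 < t" using assms by linarith
	then show ?thesis
	proof cases
		case 1
		have "((%_. - 1) has_real_derivative dr t) (at t)" using 1 by (simp add: dr_def)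
		then show ?thesis
			by (rule has_field_derivative_transform_within_open[of _ _ _ "{..< - (1 / 4)}"]) (use 1 in \<open>auto simp: rr_simps\<close>)
	next
		case 2
		have "((%t. 4 * t) has_real_derivative dr t) (at t)" using 2 by (auto intro!: derivative_eq_intros simp: dr_def)
		then show ?thesis
			by (rule has_field_derivative_transform_within_open[of _ _ _ "{- (1 / 4) <..< 1 / 4}"]) (use 2 in \<open>auto simp: rr_simps\<close>)
	next
		case 3
		have "((%_. 1) has_real_derivative dr t) (at t)" using 3 by (simp add: dr_def)
		then show ?thesis
			by (rule has_field_derivative_transform_within_open[of _ _ _ "{1 / 4 <..}"]) (use 3 in \<open>auto simp: rr_simps\<close>)
	qed
qed

lemma ZZ_outside: "1 / 4 <= \<bar>t\<bar> ==> ZZ t = 0"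
	using rr_simps(1,2)[of t] by (auto simp: ZZ_def abs_if split: if_splits)

lemma ZZ_bounds: "0 <= ZZ t" "\<bar>ZZ t\<bar> <= 4"
proof -
	have "(rr t)\<^sup>2 <= 1" using rr_bounds[of t] by (simp add: abs_square_le_1)
	then have "(1 - (rr t)\<^sup>2)\<^sup>2 <= 1" by (intro power_le_one) auto
	then show "0 <= ZZ t" "\<bar>ZZ t\<bar> <= 4" by (auto simp: ZZ_def)
qed

lemma dZ_bound: "\<bar>dZ t\<bar> <= 60"
proof -
	have "(rr t)\<^sup>2 <= 1" using rr_bounds[of t] by (simp add: abs_square_le_1)
	then have "\<bar>1 - (rr t)\<^sup>2\<bar> * \<bar>rr t\<bar> * \<bar>dr t\<bar> <= 1 * 1 * 4"
		using rr_bounds[of t] by (intro mult_mono) (auto simp: dr_def)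
	moreover have "\<bar>dZ t\<bar> = 15 * (\<bar>1 - (rr t)\<^sup>2\<bar> * \<bar>rr t\<bar> * \<bar>dr t\<bar>)"
		by (simp only: dZ_def abs_mult abs_neg_numeral mult.assoc)
	ultimately show ?thesis by linarith
qed

lemma cont_ZZ: "continuous_on S g ==> continuous_on S (%x. ZZ (g x))" "continuous_on S g ==> continuous_on S (%x. BZ (g x))"
	"continuous_on S g ==> continuous_on S (%x. BBZ (g x))"
	unfolding ZZ_def BZ_def BBZ_def by (intro continuous_intros; simp)+

lemma ZZ_deriv:
	assumes "t \<noteq> 1 / 4" "t \<noteq> - (1 / 4)"
	shows "(ZZ has_real_derivative dZ t) (at t)" "(BZ has_real_derivative ZZ t) (at t)" "(BBZ has_real_derivative BZ t) (at t)"
proof -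
	show "(ZZ has_real_derivative dZ t) (at t)"
		unfolding ZZ_def[abs_def] dZ_def by (rule derivative_eq_intros rr_deriv[OF assms] refl | simp add: algebra_simps power2_eq_square)+
	have b: "((%t. 1 / 2 + 15 / 16 * (rr t - 2 / 3 * (rr t) ^ 3 + (rr t) ^ 5 / 5)) has_real_derivative
			15 / 16 * (1 - 2 * (rr t)\<^sup>2 + (rr t) ^ 4) * dr t) (at t)"
		by (rule derivative_eq_intros rr_deriv[OF assms] refl | simp add: field_simps)+
	have "15 / 16 * (1 - 2 * (rr t)\<^sup>2 + (rr t) ^ 4) * dr t = ZZ t"
	proof (cases "\<bar>t\<bar> < 1 / 4")
		case True
		then show ?thesis by (simp add: ZZ_def dr_def power2_eq_square power4_eq_xxxx algebra_simps)
	qed (simp add: ZZ_outside dr_def)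
	with b show "(BZ has_real_derivative ZZ t) (at t)" unfolding BZ_def[abs_def] by simp
	have m: "((%t. max 0 (t - 1 / 4)) has_real_derivative (if t > 1 / 4 then 1 else 0)) (at t)"
	proof (cases "t > 1 / 4")
		case True
		have "((%t. t - 1 / 4) has_real_derivative 1) (at t)" by (auto intro!: derivative_eq_intros)
		then have "((%t. t - 1 / 4) has_real_derivative (if t > 1 / 4 then 1 else 0)) (at t)" using True by simp
		then show ?thesis
			by (rule has_field_derivative_transform_within_open[of _ _ _ "{1 / 4 <..}"]) (use True in auto)
	next
		case False
		then have "t < 1 / 4" using assms by auto
		have "((%t. 0) has_real_derivative (if t > 1 / 4 then 1 else 0)) (at t)" using False by simp
		then show ?thesis
			by (rule has_field_derivative_transform_within_open[of _ _ _ "{..<1 / 4}"]) (use \<open>t < 1 / 4\<close> in auto)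
	qed
	have c: "(BBZ has_real_derivative
			(1 / 2 + 15 / 16 * (rr t - 2 / 3 * (rr t) ^ 3 + (rr t) ^ 5 / 5)) * dr t / 4 + (if t > 1 / 4 then 1 else 0)) (at t)"
		unfolding BBZ_def[abs_def]
		by (rule derivative_eq_intros rr_deriv[OF assms] m refl | simp add: field_simps)+
	have "(1 / 2 + 15 / 16 * (rr t - 2 / 3 * (rr t) ^ 3 + (rr t) ^ 5 / 5)) * dr t / 4 + (if t > 1 / 4 then 1 else 0) = BZ t"
	proof -
		consider "t < - (1 / 4)" | "\<bar>t\<bar> < 1 / 4" | "1 / 4 < t" using assms by linarith
		then show ?thesis
		proof cases
			case 2
			then have "\<not> t > 1 / 4" by auto
			then show ?thesis using 2 by (simp add: BZ_def dr_def)
		qed (simp_all add: BZ_def dr_def rr_simps)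
	qed
	with c show "(BBZ has_real_derivative BZ t) (at t)" by simp
qed

lemma meas_rr: "rr \<in> borelf" "dr \<in> borelf" "dZ \<in> borelf" "ZZ \<in> borelf"
proof -
	show [measurable]: "rr \<in> borelf" unfolding rr_def[abs_def] by measurable
	show [measurable]: "dr \<in> borelf" unfolding dr_def[abs_def] by measurable
	show "dZ \<in> borelf" unfolding dZ_def[abs_def] by measurable
	show "ZZ \<in> borelf" unfolding ZZ_def[abs_def] by measurable
qed

lemma aczI:
	assumes "continuous_on {-1..1} a" "a (- 1) = 0" "a 1 = 0" "b \<in> borelf"
		"\<And>t. - 1 < t ==> t < 1 ==> \<bar>b t\<bar> <= B" "finite S" "\<And>t. - 1 < t ==> t < 1 ==> t \<notin> S ==> (a has_real_derivative b t) (at t)"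
	shows "acz a b"
	using assms unfolding acz_def by blast

definition s0 :: "real \<Rightarrow> real" where "s0 t = (if t < 0 then 1 else - 1)"
text \<open>A primitive of t + 2/3 \<open>dZ\<close>. The factor 2/3 gives it mean zero, so its own
  primitive \<open>om2\<close> vanishes at both ends. In effect the weight x_2 is traded for - 2/3
  \<open>dZ (x $ 2)\<close>.\<close>

definition om1 :: "real \<Rightarrow> real" where "om1 t = (t\<^sup>2 - 1) / 2 + 2 / 3 * ZZ t"
definition om2 :: "real \<Rightarrow> real" where "om2 t = t ^ 3 / 6 - t / 2 + 2 / 3 * (BZ t - 1 / 2)"
text \<open>It has mass 1, like the tent 1 - |t|, so the primitive \<open>Rth\<close> of their
  difference vanishes at both ends. Its derivative is a difference of two translates of
  \<open>ZZ\<close>: this is the origin of the x_1-difference in \<open>kap\<close>.\<close>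

definition th :: "real \<Rightarrow> real" where "th t = 4 * (BZ t - BZ (t - 1 / 4))"
definition dth :: "real \<Rightarrow> real" where "dth t = 4 * (ZZ t - ZZ (t - 1 / 4))"
definition Rth :: "real \<Rightarrow> real" where "Rth t = t - t * \<bar>t\<bar> / 2 + 1 / 2 - 4 * (BBZ t - BBZ (t - 1 / 4))"

lemma abs_deriv: "t \<noteq> 0 ==> (abs has_real_derivative sgn t) (at (t :: real))"
proof (cases "t < 0")
	case True
	have "(uminus has_real_derivative sgn t) (at t)" using True by (auto intro!: derivative_eq_intros)
	then show ?thesis
		by (rule has_field_derivative_transform_within_open[of _ _ _ "{..<0}"]) (use True in auto)
next
	case False
	assume "t \<noteq> 0"
	with False have t: "0 < t" by simp
	have "((%t. t) has_real_derivative sgn t) (at t)" using t by (auto intro!: derivative_eq_intros)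
	then show ?thesis
		by (rule has_field_derivative_transform_within_open[of _ _ _ "{0<..}"]) (use t in auto)
qed

lemma acz_ZZ: "acz ZZ dZ"
	by (rule aczI[of _ _ 60 "{1 / 4, - (1 / 4)}"]) (auto intro!: cont_ZZ continuous_on_id meas_rr dZ_bound ZZ_deriv simp: ZZ_outside)

lemma acz_S: "acz (%t. 1 - \<bar>t\<bar>) s0"
proof (rule aczI[of _ _ 1 "{0}"])
	show "s0 \<in> borelf" unfolding s0_def[abs_def] by measurable
	fix t :: real assume "t \<notin> {0}"
	then show "((%t. 1 - \<bar>t\<bar>) has_real_derivative s0 t) (at t)"
		using DERIV_diff[OF DERIV_const abs_deriv[of t], of 1] by (auto simp: s0_def sgn_if split: if_splits)
qed (auto intro!: continuous_intros simp: s0_def)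

lemma acz_om1: "acz om1 (%t. t + 2 / 3 * dZ t)"
proof (rule aczI[of _ _ 41 "{1 / 4, - (1 / 4)}"])
	show "continuous_on {- 1..1} om1" unfolding om1_def[abs_def] by (intro continuous_intros cont_ZZ; simp)
	show "(%t. t + 2 / 3 * dZ t) \<in> borelf" using meas_rr(3) by measurable
	show "\<bar>t + 2 / 3 * dZ t\<bar> <= 41" if "- 1 < t" "t < 1" for t using that dZ_bound[of t] by auto
	fix t :: real assume "t \<notin> {1 / 4, - (1 / 4)}"
	then show "(om1 has_real_derivative t + 2 / 3 * dZ t) (at t)"
		unfolding om1_def[abs_def] by (auto intro!: derivative_eq_intros ZZ_deriv)
qed (auto simp: om1_def ZZ_outside)

lemma om1_bound: "- 1 < t ==> t < 1 ==> \<bar>om1 t\<bar> <= 4"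
proof -
	assume "- 1 < t" "t < 1"
	then have "t\<^sup>2 <= 1" by (simp add: abs_square_le_1)
	then show ?thesis using ZZ_bounds[of t] zero_le_power2[of t] unfolding om1_def abs_le_iff by argo
qed

lemma acz_om2: "acz om2 om1"
proof (rule aczI[of _ _ 4 "{1 / 4, - (1 / 4)}"])
	show "continuous_on {- 1..1} om2" unfolding om2_def[abs_def] by (intro continuous_intros cont_ZZ; simp)
	show "om1 \<in> borelf" unfolding om1_def[abs_def] using meas_rr(4) by measurable
	show "om2 (- 1) = 0" "om2 1 = 0" by (simp_all add: om2_def BZ_def rr_simps)
	fix t :: real assume "t \<notin> {1 / 4, - (1 / 4)}"
	then show "(om2 has_real_derivative om1 t) (at t)"
		unfolding om2_def[abs_def] om1_def by (auto intro!: derivative_eq_intros ZZ_deriv simp: field_simps)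
qed (auto intro: om1_bound)

lemma ZZ_shift_deriv:
	assumes "t \<noteq> 0" "t \<noteq> 1 / 2"
	shows "((%t. BZ (t - 1 / 4)) has_real_derivative ZZ (t - 1 / 4)) (at t)" "((%t. BBZ (t - 1 / 4)) has_real_derivative BZ (t - 1 / 4)) (at t)"
	using DERIV_shift[of BZ "ZZ (t - 1 / 4)" t "- (1 / 4)"] DERIV_shift[of BBZ "BZ (t - 1 / 4)" t "- (1 / 4)"] ZZ_deriv(2,3)[of "t - 1 / 4"] assms
	by (simp_all add: field_simps)

lemma acz_th: "acz th dth"
proof (rule aczI[of _ _ 32 "{1 / 4, - (1 / 4), 0, 1 / 2}"])
	show "continuous_on {- 1..1} th" unfolding th_def[abs_def] by (intro continuous_intros cont_ZZ)
	show "dth \<in> borelf" unfolding dth_def[abs_def] using meas_rr(4) by measurable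
	show "th (- 1) = 0" "th 1 = 0" by (simp_all add: th_def BZ_def rr_simps)
	show "\<bar>dth t\<bar> <= 32" for t using ZZ_bounds(2)[of t] ZZ_bounds(2)[of "t - 1 / 4"] by (auto simp: dth_def)
	fix t :: real assume "t \<notin> {1 / 4, - (1 / 4), 0, 1 / 2}"
	then show "(th has_real_derivative dth t) (at t)"
		unfolding th_def[abs_def] dth_def by (intro DERIV_cmult DERIV_diff ZZ_deriv ZZ_shift_deriv) auto
qed auto

lemma BZ_bound: "\<bar>BZ t\<bar> <= 3"
proof -
	have "\<bar>(rr t) ^ 3\<bar> <= 1" "\<bar>(rr t) ^ 5\<bar> <= 1" using rr_bounds[of t] by (simp_all add: power_abs power_le_one)
	then show ?thesis using rr_bounds[of t] unfolding BZ_def abs_le_iff by argo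
qed

lemma acz_Rth: "acz Rth (%t. 1 - \<bar>t\<bar> - th t)"
proof (rule aczI[of _ _ 25 "{1 / 4, - (1 / 4), 0, 1 / 2}"])
	show "continuous_on {- 1..1} Rth" unfolding Rth_def[abs_def] by (intro continuous_intros cont_ZZ; simp)
	have "continuous_on UNIV (%t. 1 - \<bar>t\<bar> - th t)" unfolding th_def[abs_def] by (intro continuous_intros cont_ZZ)
	then show "(%t. 1 - \<bar>t\<bar> - th t) \<in> borelf" by (rule borel_measurable_continuous_onI)
	show "Rth (- 1) = 0" "Rth 1 = 0" by (simp_all add: Rth_def BBZ_def rr_simps)
	show "\<bar>1 - \<bar>t\<bar> - th t\<bar> <= 25" if "- 1 < t" "t < 1" for t
		using BZ_bound[of t] BZ_bound[of "t - 1 / 4"] that by (auto simp: th_def)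
	fix t :: real assume t: "t \<notin> {1 / 4, - (1 / 4), 0, 1 / 2}"
	have 1: "((%t. t - t * \<bar>t\<bar> / 2 + 1 / 2) has_real_derivative 1 - \<bar>t\<bar>) (at t)"
	proof -
		have "((%t. t * \<bar>t\<bar>) has_real_derivative 1 * \<bar>t\<bar> + sgn t * t) (at t)"
			using t by (intro DERIV_mult[OF DERIV_ident abs_deriv]) auto
		then have "((%t. t - t * \<bar>t\<bar> / 2 + 1 / 2) has_real_derivative 1 - (1 * \<bar>t\<bar> + sgn t * t) / 2 + 0) (at t)"
			by (intro DERIV_add DERIV_diff DERIV_cdivide DERIV_ident DERIV_const)
		then show ?thesis by (simp add: mult.commute[of "sgn t"] mult_sgn_abs[symmetric] abs_sgn)
	qed
	have "(Rth has_real_derivative (1 - \<bar>t\<bar>) - 4 * (BZ t - BZ (t - 1 / 4))) (at t)"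
		unfolding Rth_def[abs_def] by (intro DERIV_diff[OF 1] DERIV_cmult DERIV_diff ZZ_deriv ZZ_shift_deriv) (use t in auto)
	then show "(Rth has_real_derivative 1 - \<bar>t\<bar> - th t) (at t)" by (simp add: th_def)
qed auto

lemma integral_ZZ: "(LINT t|J. ZZ t) = 1"
proof -
	have "acz (%t. BZ t - (t + 1) / 2) (%t. ZZ t - 1 / 2)"
	proof (rule aczI[of _ _ 5 "{1 / 4, - (1 / 4)}"])
		show "continuous_on {- 1..1} (%t. BZ t - (t + 1) / 2)" by (intro continuous_intros cont_ZZ; simp)
		show "(%t. ZZ t - 1 / 2) \<in> borelf" using meas_rr(4) by measurable
		show "\<bar>ZZ t - 1 / 2\<bar> <= 5" for t using ZZ_bounds(2)[of t] by auto
		fix t :: real assume "t \<notin> {1 / 4, - (1 / 4)}"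
		then show "((%t. BZ t - (t + 1) / 2) has_real_derivative ZZ t - 1 / 2) (at t)"
			by (auto intro!: derivative_eq_intros ZZ_deriv)
	qed (simp_all add: BZ_def rr_simps)
	from acz_integral[OF this, of 1] have "(LINT r|J. indicator {..1} r * (ZZ r - 1 / 2)) = 0" by (simp add: BZ_def rr_simps)
	moreover have "(LINT r|J. indicator {..1} r * (ZZ r - 1 / 2)) = (LINT r|J. ZZ r - 1 / 2)"
		by (intro LINT_cong) auto
	moreover have "integrable J ZZ" by (intro integrable_J_continuous cont_ZZ continuous_on_id)
	ultimately show ?thesis by simp
qed

text \<open>This is 4/3 times \<open>ZZ (x $ 2) * ZZ (x $ 3) * dth (x $ 1)\<close>. The 4/3 is half
  of 4 * 2/3: 4 comes from the corner estimate, 2/3 from \<open>om1\<close>, and the result is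
  shared equally between v_2 and v_3.\<close>

definition kap :: "real ^ 3 \<Rightarrow> real" where
	"kap x = 16 / 3 * (ZZ (x $ 2) * (ZZ (x $ 3) * (ZZ (x $ 1) - ZZ (x $ 1 - 1 / 4))))"

lemma kernel_bound:
	assumes "bB k"
	shows "\<exists>C\<ge>0. \<forall>e. bB e \<longrightarrow> \<bar>LINT x|Q. e x * k x\<bar> <= C * (LINT x|Q. \<bar>e x\<bar>)"
proof -
	obtain B where B: "0 < B" "\<forall>x\<in>Omega. \<bar>k x\<bar> <= B" using bB_bound[OF assms] by blast
	have "\<bar>LINT x|Q. e x * k x\<bar> <= B * (LINT x|Q. \<bar>e x\<bar>)" if e: "bB e" for e
	proof -
		have "norm (LINT x|Q. e x * k x) <= (LINT x|Q. B * \<bar>e x\<bar>)"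
			by (intro LINT_norm_bound bB_integrable bB_mult bB_const bB_abs e assms)
				(use B in \<open>auto simp: abs_mult mult.commute[of B] intro!: mult_left_mono\<close>)
		then show ?thesis by simp
	qed
	then show ?thesis using B(1) by (intro exI[of _ B]) auto
qed

text \<open>Each exchange of \<partial>_j v_1 for - \<partial>_1 v_j costs one controlled strain.
  The v_3 integral left by the corner estimate is turned into an integral of v_1 against
  \<open>dZ (x $ 2) * dZ (x $ 3)\<close>, that is, a test of \<partial>_2 \<partial>_3 v_1, and from
  there into \<partial>_3 v_2 + \<partial>_2 v_3.\<close>

lemma M'_estimate_C1:
	"\<exists>C\<ge>0. \<forall>v1 v2 v3. C1fun v1 \<and> C1fun v2 \<and> C1fun v3 \<longrightarrow>
		\<bar>(LINT x|Q. x $ 2 * partial_deriv 3 v1 x) - (LINT x|Q. (partial_deriv 3 v2 x + partial_deriv 2 v3 x) * kap x)\<bar>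
		<= C * ((LINT x|Q. \<bar>partial_deriv 1 v1 x\<bar>) + (LINT x|Q. \<bar>partial_deriv 2 v2 x\<bar>) + (LINT x|Q. \<bar>partial_deriv 3 v3 x\<bar>)
			+ (LINT x|Q. \<bar>partial_deriv 2 v1 x + partial_deriv 1 v2 x\<bar>) + (LINT x|Q. \<bar>partial_deriv 3 v1 x + partial_deriv 1 v3 x\<bar>))"
proof -
	let ?S = "%t :: real. 1 - \<bar>t\<bar>"
	have bS: "bB (%x. ?S (x $ i))" for i by (intro bB_cont continuous_intros)
	have bs: "bB (%x. s0 (x $ i))" "bB (%x. dZ (x $ i))" "bB (%x. om1 (x $ i))" "bB (%x. dth (x $ i))" for i
		by (intro acz_bB[OF acz_S] acz_bB[OF acz_ZZ] acz_bB[OF acz_om2] acz_bB[OF acz_th])+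
	have bc: "bB (%x. ZZ (x $ i))" "bB (%x. om2 (x $ i))" "bB (%x. th (x $ i))" "bB (%x. Rth (x $ i))" for i
		unfolding om2_def th_def Rth_def by (intro bB_cont continuous_intros cont_ZZ; simp)+
	note b = bS bs bc bB_nth bB_mult bB_const
	define k13 where "k13 x = ?S (x $ 1) * (x $ 2 * ZZ (x $ 3))" for x :: "real ^ 3"
	define k12 where "k12 x = om1 (x $ 2) * (dZ (x $ 3) * ?S (x $ 1))" for x :: "real ^ 3"
	define k22 where "k22 x = om2 (x $ 2) * (dZ (x $ 3) * s0 (x $ 1))" for x :: "real ^ 3"
	define k11 where "k11 x = Rth (x $ 1) * (dZ (x $ 2) * dZ (x $ 3))" for x :: "real ^ 3"
	define j12 where "j12 x = ZZ (x $ 2) * (dZ (x $ 3) * th (x $ 1))" for x :: "real ^ 3"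
	define j13 where "j13 x = ZZ (x $ 3) * (dZ (x $ 2) * th (x $ 1))" for x :: "real ^ 3"
	have bk: "bB k13" "bB k12" "bB k22" "bB k11" "bB j12" "bB j13"
		unfolding k13_def[abs_def] k12_def[abs_def] k22_def[abs_def] k11_def[abs_def] j12_def[abs_def] j13_def[abs_def]
		by (intro b)+
	obtain C1 where C1: "C1 \<ge> 0" "\<And>e. bB e ==> \<bar>LINT x|Q. e x * k13 x\<bar> <= C1 * (LINT x|Q. \<bar>e x\<bar>)" using kernel_bound[OF bk(1)] by blast
	obtain C2 where C2: "C2 \<ge> 0" "\<And>e. bB e ==> \<bar>LINT x|Q. e x * k12 x\<bar> <= C2 * (LINT x|Q. \<bar>e x\<bar>)" using kernel_bound[OF bk(2)] by blast
	obtain C3 where C3: "C3 \<ge> 0" "\<And>e. bB e ==> \<bar>LINT x|Q. e x * k22 x\<bar> <= C3 * (LINT x|Q. \<bar>e x\<bar>)" using kernel_bound[OF bk(3)] by blast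
	obtain C4 where C4: "C4 \<ge> 0" "\<And>e. bB e ==> \<bar>LINT x|Q. e x * k11 x\<bar> <= C4 * (LINT x|Q. \<bar>e x\<bar>)" using kernel_bound[OF bk(4)] by blast
	obtain C5 where C5: "C5 \<ge> 0" "\<And>e. bB e ==> \<bar>LINT x|Q. e x * j12 x\<bar> <= C5 * (LINT x|Q. \<bar>e x\<bar>)" using kernel_bound[OF bk(5)] by blast
	obtain C6 where C6: "C6 \<ge> 0" "\<And>e. bB e ==> \<bar>LINT x|Q. e x * j13 x\<bar> <= C6 * (LINT x|Q. \<bar>e x\<bar>)" using kernel_bound[OF bk(6)] by blast
	show ?thesis
	proof (intro exI conjI allI impI)
		show "0 <= 10 + 4 * C1 + 4 * C2 + 4 * C3 + 3 * C4 + 2 * C5 + 2 * C6" using C1 C2 C3 C4 C5 C6 by simp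
		fix v1 v2 v3 assume "C1fun v1 \<and> C1fun v2 \<and> C1fun v3"
		then have v: "C1fun v1" "C1fun v2" "C1fun v3" by auto
		note vb = C1fun_bB[OF v(1)] C1fun_bB[OF v(2)] C1fun_bB[OF v(3)]
		let ?e11 = "%x. partial_deriv 1 v1 x" and ?e22 = "%x. partial_deriv 2 v2 x" and ?e33 = "%x. partial_deriv 3 v3 x"
		let ?E12 = "%x. partial_deriv 2 v1 x + partial_deriv 1 v2 x" and ?E13 = "%x. partial_deriv 3 v1 x + partial_deriv 1 v3 x"
		let ?N = "%e :: real ^ 3 \<Rightarrow> real. LINT x|Q. \<bar>e x\<bar>"
		note iQ = bB_integrable[OF bB_mult]
		have corner: "\<bar>(LINT x|Q. x $ 2 * partial_deriv 3 v1 x) - 4 * (LINT x|Q. v3 x * (s0 (x $ 1) * (x $ 2 * ZZ (x $ 3))))\<bar>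
			<= 10 * (?N ?e11 + ?N ?E13 + ?N ?e33)"
		proof -
			have e: "s0 (x $ 1) * (x $ 2 * (ZZ (x $ 3) * v3 x)) = v3 x * (s0 (x $ 1) * (x $ 2 * ZZ (x $ 3)))" for x by simp
			have "(LINT x|Q. \<bar>?e11 x\<bar> + \<bar>?E13 x\<bar> + \<bar>?e33 x\<bar>) = ?N ?e11 + ?N ?E13 + ?N ?e33"
				by (subst LINT_add, (intro bB_integrable bB_add bB_abs vb)+)+ simp
			then show ?thesis
				using corner_estimate[OF v(1,3) cont_ZZ(1)[OF continuous_on_id] ZZ_bounds(1) integral_ZZ refl]
				unfolding s0_def[symmetric] e by simp
		qed
		have p1: "(LINT x|Q. v3 x * (s0 (x $ 1) * (x $ 2 * ZZ (x $ 3)))) = - (LINT x|Q. partial_deriv 1 v3 x * k13 x)"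
			unfolding k13_def by (rule integral_Q_by_parts_product[OF v(3) _ acz_S]) (intro b, simp)
		have p2: "(LINT x|Q. v1 x * (dZ (x $ 3) * (x $ 2 * ?S (x $ 1)))) = - (LINT x|Q. partial_deriv 3 v1 x * (ZZ (x $ 3) * (x $ 2 * ?S (x $ 1))))"
			by (rule integral_Q_by_parts_product[OF v(1) _ acz_ZZ]) (intro b, simp)
		\<comment> \<open>Trades the weight x_2 for - 2/3 \<open>dZ (x $ 2)\<close>. The resulting
		  \<partial>_2 v_1 is exchanged for - \<partial>_1 v_2, which \<open>p4\<close> and
		  \<open>p5\<close> turn into \<partial>_2 v_2 against \<open>k22\<close>.\<close>
		have p3: "(LINT x|Q. v1 x * ((x $ 2 + 2 / 3 * dZ (x $ 2)) * (dZ (x $ 3) * ?S (x $ 1)))) = - (LINT x|Q. partial_deriv 2 v1 x * k12 x)"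
			unfolding k12_def by (rule integral_Q_by_parts_product[OF v(1) _ acz_om1]) (intro b, simp)
		have p4: "(LINT x|Q. v2 x * (s0 (x $ 1) * (om1 (x $ 2) * dZ (x $ 3)))) = - (LINT x|Q. partial_deriv 1 v2 x * (?S (x $ 1) * (om1 (x $ 2) * dZ (x $ 3))))"
			by (rule integral_Q_by_parts_product[OF v(2) _ acz_S]) (intro b, simp)
		have p5: "(LINT x|Q. v2 x * (om1 (x $ 2) * (dZ (x $ 3) * s0 (x $ 1)))) = - (LINT x|Q. partial_deriv 2 v2 x * k22 x)"
			unfolding k22_def by (rule integral_Q_by_parts_product[OF v(2) _ acz_om2]) (intro b, simp)
		\<comment> \<open>Replaces the tent in x_1 by \<open>th\<close>, at the cost of e_11 only.\<close>
		have p6: "(LINT x|Q. v1 x * ((1 - \<bar>x $ 1\<bar> - th (x $ 1)) * (dZ (x $ 2) * dZ (x $ 3)))) = - (LINT x|Q. partial_deriv 1 v1 x * k11 x)"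
			unfolding k11_def by (rule integral_Q_by_parts_product[OF v(1) _ acz_Rth]) (intro b, simp)
		\<comment> \<open>The same integral of v_1 is now expressed twice, through v_2 (\<open>p7\<close>
		  to \<open>p9\<close>) and through v_3 (\<open>p10\<close> to \<open>p12\<close>); averaging
		  makes the symmetric sum \<partial>_3 v_2 + \<partial>_2 v_3 appear.\<close>
		have p7: "(LINT x|Q. v1 x * (dZ (x $ 2) * (dZ (x $ 3) * th (x $ 1)))) = - (LINT x|Q. partial_deriv 2 v1 x * j12 x)"
			unfolding j12_def by (rule integral_Q_by_parts_product[OF v(1) _ acz_ZZ]) (intro b, simp)
		have p8: "(LINT x|Q. v2 x * (dth (x $ 1) * (ZZ (x $ 2) * dZ (x $ 3)))) = - (LINT x|Q. partial_deriv 1 v2 x * (th (x $ 1) * (ZZ (x $ 2) * dZ (x $ 3))))"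
			by (rule integral_Q_by_parts_product[OF v(2) _ acz_th]) (intro b, simp)
		have p9: "(LINT x|Q. v2 x * (dZ (x $ 3) * (ZZ (x $ 2) * dth (x $ 1)))) = - (LINT x|Q. partial_deriv 3 v2 x * (ZZ (x $ 3) * (ZZ (x $ 2) * dth (x $ 1))))"
			by (rule integral_Q_by_parts_product[OF v(2) _ acz_ZZ]) (intro b, simp)
		have p10: "(LINT x|Q. v1 x * (dZ (x $ 3) * (dZ (x $ 2) * th (x $ 1)))) = - (LINT x|Q. partial_deriv 3 v1 x * j13 x)"
			unfolding j13_def by (rule integral_Q_by_parts_product[OF v(1) _ acz_ZZ]) (intro b, simp)
		have p11: "(LINT x|Q. v3 x * (dth (x $ 1) * (ZZ (x $ 3) * dZ (x $ 2)))) = - (LINT x|Q. partial_deriv 1 v3 x * (th (x $ 1) * (ZZ (x $ 3) * dZ (x $ 2))))"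
			by (rule integral_Q_by_parts_product[OF v(3) _ acz_th]) (intro b, simp)
		have p12: "(LINT x|Q. v3 x * (dZ (x $ 2) * (ZZ (x $ 3) * dth (x $ 1)))) = - (LINT x|Q. partial_deriv 2 v3 x * (ZZ (x $ 2) * (ZZ (x $ 3) * dth (x $ 1))))"
			by (rule integral_Q_by_parts_product[OF v(3) _ acz_ZZ]) (intro b, simp)
		have E13k: "(LINT x|Q. ?E13 x * k13 x) = (LINT x|Q. partial_deriv 3 v1 x * k13 x) + (LINT x|Q. partial_deriv 1 v3 x * k13 x)"
			unfolding distrib_right by (rule LINT_add) (rule iQ vb bk)+
		have E12k: "(LINT x|Q. ?E12 x * k12 x) = (LINT x|Q. partial_deriv 2 v1 x * k12 x) + (LINT x|Q. partial_deriv 1 v2 x * k12 x)"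
			unfolding distrib_right by (rule LINT_add) (rule iQ vb bk)+
		have E12j: "(LINT x|Q. ?E12 x * j12 x) = (LINT x|Q. partial_deriv 2 v1 x * j12 x) + (LINT x|Q. partial_deriv 1 v2 x * j12 x)"
			unfolding distrib_right by (rule LINT_add) (rule iQ vb bk)+
		have E13j: "(LINT x|Q. ?E13 x * j13 x) = (LINT x|Q. partial_deriv 3 v1 x * j13 x) + (LINT x|Q. partial_deriv 1 v3 x * j13 x)"
			unfolding distrib_right by (rule LINT_add) (rule iQ vb bk)+
		have om: "(LINT x|Q. v1 x * ((x $ 2 + 2 / 3 * dZ (x $ 2)) * (dZ (x $ 3) * ?S (x $ 1))))
			= (LINT x|Q. v1 x * (dZ (x $ 3) * (x $ 2 * ?S (x $ 1)))) + 2 / 3 * (LINT x|Q. v1 x * (dZ (x $ 2) * (dZ (x $ 3) * ?S (x $ 1))))"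
		proof -
			have e: "v1 x * ((x $ 2 + 2 / 3 * dZ (x $ 2)) * (dZ (x $ 3) * ?S (x $ 1)))
				= v1 x * (dZ (x $ 3) * (x $ 2 * ?S (x $ 1))) + 2 / 3 * (v1 x * (dZ (x $ 2) * (dZ (x $ 3) * ?S (x $ 1))))" for x
				by (simp add: algebra_simps)
			show ?thesis unfolding e integral_mult_right_zero[symmetric]
				by (rule LINT_add) (intro bB_integrable b vb)+
		qed
		have Sth: "(LINT x|Q. v1 x * ((1 - \<bar>x $ 1\<bar> - th (x $ 1)) * (dZ (x $ 2) * dZ (x $ 3))))
			= (LINT x|Q. v1 x * (dZ (x $ 2) * (dZ (x $ 3) * ?S (x $ 1)))) - (LINT x|Q. v1 x * (dZ (x $ 2) * (dZ (x $ 3) * th (x $ 1))))"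
		proof -
			have e: "v1 x * ((1 - \<bar>x $ 1\<bar> - th (x $ 1)) * (dZ (x $ 2) * dZ (x $ 3)))
				= v1 x * (dZ (x $ 2) * (dZ (x $ 3) * ?S (x $ 1))) - v1 x * (dZ (x $ 2) * (dZ (x $ 3) * th (x $ 1)))" for x
				by (simp add: algebra_simps)
			show ?thesis unfolding e by (rule LINT_diff) (intro bB_integrable b vb)+
		qed
		have X: "(LINT x|Q. (partial_deriv 3 v2 x + partial_deriv 2 v3 x) * kap x)
			= 4 / 3 * ((LINT x|Q. partial_deriv 3 v2 x * (ZZ (x $ 3) * (ZZ (x $ 2) * dth (x $ 1))))
				+ (LINT x|Q. partial_deriv 2 v3 x * (ZZ (x $ 2) * (ZZ (x $ 3) * dth (x $ 1)))))"
		proof -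
			have e: "(partial_deriv 3 v2 x + partial_deriv 2 v3 x) * kap x = 4 / 3 * (partial_deriv 3 v2 x * (ZZ (x $ 3) * (ZZ (x $ 2) * dth (x $ 1)))
				+ partial_deriv 2 v3 x * (ZZ (x $ 2) * (ZZ (x $ 3) * dth (x $ 1))))" for x
				by (simp add: kap_def dth_def field_simps)
			show ?thesis unfolding e integral_mult_right_zero
				by (subst LINT_add) (intro bB_integrable b vb refl)+
		qed
		have r1: "(LINT x|Q. partial_deriv 3 v1 x * (ZZ (x $ 3) * (x $ 2 * ?S (x $ 1)))) = (LINT x|Q. partial_deriv 3 v1 x * k13 x)"
			by (simp add: k13_def mult_ac)
		have r2: "(LINT x|Q. partial_deriv 1 v2 x * (?S (x $ 1) * (om1 (x $ 2) * dZ (x $ 3)))) = (LINT x|Q. partial_deriv 1 v2 x * k12 x)"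
			by (simp add: k12_def mult_ac)
		have r3: "(LINT x|Q. v2 x * (om1 (x $ 2) * (dZ (x $ 3) * s0 (x $ 1)))) = (LINT x|Q. v2 x * (s0 (x $ 1) * (om1 (x $ 2) * dZ (x $ 3))))"
			by (simp add: mult_ac)
		have r4: "(LINT x|Q. partial_deriv 1 v2 x * (th (x $ 1) * (ZZ (x $ 2) * dZ (x $ 3)))) = (LINT x|Q. partial_deriv 1 v2 x * j12 x)"
			by (simp add: j12_def mult_ac)
		have r5: "(LINT x|Q. v2 x * (dZ (x $ 3) * (ZZ (x $ 2) * dth (x $ 1)))) = (LINT x|Q. v2 x * (dth (x $ 1) * (ZZ (x $ 2) * dZ (x $ 3))))"
			by (simp add: mult_ac)
		have r6: "(LINT x|Q. partial_deriv 1 v3 x * (th (x $ 1) * (ZZ (x $ 3) * dZ (x $ 2)))) = (LINT x|Q. partial_deriv 1 v3 x * j13 x)"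
			by (simp add: j13_def mult_ac)
		have r7: "(LINT x|Q. v3 x * (dZ (x $ 2) * (ZZ (x $ 3) * dth (x $ 1)))) = (LINT x|Q. v3 x * (dth (x $ 1) * (ZZ (x $ 3) * dZ (x $ 2))))"
			by (simp add: mult_ac)
		have r8: "(LINT x|Q. v1 x * (dZ (x $ 3) * (dZ (x $ 2) * th (x $ 1)))) = (LINT x|Q. v1 x * (dZ (x $ 2) * (dZ (x $ 3) * th (x $ 1))))"
			by (simp add: mult_ac)
		have main: "4 * (LINT x|Q. v3 x * (s0 (x $ 1) * (x $ 2 * ZZ (x $ 3)))) - (LINT x|Q. (partial_deriv 3 v2 x + partial_deriv 2 v3 x) * kap x)
			= - 4 * (LINT x|Q. ?E13 x * k13 x) + 4 * (LINT x|Q. ?E12 x * k12 x) - 4 * (LINT x|Q. ?e22 x * k22 x)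
				- 8 / 3 * (LINT x|Q. ?e11 x * k11 x) - 4 / 3 * (LINT x|Q. ?E12 x * j12 x) - 4 / 3 * (LINT x|Q. ?E13 x * j13 x)"
			using p1 p2 p3 p4 p5 p6 p7 p8 p9 p10 p11 p12 unfolding E13k E12k E12j E13j om Sth X r1 r2 r3 r4 r5 r6 r7 r8 by argo
		have n: "0 <= ?N e" for e by simp
		have f1: "\<bar>LINT x|Q. ?E13 x * k13 x\<bar> <= C1 * ?N ?E13" by (intro C1(2) bB_add vb)
		have f2: "\<bar>LINT x|Q. ?E12 x * k12 x\<bar> <= C2 * ?N ?E12" by (intro C2(2) bB_add vb)
		have f3: "\<bar>LINT x|Q. ?e22 x * k22 x\<bar> <= C3 * ?N ?e22" by (intro C3(2) vb)
		have f4: "\<bar>LINT x|Q. ?e11 x * k11 x\<bar> <= C4 * ?N ?e11" by (intro C4(2) vb)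
		have f5: "\<bar>LINT x|Q. ?E12 x * j12 x\<bar> <= C5 * ?N ?E12" by (intro C5(2) bB_add vb)
		have f6: "\<bar>LINT x|Q. ?E13 x * j13 x\<bar> <= C6 * ?N ?E13" by (intro C6(2) bB_add vb)
		let ?T = "?N ?e11 + ?N ?e22 + ?N ?e33 + ?N ?E12 + ?N ?E13"
		have g: "C * ?N e <= C * ?T" if "0 <= C" "?N e <= ?T" for C e using that by (intro mult_left_mono)
		have t: "?N ?e11 <= ?T" "?N ?e22 <= ?T" "?N ?E12 <= ?T" "?N ?E13 <= ?T" "?N ?e11 + ?N ?E13 + ?N ?e33 <= ?T"
			using n[of ?e11] n[of ?e22] n[of ?e33] n[of ?E12] n[of ?E13] by linarith+
		have aux: "\<bar>L - 4 * V\<bar> <= 10 * P ==> 4 * V - X = - 4 * a1 + 4 * a2 - 4 * a3 - 8 / 3 * a4 - 4 / 3 * a5 - 4 / 3 * a6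
			==> \<bar>a1\<bar> <= b1 ==> \<bar>a2\<bar> <= b2 ==> \<bar>a3\<bar> <= b3 ==> \<bar>a4\<bar> <= b4 ==> \<bar>a5\<bar> <= b5 ==> \<bar>a6\<bar> <= b6
			==> b1 <= c1 ==> b2 <= c2 ==> b3 <= c3 ==> b4 <= c4 ==> b5 <= c5 ==> b6 <= c6 ==> P <= T ==> 0 <= c4 ==> 0 <= c5 ==> 0 <= c6
			==> \<bar>L - X\<bar> <= 10 * T + 4 * c1 + 4 * c2 + 4 * c3 + 3 * c4 + 2 * c5 + 2 * c6"
			for L V P X a1 a2 a3 a4 a5 a6 b1 b2 b3 b4 b5 b6 c1 c2 c3 c4 c5 c6 T :: real
			unfolding abs_le_iff by argo
		have T0: "0 <= C4 * ?T" "0 <= C5 * ?T" "0 <= C6 * ?T"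
			using C4(1) C5(1) C6(1) by (intro mult_nonneg_nonneg add_nonneg_nonneg n; simp)+
		have "\<bar>(LINT x|Q. x $ 2 * partial_deriv 3 v1 x) - (LINT x|Q. (partial_deriv 3 v2 x + partial_deriv 2 v3 x) * kap x)\<bar>
			<= 10 * ?T + 4 * (C1 * ?T) + 4 * (C2 * ?T) + 4 * (C3 * ?T) + 3 * (C4 * ?T) + 2 * (C5 * ?T) + 2 * (C6 * ?T)"
			by (rule aux[OF corner main f1 f2 f3 f4 f5 f6 g[OF C1(1) t(4)] g[OF C2(1) t(3)] g[OF C3(1) t(2)] g[OF C4(1) t(1)] g[OF C5(1) t(3)] g[OF C6(1) t(4)] t(5) T0])
		then show "\<bar>(LINT x|Q. x $ 2 * partial_deriv 3 v1 x) - (LINT x|Q. (partial_deriv 3 v2 x + partial_deriv 2 v3 x) * kap x)\<bar>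
			<= (10 + 4 * C1 + 4 * C2 + 4 * C3 + 3 * C4 + 2 * C5 + 2 * C6) * ?T"
			by (simp only: distrib_right mult.assoc)
	qed
qed

section \<open>Second differences\<close>

abbreviation e4 :: "real ^ 3" where "e4 \<equiv> (1 / 4) *\<^sub>R axis 1 1"

definition D2 :: "(real ^ 3 \<Rightarrow> real) \<Rightarrow> real ^ 3 \<Rightarrow> real" where
	"D2 f x = f (x + e4) - 2 * f x + f (x - e4)"

text \<open>Second differences annihilate affine functions, so \<open>h\<close> has zero mass and
  zero first moment and can be integrated twice with zero boundary values. The support condition
  keeps the translates inside (-1,1).\<close>

lemma second_difference_moments:
	fixes g :: "real \<Rightarrow> real"
	assumes g: "g \<in> borelf" "\<And>t. \<bar>g t\<bar> <= B" "\<And>t. 1 / 2 < \<bar>t\<bar> ==> g t = 0"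
	defines "h \<equiv> %t. g (t + 1 / 4) - 2 * g t + g (t - 1 / 4)"
	shows "(LINT t|J. h t) = 0" "(LINT t|J. LINT r|J. indicator {..t} r * h r) = 0"
proof -
	note g(1)[measurable]
	have B0: "0 <= B" using g(2)[of 0] by linarith
	have ig: "integrable lborel (%t. p t * g t)" if p: "continuous_on UNIV p" for p :: "real \<Rightarrow> real"
	proof -
		have "compact (p ` {- 1..1})" by (intro compact_continuous_image continuous_on_subset[OF p]) auto
		then obtain C where C: "\<And>t. t \<in> {- 1..1} ==> \<bar>p t\<bar> <= C"
			by (metis bounded_iff compact_imp_bounded image_eqI real_norm_def)
		note [measurable] = borel_measurable_continuous_onI[OF p]
		have C0: "0 <= C" using C[of 0] by auto
		show ?thesis
		proof (rule integrableI_bounded_set[of "{- 1..1}" _ _ "C * B"])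
			show "AE t in lborel. t \<in> {- 1..1} \<longrightarrow> norm (p t * g t) <= C * B"
				using C g(2) C0 by (intro AE_I2) (auto simp: abs_mult intro!: mult_mono)
			have "g t = 0" if "t \<notin> {- 1..1}" for t using that by (intro g(3)) auto
			then show "AE t in lborel. t \<notin> {- 1..1} \<longrightarrow> p t * g t = 0" by (intro AE_I2) simp
		qed auto
	qed
	have sh: "(LINT t|lborel. p t * g (t + c)) = (LINT t|lborel. p (t - c) * g t)" "integrable lborel (%t. p t * g (t + c))"
		if p: "continuous_on UNIV p" for p c
	proof -
		have cp: "continuous_on UNIV (%t. p (t - c))" by (intro continuous_on_compose2[OF p] continuous_intros) auto
		have m: "(%t. p (t - c) * g t) \<in> borelf"
			using borel_measurable_integrable[OF ig[OF cp]] by simp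
		show "(LINT t|lborel. p t * g (t + c)) = (LINT t|lborel. p (t - c) * g t)" "integrable lborel (%t. p t * g (t + c))"
			using integral_translate[OF m, of c] ig[OF cp] by simp_all
	qed
	have hJ: "(LINT t|J. p t * h t) = (LINT t|lborel. p t * h t)" for p :: "real \<Rightarrow> real"
	proof -
		have "h t = 0" if "t \<notin> {-1<..<1}" for t
		proof -
			have "1 <= \<bar>t\<bar>" using that by auto
			then have "1 / 2 < \<bar>t\<bar>" "1 / 2 < \<bar>t + 1 / 4\<bar>" "1 / 2 < \<bar>t - 1 / 4\<bar>" by linarith+
			then show ?thesis by (simp add: h_def g(3))
		qed
		then have e: "indicator {-1<..<1} t *\<^sub>R (p t * h t) = p t * h t" for t by (cases "t \<in> {-1<..<1}") auto
		have "(LINT t|J. p t * h t) = (LINT t|lborel. indicator {-1<..<1} t *\<^sub>R (p t * h t))"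
			by (subst integral_restrict_space) auto
		then show ?thesis unfolding e .
	qed
	have int: "(LINT t|lborel. p t * h t) = (LINT t|lborel. p (t - 1 / 4) * g t) - 2 * (LINT t|lborel. p t * g t) + (LINT t|lborel. p (t + 1 / 4) * g t)"
		if p: "continuous_on UNIV p" for p
	proof -
		have e: "p t * h t = p t * g (t + 1 / 4) - 2 * (p t * g t) + p t * g (t + (- 1 / 4))" for t by (simp add: h_def algebra_simps)
		show ?thesis unfolding e using sh[OF p, of "1 / 4"] sh[OF p, of "- 1 / 4"] ig[OF p] by simp
	qed
	show 0: "(LINT t|J. h t) = 0" using hJ[of "%_. 1"] int[of "%_. 1"] by simp
	have "(LINT t|lborel. (t - 1 / 4) * g t) = (LINT t|lborel. t * g t) - 1 / 4 * (LINT t|lborel. g t)"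
		"(LINT t|lborel. (t + 1 / 4) * g t) = (LINT t|lborel. t * g t) + 1 / 4 * (LINT t|lborel. g t)"
		using ig[of "%t. t"] ig[of "%_. 1"] by (simp_all add: left_diff_distrib distrib_right continuous_on_id)
	then have 1: "(LINT t|J. t * h t) = 0" unfolding hJ using int[of "%t. t"] by (simp add: continuous_on_id)
	have hm: "h \<in> borelf" unfolding h_def by measurable
	have hb: "\<bar>h t\<bar> <= 4 * B" for t using g(2)[of "t + 1 / 4"] g(2)[of t] g(2)[of "t - 1 / 4"] unfolding h_def by linarith
	have "((%t. t) has_real_derivative 1) (at t)" for t :: real by (auto intro!: derivative_eq_intros)
	from integral_J_by_parts[OF this continuous_on_const hm hb]
	show "(LINT t|J. LINT r|J. indicator {..t} r * h r) = 0" using 0 1 by simp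
qed

lemma upd_add_e4: "upd x 1 t + e4 = upd x 1 (t + 1 / 4)" "upd x 1 t - e4 = upd x 1 (t - 1 / 4)"
	"j \<noteq> 1 ==> upd (x + e4) j t = upd x j t + e4" "j \<noteq> 1 ==> upd (x - e4) j t = upd x j t - e4"
	by (auto simp: vec_eq_iff axis_def)

lemma D2_measurable: "f \<in> borelf ==> D2 f \<in> borelf"
proof -
	assume [measurable]: "f \<in> borelf"
	show ?thesis unfolding D2_def[abs_def] by measurable
qed

lemma prim_mult_indep:
	assumes "\<And>r. k (upd x i r) = k x"
	shows "prim i (%x. k x * F x) x = k x * prim i F x" "line_int i (%x. k x * F x) x = k x * line_int i F x"
proof -
	have e: "indicator {..x $ i} r * (k (upd x i r) * F (upd x i r)) = k x * (indicator {..x $ i} r * F (upd x i r))" for r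
		by (simp add: assms)
	show "prim i (%x. k x * F x) x = k x * prim i F x" unfolding prim_def e by (rule integral_mult_right_zero)
	show "line_int i (%x. k x * F x) x = k x * line_int i F x" unfolding line_int_def assms by (rule integral_mult_right_zero)
qed

text \<open>18 = 3 (1 + 4 + 1), from the coefficients 1, -2, 1 and translation invariance. The
  support in \<open>cube (1 / 2)\<close> keeps the translates inside the cube.\<close>

lemma integral_Q_shift_square:
	assumes f: "f \<in> borelf" "\<And>x. x \<notin> cube (1 / 2) ==> f x = 0" "\<And>x. \<bar>f x\<bar> <= B"
	shows "(LINT x|Q. (D2 f x)\<^sup>2) <= 18 * (LINT x|Q. (f x)\<^sup>2)" "bB (D2 f)"
proof -
	have L: "L2z f" using cube_Omega[of "1 / 2"] f by (intro L2z_bounded[of _ B]) auto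
	have sm: "(%x. (f x)\<^sup>2) \<in> borelf" using f(1) by measurable
	have i: "integrable lborel (%x. (f (x + e4))\<^sup>2)" "integrable lborel (%x. (f (x - e4))\<^sup>2)"
		"(LINT x|lborel. (f (x + e4))\<^sup>2) = (LINT x|Q. (f x)\<^sup>2)" "(LINT x|lborel. (f (x - e4))\<^sup>2) = (LINT x|Q. (f x)\<^sup>2)"
		using integral_translate[OF sm, of e4] integral_translate[OF sm, of "- e4"] L2zD(4,5)[OF L] by simp_all
	have d0: "D2 f x = 0" if "x \<notin> Omega" for x
	proof -
		have ne: "norm e4 <= 1 / 4" by simp
		have "x \<notin> cube (1 / 2 + 1 / 4)" using that cube_Omega[of "1 / 2 + 1 / 4"] by auto
		moreover have "x \<in> cube (1 / 2 + 1 / 4)" if "x + e4 \<in> cube (1 / 2)" using cube_near[OF that, of x "1 / 4"] by simp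
		moreover have "x \<in> cube (1 / 2 + 1 / 4)" if "x - e4 \<in> cube (1 / 2)" using cube_near[OF that, of x "1 / 4"] by simp
		moreover have "x \<in> cube (1 / 2 + 1 / 4)" if "x \<in> cube (1 / 2)" using cube_mono[OF _ that] by simp
		ultimately show ?thesis using f(2) unfolding D2_def by (metis diff_zero add_0 mult_zero_right)
	qed
	have db: "\<bar>D2 f x\<bar> <= 4 * B" for x using f(3)[of "x + e4"] f(3)[of x] f(3)[of "x - e4"] unfolding D2_def by linarith
	show bB: "bB (D2 f)" using db D2_measurable[OF f(1)] by (auto simp: bB_def)
	have "(LINT x|Q. (D2 f x)\<^sup>2) = (LINT x|lborel. (D2 f x)\<^sup>2)" by (rule Q_lborel(2)) (simp add: d0)
	also have "... <= (LINT x|lborel. 3 * (f (x + e4))\<^sup>2 + 12 * (f x)\<^sup>2 + 3 * (f (x - e4))\<^sup>2)"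
	proof (rule integral_mono)
		show "integrable lborel (%x. (D2 f x)\<^sup>2)"
			using Q_lborel(1)[of "%x. (D2 f x)\<^sup>2"] bB_integrable[OF bB_power[OF bB]] d0 by simp
		show "integrable lborel (%x. 3 * (f (x + e4))\<^sup>2 + 12 * (f x)\<^sup>2 + 3 * (f (x - e4))\<^sup>2)" using i L2zD(4)[OF L] by simp
		show "(D2 f x)\<^sup>2 <= 3 * (f (x + e4))\<^sup>2 + 12 * (f x)\<^sup>2 + 3 * (f (x - e4))\<^sup>2" for x
			using square_sum3_le[of "f (x + e4)" "- 2 * f x" "f (x - e4)"] by (simp add: D2_def)
	qed
	also have "... = 18 * (LINT x|Q. (f x)\<^sup>2)" using i L2zD(4,5)[OF L] by simp
	finally show "(LINT x|Q. (D2 f x)\<^sup>2) <= 18 * (LINT x|Q. (f x)\<^sup>2)" .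
qed

lemma integral_square_mult_le:
	assumes F: "bB F" and k: "bB k" "\<And>x. \<bar>k x\<bar> <= c"
	shows "(LINT x|Q. (k x * F x)\<^sup>2) <= c\<^sup>2 * (LINT x|Q. (F x)\<^sup>2)"
proof -
	have "(LINT x|Q. (k x * F x)\<^sup>2) <= (LINT x|Q. c\<^sup>2 * (F x)\<^sup>2)"
	proof (intro integral_mono bB_integrable bB_intros F k)
		fix x
		have "(k x)\<^sup>2 <= c\<^sup>2" using power_mono[OF k(2)[of x] abs_ge_zero, of 2] by simp
		then show "(k x * F x)\<^sup>2 <= c\<^sup>2 * (F x)\<^sup>2" unfolding power_mult_distrib by (rule mult_right_mono) simp
	qed
	then show ?thesis by simp
qed

lemma CS_bB:
	assumes "bB e" "bB k" "(LINT x|Q. (k x)\<^sup>2) <= c\<^sup>2 * P" "0 <= c" "0 <= P"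
	shows "\<bar>LINT x|Q. e x * k x\<bar> <= c * sqrt (LINT x|Q. (e x)\<^sup>2) * sqrt P"
proof -
	have "(LINT x|Q. e x * k x)\<^sup>2 <= (LINT x|Q. (e x)\<^sup>2) * (LINT x|Q. (k x)\<^sup>2)"
		by (intro cauchy_schwarz_integral bB_measurable_Q bB_integrable bB_power assms(1,2))
	also have "... <= (LINT x|Q. (e x)\<^sup>2) * (c\<^sup>2 * P)" using assms(3) by (intro mult_left_mono) auto
	finally have "sqrt ((LINT x|Q. e x * k x)\<^sup>2) <= sqrt ((LINT x|Q. (e x)\<^sup>2) * (c\<^sup>2 * P))" by (rule real_sqrt_le_mono)
	then show ?thesis using assms(4) by (simp add: real_sqrt_mult mult_ac)
qed

text \<open>Dual form of w being nearly affine in x_1. A part of \<open>D2 \<phi>\<close> with mean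
  zero in x_j is paired with \<partial>_j w. The rest is \<open>ZZ (x $ j)\<close> times a function
  of the other variables with vanishing x_1-moments of order 0 and 1; there one integration by parts
  gives \<partial>_1 w, which is exchanged for - \<partial>_j v_1, and a second one in x_1 leaves
  \<partial>_1 v_1.\<close>

lemma second_difference_duality:
	assumes v: "C1fun v1" "C1fun w" and j: "j \<noteq> 1"
		and \<phi>: "\<phi> \<in> borelf" "\<And>x. x \<notin> cube (1 / 2) ==> \<phi> x = 0" "\<And>x. \<bar>\<phi> x\<bar> <= B"
	shows "\<bar>LINT x|Q. w x * D2 \<phi> x\<bar> <= 3000 * (sqrt (LINT x|Q. (partial_deriv j w x)\<^sup>2)
		+ sqrt (LINT x|Q. (partial_deriv j v1 x + partial_deriv 1 w x)\<^sup>2) + sqrt (LINT x|Q. (partial_deriv 1 v1 x)\<^sup>2)) * sqrt (LINT x|Q. (\<phi> x)\<^sup>2)"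
proof -
	note vb = C1fun_bB[OF v(1)] C1fun_bB[OF v(2)]
	let ?P = "LINT x|Q. (\<phi> x)\<^sup>2"
	have P0: "0 <= ?P" by simp
	have \<phi>b: "bB \<phi>" using \<phi> by (auto simp: bB_def)
	define \<Phi> where "\<Phi> = D2 \<phi>"
	have \<Phi>: "bB \<Phi>" "(LINT x|Q. (\<Phi> x)\<^sup>2) <= 18 * ?P" unfolding \<Phi>_def using integral_Q_shift_square[OF \<phi>] by auto
	define g where "g = line_int j \<phi>"
	define \<Psi> where "\<Psi> = line_int j \<Phi>"
	have sec: "integrable J (%r. \<phi> (upd x j r))" for x
		by (intro J.integrable_const_bound[of _ B] AE_I2 measurable_restrict_space1)
			(use \<phi>(3) measurable_compose[OF _ \<phi>(1), of "%r. upd x j r" borel] in \<open>auto intro!: borel_measurable_upd\<close>)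
	have \<Psi>_eq: "\<Psi> = D2 g"
		unfolding \<Psi>_def \<Phi>_def g_def line_int_def[abs_def] D2_def[abs_def] upd_add_e4(3,4)[OF j]
		using sec[of "x + e4" for x] sec[of "x - e4" for x] sec by (simp add: upd_add_e4(3,4)[OF j])
	have gm: "g \<in> borelf" unfolding g_def by (rule bB_measurable[OF bB_line_int[OF \<phi>b]])
	have gB: "\<bar>g x\<bar> <= 2 * B" for x
	proof -
		have "norm (LINT r|J. \<phi> (upd x j r)) <= (LINT r|J. B)"
			by (rule LINT_norm_bound) (use sec \<phi>(3) in auto)
		then show ?thesis by (simp add: g_def line_int_def)
	qed
	have g0: "g x = 0" if "1 / 2 < \<bar>x $ 1\<bar>" for x
	proof -
		have "upd x j r \<notin> cube (1 / 2)" for r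
		proof
			assume "upd x j r \<in> cube (1 / 2)"
			then have "\<bar>upd x j r $ 1\<bar> <= 1 / 2" unfolding cube_def by blast
			then show False using that j by simp
		qed
		then show ?thesis by (simp add: g_def line_int_def \<phi>(2))
	qed
	\<comment> \<open>Zero mass gives the first equation, zero first moment the second; they allow two
	  successive integrations in x_1.\<close>
	have lines: "line_int 1 \<Psi> x = 0" "line_int 1 (prim 1 \<Psi>) x = 0" for x
	proof -
		have gx: "(%t. g (upd x 1 t)) \<in> borelf"
			by (rule measurable_compose[OF _ gm]) (intro borel_measurable_upd, auto)
		have \<Psi>x: "\<Psi> (upd x 1 t) = g (upd x 1 (t + 1 / 4)) - 2 * g (upd x 1 t) + g (upd x 1 (t - 1 / 4))" for t
			by (simp add: \<Psi>_eq D2_def upd_add_e4)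
		have z: "g (upd x 1 t) = 0" if "1 / 2 < \<bar>t\<bar>" for t using that by (intro g0) simp
		note m = second_difference_moments[of "%t. g (upd x 1 t)" "2 * B", OF gx gB z, simplified]
		show "line_int 1 \<Psi> x = 0" "line_int 1 (prim 1 \<Psi>) x = 0"
			using m by (simp_all add: line_int_def prim_def \<Psi>x)
	qed
	have \<Psi>: "bB \<Psi>" "(LINT x|Q. (\<Psi> x)\<^sup>2) <= 72 * ?P"
		using integral_line_int_square[OF \<Phi>(1), of j] \<Phi>(2) bB_line_int[OF \<Phi>(1)] by (auto simp: \<Psi>_def)
	have Zb: "bB (%x. ZZ (x $ j))" "bB (%x. dZ (x $ j))"
		by (intro bB_cont cont_ZZ continuous_intros) (rule acz_bB[OF acz_ZZ])
	\<comment> \<open>\<open>ZZ\<close> has mass 1 and \<open>\<Psi>\<close> is constant along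
	  x_j-lines, so the subtraction restores mean zero in x_j.\<close>
	define F1 where "F1 x = \<Phi> x - ZZ (x $ j) * \<Psi> x" for x
	define F2 where "F2 x = ZZ (x $ j) * \<Psi> x" for x
	define G where "G = prim 1 \<Psi>"
	define F4 where "F4 x = dZ (x $ j) * G x" for x
	have Gb: "bB G" unfolding G_def by (rule bB_prim[OF \<Psi>(1)])
	have Fb: "bB F1" "bB F2" "bB F4" unfolding F1_def[abs_def] F2_def[abs_def] F4_def[abs_def] by (intro bB_diff bB_mult \<Phi> \<Psi> Zb Gb)+
	have \<Psi>ind: "\<Psi> (upd x j r) = \<Psi> x" for x r by (simp add: \<Psi>_def line_int_def)
	have Gind: "G (upd x j r) = G x" for x r
		using j \<Psi>ind by (simp add: G_def prim_def upd_commute[of j 1])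
	have l1: "line_int j F1 x = 0" if "x \<in> Omega" for x
	proof -
		have "line_int j F1 x = line_int j \<Phi> x - line_int j (%x. \<Psi> x * ZZ (x $ j)) x"
			unfolding F1_def line_int_def using bB_section(3)[OF \<Phi>(1) that, of j] bB_section(3)[OF bB_mult[OF Zb(1) \<Psi>(1)] that, of j]
			by (simp add: mult.commute)
		also have "line_int j (%x. \<Psi> x * ZZ (x $ j)) x = \<Psi> x"
			by (subst prim_mult_indep(2)) (simp_all add: \<Psi>ind line_int_def integral_ZZ)
		finally show ?thesis by (simp add: \<Psi>_def)
	qed
	have j1: "(1 :: 3) \<noteq> j" using j by simp
	have l2: "line_int 1 F2 x = 0" and pr2: "prim 1 F2 x = ZZ (x $ j) * G x" for x
		unfolding F2_def G_def using prim_mult_indep[of "%x. ZZ (x $ j)" x 1 \<Psi>] lines j by simp_all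
	have l4: "line_int 1 F4 x = 0" for x
		unfolding F4_def G_def using prim_mult_indep(2)[of "%x. dZ (x $ j)" x 1 "prim 1 \<Psi>"] lines j by simp
	have s1: "(LINT x|Q. w x * F1 x) = - (LINT x|Q. partial_deriv j w x * prim j F1 x)"
		by (intro integral_Q_by_parts v Fb l1)
	have s2: "(LINT x|Q. w x * F2 x) = - (LINT x|Q. partial_deriv 1 w x * prim 1 F2 x)"
		by (intro integral_Q_by_parts v Fb l2)
	have s3: "(LINT x|Q. v1 x * F4 x) = - (LINT x|Q. partial_deriv j v1 x * prim 1 F2 x)"
		unfolding F4_def pr2 by (rule integral_Q_by_parts_product[OF v(1) Gb acz_ZZ]) (rule Gind)
	have s4: "(LINT x|Q. v1 x * F4 x) = - (LINT x|Q. partial_deriv 1 v1 x * prim 1 F4 x)"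
		by (intro integral_Q_by_parts v Fb l4)
	have s5: "(LINT x|Q. (partial_deriv j v1 x + partial_deriv 1 w x) * prim 1 F2 x)
		= (LINT x|Q. partial_deriv j v1 x * prim 1 F2 x) + (LINT x|Q. partial_deriv 1 w x * prim 1 F2 x)"
		unfolding distrib_right by (intro LINT_add bB_integrable bB_mult vb bB_prim Fb)
	have s0: "(LINT x|Q. w x * \<Phi> x) = (LINT x|Q. w x * F1 x) + (LINT x|Q. w x * F2 x)"
	proof -
		have "w x * \<Phi> x = w x * F1 x + w x * F2 x" for x by (simp add: F1_def F2_def algebra_simps)
		then show ?thesis by (simp add: LINT_add bB_integrable bB_mult vb Fb)
	qed
	have main: "(LINT x|Q. w x * \<Phi> x) = - (LINT x|Q. partial_deriv j w x * prim j F1 x)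
		- (LINT x|Q. (partial_deriv j v1 x + partial_deriv 1 w x) * prim 1 F2 x) + (LINT x|Q. partial_deriv 1 v1 x * prim 1 F4 x)"
		using s0 s1 s2 s3 s4 s5 by linarith
	have F2n: "(LINT x|Q. (F2 x)\<^sup>2) <= 1152 * ?P"
		unfolding F2_def using integral_square_mult_le[OF \<Psi>(1) Zb(1) ZZ_bounds(2)] \<Psi>(2) by simp
	have F1n: "(LINT x|Q. (F1 x)\<^sup>2) <= 2340 * ?P"
	proof -
		have "(LINT x|Q. (F1 x)\<^sup>2) <= (LINT x|Q. 2 * (\<Phi> x)\<^sup>2 + 2 * (F2 x)\<^sup>2)"
			using square_sum_le[of "\<Phi> x" "- F2 x" for x]
			by (intro integral_mono bB_integrable bB_intros \<Phi> Fb) (simp add: F1_def F2_def)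
		also have "... = 2 * (LINT x|Q. (\<Phi> x)\<^sup>2) + 2 * (LINT x|Q. (F2 x)\<^sup>2)"
			by (simp add: bB_integrable bB_power \<Phi> Fb)
		finally show ?thesis using \<Phi>(2) F2n by linarith
	qed
	have F4n: "(LINT x|Q. (F4 x)\<^sup>2) <= 1036800 * ?P"
	proof -
		have "(LINT x|Q. (G x)\<^sup>2) <= 288 * ?P" unfolding G_def using integral_prim_square[OF \<Psi>(1), of 1] \<Psi>(2) by linarith
		then show ?thesis unfolding F4_def using integral_square_mult_le[OF Gb Zb(2) dZ_bound] by simp
	qed
	\<comment> \<open>2250000 is 3000^2 / 4, the 4 being the cost of \<open>prim\<close>. The largest
	  constant to be covered is 1036800 = 60^2 * 288, due to the bound 60 on \<open>dZ\<close>.\<close>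
	have num: "X <= 3000\<^sup>2 * ?P" if "X <= 4 * Y" "Y <= c * ?P" "c <= 2250000" for X Y c
		using that mult_right_mono[OF that(3) P0] by simp
	have b1: "\<bar>LINT x|Q. partial_deriv j w x * prim j F1 x\<bar> <= 3000 * sqrt (LINT x|Q. (partial_deriv j w x)\<^sup>2) * sqrt ?P"
		by (intro CS_bB vb bB_prim Fb num[OF integral_prim_square[OF Fb(1)] F1n] P0) auto
	have b2: "\<bar>LINT x|Q. (partial_deriv j v1 x + partial_deriv 1 w x) * prim 1 F2 x\<bar>
			<= 3000 * sqrt (LINT x|Q. (partial_deriv j v1 x + partial_deriv 1 w x)\<^sup>2) * sqrt ?P"
		by (intro CS_bB vb bB_prim Fb bB_add num[OF integral_prim_square[OF Fb(2)] F2n] P0) auto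
	have b3: "\<bar>LINT x|Q. partial_deriv 1 v1 x * prim 1 F4 x\<bar> <= 3000 * sqrt (LINT x|Q. (partial_deriv 1 v1 x)\<^sup>2) * sqrt ?P"
		by (intro CS_bB vb bB_prim Fb num[OF integral_prim_square[OF Fb(3)] F4n] P0) auto
	show ?thesis
		using main b1 b2 b3 unfolding \<Phi>_def[symmetric] distrib_left distrib_right by linarith
qed

text \<open>The test function is the truncated second difference itself. Summation by parts moves
  \<open>D2\<close> from \<open>\<phi>\<close> to \<open>w\<close>, and dividing by the norm of
  \<open>\<phi>\<close> gives the bound.\<close>

lemma second_difference_C1:
	assumes v: "C1fun v1" "C1fun w" and j: "j \<noteq> 1"
	shows "sqrt (LINT x|Q. indicator (cube (1 / 2)) x * (D2 w x)\<^sup>2) <= 3000 * (sqrt (LINT x|Q. (partial_deriv j w x)\<^sup>2)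
		+ sqrt (LINT x|Q. (partial_deriv j v1 x + partial_deriv 1 w x)\<^sup>2) + sqrt (LINT x|Q. (partial_deriv 1 v1 x)\<^sup>2))"
proof -
	define \<phi> where "\<phi> x = indicator (cube (1 / 2)) x * D2 w x" for x
	have wm: "w \<in> borelf" by (rule bB_measurable[OF C1fun_bB(1)[OF v(2)]])
	have D2c: "continuous_on UNIV (D2 w)" unfolding D2_def[abs_def]
		by (intro continuous_intros continuous_on_compose2[OF C1fun_continuous[OF v(2)]]) auto
	have \<phi>m: "\<phi> \<in> borelf" unfolding \<phi>_def[abs_def] using D2_measurable[OF wm] by measurable
	have \<phi>0: "\<phi> x = 0" if "x \<notin> cube (1 / 2)" for x using that by (simp add: \<phi>_def)
	obtain B where B: "0 < B" "\<And>x. x \<in> cube 2 ==> \<bar>D2 w x\<bar> <= B" using cube2_bound[OF D2c] by blast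
	have \<phi>B: "\<bar>\<phi> x\<bar> <= B" for x using B(1) B(2)[OF cube_mono[of "1 / 2" 2 x]] by (auto simp: \<phi>_def indicator_def)
	have L: "L2z \<phi>" using cube_Omega[of "1 / 2"] by (intro L2z_bounded[of _ B] \<phi>m \<phi>B \<phi>0) auto
	have iw: "integrable lborel (%x. k x * \<phi> x)" if "continuous_on UNIV k" for k
	proof -
		have "integrable Q (%x. k x * \<phi> x)"
			by (intro cauchy_schwarz_integral(1) bB_measurable_Q borel_measurable_Q \<phi>m L2zD(2)[OF L] bB_integrable bB_power bB_cont that)
		then show ?thesis using Q_lborel(1)[of "%x. k x * \<phi> x"] L2zD(3)[OF L] by simp
	qed
	have sh: "(LINT x|lborel. w x * \<phi> (x + c)) = (LINT x|lborel. w (x - c) * \<phi> x)" "integrable lborel (%x. w x * \<phi> (x + c))" for c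
	proof -
		have cw: "continuous_on UNIV (%x. w (x - c))" by (intro continuous_on_compose2[OF C1fun_continuous[OF v(2)]] continuous_intros) auto
		have m: "(%x. w (x - c) * \<phi> x) \<in> borelf" using borel_measurable_integrable[OF iw[OF cw]] by simp
		show "(LINT x|lborel. w x * \<phi> (x + c)) = (LINT x|lborel. w (x - c) * \<phi> x)" "integrable lborel (%x. w x * \<phi> (x + c))"
			using integral_translate[OF m, of c] iw[OF cw] by simp_all
	qed
	have "D2 \<phi> x = 0" if "x \<notin> Omega" for x
	proof -
		have "x \<notin> cube (1 / 2 + 1 / 4)" using that cube_Omega[of "1 / 2 + 1 / 4"] by auto
		then have "x + e4 \<notin> cube (1 / 2)" "x - e4 \<notin> cube (1 / 2)" "x \<notin> cube (1 / 2)"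
			using cube_near[of "x + e4" "1 / 2" x "1 / 4"] cube_near[of "x - e4" "1 / 2" x "1 / 4"] cube_mono[of "1 / 2" "1 / 2 + 1 / 4" x] by auto
		then show ?thesis by (simp add: D2_def \<phi>0)
	qed
	then have "(LINT x|Q. w x * D2 \<phi> x) = (LINT x|lborel. w x * D2 \<phi> x)" by (intro Q_lborel(2)) simp
	also have "... = (LINT x|lborel. w x * \<phi> (x + e4)) - 2 * (LINT x|lborel. w x * \<phi> (x + 0)) + (LINT x|lborel. w x * \<phi> (x + (- e4)))"
	proof -
		have e: "w x * D2 \<phi> x = w x * \<phi> (x + e4) - 2 * (w x * \<phi> (x + 0)) + w x * \<phi> (x + (- e4))" for x
			by (simp add: D2_def algebra_simps)
		show ?thesis unfolding e using sh(2)[of e4] sh(2)[of "- e4"] sh(2)[of 0] by simp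
	qed
	also have "... = (LINT x|lborel. w (x - e4) * \<phi> x) - 2 * (LINT x|lborel. w x * \<phi> x) + (LINT x|lborel. w (x + e4) * \<phi> x)"
		using sh(1)[of e4] sh(1)[of "- e4"] by simp
	also have "... = (LINT x|lborel. D2 w x * \<phi> x)"
	proof -
		have c: "continuous_on UNIV (%x. w (x - e4))" "continuous_on UNIV (%x. w (x + e4))"
			by (intro continuous_on_compose2[OF C1fun_continuous[OF v(2)]] continuous_intros; auto)+
		have e: "D2 w x * \<phi> x = w (x - e4) * \<phi> x - 2 * (w x * \<phi> x) + w (x + e4) * \<phi> x" for x
			by (simp add: D2_def algebra_simps)
		show ?thesis unfolding e using iw[OF c(1)] iw[OF c(2)] iw[OF C1fun_continuous[OF v(2)]] by simp
	qed
	also have "... = (LINT x|lborel. (\<phi> x)\<^sup>2)"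
		by (intro LINT_cong) (auto simp: \<phi>_def indicator_def power2_eq_square)
	also have "... = (LINT x|Q. (\<phi> x)\<^sup>2)" by (rule L2zD(5)[OF L])
	finally have eq: "(LINT x|Q. w x * D2 \<phi> x) = (LINT x|Q. (\<phi> x)\<^sup>2)" .
	let ?n = "sqrt (LINT x|Q. (\<phi> x)\<^sup>2)"
	let ?S = "3000 * (sqrt (LINT x|Q. (partial_deriv j w x)\<^sup>2)
		+ sqrt (LINT x|Q. (partial_deriv j v1 x + partial_deriv 1 w x)\<^sup>2) + sqrt (LINT x|Q. (partial_deriv 1 v1 x)\<^sup>2))"
	have A: "?n * ?n <= ?S * ?n"
		using second_difference_duality[OF v j \<phi>m \<phi>0 \<phi>B] unfolding eq by (simp add: real_sqrt_mult_self)
	have A0: "0 <= ?S" by (intro mult_nonneg_nonneg add_nonneg_nonneg) auto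
	have aux: "n <= S" if "n * n <= S * n" "0 <= S" "0 <= n" for n S :: real
		using that by (cases "n = 0") (auto simp: mult_le_cancel_right)
	have "?n <= ?S" by (rule aux[OF A A0]) simp
	moreover have "(LINT x|Q. (\<phi> x)\<^sup>2) = (LINT x|Q. indicator (cube (1 / 2)) x * (D2 w x)\<^sup>2)"
		by (intro LINT_cong) (auto simp: \<phi>_def indicator_def)
	ultimately show ?thesis by simp
qed

section \<open>Passage from C^1 functions to Sobolev functions\<close>

lemma L2_limits:
	fixes e :: "real ^ 3 \<Rightarrow> real"
	assumes e: "e \<in> borel_measurable Q" "integrable Q (%x. (e x)\<^sup>2)"
		and en: "\<And>n. en n \<in> borel_measurable Q" "\<And>n. integrable Q (%x. (en n x)\<^sup>2)"
		and lim: "(%n. LINT x|Q. (en n x - e x)\<^sup>2) \<longlonglongrightarrow> 0"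
	shows "k \<in> borel_measurable Q ==> integrable Q (%x. (k x)\<^sup>2) ==> (%n. LINT x|Q. en n x * k x) \<longlonglongrightarrow> (LINT x|Q. e x * k x)"
		and "(%n. sqrt (LINT x|Q. (en n x)\<^sup>2)) \<longlonglongrightarrow> sqrt (LINT x|Q. (e x)\<^sup>2)"
proof -
	have d: "(%x. en n x - e x) \<in> borel_measurable Q" "integrable Q (%x. (en n x - e x)\<^sup>2)" for n
		using e(1) en(1) by (auto intro!: integrable_square_diff e en)
	show 1: "(%n. LINT x|Q. en n x * k x) \<longlonglongrightarrow> (LINT x|Q. e x * k x)"
		if k: "k \<in> borel_measurable Q" "integrable Q (%x. (k x)\<^sup>2)" for k
	proof (rule LIM_zero_cancel, rule Lim_null_comparison)
		have "(%n. sqrt ((LINT x|Q. (en n x - e x)\<^sup>2) * (LINT x|Q. (k x)\<^sup>2))) \<longlonglongrightarrow> sqrt (0 * (LINT x|Q. (k x)\<^sup>2))"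
			by (intro tendsto_intros lim)
		then show "(%n. sqrt ((LINT x|Q. (en n x - e x)\<^sup>2) * (LINT x|Q. (k x)\<^sup>2))) \<longlonglongrightarrow> 0" by simp
		show "\<forall>\<^sub>F n in sequentially. norm ((LINT x|Q. en n x * k x) - (LINT x|Q. e x * k x)) <= sqrt ((LINT x|Q. (en n x - e x)\<^sup>2) * (LINT x|Q. (k x)\<^sup>2))"
		proof (intro always_eventually allI)
			fix n
			have "(LINT x|Q. en n x * k x) - (LINT x|Q. e x * k x) = (LINT x|Q. (en n x - e x) * k x)"
				unfolding left_diff_distrib by (intro LINT_diff[symmetric] cauchy_schwarz_integral(1) e en k)
			also have "\<bar>...\<bar> <= sqrt ((LINT x|Q. (en n x - e x)\<^sup>2) * (LINT x|Q. (k x)\<^sup>2))"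
				using cauchy_schwarz_integral(2)[OF d(1) k(1) d(2) k(2), of n] by (intro real_le_rsqrt) simp
			finally show "norm ((LINT x|Q. en n x * k x) - (LINT x|Q. e x * k x)) <= sqrt ((LINT x|Q. (en n x - e x)\<^sup>2) * (LINT x|Q. (k x)\<^sup>2))" by simp
		qed
	qed
	have "(LINT x|Q. (en n x)\<^sup>2) = 2 * (LINT x|Q. en n x * e x) - (LINT x|Q. (e x)\<^sup>2) + (LINT x|Q. (en n x - e x)\<^sup>2)" for n
	proof -
		have q: "(en n x)\<^sup>2 = 2 * (en n x * e x) - (e x)\<^sup>2 + (en n x - e x)\<^sup>2" for x by (simp add: power2_eq_square algebra_simps)
		have i: "integrable Q (%x. en n x * e x)" by (intro cauchy_schwarz_integral(1) e en)
		show ?thesis unfolding q using i e(2) d(2)[of n] by simp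
	qed
	moreover have "(%n. 2 * (LINT x|Q. en n x * e x) - (LINT x|Q. (e x)\<^sup>2) + (LINT x|Q. (en n x - e x)\<^sup>2))
			\<longlonglongrightarrow> 2 * (LINT x|Q. e x * e x) - (LINT x|Q. (e x)\<^sup>2) + 0"
		by (intro tendsto_intros 1 e lim)
	ultimately have "(%n. LINT x|Q. (en n x)\<^sup>2) \<longlonglongrightarrow> (LINT x|Q. (e x)\<^sup>2)" by (simp add: power2_eq_square)
	then show "(%n. sqrt (LINT x|Q. (en n x)\<^sup>2)) \<longlonglongrightarrow> sqrt (LINT x|Q. (e x)\<^sup>2)" by (rule tendsto_real_sqrt)
qed

lemma L2_tendsto_add:
	fixes e f :: "real ^ 3 \<Rightarrow> real"
	assumes m: "e \<in> borel_measurable Q" "f \<in> borel_measurable Q" "\<And>n. en n \<in> borel_measurable Q" "\<And>n. fn n \<in> borel_measurable Q"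
		and i: "integrable Q (%x. (e x)\<^sup>2)" "integrable Q (%x. (f x)\<^sup>2)" "\<And>n. integrable Q (%x. (en n x)\<^sup>2)" "\<And>n. integrable Q (%x. (fn n x)\<^sup>2)"
		and lim: "(%n. LINT x|Q. (en n x - e x)\<^sup>2) \<longlonglongrightarrow> 0" "(%n. LINT x|Q. (fn n x - f x)\<^sup>2) \<longlonglongrightarrow> 0"
	shows "(%n. LINT x|Q. (en n x + fn n x - (e x + f x))\<^sup>2) \<longlonglongrightarrow> 0"
proof (rule Lim_null_comparison)
	have "(%n. 2 * (LINT x|Q. (en n x - e x)\<^sup>2) + 2 * (LINT x|Q. (fn n x - f x)\<^sup>2)) \<longlonglongrightarrow> 2 * 0 + 2 * 0"
		by (intro tendsto_intros lim)
	then show "(%n. 2 * (LINT x|Q. (en n x - e x)\<^sup>2) + 2 * (LINT x|Q. (fn n x - f x)\<^sup>2)) \<longlonglongrightarrow> 0" by simp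
	show "\<forall>\<^sub>F n in sequentially. norm (LINT x|Q. (en n x + fn n x - (e x + f x))\<^sup>2) <= 2 * (LINT x|Q. (en n x - e x)\<^sup>2) + 2 * (LINT x|Q. (fn n x - f x)\<^sup>2)"
	proof (intro always_eventually allI)
		fix n
		have d: "integrable Q (%x. (en n x - e x)\<^sup>2)" "integrable Q (%x. (fn n x - f x)\<^sup>2)" by (intro integrable_square_diff m i)+
		have "(LINT x|Q. (en n x + fn n x - (e x + f x))\<^sup>2) <= (LINT x|Q. 2 * (en n x - e x)\<^sup>2 + 2 * (fn n x - f x)\<^sup>2)"
			using d square_sum_le[of "en n x - e x" "fn n x - f x" for x]
			by (intro integral_mono_AE') (auto intro!: AE_I2 simp: algebra_simps)
		also have "... = 2 * (LINT x|Q. (en n x - e x)\<^sup>2) + 2 * (LINT x|Q. (fn n x - f x)\<^sup>2)" using d by simp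
		finally show "norm (LINT x|Q. (en n x + fn n x - (e x + f x))\<^sup>2) <= 2 * (LINT x|Q. (en n x - e x)\<^sup>2) + 2 * (LINT x|Q. (fn n x - f x)\<^sup>2)" by simp
	qed
qed

lemma integrable_square_add:
	assumes "f \<in> borel_measurable M" "g \<in> borel_measurable M" "integrable M (%x. (f x)\<^sup>2)" "integrable M (%x. (g x)\<^sup>2 :: real)"
	shows "integrable M (%x. (f x + g x)\<^sup>2)"
	using integrable_square_diff[of f M "%x. - g x"] assms by simp

lemma H1_approx':
	assumes "H1 f p"
	obtains v where "\<And>n. C1fun (v n)" "(%n. LINT x|Q. (v n x - f x)\<^sup>2) \<longlonglongrightarrow> 0"
		"\<And>i. (%n. LINT x|Q. (partial_deriv i (v n) x - p i x)\<^sup>2) \<longlonglongrightarrow> 0"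
proof (rule H1_approx[OF assms])
	fix v assume "\<And>n. C1fun (v n)" "(%n. LINT x|Q. (v n x - f x)\<^sup>2) \<longlonglongrightarrow> 0"
		"\<And>i. (%n. LINT x|Q. (partial_deriv i (v n) x - p i x)\<^sup>2) \<longlonglongrightarrow> 0"
	then show thesis by (rule that)
qed

definition nrm :: "(real ^ 3 \<Rightarrow> real) \<Rightarrow> real" where "nrm f = sqrt (LINT x|Q. (f x)\<^sup>2)"

text \<open>The cube has volume 8, and 8 <= 3^2.\<close>

lemma L1_nrm: "bB f ==> (LINT x|Q. \<bar>f x\<bar>) <= 3 * nrm f"
proof -
	assume f: "bB f"
	have "(LINT x|Q. \<bar>f x\<bar>)\<^sup>2 <= 8 * (LINT x|Q. (f x)\<^sup>2)"
		using Q.L2_imp_L1(3)[OF bB_measurable_Q[OF f] bB_integrable[OF bB_power[OF f]]] by simp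
	also have "... <= 9 * (LINT x|Q. (f x)\<^sup>2)" by simp
	finally have "(LINT x|Q. \<bar>f x\<bar>) <= sqrt (9 * (LINT x|Q. (f x)\<^sup>2))" by (rule real_le_rsqrt)
	also have "... = sqrt (3\<^sup>2) * nrm f" by (simp add: nrm_def real_sqrt_mult)
	finally show ?thesis by simp
qed

lemma M'_estimate_H1:
	"\<exists>C\<ge>0. \<forall>u1 u2 u3 p1 p2 p3. H1 u1 p1 \<and> H1 u2 p2 \<and> H1 u3 p3 \<longrightarrow>
		\<bar>(LINT x|Q. x $ 2 * p1 3 x) - (LINT x|Q. (p2 3 x + p3 2 x) * kap x)\<bar>
		<= C * (nrm (p1 1) + nrm (p2 2) + nrm (p3 3) + nrm (%x. p1 2 x + p2 1 x) + nrm (%x. p1 3 x + p3 1 x))"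
proof -
	obtain C where C: "C \<ge> 0" and est: "\<And>v1 v2 v3. C1fun v1 ==> C1fun v2 ==> C1fun v3 ==>
		\<bar>(LINT x|Q. x $ 2 * partial_deriv 3 v1 x) - (LINT x|Q. (partial_deriv 3 v2 x + partial_deriv 2 v3 x) * kap x)\<bar>
		<= C * ((LINT x|Q. \<bar>partial_deriv 1 v1 x\<bar>) + (LINT x|Q. \<bar>partial_deriv 2 v2 x\<bar>) + (LINT x|Q. \<bar>partial_deriv 3 v3 x\<bar>)
			+ (LINT x|Q. \<bar>partial_deriv 2 v1 x + partial_deriv 1 v2 x\<bar>) + (LINT x|Q. \<bar>partial_deriv 3 v1 x + partial_deriv 1 v3 x\<bar>))"
		using M'_estimate_C1 by blast
	have kb: "bB kap" unfolding kap_def[abs_def] by (intro bB_cont continuous_intros cont_ZZ)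
	show ?thesis
	proof (intro exI conjI allI impI)
		show "0 <= 3 * C" using C by simp
		fix u1 u2 u3 p1 p2 p3 assume "H1 u1 p1 \<and> H1 u2 p2 \<and> H1 u3 p3"
		then have H: "H1 u1 p1" "H1 u2 p2" "H1 u3 p3" by auto
		then have L: "L2z (p1 i)" "L2z (p2 i)" "L2z (p3 i)" for i by (auto simp: H1_def)
		note Lm = borel_measurable_Q[OF L2zD(1)[OF L(1)]] borel_measurable_Q[OF L2zD(1)[OF L(2)]] borel_measurable_Q[OF L2zD(1)[OF L(3)]]
		note Li = L2zD(2)[OF L(1)] L2zD(2)[OF L(2)] L2zD(2)[OF L(3)]
		obtain v1 where v1: "\<And>n. C1fun (v1 n)" "(%n. LINT x|Q. (v1 n x - u1 x)\<^sup>2) \<longlonglongrightarrow> 0" "\<And>i. (%n. LINT x|Q. (partial_deriv i (v1 n) x - p1 i x)\<^sup>2) \<longlonglongrightarrow> 0"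
			by (rule H1_approx'[OF H(1)]) blast
		obtain v2 where v2: "\<And>n. C1fun (v2 n)" "(%n. LINT x|Q. (v2 n x - u2 x)\<^sup>2) \<longlonglongrightarrow> 0" "\<And>i. (%n. LINT x|Q. (partial_deriv i (v2 n) x - p2 i x)\<^sup>2) \<longlonglongrightarrow> 0"
			by (rule H1_approx'[OF H(2)]) blast
		obtain v3 where v3: "\<And>n. C1fun (v3 n)" "(%n. LINT x|Q. (v3 n x - u3 x)\<^sup>2) \<longlonglongrightarrow> 0" "\<And>i. (%n. LINT x|Q. (partial_deriv i (v3 n) x - p3 i x)\<^sup>2) \<longlonglongrightarrow> 0"
			by (rule H1_approx'[OF H(3)]) blast
		note vb = C1fun_bB(2)[OF v1(1)] C1fun_bB(2)[OF v2(1)] C1fun_bB(2)[OF v3(1)]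
		note vm = vb[THEN bB_measurable_Q] and vi = vb[THEN bB_power, THEN bB_integrable]
		have n: "(%n. nrm (partial_deriv i (v1 n))) \<longlonglongrightarrow> nrm (p1 i)" "(%n. nrm (partial_deriv i (v2 n))) \<longlonglongrightarrow> nrm (p2 i)" "(%n. nrm (partial_deriv i (v3 n))) \<longlonglongrightarrow> nrm (p3 i)" for i
			unfolding nrm_def by (rule L2_limits(2)[OF Lm(1) Li(1) vm(1) vi(1) v1(3)] L2_limits(2)[OF Lm(2) Li(2) vm(2) vi(2) v2(3)] L2_limits(2)[OF Lm(3) Li(3) vm(3) vi(3) v3(3)])+
		have s12: "(%n. LINT x|Q. (partial_deriv 2 (v1 n) x + partial_deriv 1 (v2 n) x - (p1 2 x + p2 1 x))\<^sup>2) \<longlonglongrightarrow> 0"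
			by (rule L2_tendsto_add[OF Lm(1) Lm(2) vm(1) vm(2) Li(1) Li(2) vi(1) vi(2) v1(3) v2(3)])
		have s13: "(%n. LINT x|Q. (partial_deriv 3 (v1 n) x + partial_deriv 1 (v3 n) x - (p1 3 x + p3 1 x))\<^sup>2) \<longlonglongrightarrow> 0"
			by (rule L2_tendsto_add[OF Lm(1) Lm(3) vm(1) vm(3) Li(1) Li(3) vi(1) vi(3) v1(3) v3(3)])
		have s23: "(%n. LINT x|Q. (partial_deriv 3 (v2 n) x + partial_deriv 2 (v3 n) x - (p2 3 x + p3 2 x))\<^sup>2) \<longlonglongrightarrow> 0"
			by (rule L2_tendsto_add[OF Lm(2) Lm(3) vm(2) vm(3) Li(2) Li(3) vi(2) vi(3) v2(3) v3(3)])
		note am = borel_measurable_add[OF Lm(1) Lm(2)] borel_measurable_add[OF Lm(1) Lm(3)] borel_measurable_add[OF Lm(2) Lm(3)]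
			borel_measurable_add[OF vm(1) vm(2)] borel_measurable_add[OF vm(1) vm(3)] borel_measurable_add[OF vm(2) vm(3)]
		note ai = integrable_square_add[OF Lm(1) Lm(2) Li(1) Li(2)] integrable_square_add[OF Lm(1) Lm(3) Li(1) Li(3)] integrable_square_add[OF Lm(2) Lm(3) Li(2) Li(3)]
			integrable_square_add[OF vm(1) vm(2) vi(1) vi(2)] integrable_square_add[OF vm(1) vm(3) vi(1) vi(3)] integrable_square_add[OF vm(2) vm(3) vi(2) vi(3)]
		have n12: "(%n. nrm (%x. partial_deriv 2 (v1 n) x + partial_deriv 1 (v2 n) x)) \<longlonglongrightarrow> nrm (%x. p1 2 x + p2 1 x)"
			unfolding nrm_def by (rule L2_limits(2)[OF am(1) ai(1) am(4) ai(4) s12])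
		have n13: "(%n. nrm (%x. partial_deriv 3 (v1 n) x + partial_deriv 1 (v3 n) x)) \<longlonglongrightarrow> nrm (%x. p1 3 x + p3 1 x)"
			unfolding nrm_def by (rule L2_limits(2)[OF am(2) ai(2) am(5) ai(5) s13])
		have k23: "(%n. LINT x|Q. (partial_deriv 3 (v2 n) x + partial_deriv 2 (v3 n) x) * kap x) \<longlonglongrightarrow> (LINT x|Q. (p2 3 x + p3 2 x) * kap x)"
			by (rule L2_limits(1)[OF am(3) ai(3) am(6) ai(6) s23 bB_measurable_Q[OF kb] bB_integrable[OF bB_power[OF kb]]])
		have k13: "(%n. LINT x|Q. partial_deriv 3 (v1 n) x * x $ 2) \<longlonglongrightarrow> (LINT x|Q. p1 3 x * x $ 2)"
			by (rule L2_limits(1)[OF Lm(1) Li(1) vm(1) vi(1) v1(3) bB_measurable_Q[OF bB_nth] bB_integrable[OF bB_power[OF bB_nth]]])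
		have est': "\<bar>(LINT x|Q. partial_deriv 3 (v1 n) x * x $ 2) - (LINT x|Q. (partial_deriv 3 (v2 n) x + partial_deriv 2 (v3 n) x) * kap x)\<bar>
			<= 3 * C * (nrm (partial_deriv 1 (v1 n)) + nrm (partial_deriv 2 (v2 n)) + nrm (partial_deriv 3 (v3 n))
				+ nrm (%x. partial_deriv 2 (v1 n) x + partial_deriv 1 (v2 n) x) + nrm (%x. partial_deriv 3 (v1 n) x + partial_deriv 1 (v3 n) x))" (is "_ <= 3 * C * ?N") for n
		proof -
			have "(LINT x|Q. \<bar>partial_deriv 1 (v1 n) x\<bar>) + (LINT x|Q. \<bar>partial_deriv 2 (v2 n) x\<bar>) + (LINT x|Q. \<bar>partial_deriv 3 (v3 n) x\<bar>)
			+ (LINT x|Q. \<bar>partial_deriv 2 (v1 n) x + partial_deriv 1 (v2 n) x\<bar>) + (LINT x|Q. \<bar>partial_deriv 3 (v1 n) x + partial_deriv 1 (v3 n) x\<bar>) <= 3 * ?N"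
				unfolding distrib_left by (intro add_mono L1_nrm vb bB_add)
			from mult_left_mono[OF this C] show ?thesis
				using est[OF v1(1) v2(1) v3(1), of n n n] by (simp add: mult_ac)
		qed
		have "\<bar>(LINT x|Q. p1 3 x * x $ 2) - (LINT x|Q. (p2 3 x + p3 2 x) * kap x)\<bar>
			<= 3 * C * (nrm (p1 1) + nrm (p2 2) + nrm (p3 3) + nrm (%x. p1 2 x + p2 1 x) + nrm (%x. p1 3 x + p3 1 x))"
			by (rule LIMSEQ_le[OF tendsto_rabs[OF tendsto_diff[OF k13 k23]] tendsto_mult_left[OF tendsto_add[OF tendsto_add[OF tendsto_add[OF tendsto_add[OF n(1) n(2)] n(3)] n12] n13]]])
				(use est' in blast)
		then show "\<bar>(LINT x|Q. x $ 2 * p1 3 x) - (LINT x|Q. (p2 3 x + p3 2 x) * kap x)\<bar>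
			<= 3 * C * (nrm (p1 1) + nrm (p2 2) + nrm (p3 3) + nrm (%x. p1 2 x + p2 1 x) + nrm (%x. p1 3 x + p3 1 x))"
			by (simp add: mult.commute)
	qed
qed

lemma D2_L2z:
	assumes f: "L2z f"
	shows "integrable lborel (%x. (D2 f x)\<^sup>2)" "(LINT x|lborel. (D2 f x)\<^sup>2) <= 18 * (LINT x|Q. (f x)\<^sup>2)"
proof -
	have sm: "(%x. (f x)\<^sup>2) \<in> borelf" using L2zD(1)[OF f] by measurable
	have i: "integrable lborel (%x. (f (x + e4))\<^sup>2)" "integrable lborel (%x. (f (x - e4))\<^sup>2)"
		"(LINT x|lborel. (f (x + e4))\<^sup>2) = (LINT x|Q. (f x)\<^sup>2)" "(LINT x|lborel. (f (x - e4))\<^sup>2) = (LINT x|Q. (f x)\<^sup>2)"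
		using integral_translate[OF sm, of e4] integral_translate[OF sm, of "- e4"] L2zD(4,5)[OF f] by simp_all
	have ib: "integrable lborel (%x. 3 * (f (x + e4))\<^sup>2 + 12 * (f x)\<^sup>2 + 3 * (f (x - e4))\<^sup>2)" using i L2zD(4)[OF f] by simp
	have le: "(D2 f x)\<^sup>2 <= 3 * (f (x + e4))\<^sup>2 + 12 * (f x)\<^sup>2 + 3 * (f (x - e4))\<^sup>2" for x
		using square_sum3_le[of "f (x + e4)" "- 2 * f x" "f (x - e4)"] by (simp add: D2_def)
	show id: "integrable lborel (%x. (D2 f x)\<^sup>2)"
		by (rule LI_bound[OF ib]) (use D2_measurable[OF L2zD(1)[OF f]] le in \<open>auto intro!: AE_I2\<close>)
	have "(LINT x|lborel. (D2 f x)\<^sup>2) <= (LINT x|lborel. 3 * (f (x + e4))\<^sup>2 + 12 * (f x)\<^sup>2 + 3 * (f (x - e4))\<^sup>2)"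
		by (intro integral_mono id ib le)
	also have "... = 18 * (LINT x|Q. (f x)\<^sup>2)" using i L2zD(4,5)[OF f] by simp
	finally show "(LINT x|lborel. (D2 f x)\<^sup>2) <= 18 * (LINT x|Q. (f x)\<^sup>2)" .
qed

text \<open>\<open>w\<close> is split into a C^1 approximation and an L^2 error, whose second
  difference is bounded by translation invariance. The splitting costs the factor 2, and the error
  then tends to 0.\<close>

lemma second_difference_H1:
	assumes H: "H1 u p" "H1 w q" and j: "j \<noteq> 1"
	shows "(LINT x|lborel. indicator (cube (1 / 2)) x * (D2 w x)\<^sup>2) <= 2 * (3000 * (nrm (q j) + nrm (%x. p j x + q 1 x) + nrm (p 1)))\<^sup>2"
proof -
	have L: "L2z (p i)" "L2z (q i)" "L2z w" for i using H by (auto simp: H1_def)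
	note Lm = borel_measurable_Q[OF L2zD(1)[OF L(1)]] borel_measurable_Q[OF L2zD(1)[OF L(2)]]
	note Li = L2zD(2)[OF L(1)] L2zD(2)[OF L(2)]
	obtain v1 where v1: "\<And>n. C1fun (v1 n)" "(%n. LINT x|Q. (v1 n x - u x)\<^sup>2) \<longlonglongrightarrow> 0" "\<And>i. (%n. LINT x|Q. (partial_deriv i (v1 n) x - p i x)\<^sup>2) \<longlonglongrightarrow> 0"
		by (rule H1_approx'[OF H(1)]) blast
	obtain v2 where v2: "\<And>n. C1fun (v2 n)" "(%n. LINT x|Q. (v2 n x - w x)\<^sup>2) \<longlonglongrightarrow> 0" "\<And>i. (%n. LINT x|Q. (partial_deriv i (v2 n) x - q i x)\<^sup>2) \<longlonglongrightarrow> 0"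
		by (rule H1_approx'[OF H(2)]) blast
	note vb = C1fun_bB(2)[OF v1(1)] C1fun_bB(2)[OF v2(1)]
	note vm = vb[THEN bB_measurable_Q] and vi = vb[THEN bB_power, THEN bB_integrable]
	have n: "(%n. nrm (partial_deriv 1 (v1 n))) \<longlonglongrightarrow> nrm (p 1)" "(%n. nrm (partial_deriv j (v2 n))) \<longlonglongrightarrow> nrm (q j)"
		unfolding nrm_def by (rule L2_limits(2)[OF Lm(1) Li(1) vm(1) vi(1) v1(3)] L2_limits(2)[OF Lm(2) Li(2) vm(2) vi(2) v2(3)])+
	have s12: "(%n. LINT x|Q. (partial_deriv j (v1 n) x + partial_deriv 1 (v2 n) x - (p j x + q 1 x))\<^sup>2) \<longlonglongrightarrow> 0"
		by (rule L2_tendsto_add[OF Lm(1) Lm(2) vm(1) vm(2) Li(1) Li(2) vi(1) vi(2) v1(3) v2(3)])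
	have n12: "(%n. nrm (%x. partial_deriv j (v1 n) x + partial_deriv 1 (v2 n) x)) \<longlonglongrightarrow> nrm (%x. p j x + q 1 x)"
		unfolding nrm_def
		by (rule L2_limits(2)[OF borel_measurable_add[OF Lm(1) Lm(2)] integrable_square_add[OF Lm(1) Lm(2) Li(1) Li(2)] borel_measurable_add[OF vm(1) vm(2)] integrable_square_add[OF vm(1) vm(2) vi(1) vi(2)] s12])
	let ?S = "%n. 3000 * (nrm (partial_deriv j (v2 n)) + nrm (%x. partial_deriv j (v1 n) x + partial_deriv 1 (v2 n) x) + nrm (partial_deriv 1 (v1 n)))"
	have "(LINT x|lborel. indicator (cube (1 / 2)) x * (D2 w x)\<^sup>2) <= 2 * (?S n)\<^sup>2 + 36 * (LINT x|Q. (v2 n x - w x)\<^sup>2)" for n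
	proof -
		define f where "f x = indicator Omega x * v2 n x - w x" for x
		have f: "L2z f" unfolding f_def[abs_def] by (intro L2z_diff L2z_bB C1fun_bB v2 L)
		have fI: "(LINT x|Q. (f x)\<^sup>2) = (LINT x|Q. (v2 n x - w x)\<^sup>2)" by (intro LINT_cong) (auto simp: f_def)
		have cO: "x + e4 \<in> Omega" "x - e4 \<in> Omega" "x \<in> Omega" if "x \<in> cube (1 / 2)" for x
			using cube_near[OF that, of "x + e4" "1 / 4"] cube_near[OF that, of "x - e4" "1 / 4"] cube_Omega[of "1 / 2 + 1 / 4"] cube_Omega[of "1 / 2"] that by auto
		have D2c: "continuous_on UNIV (D2 (v2 n))" unfolding D2_def[abs_def]
			by (intro continuous_intros continuous_on_compose2[OF C1fun_continuous[OF v2(1)]]) auto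
		have ci: "bB (%x. indicator (cube (1 / 2)) x)" by (auto simp: bB_def indicator_def intro!: exI[of _ 1])
		have iv: "integrable Q (%x. indicator (cube (1 / 2)) x * (D2 (v2 n) x)\<^sup>2)"
			by (rule bB_integrable[OF bB_mult[OF ci bB_power[OF bB_cont[OF D2c]]]])
		have zo: "indicator (cube (1 / 2)) x * (D2 (v2 n) x)\<^sup>2 = 0" if "x \<notin> Omega" for x
			using that cube_Omega[of "1 / 2"] by (auto simp: indicator_def)
		have iv': "integrable lborel (%x. indicator (cube (1 / 2)) x * (D2 (v2 n) x)\<^sup>2)"
			"(LINT x|lborel. indicator (cube (1 / 2)) x * (D2 (v2 n) x)\<^sup>2) = (LINT x|Q. indicator (cube (1 / 2)) x * (D2 (v2 n) x)\<^sup>2)"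
			using Q_lborel[OF zo] iv by auto
		have C1: "(LINT x|Q. indicator (cube (1 / 2)) x * (D2 (v2 n) x)\<^sup>2) <= (?S n)\<^sup>2"
		proof -
			have "sqrt (LINT x|Q. indicator (cube (1 / 2)) x * (D2 (v2 n) x)\<^sup>2) <= ?S n"
				using second_difference_C1[OF v1(1) v2(1) j, of n n] by (simp add: nrm_def)
			then show ?thesis by (rule sqrt_le_D)
		qed
		have "(LINT x|lborel. indicator (cube (1 / 2)) x * (D2 w x)\<^sup>2)
			<= (LINT x|lborel. 2 * (indicator (cube (1 / 2)) x * (D2 (v2 n) x)\<^sup>2) + 2 * (D2 f x)\<^sup>2)"
		proof (rule integral_mono_AE')
			show "integrable lborel (%x. 2 * (indicator (cube (1 / 2)) x * (D2 (v2 n) x)\<^sup>2) + 2 * (D2 f x)\<^sup>2)"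
				using iv' D2_L2z(1)[OF f] by simp
			show "AE x in lborel. indicator (cube (1 / 2)) x * (D2 w x)\<^sup>2 <= 2 * (indicator (cube (1 / 2)) x * (D2 (v2 n) x)\<^sup>2) + 2 * (D2 f x)\<^sup>2"
			proof (rule AE_I2)
				fix x
				show "indicator (cube (1 / 2)) x * (D2 w x)\<^sup>2 <= 2 * (indicator (cube (1 / 2)) x * (D2 (v2 n) x)\<^sup>2) + 2 * (D2 f x)\<^sup>2"
				proof (cases "x \<in> cube (1 / 2)")
					case True
					then have "D2 w x = D2 (v2 n) x + (- D2 f x)" using cO[OF True] by (simp add: D2_def f_def)
					then show ?thesis using square_sum_le[of "D2 (v2 n) x" "- D2 f x"] True by simp
				qed simp
			qed
		qed auto
		also have "... = 2 * (LINT x|lborel. indicator (cube (1 / 2)) x * (D2 (v2 n) x)\<^sup>2) + 2 * (LINT x|lborel. (D2 f x)\<^sup>2)"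
			using iv' D2_L2z(1)[OF f] by simp
		also have "... <= 2 * (?S n)\<^sup>2 + 36 * (LINT x|Q. (v2 n x - w x)\<^sup>2)"
			using C1 D2_L2z(2)[OF f] unfolding iv'(2) fI by linarith
		finally show ?thesis .
	qed
	moreover have "(%n. 2 * (?S n)\<^sup>2 + 36 * (LINT x|Q. (v2 n x - w x)\<^sup>2)) \<longlonglongrightarrow> 2 * (3000 * (nrm (q j) + nrm (%x. p j x + q 1 x) + nrm (p 1)))\<^sup>2 + 36 * 0"
		by (intro tendsto_intros n n12 v2)
	ultimately have "(LINT x|lborel. indicator (cube (1 / 2)) x * (D2 w x)\<^sup>2) <= 2 * (3000 * (nrm (q j) + nrm (%x. p j x + q 1 x) + nrm (p 1)))\<^sup>2 + 36 * 0"
		by (intro LIMSEQ_le_const) auto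
	then show ?thesis by simp
qed

section \<open>Phase functions of bounded variation\<close>

lemma conv_Fubini:
	assumes k: "kern k" and s: "integrable lborel s" and f: "integrable lborel f"
	shows "(LINT x|lborel. s x * conv d k f x) = (LINT y|lborel. f y * (LINT x|lborel. s x * (k ((x - y) /\<^sub>R d) / d ^ 3)))"
proof -
	note [measurable] = borel_measurable_integrable[OF s, simplified] borel_measurable_integrable[OF f, simplified] kern_measurable[OF k]
	obtain B where B: "\<And>z. \<bar>k z\<bar> <= B" using k by (auto simp: kern_def)
	have KB: "\<bar>k z / d ^ 3\<bar> <= \<bar>B / d ^ 3\<bar>" for z
		unfolding abs_divide by (intro divide_right_mono order_trans[OF B abs_ge_self]) simp
	let ?H = "%x y. s x * (f y * (k ((x - y) /\<^sub>R d) / d ^ 3))"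
	have m: "(%p. ?H (fst p) (snd p)) \<in> borel_measurable (lborel \<Otimes>\<^sub>M lborel)" by measurable
	have int: "integrable (lborel \<Otimes>\<^sub>M lborel) (%(x, y). ?H x y)"
		unfolding split_beta'
	proof (rule integrableI_bounded[OF m])
		have "(\<integral>\<^sup>+p. ennreal (norm (?H (fst p) (snd p))) \<partial>(lborel \<Otimes>\<^sub>M lborel))
				<= (\<integral>\<^sup>+p. (ennreal \<bar>s (fst p)\<bar> * ennreal \<bar>f (snd p)\<bar>) * ennreal \<bar>B / d ^ 3\<bar> \<partial>(lborel \<Otimes>\<^sub>M lborel))"
		proof (rule nn_integral_mono)
			fix p
			have "\<bar>?H (fst p) (snd p)\<bar> <= (\<bar>s (fst p)\<bar> * \<bar>f (snd p)\<bar>) * \<bar>B / d ^ 3\<bar>"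
				unfolding abs_mult mult.assoc by (intro mult_left_mono KB) auto
			then show "ennreal (norm (?H (fst p) (snd p))) <= (ennreal \<bar>s (fst p)\<bar> * ennreal \<bar>f (snd p)\<bar>) * ennreal \<bar>B / d ^ 3\<bar>"
				by (simp add: ennreal_mult'[symmetric] ennreal_leI)
		qed
		also have "... = (\<integral>\<^sup>+x. \<integral>\<^sup>+y. (ennreal \<bar>s x\<bar> * ennreal \<bar>f y\<bar>) * ennreal \<bar>B / d ^ 3\<bar> \<partial>lborel \<partial>lborel)"
		proof -
			have "(%p. (ennreal \<bar>s (fst p)\<bar> * ennreal \<bar>f (snd p)\<bar>) * ennreal \<bar>B / d ^ 3\<bar>) \<in> borel_measurable (lborel \<Otimes>\<^sub>M lborel)"
				by measurable
			from lborel.nn_integral_fst[OF this] show ?thesis by simp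
		qed
		also have "... = (\<integral>\<^sup>+x. ennreal \<bar>s x\<bar> * ((\<integral>\<^sup>+y. ennreal \<bar>f y\<bar> \<partial>lborel) * ennreal \<bar>B / d ^ 3\<bar>) \<partial>lborel)"
			by (intro nn_integral_cong) (simp add: nn_integral_cmult nn_integral_multc mult.assoc)
		also have "... = (\<integral>\<^sup>+x. ennreal \<bar>s x\<bar> \<partial>lborel) * ((\<integral>\<^sup>+y. ennreal \<bar>f y\<bar> \<partial>lborel) * ennreal \<bar>B / d ^ 3\<bar>)"
			by (intro nn_integral_multc) measurable
		also have "... < \<infinity>"
			using s f by (simp add: integrable_iff_bounded ennreal_mult_less_top)
		finally show "(\<integral>\<^sup>+p. ennreal (norm (?H (fst p) (snd p))) \<partial>(lborel \<Otimes>\<^sub>M lborel)) < \<infinity>" .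
	qed
	have "(LINT x|lborel. s x * conv d k f x) = (LINT x|lborel. LINT y|lborel. ?H x y)"
		unfolding conv_def by simp
	also have "... = (LINT y|lborel. LINT x|lborel. ?H x y)" by (rule lborel_pair.Fubini_integral[OF int, symmetric])
	also have "... = (LINT y|lborel. LINT x|lborel. f y * (s x * (k ((x - y) /\<^sub>R d) / d ^ 3)))"
		by (intro LINT_cong refl) (simp add: mult_ac)
	also have "... = (LINT y|lborel. f y * (LINT x|lborel. s x * (k ((x - y) /\<^sub>R d) / d ^ 3)))"
		unfolding integral_mult_right_zero ..
	finally show ?thesis .
qed

text \<open>\<open>K\<close> bounds the variation in each coordinate direction separately, which is
  the source of the factors 3 below. Extension by zero makes \<open>ch\<close> available to
  convolutions.\<close>

locale bv_phase =
	fixes ch :: "real ^ 3 \<Rightarrow> real" and K :: real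
	assumes chm: "ch \<in> borelf" and ch0: "x \<notin> Omega ==> ch x = 0" and ch1: "x \<in> Omega ==> ch x = 1 \<or> ch x = - 1"
		and K0: "0 <= K" and tv: "\<psi> \<in> C1_compact Omega ==> (\<And>x. \<bar>\<psi> x\<bar> <= 1) ==> (LINT x|Q. ch x * partial_deriv i \<psi> x) <= K"
begin

lemma ch_bound: "\<bar>ch x\<bar> <= 1" using ch0[of x] ch1[of x] by (cases "x \<in> Omega") auto

lemma L: "L2z ch" by (rule L2z_bounded[OF chm ch_bound ch0])

text \<open>Duality: Fubini moves the mollifier from \<open>ch\<close> to the sign of the gradient,
  and the mollified sign is an admissible test function because r + d < 1. The sign is reversed
  since \<open>deta i\<close> is odd.\<close>

lemma gradient_bound:
	assumes d: "0 < d" "r + d < 1"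
	shows "(\<integral>\<^sup>+x. ennreal (indicator (cube r) x * \<bar>conv d (deta i) ch x / d\<bar>) \<partial>lborel) <= ennreal K"
proof -
	let ?G = "%x. conv d (deta i) ch x / d"
	have Gm[measurable]: "conv d (deta i) ch \<in> borelf" by (intro conv_measurable kern_eta chm)
	define s where "s x = indicator (cube r) x * sgn (?G x)" for x
	have [measurable]: "s \<in> borelf" unfolding s_def[abs_def] by measurable
	have s1: "\<bar>s x\<bar> <= 1" for x by (auto simp: s_def indicator_def sgn_if)
	have s0: "s x = 0" if "x \<notin> cube r" for x using that by (simp add: s_def)
	have sL: "L2z s" using s1 s0 cube_Omega[of r] d by (intro L2z_bounded[of _ 1]) auto
	have nsL: "L2z (%x. - s x)" using s1 s0 cube_Omega[of r] d by (intro L2z_bounded[of _ 1]) auto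
	define \<psi> where "\<psi> = conv d eta (%x. - s x)"
	have \<psi>C: "\<psi> \<in> C1_compact Omega"
		unfolding \<psi>_def using d by (intro C1_compact_C1fun[OF C1fun_conv[OF L2zD(7)[OF nsL] d(1)], of "r + d"] conv_outside[of r] kern_eta) (auto simp: s0)
	have \<psi>1: "\<bar>\<psi> x\<bar> <= 1" for x unfolding \<psi>_def using s1 by (intro conv_bound L2zD(7)[OF nsL] d) simp
	have pd: "partial_deriv i \<psi> y = (LINT x|lborel. s x * (deta i ((x - y) /\<^sub>R d) / d ^ 3)) / d" for y
	proof -
		have "deta i ((y - x) /\<^sub>R d) = - deta i ((x - y) /\<^sub>R d)" for x
			using eta_minus(2)[of i "(x - y) /\<^sub>R d"] by (simp add: scaleR_right_diff_distrib)
		then show ?thesis unfolding \<psi>_def partial_deriv_conv[OF L2zD(7)[OF nsL] d(1)] conv_def by simp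
	qed
	have "(LINT x|lborel. s x * conv d (deta i) ch x) / d = (LINT y|lborel. ch y * partial_deriv i \<psi> y)"
		unfolding conv_Fubini[OF kern_eta(2) L2zD(7)[OF sL] L2zD(7)[OF L]] pd by simp
	also have "... = (LINT y|Q. ch y * partial_deriv i \<psi> y)" by (rule Q_lborel(2)[symmetric]) (simp add: ch0)
	also have "... <= K" by (rule tv[OF \<psi>C \<psi>1])
	finally have le: "(LINT x|lborel. s x * conv d (deta i) ch x) / d <= K" .
	have e: "indicator (cube r) x * \<bar>?G x\<bar> = s x * conv d (deta i) ch x / d" for x
		using d by (simp add: s_def abs_sgn[of "conv d (deta i) ch x"] mult.commute)
	have "integrable lborel (%x. s x * conv d (deta i) ch x)"
		by (intro cauchy_schwarz_integral(1) L2zD(4)[OF sL] conv_L2_bound(1) kern_eta chm L2zD(4)[OF L] d) (auto simp: Gm)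
	then have i: "integrable lborel (%x. indicator (cube r) x * \<bar>?G x\<bar>)" unfolding e by simp
	have "(\<integral>\<^sup>+x. ennreal (indicator (cube r) x * \<bar>?G x\<bar>) \<partial>lborel) = ennreal (LINT x|lborel. indicator (cube r) x * \<bar>?G x\<bar>)"
		using i by (intro nn_integral_eq_integral) auto
	also have "... <= ennreal K" unfolding e using le by (intro ennreal_leI) simp
	finally show ?thesis .
qed

lemma cube_add: "x \<in> cube r ==> norm w <= d ==> x + w \<in> cube (r + d)"
	using cube_near[of x r "x + w" d] by simp

text \<open>The fundamental theorem along the segment from x to x + w, followed by Fubini and
  translation invariance. The segment stays in \<open>cube (3 / 4)\<close>, where the gradient bound
  applies.\<close>

lemma translation_smooth:
	assumes d: "0 < d" "d < 1 / 8" and w: "norm w <= 1 / 4"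
	shows "(\<integral>\<^sup>+x. ennreal (indicator (cube (1 / 2)) x * \<bar>conv d eta ch (x + w) - conv d eta ch x\<bar>) \<partial>lborel) <= ennreal (3 * norm w * K)"
proof -
	let ?g = "conv d eta ch" and ?G = "%i x. conv d (deta i) ch x / d" and ?A = "cube (1 / 2)"
	have C: "C1fun ?g" by (intro C1fun_conv L2zD(7)[OF L] d)
	have pd: "partial_deriv i ?g = ?G i" for i by (intro ext partial_deriv_conv L2zD(7)[OF L] d)
	have Gm[measurable]: "conv d (deta i) ch \<in> borelf" for i by (intro conv_measurable kern_eta chm)
	define I where "I t x = (\<Sum>i\<in>UNIV. ennreal \<bar>w $ i\<bar> * ennreal (indicator ?A x * \<bar>?G i (x + t *\<^sub>R w)\<bar>))" for t x
	have Im: "(%p. I (fst p) (snd p) * indicator {0..1} (fst p)) \<in> borel_measurable (borel \<Otimes>\<^sub>M borel)"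
		unfolding I_def by measurable
	have pt: "ennreal (indicator ?A x * \<bar>?g (x + w) - ?g x\<bar>) <= (\<integral>\<^sup>+t. I t x * indicator {0..1} t \<partial>lborel)" for x
	proof (cases "x \<in> ?A")
		case True
		let ?w' = "%t. \<Sum>i\<in>UNIV. w $ i * ?G i (x + t *\<^sub>R w)"
		have der: "((%t. ?g (x + t *\<^sub>R w)) has_real_derivative ?w' t) (at t)" for t
			using C1fun_direction[OF C, of x w t] unfolding pd .
		have cont: "continuous_on UNIV ?w'"
		proof (intro continuous_on_sum continuous_on_mult continuous_on_const)
			fix i
			have "continuous_on UNIV (?G i)" using C1fun_continuous_deriv[OF C, of i] unfolding pd .
			moreover have "continuous_on UNIV (%t. x + t *\<^sub>R w)" by (intro continuous_intros)
			ultimately show "continuous_on UNIV (%t. ?G i (x + t *\<^sub>R w))" by (rule continuous_on_compose2) simp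
		qed
		have "(LINT t|lborel. ?w' t * indicator {0..1} t) = ?g (x + 1 *\<^sub>R w) - ?g (x + 0 *\<^sub>R w)"
			using der cont by (intro integral_FTC_Icc_real) (auto simp: continuous_on_eq_continuous_at)
		then have "ennreal \<bar>?g (x + w) - ?g x\<bar> = ennreal (norm (LINT t|lborel. ?w' t * indicator {0..1} t))" by simp
		also have "... <= (\<integral>\<^sup>+t. ennreal (norm (?w' t * indicator {0..1} t)) \<partial>lborel)"
		\<comment> \<open>In the non-integrable case the Bochner integral is 0 by convention and the bound
		  is trivial.\<close>
		proof (cases "integrable lborel (%t. ?w' t * indicator {0..1} t)")
			case True
			then show ?thesis by (rule integral_norm_bound_ennreal)
		next
			case False
			then show ?thesis by (simp add: not_integrable_integral_eq)
		qed
		also have "... <= (\<integral>\<^sup>+t. I t x * indicator {0..1} t \<partial>lborel)"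
		proof (rule nn_integral_mono)
			fix t
			have "\<bar>?w' t\<bar> <= (\<Sum>i\<in>UNIV. \<bar>w $ i\<bar> * \<bar>?G i (x + t *\<^sub>R w)\<bar>)"
				unfolding abs_mult[symmetric] by (rule sum_abs)
			then have "ennreal \<bar>?w' t\<bar> <= ennreal (\<Sum>i\<in>UNIV. \<bar>w $ i\<bar> * \<bar>?G i (x + t *\<^sub>R w)\<bar>)" by (rule ennreal_leI)
			also have "... = (\<Sum>i\<in>UNIV. ennreal (\<bar>w $ i\<bar> * \<bar>?G i (x + t *\<^sub>R w)\<bar>))" by (intro sum_ennreal[symmetric] mult_nonneg_nonneg abs_ge_zero)
			also have "... = I t x" unfolding I_def using True by (intro sum.cong refl) (simp only: ennreal_mult'[OF abs_ge_zero] indicator_simps mult_1)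
			finally have "ennreal \<bar>?w' t\<bar> <= I t x" .
			then show "ennreal (norm (?w' t * indicator {0..1} t)) <= I t x * indicator {0..1} t"
				by (cases "t \<in> {0..1}") (simp_all del: sum_abs)
		qed
		finally show ?thesis using True by simp
	qed simp
	have "(\<integral>\<^sup>+x. ennreal (indicator ?A x * \<bar>?g (x + w) - ?g x\<bar>) \<partial>lborel) <= (\<integral>\<^sup>+x. \<integral>\<^sup>+t. I t x * indicator {0..1} t \<partial>lborel \<partial>lborel)"
		by (intro nn_integral_mono pt)
	also have "... = (\<integral>\<^sup>+t. \<integral>\<^sup>+x. I t x * indicator {0..1} t \<partial>lborel \<partial>lborel)"
		using Im by (intro lborel_pair.Fubini') (simp add: split_beta')
	also have "... <= (\<integral>\<^sup>+t. ennreal (3 * norm w * K) * indicator {0..1 :: real} t \<partial>lborel)"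
	proof (rule nn_integral_mono)
		fix t :: real
		show "(\<integral>\<^sup>+x. I t x * indicator {0..1} t \<partial>lborel) <= ennreal (3 * norm w * K) * indicator {0..1} t"
		proof (cases "t \<in> {0..1}")
			case True
			have "(\<integral>\<^sup>+x. I t x \<partial>lborel) = (\<Sum>i\<in>UNIV. ennreal \<bar>w $ i\<bar> * (\<integral>\<^sup>+x. ennreal (indicator ?A x * \<bar>?G i (x + t *\<^sub>R w)\<bar>) \<partial>lborel))"
				unfolding I_def by (subst nn_integral_sum) (measurable, simp add: nn_integral_cmult)
			also have "... <= (\<Sum>i\<in>(UNIV :: 3 set). ennreal (norm w) * ennreal K)"
			proof (intro sum_mono mult_mono ennreal_leI component_le_norm_cart)
				fix i
				have tw: "norm (t *\<^sub>R w) <= 1 / 4" using True w mult_left_le_one_le[of "norm w" t] by simp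
				have "(\<integral>\<^sup>+x. ennreal (indicator ?A x * \<bar>?G i (x + t *\<^sub>R w)\<bar>) \<partial>lborel)
					<= (\<integral>\<^sup>+x. ennreal (indicator (cube (3 / 4)) (x + t *\<^sub>R w) * \<bar>?G i (x + t *\<^sub>R w)\<bar>) \<partial>lborel)"
					using cube_add[of _ "1 / 2" "t *\<^sub>R w" "1 / 4"] tw by (intro nn_integral_mono ennreal_leI mult_right_mono) (auto simp: indicator_def)
				also have "... = (\<integral>\<^sup>+x. ennreal (indicator (cube (3 / 4)) x * \<bar>?G i x\<bar>) \<partial>lborel)"
					by (rule nn_integral_translate[of "%x. ennreal (indicator (cube (3 / 4)) x * \<bar>?G i x\<bar>)"]) measurable
				also have "... <= ennreal K" using d by (intro gradient_bound) auto
				finally show "(\<integral>\<^sup>+x. ennreal (indicator ?A x * \<bar>?G i (x + t *\<^sub>R w)\<bar>) \<partial>lborel) <= ennreal K" .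
			qed auto
			also have "... = ennreal (3 * norm w * K)" using K0 by (simp add: ennreal_mult' mult.assoc)
			finally show ?thesis using True by simp
		qed simp
	qed
	also have "... = ennreal (3 * norm w * K)" by (subst nn_integral_cmult) auto
	finally show ?thesis .
qed

text \<open>The bound for the mollified phase is independent of the radius, and the mollified phases
  tend to \<open>ch\<close> in L^1 on \<open>cube (3 / 4)\<close>.\<close>

lemma translation:
	assumes w: "norm w <= 1 / 4"
	shows "(LINT x|lborel. indicator (cube (1 / 2)) x * \<bar>ch (x + w) - ch x\<bar>) <= 3 * norm w * K"
proof -
	let ?A = "cube (1 / 2)" and ?B = "cube (3 / 4)"
	define d where "d n = (1 / 16) * (1 / real (Suc n))" for n
	have d: "0 < d n" for n by (simp add: d_def)
	have d2: "d n <= 1 / 16" for n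
	proof -
		have "1 / real (Suc n) <= 1" by simp
		then show ?thesis unfolding d_def by linarith
	qed
	have "(%n. 1 / real (Suc n)) \<longlonglongrightarrow> 0" using LIMSEQ_inverse_real_of_nat by (simp add: inverse_eq_divide)
	from tendsto_mult_right_zero[OF this, of "1 / 16"] have d0: "d \<longlonglongrightarrow> 0" by (simp only: d_def[abs_def])
	define g where "g n = conv (d n) eta ch" for n
	have gm[measurable]: "g n \<in> borelf" for n unfolding g_def by (intro conv_measurable kern_eta chm)
	have g1: "\<bar>g n x\<bar> <= 1" for n x unfolding g_def by (intro conv_bound L2zD(7)[OF L] d ch_bound)
	note chm[measurable]
	have BO: "?B \<subseteq> Omega" by (rule cube_Omega) simp
	have lim: "(%n. LINT x|Q. indicator ?B x * (conv (d n) eta ch (1 *\<^sub>R x) - ch x)\<^sup>2) \<longlonglongrightarrow> 0"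
	proof (rule conv_L2_tendsto[OF L d d0])
		fix n x y assume "x \<in> ?B" "norm (1 *\<^sub>R x - y) < d n"
		then have "y \<in> cube (3 / 4 + d n)" using cube_near[of x "3 / 4" y "d n"] by simp
		then show "y \<in> Omega" using cube_Omega[of "3 / 4 + d n"] d2[of n] by auto
	qed (use BO in auto)
	define E where "E n = (LINT x|Q. indicator ?B x * (g n x - ch x)\<^sup>2)" for n
	have E0: "E \<longlonglongrightarrow> 0" using lim by (simp add: E_def[abs_def] g_def)
	let ?b = "%n x. indicator ?B x * \<bar>g n x - ch x\<bar> :: real"
	have bb: "bB (?b n)" for n
	proof -
		have "\<bar>g n x - ch x\<bar> <= 2" for x using g1[of n x] ch_bound[of x] by linarith
		then show ?thesis by (auto simp: bB_def indicator_def intro!: exI[of _ 2])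
	qed
	have bz: "?b n x = 0" if "x \<notin> Omega" for n x using that BO by (auto simp: indicator_def)
	have ib: "integrable lborel (?b n)" for n by (rule iffD1[OF Q_lborel(1)[OF bz] bB_integrable[OF bb]])
	have b: "(LINT x|lborel. ?b n x) <= sqrt (8 * E n)" for n
	proof -
		have "(LINT x|Q. \<bar>?b n x\<bar>)\<^sup>2 <= 8 * (LINT x|Q. (?b n x)\<^sup>2)"
			using Q.L2_imp_L1(3)[OF bB_measurable_Q[OF bb] bB_integrable[OF bB_power[OF bb]]] by simp
		also have "(LINT x|Q. (?b n x)\<^sup>2) = E n" unfolding E_def
			by (intro LINT_cong) (auto simp: indicator_def)
		finally have "(LINT x|Q. \<bar>?b n x\<bar>) <= sqrt (8 * E n)" by (rule real_le_rsqrt)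
		moreover have "(LINT x|Q. ?b n x) = (LINT x|lborel. ?b n x)" by (rule Q_lborel(2)[OF bz])
		ultimately show ?thesis by simp
	qed
	have le: "(LINT x|lborel. indicator ?A x * \<bar>ch (x + w) - ch x\<bar>) <= 3 * norm w * K + 2 * sqrt (8 * E n)" for n
	proof -
		let ?t = "%x. indicator ?A x * \<bar>g n (x + w) - g n x\<bar>"
		have tn: "(\<integral>\<^sup>+x. ennreal (?t x) \<partial>lborel) <= ennreal (3 * norm w * K)"
			unfolding g_def using d2[of n] by (intro translation_smooth d w) auto
		then have it: "integrable lborel ?t"
			by (intro integrableI_nonneg) (auto simp: top.not_eq_extremum ennreal_less_top intro: le_less_trans)
		have t: "(LINT x|lborel. ?t x) <= 3 * norm w * K"
			using tn it K0 by (subst (asm) nn_integral_eq_integral) (auto simp: ennreal_le_iff)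
		have bm: "?b n \<in> borelf" by measurable
		note sh = integral_translate[OF bm, of w]
		have "(LINT x|lborel. indicator ?A x * \<bar>ch (x + w) - ch x\<bar>) <= (LINT x|lborel. ?t x + ?b n (x + w) + ?b n x)"
		proof (rule integral_mono_AE')
			show "integrable lborel (%x. ?t x + ?b n (x + w) + ?b n x)" using it ib sh(2) by simp
			show "AE x in lborel. indicator ?A x * \<bar>ch (x + w) - ch x\<bar> <= ?t x + ?b n (x + w) + ?b n x"
			proof (rule AE_I2)
				fix x
				show "indicator ?A x * \<bar>ch (x + w) - ch x\<bar> <= ?t x + ?b n (x + w) + ?b n x"
				proof (cases "x \<in> ?A")
					case True
					then have "x + w \<in> ?B" "x \<in> ?B" using cube_add[OF True w] cube_mono[of "1 / 2" "3 / 4" x] by simp_all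
					then show ?thesis using True by simp
				qed (simp add: indicator_def)
			qed
		qed auto
		also have "... = (LINT x|lborel. ?t x) + (LINT x|lborel. ?b n x) + (LINT x|lborel. ?b n x)"
			using it ib sh by simp
		finally show ?thesis using t b[of n] by linarith
	qed
	have "(%n. 3 * norm w * K + 2 * sqrt (8 * E n)) \<longlonglongrightarrow> 3 * norm w * K + 2 * sqrt (8 * 0)"
		by (intro tendsto_intros E0)
	then have "(LINT x|lborel. indicator ?A x * \<bar>ch (x + w) - ch x\<bar>) <= 3 * norm w * K + 2 * sqrt (8 * 0)"
		using le by (intro LIMSEQ_le_const) auto
	then show ?thesis by simp
qed

text \<open>The mollification error is an average of translation differences over shifts shorter
  than \<open>h\<close>, each of which is bounded by the translation estimate.\<close>

lemma mollification:
	assumes h: "0 < h" "h <= 1 / 4"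
	shows "(LINT x|lborel. indicator (cube (1 / 2)) x * \<bar>conv h eta ch x - ch x\<bar>) <= 3 * h * K"
		"integrable lborel (%x. indicator (cube (1 / 2)) x * \<bar>conv h eta ch x - ch x\<bar>)"
proof -
	let ?A = "cube (1 / 2)"
	define k where "k w = eta (w /\<^sub>R h) / h ^ 3" for w
	note chm[measurable] kern_measurable[OF kern_eta(1), measurable]
	have km[measurable]: "k \<in> borelf" unfolding k_def[abs_def] by measurable
	have k0: "0 <= k w" for w using h eta_nonneg by (simp add: k_def)
	have kz: "k w = 0" if "h <= norm w" for w
	proof -
		have "1 <= norm (w /\<^sub>R h)" using that h by (simp add: divide_simps)
		then show ?thesis using kern_eta(1) by (simp add: k_def kern_def)
	qed
	have knn: "(\<integral>\<^sup>+w. ennreal (k w) \<partial>lborel) = 1"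
		using kern_abs_nn(2)[OF kern_eta(1) h(1), of 0] integral_eta eta_nonneg k0 h by (simp add: k_def abs_of_nonneg)
	have ki: "integrable lborel k" "(LINT w|lborel. k w) = 1"
	proof -
		show "integrable lborel k" using knn k0 by (intro integrableI_nonneg) auto
		show "(LINT w|lborel. k w) = 1" using knn k0 by (subst integral_eq_nn_integral) auto
	qed
	let ?R = "%x w. ennreal (indicator ?A x * (k w * \<bar>ch (x + w) - ch x\<bar>))"
	have cv: "conv h eta ch x = (LINT w|lborel. ch (x + w) * k w)" for x
	proof -
		have m: "(%y. ch y * (eta ((x - y) /\<^sub>R h) / h ^ 3)) \<in> borelf" by measurable
		have e: "(x - (w + x)) /\<^sub>R h = - (w /\<^sub>R h)" for w by (simp add: algebra_simps)
		show ?thesis unfolding conv_def integral_translate(1)[OF m, of x, symmetric] e eta_minus k_def by (simp add: add.commute)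
	qed
	have ic: "integrable lborel (%w. ch (x + w) * k w)" for x
		by (rule LI_bound[OF ki(1)]) (use ch_bound k0 in \<open>auto intro!: AE_I2 mult_left_le_one_le simp: abs_mult\<close>)
	have pt: "ennreal (indicator ?A x * \<bar>conv h eta ch x - ch x\<bar>) <= (\<integral>\<^sup>+w. ?R x w \<partial>lborel)" for x
	proof (cases "x \<in> ?A")
		case True
		have i: "integrable lborel (%w. k w * (ch (x + w) - ch x))"
			using ic[of x] ki(1) by (simp add: right_diff_distrib mult.commute)
		have "conv h eta ch x - ch x = (LINT w|lborel. k w * (ch (x + w) - ch x))"
			unfolding cv right_diff_distrib using ic[of x] ki by (simp add: mult.commute)
		then have "ennreal \<bar>conv h eta ch x - ch x\<bar> <= (\<integral>\<^sup>+w. ennreal (norm (k w * (ch (x + w) - ch x))) \<partial>lborel)"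
			using integral_norm_bound_ennreal[OF i] by simp
		then show ?thesis using True k0 by (simp add: abs_mult)
	qed simp
	have "(\<integral>\<^sup>+x. ennreal (indicator ?A x * \<bar>conv h eta ch x - ch x\<bar>) \<partial>lborel) <= (\<integral>\<^sup>+x. \<integral>\<^sup>+w. ?R x w \<partial>lborel \<partial>lborel)"
		by (intro nn_integral_mono pt)
	also have "... = (\<integral>\<^sup>+w. \<integral>\<^sup>+x. ?R x w \<partial>lborel \<partial>lborel)"
		by (rule lborel_pair.Fubini'[symmetric]) measurable
	also have "... <= (\<integral>\<^sup>+w. ennreal (k w) * ennreal (3 * h * K) \<partial>lborel)"
	proof (rule nn_integral_mono)
		fix w
		show "(\<integral>\<^sup>+x. ?R x w \<partial>lborel) <= ennreal (k w) * ennreal (3 * h * K)"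
		proof (cases "norm w < h")
			case True
			have w: "norm w <= 1 / 4" using True h by simp
			let ?t = "%x. indicator ?A x * \<bar>ch (x + w) - ch x\<bar>"
			have it: "integrable lborel ?t"
			proof (rule integrableI_bounded_set[of ?A _ _ 2])
				show "AE x in lborel. x \<in> ?A \<longrightarrow> norm (?t x) <= 2"
				proof (rule AE_I2)
					fix x have "\<bar>ch (x + w) - ch x\<bar> <= 2" using ch_bound[of "x + w"] ch_bound[of x] by linarith
					then show "x \<in> ?A \<longrightarrow> norm (?t x) <= 2" by simp
				qed
				show "emeasure lborel ?A < \<infinity>" by (rule emeasure_bounded_finite) (simp add: cube_cbox)
			qed (auto intro!: AE_I2)
			have "(\<integral>\<^sup>+x. ?R x w \<partial>lborel) = (\<integral>\<^sup>+x. ennreal (k w) * ennreal (?t x) \<partial>lborel)"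
				using k0 by (intro nn_integral_cong) (simp add: ennreal_mult'[symmetric] mult_ac)
			also have "... = ennreal (k w) * (\<integral>\<^sup>+x. ennreal (?t x) \<partial>lborel)" by (intro nn_integral_cmult) measurable
			also have "(\<integral>\<^sup>+x. ennreal (?t x) \<partial>lborel) = ennreal (LINT x|lborel. ?t x)" by (intro nn_integral_eq_integral it) auto
			also have "(LINT x|lborel. ?t x) <= 3 * h * K"
			proof -
				have "3 * norm w * K <= 3 * h * K" using True K0 by (intro mult_right_mono) auto
				then show ?thesis using translation[OF w] by linarith
			qed
			finally show ?thesis by (simp add: mult_left_mono ennreal_leI)
		next
			case False
			then have "k w = 0" by (intro kz) simp
			then show ?thesis by simp
		qed
	qed
	also have "... = ennreal (3 * h * K)" by (subst nn_integral_multc) (auto simp: knn)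
	finally have main: "(\<integral>\<^sup>+x. ennreal (indicator ?A x * \<bar>conv h eta ch x - ch x\<bar>) \<partial>lborel) <= ennreal (3 * h * K)" .
	have cm[measurable]: "conv h eta ch \<in> borelf" by (intro conv_measurable kern_eta chm)
	show i: "integrable lborel (%x. indicator ?A x * \<bar>conv h eta ch x - ch x\<bar>)"
		using main by (intro integrableI_nonneg) (auto simp: top.not_eq_extremum ennreal_less_top intro: le_less_trans)
	show "(LINT x|lborel. indicator ?A x * \<bar>conv h eta ch x - ch x\<bar>) <= 3 * h * K"
		using main i K0 h by (subst (asm) nn_integral_eq_integral) (auto simp: ennreal_le_iff)
qed

end

lemma conv_D2:
	assumes k: "kern k" and f: "integrable lborel f"
	shows "D2 (conv d k f) x = conv d k (D2 f) x"
proof -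
	have fm[measurable]: "f \<in> borelf" using borel_measurable_integrable[OF f] by simp
	note [measurable] = kern_measurable[OF k]
	let ?w = "%y. k ((x - y) /\<^sub>R d) / d ^ 3"
	have tr: "conv d k f (x + c) = (LINT y|lborel. f (y + c) * ?w y)" for c
	proof -
		have m: "(%y. f y * (k ((x + c - y) /\<^sub>R d) / d ^ 3)) \<in> borelf" by measurable
		show ?thesis unfolding conv_def integral_translate(1)[OF m, of c, symmetric] by simp
	qed
	have sh: "integrable lborel (%y. f (y + c) * ?w y)" for c
		using conv_integrable[OF k iffD2[OF integral_translate(2)[OF fm, of c] f]] .
	have "conv d k (D2 f) x = (LINT y|lborel. (f (y + e4) * ?w y - 2 * (f y * ?w y)) + f (y + - e4) * ?w y)"
		unfolding conv_def D2_def by (intro LINT_cong refl) (simp add: algebra_simps)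
	also have "... = (LINT y|lborel. f (y + e4) * ?w y) - 2 * (LINT y|lborel. f y * ?w y) + (LINT y|lborel. f (y + - e4) * ?w y)"
	proof -
		have i: "integrable lborel (%y. f (y + e4) * ?w y - 2 * (f y * ?w y))"
			by (rule LI_diff[OF sh integrable_mult_right[OF conv_integrable[OF k f]]])
		show ?thesis
			unfolding LINT_add[OF i sh] LINT_diff[OF sh integrable_mult_right[OF conv_integrable[OF k f]]]
			by (simp only: integral_mult_right_zero)
	qed
	also have "... = D2 (conv d k f) x"
		using tr[of e4] tr[of "- e4"] tr[of 0] by (simp add: D2_def)
	finally show ?thesis by simp
qed

lemma conv_cong_near:
	assumes k: "kern k" and d: "0 < d" and e: "\<And>y. norm (x - y) < d ==> f y = g y"
	shows "conv d k f x = conv d k g x"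
	unfolding conv_def
proof (intro LINT_cong refl)
	fix y
	show "f y * (k ((x - y) /\<^sub>R d) / d ^ 3) = g y * (k ((x - y) /\<^sub>R d) / d ^ 3)"
	proof (cases "norm (x - y) < d")
		case False
		then have "1 <= norm ((x - y) /\<^sub>R d)" using d by (simp add: divide_simps)
		then have "k ((x - y) /\<^sub>R d) = 0" using k by (simp add: kern_def)
		then show ?thesis by simp
	qed (simp add: e)
qed

text \<open>If a and b differ, then |a - b| = 2 and |a - 2 b + c| >= 2. So either |A - 2 B + C| >= 1
  or the weighted approximation error exceeds 1, and in both cases the right side is at least
  2.\<close>

lemma phase_jump_bound:
	fixes a b c A B C :: real
	assumes "a = 1 \<or> a = - 1" "b = 1 \<or> b = - 1" "c = 1 \<or> c = - 1"
	shows "\<bar>a - b\<bar> <= 2 * (A - 2 * B + C)\<^sup>2 + 2 * (\<bar>A - a\<bar> + 2 * \<bar>B - b\<bar> + \<bar>C - c\<bar>)"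
proof -
	define P where "P = (A - 2 * B + C)\<^sup>2"
	have "0 <= P" by (simp add: P_def)
	moreover have "1 <= P" if "1 <= \<bar>A - 2 * B + C\<bar>"
		using that abs_le_square_iff[of 1 "A - 2 * B + C"] by (simp add: P_def)
	ultimately show ?thesis using assms unfolding P_def[symmetric] by (smt (verit))
qed

section \<open>The phase estimate: second differences of displacements against mollified
  phases\<close>

definition snorm :: "(3 \<Rightarrow> real ^ 3 \<Rightarrow> real) \<Rightarrow> (3 \<Rightarrow> real ^ 3 \<Rightarrow> real) \<Rightarrow> (3 \<Rightarrow> real ^ 3 \<Rightarrow> real) \<Rightarrow> real" where
	"snorm p1 p2 p3 = nrm (p1 1) + nrm (p2 2) + nrm (p3 3) + nrm (%x. p1 2 x + p2 1 x) + nrm (%x. p1 3 x + p3 1 x)"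

lemma nrm_nonneg: "0 <= nrm f" by (simp add: nrm_def)

definition kd :: real where "kd = (\<Sum>i\<in>UNIV. LINT z|lborel. \<bar>deta i z\<bar>)"

lemma conv_deta_L2:
	assumes f: "f \<in> borelf" "integrable lborel (%x. (f x)\<^sup>2)" and h: "0 < h"
	shows "(LINT x|lborel. (conv h (deta i) f x)\<^sup>2) <= kd\<^sup>2 * (LINT x|lborel. (f x)\<^sup>2)"
proof -
	have "(LINT z|lborel. \<bar>deta i z\<bar>) <= kd" unfolding kd_def by (rule member_le_sum) auto
	then have "(LINT z|lborel. \<bar>deta i z\<bar>)\<^sup>2 <= kd\<^sup>2" by (intro power_mono) auto
	then have "(LINT z|lborel. \<bar>deta i z\<bar>)\<^sup>2 * (LINT x|lborel. (f x)\<^sup>2) <= kd\<^sup>2 * (LINT x|lborel. (f x)\<^sup>2)"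
		by (intro mult_right_mono) auto
	then show ?thesis using conv_L2_bound(2)[OF kern_eta(2) f h, of i] by linarith
qed

context bv_phase
begin

text \<open>\<open>kap\<close> is 16/3 times an x_1-difference of a bump of height at most 64,
  supported in \<open>cube (1 / 4)\<close>. Moving the difference to \<open>ch\<close> gives 2 *
  16/3 * 64 < 683.\<close>

lemma kap_bound:
	"\<bar>LINT x|Q. 2 * ch x * kap x\<bar> <= 683 * (LINT x|lborel. indicator (cube (1 / 4)) x * \<bar>ch (x + e4) - ch x\<bar>)"
proof -
	define Z where "Z x = ZZ (x $ 1) * (ZZ (x $ 2) * ZZ (x $ 3))" for x :: "real ^ 3"
	note chm[measurable]
	have Zc: "continuous_on UNIV Z" unfolding Z_def[abs_def] by (intro continuous_intros cont_ZZ)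
	have Zm[measurable]: "Z \<in> borelf" by (rule borel_measurable_continuous_onI[OF Zc])
	have Z64: "\<bar>Z x\<bar> <= 64" for x
	proof -
		have "\<bar>Z x\<bar> <= 4 * (4 * 4)" unfolding Z_def abs_mult by (intro mult_mono ZZ_bounds) auto
		then show ?thesis by simp
	qed
	have Z0: "Z x = 0" if "x \<notin> cube (1 / 4)" for x
	proof -
		have "\<exists>i. 1 / 4 < \<bar>x $ i\<bar>" using that unfolding cube_def by (simp add: not_le)
		then obtain i where "1 / 4 < \<bar>x $ i\<bar>" by blast
		then have "ZZ (x $ i) = 0" by (intro ZZ_outside) simp
		then show ?thesis using exhaust_3[of i] by (auto simp: Z_def)
	qed
	have kZ: "kap x = 16 / 3 * (Z x - Z (x - e4))" for x by (simp add: kap_def Z_def axis_def algebra_simps)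
	have bd: "\<bar>ch x * Z y\<bar> <= \<bar>64 * ch x\<bar>" for x y
		using mult_left_mono[OF Z64, of "\<bar>ch x\<bar>" y] by (simp add: abs_mult mult.commute)
	have i1: "integrable lborel (%x. ch x * Z x)"
		by (rule LI_bound[of _ "%x. 64 * ch x"]) (use L2zD(7)[OF L] bd in \<open>auto intro!: AE_I2\<close>)
	have i2: "integrable lborel (%x. ch x * Z (x - e4))"
		by (rule LI_bound[of _ "%x. 64 * ch x"]) (use L2zD(7)[OF L] bd in \<open>auto intro!: AE_I2\<close>)
	have m2: "(%x. ch x * Z (x - e4)) \<in> borelf" by measurable
	have t: "integrable lborel (%x. ch (x + e4) * Z x)" "(LINT x|lborel. ch (x + e4) * Z x) = (LINT x|lborel. ch x * Z (x - e4))"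
		using integral_translate[OF m2, of e4] i2 by simp_all
	let ?I = "%x. indicator (cube (1 / 4)) x * \<bar>ch (x + e4) - ch x\<bar> :: real"
	have bI: "bB ?I"
	proof -
		have "\<bar>?I x\<bar> <= 2" for x using ch_bound[of "x + e4"] ch_bound[of x] by (auto simp: indicator_def)
		then show ?thesis by (auto simp: bB_def)
	qed
	have I0: "?I x = 0" if "x \<notin> Omega" for x using that cube_Omega[of "1 / 4"] by (auto simp: indicator_def)
	have iI: "integrable lborel ?I" by (rule iffD1[OF Q_lborel(1)[OF I0] bB_integrable[OF bI]])
	have "(LINT x|Q. 2 * ch x * kap x) = (LINT x|lborel. 2 * ch x * kap x)" by (rule Q_lborel(2)) (simp add: ch0)
	also have "... = (LINT x|lborel. 32 / 3 * (ch x * Z x - ch x * Z (x - e4)))"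
		by (intro LINT_cong refl) (simp add: kZ algebra_simps)
	also have "... = 32 / 3 * ((LINT x|lborel. ch x * Z x) - (LINT x|lborel. ch (x + e4) * Z x))"
		using i1 i2 t by simp
	also have "... = 32 / 3 * (LINT x|lborel. ch x * Z x - ch (x + e4) * Z x)" using i1 t by simp
	finally have e: "(LINT x|Q. 2 * ch x * kap x) = 32 / 3 * (LINT x|lborel. ch x * Z x - ch (x + e4) * Z x)" .
	have "\<bar>LINT x|lborel. ch x * Z x - ch (x + e4) * Z x\<bar> <= (LINT x|lborel. \<bar>ch x * Z x - ch (x + e4) * Z x\<bar>)"
		by (rule integral_abs_bound)
	moreover have "(LINT x|lborel. \<bar>ch x * Z x - ch (x + e4) * Z x\<bar>) <= (LINT x|lborel. 64 * ?I x)"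
	proof (rule integral_mono)
		show "integrable lborel (%x. \<bar>ch x * Z x - ch (x + e4) * Z x\<bar>)" using i1 t by simp
		show "integrable lborel (%x. 64 * ?I x)" using iI by simp
		fix x
		have "\<bar>ch x * Z x - ch (x + e4) * Z x\<bar> = \<bar>Z x\<bar> * \<bar>ch (x + e4) - ch x\<bar>"
			by (simp add: left_diff_distrib[symmetric] abs_mult abs_minus_commute)
		also have "... <= 64 * ?I x"
			using mult_right_mono[OF Z64, of "\<bar>ch (x + e4) - ch x\<bar>" x] Z0[of x] by (cases "x \<in> cube (1 / 4)") auto
		finally show "\<bar>ch x * Z x - ch (x + e4) * Z x\<bar> <= 64 * ?I x" .
	qed
	moreover have "(LINT x|lborel. 64 * ?I x) = 64 * (LINT x|lborel. ?I x)" by (rule integral_mult_right_zero)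
	moreover have "0 <= (LINT x|lborel. ?I x)" by (intro LINT_nonneg) auto
	moreover have "\<bar>32 / 3 * X\<bar> <= 683 * I" if "\<bar>X\<bar> <= Y" "Y <= Z" "Z = 64 * I" "0 <= I" for X Y Z I :: real
		using that by (simp add: abs_mult)
	ultimately show ?thesis unfolding e by blast
qed

text \<open>The mollification errors at the three points have weights 2, 4 and 2, and each costs 3 h
  K, whence 24. Points of \<open>cube (1 / 4)\<close> stay in \<open>cube (1 / 2)\<close> under
  shifts by 1/4.\<close>

lemma jump_bound:
	assumes h: "0 < h" "h <= 1 / 4" and i: "integrable lborel (%x. indicator (cube (1 / 4)) x * (D2 (conv h eta ch) x)\<^sup>2)"
	shows "(LINT x|lborel. indicator (cube (1 / 4)) x * \<bar>ch (x + e4) - ch x\<bar>)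
		<= 2 * (LINT x|lborel. indicator (cube (1 / 4)) x * (D2 (conv h eta ch) x)\<^sup>2) + 24 * (h * K)"
proof -
	let ?g = "conv h eta ch" and ?A = "cube (1 / 4)" and ?b = "%x. indicator (cube (1 / 2)) x * \<bar>conv h eta ch x - ch x\<bar> :: real"
	note chm[measurable]
	have [measurable]: "?g \<in> borelf" by (intro conv_measurable kern_eta chm)
	have bm: "?b \<in> borelf" by measurable
	note b = mollification[OF h] integral_translate[OF bm, of e4] integral_translate[OF bm, of "- e4"]
	have "(LINT x|lborel. indicator ?A x * \<bar>ch (x + e4) - ch x\<bar>)
		<= (LINT x|lborel. 2 * (indicator ?A x * (D2 ?g x)\<^sup>2) + 2 * ?b (x + e4) + 4 * ?b x + 2 * ?b (x + - e4))"
	proof (rule integral_mono_AE')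
		show "integrable lborel (%x. 2 * (indicator ?A x * (D2 ?g x)\<^sup>2) + 2 * ?b (x + e4) + 4 * ?b x + 2 * ?b (x + - e4))"
			using i b by (intro LI_add integrable_mult_right) simp_all
		show "AE x in lborel. indicator ?A x * \<bar>ch (x + e4) - ch x\<bar>
				<= 2 * (indicator ?A x * (D2 ?g x)\<^sup>2) + 2 * ?b (x + e4) + 4 * ?b x + 2 * ?b (x + - e4)"
		proof (rule AE_I2)
			fix x
			show "indicator ?A x * \<bar>ch (x + e4) - ch x\<bar>
				<= 2 * (indicator ?A x * (D2 ?g x)\<^sup>2) + 2 * ?b (x + e4) + 4 * ?b x + 2 * ?b (x + - e4)"
			proof (cases "x \<in> ?A")
				case True
				have c: "x + e4 \<in> cube (1 / 2)" "x + - e4 \<in> cube (1 / 2)" "x \<in> cube (1 / 2)"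
					using cube_add[OF True, of e4 "1 / 4"] cube_add[OF True, of "- e4" "1 / 4"] cube_mono[OF _ True, of "1 / 2"] by simp_all
				have O: "x + e4 \<in> Omega" "x + - e4 \<in> Omega" "x \<in> Omega" using c cube_Omega[of "1 / 2"] by auto
				have "\<bar>ch (x + e4) - ch x\<bar> <= 2 * (?g (x + e4) - 2 * ?g x + ?g (x + - e4))\<^sup>2
					+ 2 * (\<bar>?g (x + e4) - ch (x + e4)\<bar> + 2 * \<bar>?g x - ch x\<bar> + \<bar>?g (x + - e4) - ch (x + - e4)\<bar>)"
					by (rule phase_jump_bound[OF ch1[OF O(1)] ch1[OF O(3)] ch1[OF O(2)]])
				then show ?thesis using True c unfolding D2_def by simp
			qed simp
		qed
	qed simp
	also have "... = 2 * (LINT x|lborel. indicator ?A x * (D2 ?g x)\<^sup>2) + 2 * (LINT x|lborel. ?b x) + 4 * (LINT x|lborel. ?b x) + 2 * (LINT x|lborel. ?b x)"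
	proof -
		have 1: "integrable lborel (%x. 2 * (indicator ?A x * (D2 ?g x)\<^sup>2))" "integrable lborel (%x. 2 * ?b (x + e4))"
			"integrable lborel (%x. 4 * ?b x)" "integrable lborel (%x. 2 * ?b (x + - e4))"
			using i b by (intro integrable_mult_right; simp)+
		show ?thesis
			unfolding LINT_add[OF LI_add[OF LI_add[OF 1(1,2)] 1(3)] 1(4)]
				LINT_add[OF LI_add[OF 1(1,2)] 1(3)] LINT_add[OF 1(1,2)]
				integral_mult_right_zero b(3) b(5) ..
	qed
	finally show ?thesis using b(1) by linarith
qed

text \<open>Twice the phase is \<partial>_3 u_2 + \<partial>_2 u_3, so the derivative can be put on
  the mollifier and the second difference on the displacements. As h <= 1/4, the mollifier at a
  point of \<open>cube (1 / 4)\<close> sees only \<open>cube (1 / 2)\<close>, where the second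
  differences are controlled.\<close>

lemma D2_conv_phase:
	assumes H: "H1 u2 p2" "H1 u3 p3" and ae: "AE x in Q. p2 3 x + p3 2 x = 2 * ch x"
		and h: "0 < h" "h <= 1 / 4" and x: "x \<in> cube (1 / 4)"
	shows "D2 (conv h eta ch) x = (conv h (deta 3) (%y. indicator (cube (1 / 2)) y * D2 u2 y) x
		+ conv h (deta 2) (%y. indicator (cube (1 / 2)) y * D2 u3 y) x) / (2 * h)"
proof -
	have L2: "L2z u2" "L2z (p2 i)" "L2z u3" "L2z (p3 i)" for i using H by (auto simp: H1_def)
	have g: "conv h eta ch z = (conv h (deta 3) u2 z + conv h (deta 2) u3 z) / (2 * h)" if z: "z \<in> cube (1 / 2)" for z
	proof -
		have near: "y \<in> cube (3 / 4)" if "norm (z - y) < h" for y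
			using cube_near[OF z, of y "1 / 4"] that h by simp
		have c: "conv h (deta 3) u2 z / h = conv h eta (p2 3) z" "conv h (deta 2) u3 z / h = conv h eta (p3 2) z"
			by (rule conv_weak_partial[OF H(1) h(1) near], assumption, simp, rule conv_weak_partial[OF H(2) h(1) near], assumption, simp)
		have ae': "AE y in lborel. p2 3 y + p3 2 y = 2 * ch y"
			using ae unfolding AE_Q_iff by eventually_elim (use L2zD(3)[OF L2(2)] L2zD(3)[OF L2(4)] ch0 in fastforce)
		note [measurable] = L2zD(1)[OF L2(2)] L2zD(1)[OF L2(4)] chm kern_measurable[OF kern_eta(1)]
		have "2 * conv h eta ch z = (LINT y|lborel. 2 * ch y * (eta ((z - y) /\<^sub>R h) / h ^ 3))"
			unfolding conv_def mult.assoc by simp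
		also have "... = (LINT y|lborel. (p2 3 y + p3 2 y) * (eta ((z - y) /\<^sub>R h) / h ^ 3))"
			by (rule integral_cong_AE) (measurable, use ae' in eventually_elim, simp)
		also have "... = conv h eta (p2 3) z + conv h eta (p3 2) z"
			unfolding conv_def distrib_right
			by (intro LINT_add conv_integrable kern_eta L2zD(7)[OF L2(2)] L2zD(7)[OF L2(4)])
		also have "... = (conv h (deta 3) u2 z + conv h (deta 2) u3 z) / h"
			unfolding c[symmetric] by (simp add: add_divide_distrib)
		finally show ?thesis using h by (simp add: field_simps)
	qed
	have c: "x + e4 \<in> cube (1 / 2)" "x - e4 \<in> cube (1 / 2)" "x \<in> cube (1 / 2)"
		using cube_add[OF x, of e4 "1 / 4"] cube_add[OF x, of "- e4" "1 / 4"] cube_mono[OF _ x, of "1 / 2"] by simp_all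
	have i: "conv h (deta j) (%y. indicator (cube (1 / 2)) y * D2 u y) x = D2 (conv h (deta j) u) x" if "L2z u" for u j
		unfolding conv_D2[OF kern_eta(2) L2zD(7)[OF that]]
	proof (rule conv_cong_near[OF kern_eta(2) h(1)])
		fix y assume "norm (x - y) < h"
		then have "y \<in> cube (1 / 4 + 1 / 4)" using h by (intro cube_near[OF x]) simp
		then show "indicator (cube (1 / 2)) y * D2 u y = D2 u y" by simp
	qed
	show ?thesis
		unfolding i[OF L2(1)] i[OF L2(3)] unfolding D2_def g[OF c(1)] g[OF c(2)] g[OF c(3)] by (simp add: add_divide_distrib diff_divide_distrib algebra_simps)
qed

text \<open>Young's inequality for \<open>deta i\<close> at scale \<open>h\<close> costs one factor
  1 / h and converts the O(S) bound for the second differences of u_2 and u_3 into O(S / h) for the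
  mollified phase.\<close>

lemma D2_conv_bound:
	assumes H: "H1 u1 p1" "H1 u2 p2" "H1 u3 p3" and ae: "AE x in Q. p2 3 x + p3 2 x = 2 * ch x"
		and h: "0 < h" "h <= 1 / 4"
	shows "integrable lborel (%x. indicator (cube (1 / 4)) x * (D2 (conv h eta ch) x)\<^sup>2)"
		"(LINT x|lborel. indicator (cube (1 / 4)) x * (D2 (conv h eta ch) x)\<^sup>2) <= 2 * (3000 * kd)\<^sup>2 * ((snorm p1 p2 p3)\<^sup>2 / h\<^sup>2)"
proof -
	let ?S = "snorm p1 p2 p3" and ?I = "indicator (cube (1 / 2)) :: real ^ 3 \<Rightarrow> real"
	have L2: "L2z u2" "L2z u3" using H by (auto simp: H1_def)
	define U where "U u x = ?I x * D2 u x" for u x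
	have U: "U u \<in> borelf" "integrable lborel (%x. (U u x)\<^sup>2)"
		"(LINT x|lborel. (U u x)\<^sup>2) = (LINT x|lborel. ?I x * (D2 u x)\<^sup>2)" if "L2z u" for u
	proof -
		note [measurable] = D2_measurable[OF L2zD(1)[OF that]]
		show "U u \<in> borelf" unfolding U_def[abs_def] by measurable
		have e: "(U u x)\<^sup>2 = ?I x * (D2 u x)\<^sup>2" for x by (simp add: U_def indicator_def)
		show "(LINT x|lborel. (U u x)\<^sup>2) = (LINT x|lborel. ?I x * (D2 u x)\<^sup>2)" unfolding e ..
		show "integrable lborel (%x. (U u x)\<^sup>2)" unfolding e
			by (rule LI_bound[OF D2_L2z(1)[OF that]]) (auto simp: indicator_def)
	qed
	let ?c3 = "conv h (deta 3) (U u2)" and ?c2 = "conv h (deta 2) (U u3)"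
	have iC: "integrable lborel (%x. (?c3 x)\<^sup>2)" "integrable lborel (%x. (?c2 x)\<^sup>2)"
		by (intro conv_L2_bound(1) kern_eta U L2 h)+
	have S0: "0 <= nrm f" for f by (rule nrm_nonneg)
	have s: "(LINT x|lborel. ?I x * (D2 u2 x)\<^sup>2) <= 2 * (3000 * ?S)\<^sup>2" "(LINT x|lborel. ?I x * (D2 u3 x)\<^sup>2) <= 2 * (3000 * ?S)\<^sup>2"
	proof -
		have "2 * (3000 * (nrm (p2 2) + nrm (%x. p1 2 x + p2 1 x) + nrm (p1 1)))\<^sup>2 <= 2 * (3000 * ?S)\<^sup>2"
			unfolding snorm_def by (intro mult_left_mono power_mono) (simp_all add: S0 add_nonneg_nonneg)
		then show "(LINT x|lborel. ?I x * (D2 u2 x)\<^sup>2) <= 2 * (3000 * ?S)\<^sup>2"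
			using second_difference_H1[OF H(1,2), of 2] by simp
		have "2 * (3000 * (nrm (p3 3) + nrm (%x. p1 3 x + p3 1 x) + nrm (p1 1)))\<^sup>2 <= 2 * (3000 * ?S)\<^sup>2"
			unfolding snorm_def by (intro mult_left_mono power_mono) (simp_all add: S0 add_nonneg_nonneg)
		then show "(LINT x|lborel. ?I x * (D2 u3 x)\<^sup>2) <= 2 * (3000 * ?S)\<^sup>2"
			using second_difference_H1[OF H(1,3), of 3] by simp
	qed
	have c: "(LINT x|lborel. (?c3 x)\<^sup>2) <= kd\<^sup>2 * (2 * (3000 * ?S)\<^sup>2)" "(LINT x|lborel. (?c2 x)\<^sup>2) <= kd\<^sup>2 * (2 * (3000 * ?S)\<^sup>2)"
		using conv_deta_L2[OF U(1,2)[OF L2(1)] h(1), of 3] conv_deta_L2[OF U(1,2)[OF L2(2)] h(1), of 2]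
			mult_left_mono[OF s(1) zero_le_power2[of kd]] mult_left_mono[OF s(2) zero_le_power2[of kd]]
		unfolding U(3)[OF L2(1)] U(3)[OF L2(2)] by linarith+
	note chm[measurable]
	have gm[measurable]: "conv h eta ch \<in> borelf" by (intro conv_measurable kern_eta chm)
	note [measurable] = D2_measurable[OF gm]
	let ?F = "%x. (1 / (2 * h\<^sup>2)) * ((?c3 x)\<^sup>2 + (?c2 x)\<^sup>2)"
	have iF: "integrable lborel ?F" by (intro integrable_mult_right LI_add iC)
	have le: "indicator (cube (1 / 4)) x * (D2 (conv h eta ch) x)\<^sup>2 <= ?F x" for x
	proof (cases "x \<in> cube (1 / 4)")
		case True
		have "D2 (conv h eta ch) x = (?c3 x + ?c2 x) / (2 * h)"
			unfolding D2_conv_phase[OF H(2,3) ae h True] U_def[abs_def] ..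
		then have "(D2 (conv h eta ch) x)\<^sup>2 = (1 / (4 * h\<^sup>2)) * (?c3 x + ?c2 x)\<^sup>2"
			by (simp add: power_divide power_mult_distrib)
		also have "... <= (1 / (4 * h\<^sup>2)) * (2 * (?c3 x)\<^sup>2 + 2 * (?c2 x)\<^sup>2)"
			by (intro mult_left_mono square_sum_le) simp
		also have "... = ?F x" using h by (simp add: field_simps)
		finally show ?thesis using True by simp
	qed simp
	show i: "integrable lborel (%x. indicator (cube (1 / 4)) x * (D2 (conv h eta ch) x)\<^sup>2)"
	proof (rule LI_bound[OF iF])
		show "AE x in lborel. norm (indicator (cube (1 / 4)) x * (D2 (conv h eta ch) x)\<^sup>2) <= norm (?F x)"
		proof (rule AE_I2)
			fix x
			have "0 <= indicator (cube (1 / 4)) x * (D2 (conv h eta ch) x)\<^sup>2" by simp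
			then show "norm (indicator (cube (1 / 4)) x * (D2 (conv h eta ch) x)\<^sup>2) <= norm (?F x)"
				unfolding real_norm_def by (subst abs_of_nonneg) (assumption, rule order_trans[OF le abs_ge_self])
		qed
	qed measurable
	have "(LINT x|lborel. indicator (cube (1 / 4)) x * (D2 (conv h eta ch) x)\<^sup>2) <= (LINT x|lborel. ?F x)"
		by (rule integral_mono[OF i iF le])
	also have "... = (1 / (2 * h\<^sup>2)) * ((LINT x|lborel. (?c3 x)\<^sup>2) + (LINT x|lborel. (?c2 x)\<^sup>2))"
		unfolding integral_mult_right_zero LINT_add[OF iC] ..
	also have "... <= (1 / (2 * h\<^sup>2)) * (kd\<^sup>2 * (2 * (3000 * ?S)\<^sup>2) + kd\<^sup>2 * (2 * (3000 * ?S)\<^sup>2))"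
		by (intro mult_left_mono add_mono c) simp
	also have "... = 2 * (3000 * kd)\<^sup>2 * (?S\<^sup>2 / h\<^sup>2)" by (simp add: power_mult_distrib)
	finally show "(LINT x|lborel. indicator (cube (1 / 4)) x * (D2 (conv h eta ch) x)\<^sup>2) <= 2 * (3000 * kd)\<^sup>2 * (?S\<^sup>2 / h\<^sup>2)" .
qed

text \<open>The second bound is elementary: the jump is at most 2 on a set inside the cube of volume
  8. It is kept for large |\<gamma>|.\<close>

lemma phase_estimate:
	assumes H: "H1 u1 p1" "H1 u2 p2" "H1 u3 p3" and ae: "AE x in Q. p2 3 x + p3 2 x = 2 * ch x"
	shows "0 < h ==> h <= 1 / 4 ==> \<bar>LINT x|Q. (p2 3 x + p3 2 x) * kap x\<bar>
			<= 683 * (4 * (3000 * kd)\<^sup>2 * ((snorm p1 p2 p3)\<^sup>2 / h\<^sup>2) + 24 * (h * K))"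
		"\<bar>LINT x|Q. (p2 3 x + p3 2 x) * kap x\<bar> <= 683 * 16"
proof -
	have L2: "L2z (p2 i)" "L2z (p3 i)" for i using H by (auto simp: H1_def)
	have kb: "bB kap" unfolding kap_def[abs_def] by (intro bB_cont continuous_intros cont_ZZ)
	note [measurable] = L2zD(1)[OF L2(1)] L2zD(1)[OF L2(2)] chm bB_measurable[OF kb]
	have e: "(LINT x|Q. (p2 3 x + p3 2 x) * kap x) = (LINT x|Q. 2 * ch x * kap x)"
	proof (rule integral_cong_AE)
		have m: "(%x. (p2 3 x + p3 2 x) * kap x) \<in> borel_measurable lborel" "(%x. 2 * ch x * kap x) \<in> borel_measurable lborel"
			by measurable
		show "(%x. (p2 3 x + p3 2 x) * kap x) \<in> borel_measurable Q" by (rule measurable_restrict_space1[OF m(1)])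
		show "(%x. 2 * ch x * kap x) \<in> borel_measurable Q" by (rule measurable_restrict_space1[OF m(2)])
		show "AE x in Q. (p2 3 x + p3 2 x) * kap x = 2 * ch x * kap x" using ae by eventually_elim simp
	qed
	show "\<bar>LINT x|Q. (p2 3 x + p3 2 x) * kap x\<bar> <= 683 * (4 * (3000 * kd)\<^sup>2 * ((snorm p1 p2 p3)\<^sup>2 / h\<^sup>2) + 24 * (h * K))"
		if h: "0 < h" "h <= 1 / 4"
	proof -
		note D = D2_conv_bound[OF H ae h]
		have "(LINT x|lborel. indicator (cube (1 / 4)) x * \<bar>ch (x + e4) - ch x\<bar>) <= 4 * (3000 * kd)\<^sup>2 * ((snorm p1 p2 p3)\<^sup>2 / h\<^sup>2) + 24 * (h * K)"
			using jump_bound[OF h D(1)] D(2) by linarith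
		then show ?thesis unfolding e by (rule order_trans[OF kap_bound mult_left_mono]) simp
	qed
	let ?I = "%x. indicator (cube (1 / 4)) x * \<bar>ch (x + e4) - ch x\<bar> :: real"
	have I2: "\<bar>?I x\<bar> <= 2" for x using ch_bound[of "x + e4"] ch_bound[of x] by (auto simp: indicator_def)
	have I0: "?I x = 0" if "x \<notin> Omega" for x using that cube_Omega[of "1 / 4"] by (auto simp: indicator_def)
	have "(LINT x|Q. ?I x) <= (LINT x|Q. 2)"
	proof (rule integral_mono_AE')
		show "AE x in Q. ?I x <= 2" using I2 by (intro AE_I2) (auto simp: abs_le_iff)
	qed auto
	moreover have "(LINT x|Q. ?I x) = (LINT x|lborel. ?I x)" by (rule Q_lborel(2)[OF I0])
	ultimately have "(LINT x|lborel. ?I x) <= 16" by simp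
	then show "\<bar>LINT x|Q. (p2 3 x + p3 2 x) * kap x\<bar> <= 683 * 16" unfolding e using kap_bound by linarith
qed

end

lemma nonlinear_estimate:
	"\<exists>C\<ge>0. \<forall>ch K u1 u2 u3 p1 p2 p3 h. bv_phase ch K \<and> H1 u1 p1 \<and> H1 u2 p2 \<and> H1 u3 p3 \<and> (AE x in Q. p2 3 x + p3 2 x = 2 * ch x)
		\<and> 0 < h \<and> h <= 1 / 4 \<longrightarrow>
		\<bar>LINT x|Q. x $ 2 * p1 3 x\<bar> <= C * (snorm p1 p2 p3 + (snorm p1 p2 p3)\<^sup>2 / h\<^sup>2 + h * K) \<and>
		\<bar>LINT x|Q. x $ 2 * p1 3 x\<bar> <= C * (1 + snorm p1 p2 p3)"
proof -
	obtain C where C: "C \<ge> 0" and est': "\<forall>u1 u2 u3 p1 p2 p3. H1 u1 p1 \<and> H1 u2 p2 \<and> H1 u3 p3 \<longrightarrow>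
		\<bar>(LINT x|Q. x $ 2 * p1 3 x) - (LINT x|Q. (p2 3 x + p3 2 x) * kap x)\<bar> <= C * snorm p1 p2 p3"
		using M'_estimate_H1[folded snorm_def] by (elim exE conjE)
	define A where "A = 683 * (4 * (3000 * kd)\<^sup>2)"
	\<comment> \<open>One constant serves both conclusions, as 683 * 16 <= 683 * 24.\<close>
	define C' where "C' = C + A + 683 * 24"
	have A0: "0 <= A" by (simp add: A_def)
	have gen: "\<bar>X\<bar> <= C' * (S + T + hK) \<and> \<bar>X\<bar> <= C' * (1 + S)"
		if "\<bar>X - Y\<bar> <= C * S" "\<bar>Y\<bar> <= A * T + 683 * 24 * hK" "\<bar>Y\<bar> <= 683 * 16" "0 <= S" "0 <= T" "0 <= hK" for X Y S T hK :: real
	proof -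
		have n: "0 <= C * T" "0 <= C * hK" "0 <= A * S" "0 <= A * hK" "0 <= C * S" using that C A0 by simp_all
		have X: "\<bar>X\<bar> <= C * S + \<bar>Y\<bar>" using that(1) by linarith
		show ?thesis unfolding C'_def distrib_left distrib_right using X that n C A0 by (intro conjI; linarith)
	qed
	show ?thesis
	proof (intro exI[of _ C'] conjI allI impI)
		show "0 <= C'" using C A0 by (simp add: C'_def)
		fix ch K u1 u2 u3 p1 p2 p3 and h :: real
		assume a: "bv_phase ch K \<and> H1 u1 p1 \<and> H1 u2 p2 \<and> H1 u3 p3 \<and> (AE x in Q. p2 3 x + p3 2 x = 2 * ch x) \<and> 0 < h \<and> h <= 1 / 4"
		then interpret bv_phase ch K by blast
		let ?S = "snorm p1 p2 p3"
		have H: "H1 u1 p1" "H1 u2 p2" "H1 u3 p3" and ae: "AE x in Q. p2 3 x + p3 2 x = 2 * ch x" and h: "0 < h" "h <= 1 / 4"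
			using a by blast+
		have S0: "0 <= ?S" unfolding snorm_def by (intro add_nonneg_nonneg nrm_nonneg)
		have Y: "\<bar>LINT x|Q. (p2 3 x + p3 2 x) * kap x\<bar> <= A * (?S\<^sup>2 / h\<^sup>2) + 683 * 24 * (h * K)"
			using phase_estimate(1)[OF H ae h] unfolding A_def by (simp only: distrib_left mult.assoc)
		have n: "0 <= ?S\<^sup>2 / h\<^sup>2" "0 <= h * K" using h K0 by simp_all
		have est: "\<bar>(LINT x|Q. x $ 2 * p1 3 x) - (LINT x|Q. (p2 3 x + p3 2 x) * kap x)\<bar> <= C * ?S"
			using est'[rule_format, of u1 p1 u2 p2 u3 p3] H by simp
		note g = gen[OF est Y phase_estimate(2)[OF H ae] S0 n]
		show "\<bar>LINT x|Q. x $ 2 * p1 3 x\<bar> <= C' * (?S + ?S\<^sup>2 / h\<^sup>2 + h * K)" using g by blast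
		show "\<bar>LINT x|Q. x $ 2 * p1 3 x\<bar> <= C' * (1 + ?S)" using g by blast
	qed
qed

section \<open>Energy bounds\<close>

lemma nn_integral_lebesgue_on_Omega: "(\<integral>\<^sup>+x. F x \<partial>lebesgue_on Omega) = (\<integral>\<^sup>+x. F x \<partial>Q)"
proof -
	have "Omega \<inter> space lebesgue \<in> sets lebesgue" "Omega \<inter> space lborel \<in> sets lborel" by (simp_all add: sets_completionI_sets)
	then show ?thesis by (simp add: nn_integral_restrict_space nn_integral_completion)
qed

lemma lebesgue_on_measurable_AE:
	fixes f g :: "real ^ 3 \<Rightarrow> real"
	assumes g: "g \<in> borelf" and ae: "AE x in Q. f x = g x"
	shows "f \<in> borel_measurable (lebesgue_on Omega)"
proof -
	have O: "Omega \<inter> space lebesgue \<in> sets lebesgue" by (simp add: sets_completionI_sets)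
	have m: "(%x. indicator Omega x *\<^sub>R g x) \<in> borel_measurable lebesgue"
		by (rule measurable_completion) (use g in measurable)
	have "AE x in lebesgue. indicator Omega x *\<^sub>R g x = indicator Omega x *\<^sub>R f x"
		by (rule AE_completion) (use ae[unfolded AE_Q_iff] in eventually_elim, auto simp: indicator_def)
	from borel_measurable_AE[OF m this] show ?thesis by (simp add: borel_measurable_restrict_space_iff[OF O])
qed

lemma strain_AE:
	assumes "\<And>i. W (%x. u x $ i) (p i)"
	shows "AE x in Q. \<forall>i j. strain u x $ i $ j = (p i j x + p j i x) / 2"
proof -
	have "AE x in Q. \<forall>i j. weak_partial Omega j (%y. u y $ i) x = p i j x"
		unfolding AE_all_countable using W_imp_W12(3)[OF assms] by blast
	then show ?thesis by eventually_elim (simp add: strain_def)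
qed

definition elin :: "(3 \<Rightarrow> 3 \<Rightarrow> real ^ 3 \<Rightarrow> real) \<Rightarrow> real ^ 3 \<Rightarrow> real" where
	"elin p x = (p 1 1 x)\<^sup>2 + (p 2 2 x)\<^sup>2 + (p 3 3 x)\<^sup>2 + (p 1 2 x + p 2 1 x)\<^sup>2 / 2 + (p 1 3 x + p 3 1 x)\<^sup>2 / 2"

lemma elastic_energy_eq:
	assumes "\<And>i. W (%x. u x $ i) (p i)"
	shows "elastic_energy u = (\<integral>\<^sup>+x. (if \<bar>(p 2 3 x + p 3 2 x) / 2\<bar> = 1 then ennreal (elin p x) else \<infinity>) \<partial>Q)"
	unfolding elastic_energy_def nn_integral_lebesgue_on_Omega
proof (rule nn_integral_cong_AE)
	have e: "2 * ((a + b) / 2)\<^sup>2 = (a + b)\<^sup>2 / 2" "(a + a) / 2 = a" for a b :: real by (simp_all add: power_divide)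
	show "AE x in Q. energy_density (strain u x) = (if \<bar>(p 2 3 x + p 3 2 x) / 2\<bar> = 1 then ennreal (elin p x) else \<infinity>)"
		using strain_AE[OF assms]
	proof eventually_elim
		fix x assume s: "\<forall>i j. strain u x $ i $ j = (p i j x + p j i x) / 2"
		show "energy_density (strain u x) = (if \<bar>(p 2 3 x + p 3 2 x) / 2\<bar> = 1 then ennreal (elin p x) else \<infinity>)"
			unfolding energy_density_def s[rule_format] e elin_def ..
	qed
qed

text \<open>Collects what an explicit competitor has to provide: gradient representatives, a phase
  with values \<plusminus>1, a pointwise bound on the elastic density and a bound on the variation
  in each direction. The factors 8 and 3 are the volume of the cube and the number of
  directions.\<close>

lemma test_energy:
	assumes W: "\<And>i. W (%x. u x $ i) (%j x. indicator Omega x * q i j x)"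
		and e: "bB e" "\<And>x. x \<in> Omega ==> (q 2 3 x + q 3 2 x) / 2 = e x" "\<And>x. x \<in> Omega ==> \<bar>e x\<bar> = 1"
		and b: "\<And>x. x \<in> Omega ==> elin q x <= b" "0 <= b"
		and tv: "\<And>i \<psi>. \<psi> \<in> C1_compact Omega ==> (\<And>x. \<bar>\<psi> x\<bar> <= 1) ==> (LINT x|Q. e x * partial_deriv i \<psi> x) <= K" "0 <= K"
		and \<epsilon>: "0 <= \<epsilon>"
	shows "u \<in> W12_vec Omega" "total_energy \<epsilon> u <= ennreal (8 * b + \<epsilon> * (3 * K))"
		"M' u = (LINT x|Q. x $ 2 * (indicator Omega x * q 1 3 x))"
proof -
	let ?p = "%i j x. indicator Omega x * q i j x"
	show "u \<in> W12_vec Omega" using W_imp_W12(1)[OF W] by (simp add: W12_vec_def)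
	show "M' u = (LINT x|Q. x $ 2 * ?p 1 3 x)" by (rule M'_eq[OF W])
	have "elastic_energy u <= (\<integral>\<^sup>+x. ennreal b \<partial>Q)"
		unfolding elastic_energy_eq[OF W]
	proof (rule nn_integral_mono)
		fix x assume "x \<in> space Q"
		then have x: "x \<in> Omega" by simp
		have "elin ?p x = elin q x" using x by (simp add: elin_def)
		then show "(if \<bar>(?p 2 3 x + ?p 3 2 x) / 2\<bar> = 1 then ennreal (elin ?p x) else \<infinity>) <= ennreal b"
			using x b(1)[OF x] e(2,3)[OF x] by (simp add: ennreal_leI)
	qed
	also have "... = ennreal (8 * b)"
		using b(2) ennreal_mult[of 8 b] by (simp add: Q.emeasure_eq_measure mult.commute)
	finally have el: "elastic_energy u <= ennreal (8 * b)" .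
	let ?f = "%x. strain u x $ 2 $ 3"
	have eb: "e \<in> borelf" using e(1) by (rule bB_measurable)
	have ae: "AE x in Q. ?f x = e x"
	proof -
		have "AE x in Q. x \<in> Omega" using AE_space[of Q] by simp
		then show ?thesis using strain_AE[OF W]
		proof eventually_elim
			fix x assume x: "x \<in> Omega" and s: "\<forall>i j. strain u x $ i $ j = (?p i j x + ?p j i x) / 2"
			show "?f x = e x" unfolding s[rule_format] using x e(2)[OF x] by simp
		qed
	qed
	have fm: "?f \<in> borel_measurable (lebesgue_on Omega)" by (rule lebesgue_on_measurable_AE[OF eb ae])
	have em: "e \<in> borel_measurable (lebesgue_on Omega)" using eb by (intro measurable_restrict_space1 measurable_completion) simp
	have "integrable (lebesgue_on Omega) e" using lebesgue_on_Omega_Q(1)[OF eb] bB_integrable[OF e(1)] by simp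
	then have int: "integrable (lebesgue_on Omega) ?f"
		by (subst integrable_cong_AE[OF fm em]) (use ae in \<open>simp_all add: AE_lebesgue_on_Omega\<close>)
	have "total_variation Omega ?f <= ennreal (3 * K)"
		unfolding total_variation_def
	proof (rule SUP_least)
		fix \<phi> :: "real ^ 3 \<Rightarrow> real ^ 3"
		assume "\<phi> \<in> {\<phi>. (\<forall>i. (%x. \<phi> x $ i) \<in> C1_compact Omega) \<and> (\<forall>x. norm (\<phi> x) <= 1)}"
		then have \<phi>: "(%x. \<phi> x $ i) \<in> C1_compact Omega" "\<bar>\<phi> x $ i\<bar> <= 1" for i x
			using order_trans[OF component_le_norm_cart[of "\<phi> x" i]] by auto
		have pb: "bB (partial_deriv i (%x. \<phi> x $ i))" for i by (rule C1_compactD(3)[OF \<phi>(1)])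
		have dm: "divergence \<phi> \<in> borelf"
			unfolding divergence_def[abs_def] by (intro borel_measurable_sum bB_measurable pb)
		have "(LINT x|lebesgue_on Omega. ?f x * divergence \<phi> x) = (LINT x|Q. e x * divergence \<phi> x)"
			by (rule integral_lebesgue_on_rep[OF fm eb ae dm])
		also have "... = (\<Sum>i\<in>UNIV. LINT x|Q. e x * partial_deriv i (%x. \<phi> x $ i) x)"
			unfolding divergence_def sum_distrib_left by (intro LINT_sum bB_integrable bB_mult e pb)
		also have "... <= (\<Sum>i\<in>(UNIV :: 3 set). K)" by (intro sum_mono tv \<phi>)
		finally show "ennreal (LINT x|lebesgue_on Omega. ?f x * divergence \<phi> x) <= ennreal (3 * K)"
			by (intro ennreal_leI) simp
	qed
	then have su: "surface_energy u <= ennreal (3 * K)"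
		using int by (auto simp: surface_energy_def BV_def intro: le_less_trans)
	have "total_energy \<epsilon> u <= ennreal (8 * b) + ennreal \<epsilon> * ennreal (3 * K)"
		unfolding total_energy_def by (intro add_mono mult_left_mono el su) simp
	also have "... = ennreal (8 * b + \<epsilon> * (3 * K))"
		using b(2) tv(2) \<epsilon> by (simp only: ennreal_mult'[symmetric]) (simp add: ennreal_plus[symmetric] del: ennreal_plus)
	finally show "total_energy \<epsilon> u <= ennreal (8 * b + \<epsilon> * (3 * K))" .
qed

text \<open>Finite energy excludes the value \<infinity> of the density almost everywhere, which
  enforces the phase constraint. Each of the five norms is at most 2 sqrt E, whence the factor
  10.\<close>

lemma elastic_energy_controls:
	assumes p: "\<And>i j. L2z (p i j)"
		and E: "(\<integral>\<^sup>+x. (if \<bar>(p 2 3 x + p 3 2 x) / 2\<bar> = 1 then ennreal (elin p x) else \<infinity>) \<partial>Q) <= ennreal E" "0 <= E"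
	shows "AE x in Q. \<bar>(p 2 3 x + p 3 2 x) / 2\<bar> = 1" "snorm (p 1) (p 2) (p 3) <= 10 * sqrt E"
proof -
	note pm[measurable] = L2zD(1)[OF p]
	let ?G = "%x. (if \<bar>(p 2 3 x + p 3 2 x) / 2\<bar> = 1 then ennreal (elin p x) else \<infinity>)"
	have "?G \<in> borel_measurable lborel" unfolding elin_def by measurable
	then have G: "?G \<in> borel_measurable Q" by (rule measurable_restrict_space1)
	have "(\<integral>\<^sup>+x. ?G x \<partial>Q) < \<infinity>" using E(1) by (rule le_less_trans) simp
	then have "AE x in Q. ?G x \<noteq> \<infinity>" using G by (intro nn_integral_PInf_AE) auto
	then show "AE x in Q. \<bar>(p 2 3 x + p 3 2 x) / 2\<bar> = 1" by eventually_elim (auto split: if_splits)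
	have pQ: "p i j \<in> borel_measurable Q" for i j by (rule measurable_restrict_space1) (use pm in simp)
	have ia: "integrable Q (%x. (p i j x + p j i x)\<^sup>2)" for i j by (rule integrable_square_add[OF pQ pQ L2zD(2)[OF p] L2zD(2)[OF p]])
	have iw: "integrable Q (elin p)" unfolding elin_def[abs_def]
		by (intro LI_add integrable_divide ia L2zD(2)[OF p])
	have w0: "0 <= elin p x" for x by (simp add: elin_def)
	have "ennreal (LINT x|Q. elin p x) = (\<integral>\<^sup>+x. ennreal (elin p x) \<partial>Q)"
		by (rule nn_integral_eq_integral[symmetric, OF iw]) (simp add: w0)
	also have "... <= (\<integral>\<^sup>+x. ?G x \<partial>Q)" by (intro nn_integral_mono) auto
	also have "... <= ennreal E" by (rule E)
	finally have wE: "(LINT x|Q. elin p x) <= E" using E(2) by simp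
	have n: "nrm f <= 2 * sqrt E" if f: "integrable Q (%x. (f x)\<^sup>2)" "\<And>x. (f x)\<^sup>2 <= 4 * elin p x" for f
	proof -
		have "(LINT x|Q. (f x)\<^sup>2) <= (LINT x|Q. 4 * elin p x)" by (rule integral_mono[OF f(1) integrable_mult_right[OF iw] f(2)])
		then have "(LINT x|Q. (f x)\<^sup>2) <= 4 * E" using wE by simp
		then have "nrm f <= sqrt (4 * E)" unfolding nrm_def by (rule real_sqrt_le_mono)
		then show ?thesis by (simp add: real_sqrt_mult)
	qed
	have sq: "a <= 4 * (a + b + c + d / 2 + f / 2)" "b <= 4 * (a + b + c + d / 2 + f / 2)" "c <= 4 * (a + b + c + d / 2 + f / 2)"
		"d <= 4 * (a + b + c + d / 2 + f / 2)" "f <= 4 * (a + b + c + d / 2 + f / 2)"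
		if "0 <= a" "0 <= b" "0 <= c" "0 <= d" "0 <= f" for a b c d f :: real using that by auto
	have "nrm (p 1 1) <= 2 * sqrt E" "nrm (p 2 2) <= 2 * sqrt E" "nrm (p 3 3) <= 2 * sqrt E"
		by (rule n[OF L2zD(2)[OF p]], unfold elin_def, rule sq; simp)+
	moreover have "nrm (%x. p 1 2 x + p 2 1 x) <= 2 * sqrt E" "nrm (%x. p 1 3 x + p 3 1 x) <= 2 * sqrt E"
		by (rule n[OF ia], unfold elin_def, rule sq; simp)+
	ultimately show "snorm (p 1) (p 2) (p 3) <= 10 * sqrt E" unfolding snorm_def by linarith
qed

text \<open>A field whose only component is \<open>\<psi>\<close> is admissible in
  \<open>total_variation\<close>, and its divergence is the single partial derivative that the
  locale asks for.\<close>

lemma surface_energy_phase: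
	assumes ch: "ch \<in> borelf" "\<And>x. x \<notin> Omega ==> ch x = 0" "\<And>x. x \<in> Omega ==> ch x = 1 \<or> ch x = - 1"
		and ae: "AE x in Q. strain u x $ 2 $ 3 = ch x" and S: "surface_energy u <= ennreal K" "0 <= K"
	shows "bv_phase ch K"
proof
	show "ch \<in> borelf" "0 <= K" by fact+
	show "ch x = 0" if "x \<notin> Omega" for x by (rule ch(2)[OF that])
	show "ch x = 1 \<or> ch x = - 1" if "x \<in> Omega" for x by (rule ch(3)[OF that])
	let ?f = "%x. strain u x $ 2 $ 3"
	have tv: "total_variation Omega ?f <= ennreal K"
		using S by (auto simp: surface_energy_def top_unique split: if_splits)
	fix \<psi> :: "real ^ 3 \<Rightarrow> real" and i :: 3
	assume \<psi>: "\<psi> \<in> C1_compact Omega" "\<And>x. \<bar>\<psi> x\<bar> <= 1"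
	define \<phi> where "\<phi> x = \<psi> x *\<^sub>R axis i (1 :: real)" for x
	have c: "(%x. \<phi> x $ j) = (if j = i then \<psi> else (%x. 0))" for j by (auto simp: \<phi>_def axis_def)
	have z: "partial_deriv j (%x. 0 :: real) x = 0" for j :: 3 and x by (simp add: partial_deriv_def frechet_derivative_const)
	have zC: "(%x. 0) \<in> C1_compact Omega" using z by (simp add: C1_compact_def)
	have d: "divergence \<phi> = partial_deriv i \<psi>"
	proof
		fix x
		have "divergence \<phi> x = (\<Sum>j\<in>UNIV. if j = i then partial_deriv i \<psi> x else 0)"
			unfolding divergence_def c by (intro sum.cong refl) (auto simp: z)
		then show "divergence \<phi> x = partial_deriv i \<psi> x" by simp
	qed
	have "\<phi> \<in> {\<phi>. (\<forall>i. (%x. \<phi> x $ i) \<in> C1_compact Omega) \<and> (\<forall>x. norm (\<phi> x) <= 1)}"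
		unfolding mem_Collect_eq c using \<psi> zC by (auto simp: \<phi>_def)
	then have "ennreal (LINT x|lebesgue_on Omega. ?f x * divergence \<phi> x) <= total_variation Omega ?f"
		unfolding total_variation_def by (rule SUP_upper)
	then have "ennreal (LINT x|lebesgue_on Omega. ?f x * divergence \<phi> x) <= ennreal K" using tv by (rule order_trans)
	moreover have "(LINT x|lebesgue_on Omega. ?f x * divergence \<phi> x) = (LINT x|Q. ch x * partial_deriv i \<psi> x)"
		unfolding d using lebesgue_on_measurable_AE[OF ch(1) ae] bB_measurable[OF C1_compactD(3)[OF \<psi>(1)]]
		by (intro integral_lebesgue_on_rep ch ae)
	ultimately show "(LINT x|Q. ch x * partial_deriv i \<psi> x) <= K" using S(2) by simp
qed

lemma energy_lower:
	"\<exists>C\<ge>1. \<forall>\<epsilon> u E. 0 < \<epsilon> \<and> \<epsilon> <= 1 \<and> u \<in> W12_vec Omega \<and> 0 <= E \<and> total_energy \<epsilon> u <= ennreal E \<longrightarrow>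
		\<bar>M' u\<bar> <= C * (sqrt E + E / \<epsilon> powr (2 / 3)) \<and> \<bar>M' u\<bar> <= C * (1 + sqrt E)"
proof -
	obtain C where C: "C \<ge> 0" and est: "\<forall>ch K u1 u2 u3 p1 p2 p3 h. bv_phase ch K \<and> H1 u1 p1 \<and> H1 u2 p2 \<and> H1 u3 p3 \<and> (AE x in Q. p2 3 x + p3 2 x = 2 * ch x)
		\<and> 0 < h \<and> h <= 1 / 4 \<longrightarrow>
		\<bar>LINT x|Q. x $ 2 * p1 3 x\<bar> <= C * (snorm p1 p2 p3 + (snorm p1 p2 p3)\<^sup>2 / h\<^sup>2 + h * K) \<and>
		\<bar>LINT x|Q. x $ 2 * p1 3 x\<bar> <= C * (1 + snorm p1 p2 p3)"
		using nonlinear_estimate by (elim exE conjE)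
	show ?thesis
	proof (intro exI[of _ "1601 * C + 1"] conjI allI impI)
		show "1 <= 1601 * C + 1" using C by simp
		fix \<epsilon> E :: real and u :: "real ^ 3 \<Rightarrow> real ^ 3"
		assume a: "0 < \<epsilon> \<and> \<epsilon> <= 1 \<and> u \<in> W12_vec Omega \<and> 0 <= E \<and> total_energy \<epsilon> u <= ennreal E"
		then have \<epsilon>: "0 < \<epsilon>" "\<epsilon> <= 1" and u: "u \<in> W12_vec Omega" and E: "0 <= E" and te: "total_energy \<epsilon> u <= ennreal E" by auto
		have "\<forall>i. \<exists>p. W (%x. u x $ i) p" using u W12_imp_W by (auto simp: W12_vec_def)
		from choice[OF this] obtain p where W: "\<And>i. W (%x. u x $ i) (p i)" by auto
		then have "\<forall>i. \<exists>v. H1 v (p i)" by (auto simp: W_def)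
		from choice[OF this] obtain v where H: "\<And>i. H1 (v i) (p i)" by auto
		have L: "L2z (p i j)" for i j using H[of i] by (simp add: H1_def)
		have "elastic_energy u <= ennreal E" using te unfolding total_energy_def by (rule order_trans[rotated]) simp
		note ec = elastic_energy_controls[OF L this[unfolded elastic_energy_eq[OF W]] E]
		have "ennreal \<epsilon> * surface_energy u <= ennreal E" using te unfolding total_energy_def by (rule order_trans[rotated]) simp
		then have "ennreal (1 / \<epsilon>) * (ennreal \<epsilon> * surface_energy u) <= ennreal (1 / \<epsilon>) * ennreal E" by (rule mult_left_mono) simp
		then have su: "surface_energy u <= ennreal (E / \<epsilon>)"
			using \<epsilon> E by (simp add: mult.assoc[symmetric] ennreal_mult'[symmetric])
		\<comment> \<open>Built from the sign of the representative so that the values are \<plusminus>1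
		  everywhere on the cube, not merely almost everywhere.\<close>
		define ch where "ch x = indicator Omega x * (if 0 <= p 2 3 x + p 3 2 x then 1 else - 1 :: real)" for x
		note [measurable] = L2zD(1)[OF L]
		have chm: "ch \<in> borelf" unfolding ch_def[abs_def] by measurable
		have ch1: "ch x = 1 \<or> ch x = - 1" if "x \<in> Omega" for x using that by (simp add: ch_def)
		have ch0: "ch x = 0" if "x \<notin> Omega" for x using that by (simp add: ch_def)
		have xO: "AE x in Q. x \<in> Omega" using AE_space[of Q] by simp
		have ae: "AE x in Q. p 2 3 x + p 3 2 x = 2 * ch x" using ec(1) xO by eventually_elim (auto simp: ch_def abs_if split: if_splits)
		have ae': "AE x in Q. strain u x $ 2 $ 3 = ch x" using strain_AE[OF W] ae by eventually_elim (drule spec[of _ 2], drule spec[of _ 3], simp)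
		have bv: "bv_phase ch (E / \<epsilon>)" by (rule surface_energy_phase[OF chm ch0 ch1 ae' su]) (use \<epsilon> E in simp_all)
		\<comment> \<open>Dividing by 4 ensures h <= 1/4. With e = \<epsilon>^(2/3) the competing terms
		  become S^2 / h^2 <= 1600 E / e and h E / \<epsilon> = E / (4 e), both of order E / e.\<close>
		define h where "h = \<epsilon> powr (1 / 3) / 4"
		define e where "e = \<epsilon> powr (2 / 3)"
		define T where "T = snorm (p 1) (p 2) (p 3)"
		have e0: "0 < e" using \<epsilon> by (simp add: e_def)
		have h0: "0 < h" using \<epsilon> by (simp add: h_def)
		have h4: "h <= 1 / 4" using \<epsilon> powr_mono2[of "1 / 3" \<epsilon> 1] by (simp add: h_def)
		have h2: "h\<^sup>2 = e / 16" using \<epsilon> by (simp add: h_def e_def power_divide power2_eq_square powr_add[symmetric])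
		have "4 * h * e = \<epsilon>" using \<epsilon> by (simp add: h_def e_def powr_add[symmetric])
		then have hE: "h * (E / \<epsilon>) = E / e / 4" using e0 h0 by (auto simp: field_simps)
		have M: "M' u = (LINT x|Q. x $ 2 * p 1 3 x)" by (rule M'_eq[OF W])
		have T0: "0 <= T" unfolding T_def snorm_def by (intro add_nonneg_nonneg nrm_nonneg)
		have T: "T <= 10 * sqrt E" unfolding T_def by (rule ec(2))
		have "T\<^sup>2 <= (10 * sqrt E)\<^sup>2" using T T0 by (rule power_mono)
		then have "T\<^sup>2 <= 100 * E" using E by (simp add: power_mult_distrib)
		then have "T\<^sup>2 / h\<^sup>2 <= 100 * E / h\<^sup>2" by (rule divide_right_mono) simp
		then have T2: "T\<^sup>2 / h\<^sup>2 <= 1600 * (E / e)" by (simp add: h2)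
		have m: "\<bar>M' u\<bar> <= C * (T + T\<^sup>2 / h\<^sup>2 + h * (E / \<epsilon>))" "\<bar>M' u\<bar> <= C * (1 + T)"
			using est[rule_format, of ch "E / \<epsilon>" "v 1" "p 1" "v 2" "p 2" "v 3" "p 3" h] bv H ae h0 h4 unfolding M T_def by blast+
		have q: "0 <= E / e" "0 <= sqrt E" using E e0 by simp_all
		have 1: "T + T\<^sup>2 / h\<^sup>2 + h * (E / \<epsilon>) <= 1601 * (sqrt E + E / e)" unfolding hE using T T2 q by argo
		have 2: "1 + T <= 1601 * (1 + sqrt E)" using T q by argo
		have gen: "X <= (1601 * C + 1) * Z" if "X <= C * Y" "Y <= 1601 * Z" "0 <= Z" for X Y Z
		proof -
			have "C * Y <= C * (1601 * Z)" using that C by (intro mult_left_mono)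
			then show ?thesis using that by (simp add: algebra_simps)
		qed
		show "\<bar>M' u\<bar> <= (1601 * C + 1) * (sqrt E + E / \<epsilon> powr (2 / 3))" unfolding e_def[symmetric] by (rule gen[OF m(1) 1]) (use q in simp)
		show "\<bar>M' u\<bar> <= (1601 * C + 1) * (1 + sqrt E)" by (rule gen[OF m(2) 2]) (use q in simp)
	qed
qed

section \<open>Test functions for the upper bound\<close>

lemma integral_lborel_Icc_FTC:
	fixes w w' :: "real \<Rightarrow> real"
	assumes w: "\<And>t. (w has_real_derivative w' t) (at t)" "continuous_on UNIV w'"
	shows "a <= b ==> (LINT t|lborel. w' t * indicator {a..b} t) = w b - w a" "integrable lborel (%t. w' t * indicator {a..b} t)"
proof -
	show "(LINT t|lborel. w' t * indicator {a..b} t) = w b - w a" if "a <= b"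
		using that w by (intro integral_FTC_Icc_real) (auto simp: continuous_on_eq_continuous_at)
	have "integrable lborel (%t. indicator {a..b} t *\<^sub>R w' t)"
		by (rule borel_integrable_compact) (auto intro: continuous_on_subset[OF w(2)])
	then show "integrable lborel (%t. w' t * indicator {a..b} t)" by (simp add: mult.commute)
qed

text \<open>Encodes a two-phase profile by its layers, the closed intervals where it is 1;
  \<open>S\<close> absorbs the endpoints. In this form an integral against w' is a sum of boundary
  values, and two jumps of height 2 per layer bound the variation by 4 n.\<close>

definition step_line :: "nat \<Rightarrow> (real \<Rightarrow> real) \<Rightarrow> bool" where
	"step_line n e \<longleftrightarrow> (\<exists>(I :: int set) \<alpha> \<beta> S. finite I \<and> card I <= n \<and> finite S \<and>
		(\<forall>m\<in>I. - 1 <= \<alpha> m \<and> \<alpha> m <= \<beta> m \<and> \<beta> m <= 1) \<and>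
		(\<forall>t. - 1 < t \<longrightarrow> t < 1 \<longrightarrow> t \<notin> S \<longrightarrow> e t = 2 * (\<Sum>m\<in>I. indicator {\<alpha> m..\<beta> m} t) - 1))"

lemma line_variation:
	fixes w w' e :: "real \<Rightarrow> real"
	assumes w: "\<And>t. (w has_real_derivative w' t) (at t)" "continuous_on UNIV w'" "\<And>t. \<bar>w t\<bar> <= 1" "w (- 1) = 0" "w 1 = 0"
		and e: "e \<in> borelf" "step_line n e"
	shows "\<bar>LINT t|J. e t * w' t\<bar> <= 4 * real n"
proof -
	obtain I :: "int set" and \<alpha> \<beta> S where I: "finite I" "card I <= n" and S: "finite S"
		and ab: "\<And>m. m \<in> I ==> - 1 <= \<alpha> m \<and> \<alpha> m <= \<beta> m \<and> \<beta> m <= 1"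
		and eq: "\<And>t. - 1 < t ==> t < 1 ==> t \<notin> S ==> e t = 2 * (\<Sum>m\<in>I. indicator {\<alpha> m..\<beta> m} t) - 1"
		using e(2) unfolding step_line_def by (elim exE conjE) blast
	have [measurable]: "w' \<in> borelf" by (rule borel_measurable_continuous_onI[OF w(2)])
	note [measurable] = e(1)
	note F = integral_lborel_Icc_FTC[OF w(1,2)]
	let ?R = "%t. 2 * (\<Sum>m\<in>I. w' t * indicator {\<alpha> m..\<beta> m} t) - w' t * indicator {- 1..1} t"
	have "(LINT t|J. e t * w' t) = (LINT t|lborel. indicator {- 1<..<1} t *\<^sub>R (e t * w' t))"
		by (rule integral_restrict_space) simp
	also have "... = (LINT t|lborel. ?R t)"
	proof (rule integral_cong_AE)
		have "AE t in lborel. t \<notin> S \<union> {- 1, 1}" by (rule AE_not_in[OF finite_imp_null_set_lborel]) (use S in simp)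
		then show "AE t in lborel. indicator {- 1<..<1} t *\<^sub>R (e t * w' t) = ?R t"
		proof eventually_elim
			fix t assume t: "t \<notin> S \<union> {- 1, 1}"
			show "indicator {- 1<..<1} t *\<^sub>R (e t * w' t) = ?R t"
			proof (cases "- 1 < t \<and> t < 1")
				case True
				then have et: "e t = 2 * (\<Sum>m\<in>I. indicator {\<alpha> m..\<beta> m} t) - 1" using t by (intro eq) auto
				show ?thesis unfolding et sum_distrib_left[symmetric] using True by (simp add: left_diff_distrib)
			next
				case False
				then have "t < - 1 \<or> 1 < t" using t by auto
				then have "w' t * indicator {\<alpha> m..\<beta> m} t = 0" if "m \<in> I" for m using ab[OF that] by (auto simp: indicator_def)
				then have "(\<Sum>m\<in>I. w' t * indicator {\<alpha> m..\<beta> m} t) = 0" by (rule sum.neutral[OF ballI])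
				then show ?thesis using \<open>t < - 1 \<or> 1 < t\<close> by (auto simp: indicator_def)
			qed
		qed
	qed measurable
	also have "... = 2 * (\<Sum>m\<in>I. w (\<beta> m) - w (\<alpha> m)) - (w 1 - w (- 1))"
	proof -
		have s: "integrable lborel (%t. \<Sum>m\<in>I. w' t * indicator {\<alpha> m..\<beta> m} t)" by (intro LI_sum F)
		have "(LINT t|lborel. ?R t) = 2 * (\<Sum>m\<in>I. LINT t|lborel. w' t * indicator {\<alpha> m..\<beta> m} t) - (LINT t|lborel. w' t * indicator {- 1..1} t)"
			unfolding LINT_diff[OF integrable_mult_right[OF s] F(2)] integral_mult_right_zero
				LINT_sum[of I lborel, OF F(2)] ..
		also have "(\<Sum>m\<in>I. LINT t|lborel. w' t * indicator {\<alpha> m..\<beta> m} t) = (\<Sum>m\<in>I. w (\<beta> m) - w (\<alpha> m))"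
			by (intro sum.cong refl F) (use ab in auto)
		also have "(LINT t|lborel. w' t * indicator {- 1..1} t) = w 1 - w (- 1)" by (rule F) simp
		finally show ?thesis .
	qed
	finally have "(LINT t|J. e t * w' t) = 2 * (\<Sum>m\<in>I. w (\<beta> m) - w (\<alpha> m))" using w(4,5) by simp
	moreover have "\<bar>\<Sum>m\<in>I. w (\<beta> m) - w (\<alpha> m)\<bar> <= (\<Sum>m\<in>I. 2)"
	proof (rule order_trans[OF sum_abs sum_mono])
		fix m show "\<bar>w (\<beta> m) - w (\<alpha> m)\<bar> <= 2" using w(3)[of "\<beta> m"] w(3)[of "\<alpha> m"] by linarith
	qed
	ultimately show ?thesis using I by simp
qed

text \<open>Fubini reduces a directional variation to the lines in that direction, each of which
  contributes at most \<open>4 * real n\<close>.\<close>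

lemma slice_variation:
	assumes e: "bB e" and n: "\<And>x. x \<in> Omega ==> step_line n (%t. e (upd x i t))"
		and \<psi>: "\<psi> \<in> C1_compact Omega" "\<And>x. \<bar>\<psi> x\<bar> <= 1"
	shows "\<bar>LINT x|Q. e x * partial_deriv i \<psi> x\<bar> <= 4 * real n * measure Qf face"
proof -
	let ?F = "%x. e x * partial_deriv i \<psi> x"
	have iQ: "integrable Q ?F" by (intro bB_integrable bB_mult e C1_compactD(3)[OF \<psi>(1)])
	note [measurable] = bB_measurable[OF e]
	have line: "\<bar>LINT t|J. ?F (ins i y t)\<bar> <= 4 * real n" if y: "y \<in> face" for y
	proof -
		have x: "ins i y 0 \<in> Omega" using y by simp
		have s: "(%t. ?F (ins i y t)) = (%t. e (upd (ins i y 0) i t) * partial_deriv i \<psi> (upd (ins i y 0) i t))" by simp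
		have cu: "continuous_on UNIV (%t. upd (ins i y 0) i t)"
			unfolding upd_def
		proof (rule continuous_on_vec_lambda)
			fix j show "continuous_on UNIV (%t. if j = i then t else ins i y 0 $ j)" by (cases "j = i") simp_all
		qed
		have m: "(%t. upd (ins i y 0) i t) \<in> borelf" by (rule borel_measurable_continuous_onI[OF cu])
		show ?thesis unfolding s
		proof (rule line_variation[where w = "%t. \<psi> (upd (ins i y 0) i t)"])
			show "((%t. \<psi> (upd (ins i y 0) i t)) has_real_derivative partial_deriv i \<psi> (upd (ins i y 0) i t)) (at t)" for t
				by (rule C1fun_line[OF C1_compactD(1)[OF \<psi>(1)]])
			show "continuous_on UNIV (%t. partial_deriv i \<psi> (upd (ins i y 0) i t))"
				by (rule continuous_on_compose2[OF C1fun_continuous_deriv[OF C1_compactD(1)[OF \<psi>(1)]] cu]) simp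
			show "\<psi> (upd (ins i y 0) i (- 1)) = 0" "\<psi> (upd (ins i y 0) i 1) = 0" by (rule C1_compactD(4)[OF \<psi>(1)], simp)+
			show "(%t. e (upd (ins i y 0) i t)) \<in> borelf" using m by measurable
		qed (use \<psi>(2) n[OF x] in auto)
	qed
	have A: "(LINT x|Q. ?F x) = (LINT y|Qf. LINT t|J. ?F (ins i y t))" by (rule integral_Q(1)[OF iQ])
	have B: "\<bar>LINT y|Qf. LINT t|J. ?F (ins i y t)\<bar> <= (LINT y|Qf. \<bar>LINT t|J. ?F (ins i y t)\<bar>)" by (rule integral_abs_bound)
	have C: "(LINT y|Qf. \<bar>LINT t|J. ?F (ins i y t)\<bar>) <= (LINT y|Qf. 4 * real n)"
		by (rule integral_mono) (use integral_Q(2)[OF iQ, of i] line in \<open>auto intro: integrable_abs\<close>)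
	have D: "(LINT y|Qf. 4 * real n) = 4 * real n * measure Qf face" by simp
	show ?thesis unfolding A by (rule order_trans[OF B C[unfolded D]])
qed

section \<open>The two competitors: the elastic one and the laminate\<close>

lemma W_bilinear:
	assumes "a \<noteq> b"
	shows "W (%x. c * (x $ a * x $ b)) (%j x. indicator Omega x * (c * (if j = a then x $ b else if j = b then x $ a else 0)))"
proof (rule line_acz_imp_W)
	show "bB (%x. c * (x $ a * x $ b))" by (intro bB_intros)
	show "bB (%x. c * (if i = a then x $ b else if i = b then x $ a else 0))" for i
		by (cases "i = a"; cases "i = b"; simp; intro bB_intros)
	fix i and x :: "real ^ 3"
	show "continuous_on {- 1..1} (%t. c * (upd x i t $ a * upd x i t $ b)) \<and>
		(\<exists>S. finite S \<and> (\<forall>t. - 1 < t \<and> t < 1 \<and> t \<notin> S \<longrightarrow> ((%t. c * (upd x i t $ a * upd x i t $ b))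
			has_real_derivative c * (if i = a then upd x i t $ b else if i = b then upd x i t $ a else 0)) (at t)))"
		using assms by (cases "i = a"; cases "i = b") (auto intro!: exI[of _ "{}"] continuous_intros derivative_eq_intros)
qed

lemma W_coord: "W (%x. x $ a) (%j x. indicator Omega x * (if j = a then 1 else 0))"
proof (rule line_acz_imp_W)
	show "bB (%x. x $ a)" by (intro bB_intros)
	show "bB (%x. if i = a then 1 else 0)" for i by (cases "i = a"; simp; intro bB_intros)
	fix i and x :: "real ^ 3"
	show "continuous_on {- 1..1} (%t. upd x i t $ a) \<and>
		(\<exists>S. finite S \<and> (\<forall>t. - 1 < t \<and> t < 1 \<and> t \<notin> S \<longrightarrow> ((%t. upd x i t $ a) has_real_derivative (if i = a then 1 else 0)) (at t)))"
		by (cases "i = a") (auto intro!: exI[of _ "{}"] continuous_intros derivative_eq_intros)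
qed

text \<open>The value of \<open>M'\<close> for a map with first component x_2 x_3; only its
  positivity enters the constants.\<close>

definition m2 :: real where "m2 = (LINT x|Q. (x $ 2)\<^sup>2)"

lemma m2_pos: "0 < m2"
proof -
	have bb: "bB (%x. (x $ 2)\<^sup>2)" by (intro bB_intros)
	have "m2 = (LINT y|Qf. LINT t|J. (ins 2 y t $ 2)\<^sup>2)" unfolding m2_def by (rule integral_Q(1)[OF bB_integrable[OF bb]])
	also have "... = measure Qf face * (LINT t|J. t\<^sup>2)" by simp
	finally have m: "m2 = measure Qf face * (LINT t|J. t\<^sup>2)" .
	have "(8 :: real) = (LINT x|Q. 1)" by simp
	also have "... = (LINT y|Qf. LINT t|J. 1)" by (rule integral_Q(1)) simp
	also have "... = measure Qf face * measure J {- 1<..<1}" by simp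
	finally have "measure Qf face \<noteq> 0" by auto
	then have f: "0 < measure Qf face" using measure_nonneg[of Qf face] by linarith
	have "(LINT t|J. t\<^sup>2) = (LINT t|lborel. indicator {- 1<..<1} t *\<^sub>R t\<^sup>2)" by (rule integral_restrict_space) simp
	also have "... = (LINT t|lborel. t\<^sup>2 * indicator {- 1..1 :: real} t)"
	proof (rule integral_cong_AE)
		have "AE t in lborel. t \<notin> {- 1, 1 :: real}" by (rule AE_not_in[OF finite_imp_null_set_lborel]) simp
		then show "AE t :: real in lborel. indicator {- 1<..<1} t *\<^sub>R t\<^sup>2 = t\<^sup>2 * indicator {- 1..1} t"
			by eventually_elim (auto simp: indicator_def)
	qed measurable
	also have "... = 1 ^ 3 / 3 - (- 1) ^ 3 / 3"
		by (rule integral_lborel_Icc_FTC(1)[where w = "%t. t ^ 3 / 3"]) (auto intro!: derivative_eq_intros continuous_intros)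
	finally show ?thesis unfolding m using f by simp
qed

text \<open>The map (t x_2 x_3, x_3, x_2) has the constant phase e_23 = 1 and hence no surface
  energy, while its remaining shear costs at most 8 t^2 and \<open>M'\<close> is linear in
  t.\<close>

lemma elastic_test:
	assumes \<epsilon>: "0 <= \<epsilon>"
	shows "\<exists>u \<in> W12_vec Omega. total_energy \<epsilon> u <= ennreal (8 * t\<^sup>2) \<and> M' u = t * m2"
proof -
	define u :: "real ^ 3 \<Rightarrow> real ^ 3" where "u x = (\<chi> i. if i = 1 then t * (x $ 2 * x $ 3) else if i = 2 then x $ 3 else x $ 2)" for x
	define q :: "3 \<Rightarrow> 3 \<Rightarrow> real ^ 3 \<Rightarrow> real" where "q i j x = (if i = 1 then t * (if j = 2 then x $ 3 else if j = 3 then x $ 2 else 0)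
		else if i = 2 then (if j = 3 then 1 else 0) else (if j = 2 then 1 else 0))" for i j x
	have W: "W (%x. u x $ i) (%j x. indicator Omega x * q i j x)" for i
		using exhaust_3[of i] W_bilinear[of 2 3 t] W_coord[of 2] W_coord[of 3] by (auto simp: u_def q_def)
	have t2: "elin q x <= t\<^sup>2" if "x \<in> Omega" for x
	proof -
		have "\<bar>x $ 2\<bar> <= 1" "\<bar>x $ 3\<bar> <= 1" using that by (auto simp: Omega_def abs_le_iff less_imp_le minus_le_iff)
		then have "(x $ 2)\<^sup>2 <= 1" "(x $ 3)\<^sup>2 <= 1" by (simp_all add: abs_square_le_1)
		then have "t\<^sup>2 * (x $ 2)\<^sup>2 <= t\<^sup>2 * 1" "t\<^sup>2 * (x $ 3)\<^sup>2 <= t\<^sup>2 * 1" by (intro mult_left_mono; simp)+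
		then show ?thesis by (simp add: elin_def q_def power_mult_distrib)
	qed
	have tv: "(LINT x|Q. 1 * partial_deriv i \<psi> x) <= 0" if \<psi>: "\<psi> \<in> C1_compact Omega" "\<And>x. \<bar>\<psi> x\<bar> <= 1" for i \<psi>
	proof -
		have z: "partial_deriv i (%x. 1 :: real) x = 0" for x by (simp add: partial_deriv_def frechet_derivative_const)
		have cC: "C1fun (%x. 1 :: real)"
			by (auto simp: C1fun_def z[abs_def] partial_deriv_def frechet_derivative_const)
		have w: "has_weak_partial Omega i (%x. 1) (%x. indicator Omega x * partial_deriv i (%x. 1) x)"
			by (rule W_imp_W12(2)[OF C1fun_W[OF cC]])
		have "(LINT x|lebesgue_on Omega. 1 * partial_deriv i \<psi> x) = 0"
			using w \<psi>(1) unfolding has_weak_partial_def z by simp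
		then show ?thesis using lebesgue_on_Omega_Q(2)[OF bB_measurable[OF C1_compactD(3)[OF \<psi>(1)]], of i] by simp
	qed
	have e: "(q 2 3 x + q 3 2 x) / 2 = 1" for x by (simp add: q_def)
	note T = test_energy[of u q "%x. 1" "t\<^sup>2" 0 \<epsilon>, OF W bB_const e _ t2 _ tv _ \<epsilon>]
	have "M' u = (LINT x|Q. x $ 2 * (indicator Omega x * q 1 3 x))" by (rule T(3)) simp_all
	also have "... = (LINT x|Q. t * (x $ 2)\<^sup>2)"
		by (intro LINT_cong refl) (simp add: q_def power2_eq_square)
	also have "... = t * m2" unfolding m2_def by (rule integral_mult_right_zero)
	finally have "M' u = t * m2" .
	moreover have "u \<in> W12_vec Omega" by (rule T(1)) simp_all
	moreover have "total_energy \<epsilon> u <= ennreal (8 * t\<^sup>2 + \<epsilon> * (3 * 0))" by (rule T(2)) simp_all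
	ultimately show ?thesis by auto
qed

definition lam :: "nat \<Rightarrow> real ^ 3 \<Rightarrow> real" where
	"lam N x = (if frac (real N * x $ 2) < (2 - x $ 1) / 4 then 1 else - 1)"

text \<open>The corrector \<open>kk N\<close> has \<open>x\<^sub>2\<close>-derivative \<open>x\<^sub>1 + 2\<close> where \<open>lam N = 1\<close> and \<open>x\<^sub>1 - 2\<close> elsewhere;
	the volume fraction \<open>(2 - x\<^sub>1) / 4\<close> makes it periodic in \<open>x\<^sub>2\<close>.\<close>

definition kk :: "nat \<Rightarrow> real ^ 3 \<Rightarrow> real" where
	"kk N x = (1 / real N) * (\<Sum>j\<in>{- int N..<int N}.
		max 0 (min ((2 + x $ 1) * (real N * x $ 2 - of_int j)) ((2 - x $ 1) * (of_int j + 1 - real N * x $ 2))))"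

lemma frac_unique_floor: "of_int m <= y ==> y < of_int m + 1 ==> frac y = y - of_int m" for y :: real
	by (simp add: frac_def floor_unique)

lemma floor_range:
	assumes "- 1 < t" "t < 1"
	shows "\<lfloor>real N * t\<rfloor> \<in> {- int N..<int N} \<or> N = 0"
proof (cases "N = 0")
	case False
	have "- real N <= real N * t" "real N * t < real N" using assms mult_left_mono[of "- 1" t "real N"] False by auto
	then show ?thesis by (auto simp: le_floor_iff floor_less_iff)
qed simp

text \<open>In each cell only the tent with index \<open>\<lfloor>real N * x $ 2\<rfloor>\<close>
  can be nonzero. The sum of truncated tents makes continuity on the whole space immediate; the form
  with \<open>frac\<close> is the one suited to derivatives.\<close>

lemma kk_eq:
	assumes N: "N \<noteq> 0" and x: "- 1 < x $ 2" "x $ 2 < 1" "\<bar>x $ 1\<bar> <= 1"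
	shows "kk N x = min ((2 + x $ 1) * frac (real N * x $ 2)) ((2 - x $ 1) * (1 - frac (real N * x $ 2))) / real N"
proof -
	let ?y = "real N * x $ 2"
	let ?m = "\<lfloor>?y\<rfloor>" and ?M = "min ((2 + x $ 1) * frac ?y) ((2 - x $ 1) * (1 - frac ?y))"
	have p: "0 <= 2 + x $ 1" "0 <= 2 - x $ 1" using x by auto
	have m: "?m \<in> {- int N..<int N}" using floor_range[OF x(1,2), of N] N by simp
	have "max 0 (min ((2 + x $ 1) * (?y - of_int j)) ((2 - x $ 1) * (of_int j + 1 - ?y))) = (if j = ?m then ?M else 0)" for j
	proof -
		consider "j = ?m" | "j + 1 <= ?m" | "?m + 1 <= j" by linarith
		then show ?thesis
		proof cases
			case 1
			have "0 <= frac ?y" "frac ?y < 1" by (simp_all add: frac_lt_1)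
			then have "0 <= (2 + x $ 1) * frac ?y" "0 <= (2 - x $ 1) * (1 - frac ?y)" using p by simp_all
			moreover have e: "?y - of_int j = frac ?y" "of_int j + 1 - ?y = 1 - frac ?y" using 1 by (simp_all add: frac_def)
			ultimately show ?thesis unfolding e using 1 by (simp add: max_absorb2)
		next
			case 2
			then have "of_int j + 1 - ?y <= 0" by (simp add: le_floor_iff)
			then have "(2 - x $ 1) * (of_int j + 1 - ?y) <= 0" using p by (simp add: mult_nonneg_nonpos)
			then show ?thesis using 2 by auto
		next
			case 3
			then have "?y - of_int j <= 0" by linarith
			then have "(2 + x $ 1) * (?y - of_int j) <= 0" using p by (simp add: mult_nonneg_nonpos)
			then show ?thesis using 3 by auto
		qed
	qed
	then show ?thesis unfolding kk_def using m by simp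
qed

text \<open>The two affine pieces (2 + x_1) r and (2 - x_1)(1 - r) meet exactly at r = (2 - x_1) /
  4, which is the interface of \<open>lam\<close>.\<close>

lemma kk_branch:
	assumes N: "N \<noteq> 0" and x: "- 1 < x $ 2" "x $ 2 < 1" "\<bar>x $ 1\<bar> <= 1"
		and m: "of_int m <= real N * x $ 2" "real N * x $ 2 < of_int m + 1"
	shows "real N * x $ 2 - of_int m <= (2 - x $ 1) / 4 ==> kk N x = (2 + x $ 1) * (real N * x $ 2 - of_int m) / real N"
		"(2 - x $ 1) / 4 <= real N * x $ 2 - of_int m ==> kk N x = (2 - x $ 1) * (1 - (real N * x $ 2 - of_int m)) / real N"
proof -
	define r where "r = real N * x $ 2 - of_int m"
	have k: "kk N x = min ((2 + x $ 1) * r) ((2 - x $ 1) * (1 - r)) / real N"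
		using kk_eq[OF N x] frac_unique_floor[OF m] by (simp add: r_def)
	have d: "(2 - x $ 1) * (1 - r) - (2 + x $ 1) * r = 2 - x $ 1 - 4 * r" by (simp add: algebra_simps)
	show "kk N x = (2 + x $ 1) * (real N * x $ 2 - of_int m) / real N" if "real N * x $ 2 - of_int m <= (2 - x $ 1) / 4"
	proof -
		have "0 <= (2 - x $ 1) * (1 - r) - (2 + x $ 1) * r" using that unfolding d r_def[symmetric] by (simp add: field_simps)
		then have "(2 + x $ 1) * r <= (2 - x $ 1) * (1 - r)" by (simp only: diff_ge_0_iff_ge)
		then show ?thesis unfolding k r_def[symmetric] by (simp add: min_absorb1)
	qed
	show "kk N x = (2 - x $ 1) * (1 - (real N * x $ 2 - of_int m)) / real N" if "(2 - x $ 1) / 4 <= real N * x $ 2 - of_int m"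
	proof -
		have "(2 - x $ 1) * (1 - r) - (2 + x $ 1) * r <= 0" using that unfolding d r_def[symmetric] by (simp add: field_simps)
		then have "(2 - x $ 1) * (1 - r) <= (2 + x $ 1) * r" by (simp only: diff_le_0_iff_le)
		then show ?thesis unfolding k r_def[symmetric] by (simp add: min_absorb2)
	qed
qed

text \<open>A line in direction 1 crosses at most one interface since the volume fraction is
  monotone in x_1, a line in direction 2 meets 2 N layers, and in direction 3 the phase is
  constant.\<close>

lemma lam_step_line:
	assumes N: "N \<noteq> 0" and x: "x \<in> Omega"
	shows "step_line (2 * N) (%t. lam N (upd x i t))"
proof -
	have x1: "- 1 < x $ 1" "x $ 1 < 1" using x by (auto simp: Omega_def)
	consider "i = 1" | "i = 2" | "i = 3" using exhaust_3 by blast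
	then show ?thesis
	proof cases
		case 1
		\<comment> \<open>The value of x_1 at which the volume fraction (2 - x_1) / 4 equals the fixed
		  fractional part. It may lie outside (-1,1), hence the clamped endpoint below.\<close>
		define t0 where "t0 = 2 - 4 * frac (real N * x $ 2)"
		have e: "lam N (upd x i t) = (if t < t0 then 1 else - 1)" for t
			using 1 by (auto simp: lam_def t0_def field_simps)
		show ?thesis unfolding step_line_def e
		proof (rule exI[of _ "{0}"], rule exI[of _ "%_. - 1"], rule exI[of _ "%_. max (- 1) (min 1 t0)"], rule exI[of _ "{t0}"], intro conjI allI impI)
			fix t :: real assume "- 1 < t" "t < 1" "t \<notin> {t0}"
			then show "(if t < t0 then 1 else - 1) = 2 * (\<Sum>m\<in>{0::int}. indicator {- 1..max (- 1) (min 1 t0)} t) - (1 :: real)"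
				by (auto simp: indicator_def)
		qed (use N in auto)
	next
		case 2
		define b where "b = (2 - x $ 1) / 4"
		have b: "0 < b" "b < 1" using x1 by (simp_all add: b_def)
		have e: "lam N (upd x i t) = (if frac (real N * t) < b then 1 else - 1)" for t
			using 2 by (simp add: lam_def b_def)
		let ?I = "{- int N..<int N}" and ?\<alpha> = "%m :: int. of_int m / real N" and ?\<beta> = "%m :: int. (of_int m + b) / real N"
		show ?thesis unfolding step_line_def e
		proof (rule exI[of _ ?I], rule exI[of _ ?\<alpha>], rule exI[of _ ?\<beta>], rule exI[of _ "?\<beta> ` ?I"], intro conjI allI impI ballI)
			fix m assume m: "m \<in> ?I"
			then have "- int N <= m" "m + 1 <= int N" by auto
			then have "of_int (- int N) <= (of_int m :: real)" "of_int (m + 1) <= (of_int (int N) :: real)" by (simp_all only: of_int_le_iff)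
			then have "- real N <= of_int m" "of_int m + 1 <= real N" by simp_all
			then show "- 1 <= ?\<alpha> m" "?\<alpha> m <= ?\<beta> m" "?\<beta> m <= 1" using N b by (simp_all add: field_simps)
		next
			fix t :: real assume t: "- 1 < t" "t < 1" "t \<notin> ?\<beta> ` ?I"
			let ?m = "\<lfloor>real N * t\<rfloor>"
			have m: "?m \<in> ?I" using floor_range[OF t(1,2), of N] N by simp
			have "indicator {?\<alpha> m..?\<beta> m} t = (if m = ?m then (if frac (real N * t) < b then 1 else 0) else (0 :: real))" if "m \<in> ?I" for m
			proof -
				have i: "t \<in> {?\<alpha> m..?\<beta> m} \<longleftrightarrow> of_int m <= real N * t \<and> real N * t <= of_int m + b"
					using N by (auto simp: field_simps)
				have ne: "real N * t \<noteq> of_int m + b" using t(3) that N by (auto simp: field_simps)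
				show ?thesis
				proof (cases "m = ?m")
					case True
					then have "frac (real N * t) = real N * t - of_int m" "of_int m <= real N * t" by (simp_all add: frac_def)
					then show ?thesis using True i ne by (auto simp: indicator_def)
				next
					case False
					have "\<not> (of_int m <= real N * t \<and> real N * t <= of_int m + b)"
					proof
						assume "of_int m <= real N * t \<and> real N * t <= of_int m + b"
						then have "?m = m" using b by (intro floor_unique) auto
						then show False using False by simp
					qed
					then show ?thesis using False i by (simp add: indicator_def)
				qed
			qed
			then have "(\<Sum>m\<in>?I. indicator {?\<alpha> m..?\<beta> m} t) = (\<Sum>m\<in>?I. if m = ?m then (if frac (real N * t) < b then 1 else 0) else (0 :: real))"
				by (rule sum.cong[OF refl])
			also have "... = (if frac (real N * t) < b then 1 else 0)" using m by (subst sum.delta) auto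
			finally show "(if frac (real N * t) < b then 1 else - 1) = 2 * (\<Sum>m\<in>?I. indicator {?\<alpha> m..?\<beta> m} t) - (1 :: real)" by simp
		qed auto
	next
		case 3
		have e: "lam N (upd x i t) = lam N x" for t using 3 by (simp add: lam_def)
		have v: "lam N x = 1 \<or> lam N x = - 1" by (simp add: lam_def)
		show ?thesis unfolding step_line_def e
			by (rule exI[of _ "if lam N x = 1 then {0} else {}"], rule exI[of _ "%_. - 1"], rule exI[of _ "%_. 1"], rule exI[of _ "{}"]) (use N v in auto)
	qed
qed

text \<open>The gradient of \<open>kk N\<close> away from interfaces and cell boundaries. Its
  x_1-component has size at most 1 / N and is the only source of elastic energy in the
  laminate.\<close>

definition kder :: "nat \<Rightarrow> 3 \<Rightarrow> real ^ 3 \<Rightarrow> real" where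
	"kder N j x = (if j = 1 then (if lam N x = 1 then frac (real N * x $ 2) else frac (real N * x $ 2) - 1) / real N
		else if j = 2 then (if lam N x = 1 then 2 + x $ 1 else x $ 1 - 2) else 0)"

lemma lam_measurable [measurable]: "lam N \<in> borelf"
	unfolding lam_def[abs_def] frac_def by measurable

lemma bB_kder: "bB (kder N j)"
proof -
	have "\<bar>kder N j x\<bar> <= 3 + 1 / real N" if "x \<in> Omega" for x
	proof -
		have "\<bar>x $ 1\<bar> <= 1" using that by (auto simp: Omega_def abs_le_iff less_imp_le minus_le_iff)
		moreover have "0 <= frac (real N * x $ 2)" "frac (real N * x $ 2) <= 1" by (simp_all add: less_imp_le frac_lt_1)
		moreover have "\<bar>frac (real N * x $ 2) / real N\<bar> <= 1 / real N" "\<bar>(frac (real N * x $ 2) - 1) / real N\<bar> <= 1 / real N"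
			using calculation(2,3) by (simp_all add: divide_right_mono)
		moreover define c where "c = 1 / real N"
		moreover have "0 <= c" by (simp add: c_def)
		ultimately show ?thesis unfolding kder_def c_def[symmetric] by auto
	qed
	moreover have "kder N j \<in> borelf" unfolding kder_def[abs_def] frac_def by measurable
	ultimately show ?thesis unfolding bB_def by blast
qed

lemma W_kk:
	assumes N: "N \<noteq> 0"
	shows "W (kk N) (%j x. indicator Omega x * kder N j x)"
proof (rule line_acz_imp_W)
	have kc: "continuous_on UNIV (kk N)" unfolding kk_def[abs_def] by (intro continuous_intros)
	then show "bB (kk N)" by (rule bB_cont)
	show "bB (kder N j)" for j by (rule bB_kder)
	fix i and x :: "real ^ 3" assume x: "x \<in> Omega"
	have x1: "- 1 < x $ 1" "x $ 1 < 1" "- 1 < x $ 2" "x $ 2 < 1" using x by (auto simp: Omega_def)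
	have N0: "0 < real N" using N by simp
	have cu: "continuous_on {- 1..1} (%t. upd x i t)"
		unfolding upd_def
	proof (rule continuous_on_vec_lambda)
		fix j show "continuous_on {- 1..1} (%t. if j = i then t else x $ j)" by (cases "j = i") simp_all
	qed
	have c: "continuous_on {- 1..1} (%t. kk N (upd x i t))" by (rule continuous_on_compose2[OF kc cu]) simp
	have "\<exists>S. finite S \<and> (\<forall>t. - 1 < t \<and> t < 1 \<and> t \<notin> S \<longrightarrow> ((%t. kk N (upd x i t)) has_real_derivative kder N i (upd x i t)) (at t))"
	proof -
		consider "i = 1" | "i = 2" | "i = 3" using exhaust_3 by blast
		then show ?thesis
		proof cases
			case 1
			let ?r = "frac (real N * x $ 2)" and ?m = "\<lfloor>real N * x $ 2\<rfloor>"
			define t0 where "t0 = 2 - 4 * ?r"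
			have mr: "of_int ?m <= real N * x $ 2" "real N * x $ 2 < of_int ?m + 1" by linarith+
			have r: "real N * x $ 2 - of_int ?m = ?r" by (simp add: frac_def)
			have d: "((%t. kk N (upd x i t)) has_real_derivative kder N i (upd x i t)) (at t)" if t: "- 1 < t" "t < 1" "t \<noteq> t0" for t
			proof (cases "t < t0")
				case True
				then have "?r < (2 - t) / 4" by (simp add: t0_def)
				then have k: "kder N i (upd x i t) = ?r / real N" using 1 by (simp add: kder_def lam_def)
				have "((%t. (2 + t) * ?r / real N) has_real_derivative ?r / real N) (at t)"
					using N0 by (auto intro!: derivative_eq_intros)
				then show ?thesis unfolding k
				proof (rule has_field_derivative_transform_within_open[of _ _ _ "{- 1<..<1} \<inter> {..<t0}"])
					fix s assume s: "s \<in> {- 1<..<1} \<inter> {..<t0}"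
					then have s1: "\<bar>s\<bar> <= 1" by auto
					have "real N * upd x 1 s $ 2 - of_int ?m <= (2 - upd x 1 s $ 1) / 4" using s r by (simp add: t0_def field_simps)
					then have "kk N (upd x 1 s) = (2 + s) * (real N * x $ 2 - of_int ?m) / real N"
						using kk_branch(1)[OF N, of "upd x 1 s" ?m] s s1 mr x1 by simp
					then show "(2 + s) * ?r / real N = kk N (upd x i s)" using 1 r by simp
				qed (use t True in auto)
			next
				case False
				then have tt: "t0 < t" using t by simp
				then have "\<not> ?r < (2 - t) / 4" by (simp add: t0_def)
				then have k: "kder N i (upd x i t) = (?r - 1) / real N" using 1 by (simp add: kder_def lam_def)
				have "((%t. (2 - t) * (1 - ?r) / real N) has_real_derivative (?r - 1) / real N) (at t)"
					using N0 by (auto intro!: derivative_eq_intros)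
				then show ?thesis unfolding k
				proof (rule has_field_derivative_transform_within_open[of _ _ _ "{- 1<..<1} \<inter> {t0<..}"])
					fix s assume s: "s \<in> {- 1<..<1} \<inter> {t0<..}"
					then have s1: "\<bar>s\<bar> <= 1" by auto
					have "(2 - upd x 1 s $ 1) / 4 <= real N * upd x 1 s $ 2 - of_int ?m" using s r by (simp add: t0_def field_simps)
					then have "kk N (upd x 1 s) = (2 - s) * (1 - (real N * x $ 2 - of_int ?m)) / real N"
						using kk_branch(2)[OF N, of "upd x 1 s" ?m] s s1 mr x1 by simp
					then show "(2 - s) * (1 - ?r) / real N = kk N (upd x i s)" using 1 r by simp
				qed (use t tt in auto)
			qed
			show ?thesis by (rule exI[of _ "{t0}"]) (use d in auto)
		next
			case 2
			define b where "b = (2 - x $ 1) / 4"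
			have b: "0 < b" "b < 1" using x1 by (simp_all add: b_def)
			let ?I = "{- int N..<int N}"
			\<comment> \<open>Cell boundaries and interfaces, where the x_2-slope of \<open>kk N\<close>
			  jumps.\<close>
			define S where "S = (%m. of_int m / real N) ` ?I \<union> (%m. (of_int m + b) / real N) ` ?I"
			have d: "((%t. kk N (upd x i t)) has_real_derivative kder N i (upd x i t)) (at t)" if t: "- 1 < t" "t < 1" "t \<notin> S" for t
			proof -
				define m where "m = \<lfloor>real N * t\<rfloor>"
				have mI: "m \<in> ?I" using floor_range[OF t(1,2), of N] N by (simp add: m_def)
				have "t \<noteq> of_int m / real N" "t \<noteq> (of_int m + b) / real N" using t(3) mI by (auto simp: S_def)
				then have ne: "real N * t \<noteq> of_int m" "real N * t \<noteq> of_int m + b" using N0 by (auto simp: field_simps)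
				have mr: "of_int m < real N * t" "real N * t < of_int m + 1" using ne(1) unfolding m_def by linarith+
				have fr: "frac (real N * t) = real N * t - of_int m" by (simp add: frac_def m_def)
				have lm: "lam N (upd x 2 t) = (if frac (real N * t) < b then 1 else - 1)" by (simp add: lam_def b_def)
				have op: "open {s. - 1 < s \<and> s < 1 \<and> of_int m < real N * s \<and> real N * s < of_int m + b}"
					"open {s. - 1 < s \<and> s < 1 \<and> of_int m + b < real N * s \<and> real N * s < of_int m + 1}"
					by (intro open_Collect_conj open_Collect_less continuous_intros)+
				show ?thesis
				proof (cases "real N * t < of_int m + b")
					case True
					have "frac (real N * t) < b" using True fr by linarith
					then have k: "kder N i (upd x i t) = 2 + x $ 1" using 2 by (simp add: kder_def lm)
					have "((%s. (2 + x $ 1) * (real N * s - of_int m) / real N) has_real_derivative 2 + x $ 1) (at t)"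
						using N0 by (auto intro!: derivative_eq_intros)
					then show ?thesis unfolding k
					proof (rule has_field_derivative_transform_within_open[OF _ op(1)])
						fix s assume s: "s \<in> {s. - 1 < s \<and> s < 1 \<and> of_int m < real N * s \<and> real N * s < of_int m + b}"
						then have "real N * s - of_int m <= b" by simp
						then have "real N * upd x 2 s $ 2 - of_int m <= (2 - upd x 2 s $ 1) / 4" by (simp add: b_def)
						moreover have "real N * s < of_int m + 1" using s b by simp
						ultimately show "(2 + x $ 1) * (real N * s - of_int m) / real N = kk N (upd x i s)"
							using kk_branch(1)[OF N, of "upd x 2 s" m] s x1 2 by simp
					qed (use t True mr in auto)
				next
					case False
					then have tt: "of_int m + b < real N * t" using ne by simp
					have "\<not> frac (real N * t) < b" using tt fr by linarith
					then have k: "kder N i (upd x i t) = x $ 1 - 2" using 2 by (simp add: kder_def lm)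
					have "((%s. (2 - x $ 1) * (1 - (real N * s - of_int m)) / real N) has_real_derivative x $ 1 - 2) (at t)"
						using N0 by (auto intro!: derivative_eq_intros simp: field_simps)
					then show ?thesis unfolding k
					proof (rule has_field_derivative_transform_within_open[OF _ op(2)])
						fix s assume s: "s \<in> {s. - 1 < s \<and> s < 1 \<and> of_int m + b < real N * s \<and> real N * s < of_int m + 1}"
						then have "b <= real N * s - of_int m" by simp
						then have "(2 - upd x 2 s $ 1) / 4 <= real N * upd x 2 s $ 2 - of_int m" by (simp add: b_def)
						moreover have "of_int m < real N * s" using s b by simp
						ultimately show "(2 - x $ 1) * (1 - (real N * s - of_int m)) / real N = kk N (upd x i s)"
							using kk_branch(2)[OF N, of "upd x 2 s" m] s x1 2 by simp
					qed (use t tt mr in auto)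
				qed
			qed
			have "finite S" by (simp add: S_def)
			then show ?thesis by (intro exI[of _ S]) (use d in auto)
		next
			case 3
			have "kk N (upd x i t) = kk N x" for t using 3 by (simp add: kk_def)
			then show ?thesis using 3 by (intro exI[of _ "{}"]) (simp add: kder_def)
		qed
	qed
	with c show "continuous_on {- 1..1} (%t. kk N (upd x i t)) \<and>
		(\<exists>S. finite S \<and> (\<forall>t. - 1 < t \<and> t < 1 \<and> t \<notin> S \<longrightarrow> ((%t. kk N (upd x i t)) has_real_derivative kder N i (upd x i t)) (at t)))"
		by blast
qed

text \<open>The bilinear part has e_12 = e_13 = 0 and e_23 = - \<sigma> x_1 / 2. The corrector adds
  \<sigma> (x_1 + 2) / 2 or \<sigma> (x_1 - 2) / 2 to e_23, giving \<plusminus>1, and disturbs e_13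
  by O(1 / N). The variation bound is 8 N times the face area in each of three directions.\<close>

lemma laminate_test:
	assumes \<epsilon>: "0 <= \<epsilon>" and N: "N \<noteq> 0" and \<sigma>: "\<sigma> = 1 \<or> \<sigma> = - 1"
	shows "\<exists>u \<in> W12_vec Omega. total_energy \<epsilon> u <= ennreal (4 / (real N)\<^sup>2 + \<epsilon> * (24 * real N * measure Qf face)) \<and> M' u = \<sigma> * m2 / 2"
proof -
	\<comment> \<open>The double negation writes the sum as a difference, the form to which
	  \<open>W_diff\<close> applies.\<close>
	define u :: "real ^ 3 \<Rightarrow> real ^ 3" where "u x = (\<chi> i. if i = 1 then \<sigma> / 2 * (x $ 2 * x $ 3) else if i = 2 then - \<sigma> / 2 * (x $ 1 * x $ 3)
		else - \<sigma> / 2 * (x $ 1 * x $ 2) - (- \<sigma>) * kk N x)" for x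
	define q :: "3 \<Rightarrow> 3 \<Rightarrow> real ^ 3 \<Rightarrow> real" where "q i j x = (if i = 1 then \<sigma> / 2 * (if j = 2 then x $ 3 else if j = 3 then x $ 2 else 0)
		else if i = 2 then - \<sigma> / 2 * (if j = 1 then x $ 3 else if j = 3 then x $ 1 else 0)
		else - \<sigma> / 2 * (if j = 1 then x $ 2 else if j = 2 then x $ 1 else 0) - (- \<sigma>) * kder N j x)" for i j x
	have Wk: "W (%x. (- \<sigma>) * kk N x) (%j x. indicator Omega x * ((- \<sigma>) * kder N j x))"
	proof -
		have z: "W (%x. 0) (%j x. 0)" using W_bilinear[of 1 2 0] by simp
		have "W (%x. - kk N x) (%j x. - (indicator Omega x * kder N j x))" using W_diff[OF z W_kk[OF N]] by simp
		then show ?thesis using \<sigma> W_kk[OF N] by (elim disjE) (simp_all only: minus_mult_minus mult_minus1 mult_minus_right minus_minus mult_1)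
	qed
	have W3: "W (%x. - \<sigma> / 2 * (x $ 1 * x $ 2) - (- \<sigma>) * kk N x) (%j x. indicator Omega x *
			(- \<sigma> / 2 * (if j = 1 then x $ 2 else if j = 2 then x $ 1 else 0) - (- \<sigma>) * kder N j x))"
		using W_diff[OF W_bilinear[of 1 2 "- \<sigma> / 2"] Wk] unfolding right_diff_distrib by simp
	have W: "W (%x. u x $ i) (%j x. indicator Omega x * q i j x)" for i
	proof -
		consider "i = 1" | "i = 2" | "i = 3" using exhaust_3 by blast
		then show ?thesis
		proof cases
			case 1 then show ?thesis using W_bilinear[of 2 3 "\<sigma> / 2"] by (simp add: u_def q_def)
		next
			case 2 then show ?thesis using W_bilinear[of 1 3 "- \<sigma> / 2"] by (simp add: u_def q_def)
		next
			case 3 then show ?thesis using W3 by (simp add: u_def q_def)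
		qed
	qed
	have bl: "bB (%x. \<sigma> * lam N x)"
	proof -
		have "\<bar>\<sigma> * lam N x\<bar> <= 1" for x using \<sigma> by (auto simp: lam_def)
		then show ?thesis by (auto simp: bB_def intro!: exI[of _ 1])
	qed
	have bl': "bB (lam N)" by (auto simp: bB_def lam_def intro!: exI[of _ 1])
	have e: "(q 2 3 x + q 3 2 x) / 2 = \<sigma> * lam N x" for x
	proof (cases "lam N x = 1")
		case True
		then show ?thesis by (simp add: q_def kder_def algebra_simps)
	next
		case False
		then have "lam N x = - 1" by (simp add: lam_def split: if_splits)
		then show ?thesis by (simp add: q_def kder_def algebra_simps)
	qed
	have e1: "\<bar>\<sigma> * lam N x\<bar> = 1" for x using \<sigma> by (auto simp: lam_def)
	have b: "elin q x <= 1 / (2 * (real N)\<^sup>2)" if "x \<in> Omega" for x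
	proof -
		let ?r = "frac (real N * x $ 2)"
		have r: "0 <= ?r" "?r <= 1" by (simp_all add: less_imp_le frac_lt_1)
		have s: "q 1 3 x + q 3 1 x = \<sigma> * kder N 1 x" "q 1 1 x = 0" "q 2 2 x = 0" "q 3 3 x = 0" "q 1 2 x + q 2 1 x = 0"
			by (simp_all add: q_def kder_def)
		have "(kder N 1 x)\<^sup>2 <= (1 / real N)\<^sup>2"
		proof (rule abs_le_square_iff[THEN iffD1])
			show "\<bar>kder N 1 x\<bar> <= \<bar>1 / real N\<bar>" using r by (auto simp: kder_def divide_right_mono)
		qed
		moreover have "\<sigma>\<^sup>2 = 1" using \<sigma> by auto
		ultimately show ?thesis unfolding elin_def s by (simp add: power_mult_distrib power_divide)
	qed
	have tv: "(LINT x|Q. \<sigma> * lam N x * partial_deriv i \<psi> x) <= 8 * real N * measure Qf face" if \<psi>: "\<psi> \<in> C1_compact Omega" "\<And>x. \<bar>\<psi> x\<bar> <= 1" for i \<psi>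
	proof -
		have "\<bar>LINT x|Q. lam N x * partial_deriv i \<psi> x\<bar> <= 8 * real N * measure Qf face"
			using slice_variation[OF bl' lam_step_line[OF N] \<psi>, of i] by simp
		moreover have "(LINT x|Q. \<sigma> * lam N x * partial_deriv i \<psi> x) = \<sigma> * (LINT x|Q. lam N x * partial_deriv i \<psi> x)"
			unfolding mult.assoc by (rule integral_mult_right_zero)
		ultimately show ?thesis using \<sigma> by auto
	qed
	have n: "0 <= 1 / (2 * (real N)\<^sup>2)" "0 <= 8 * real N * measure Qf face" by simp_all
	note T = test_energy[of u q "%x. \<sigma> * lam N x" "1 / (2 * (real N)\<^sup>2)" "8 * real N * measure Qf face" \<epsilon>, OF W bl e e1 b n(1) tv n(2) \<epsilon>]
	have "M' u = (LINT x|Q. x $ 2 * (indicator Omega x * q 1 3 x))" by (rule T(3))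
	also have "... = (LINT x|Q. (\<sigma> / 2) * (x $ 2)\<^sup>2)"
		by (intro LINT_cong refl) (simp add: q_def power2_eq_square)
	also have "... = \<sigma> * m2 / 2" unfolding m2_def integral_mult_right_zero by simp
	finally have "M' u = \<sigma> * m2 / 2" .
	moreover have "u \<in> W12_vec Omega" by (rule T(1))
	moreover have "8 * (1 / (2 * (real N)\<^sup>2)) + \<epsilon> * (3 * (8 * real N * measure Qf face)) = 4 / (real N)\<^sup>2 + \<epsilon> * (24 * real N * measure Qf face)"
		by simp
	ultimately show ?thesis using T(2) by (intro bexI[of _ u] conjI) (simp_all only:)
qed

section \<open>The two bounds for the infimum\<close>

lemma enn2ereal_minus_le:
	assumes "t <= ennreal E" "0 <= E"
	shows "enn2ereal t - ereal r <= ereal (E - r)"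
proof -
	have "enn2ereal t <= enn2ereal (ennreal E)" using assms(1) by (simp add: less_eq_ennreal.rep_eq)
	then have "enn2ereal t - ereal r <= ereal E - ereal r" using assms(2) by (intro ereal_minus_mono) simp_all
	then show ?thesis by simp
qed

text \<open>Two regimes. If 2 B |g| <= e, half of the energy absorbs the term E / e. Otherwise the
  second bound on M is used, and the loss is compared with the linear entry of the minimum when |g|
  <= 1 and with the quadratic one when |g| > 1. The choice c = 4 B + B^2 covers all these
  losses.\<close>

lemma lower_scalar:
	fixes B c e g M E :: real
	assumes B: "1 <= B" and c: "c = 4 * B + B\<^sup>2" and e: "0 < e" and E: "0 <= E"
		and M: "\<bar>M\<bar> <= B * (sqrt E + E / e)" "\<bar>M\<bar> <= B * (1 + sqrt E)"
	shows "c * min (- g\<^sup>2) (1 / c\<^sup>2 * e - \<bar>g\<bar>) <= E - g * M"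
proof -
	define s where "s = sqrt E"
	define a where "a = \<bar>g\<bar>"
	have s: "0 <= s" "s\<^sup>2 = E" using E by (simp_all add: s_def)
	have a: "0 <= a" "g\<^sup>2 = a\<^sup>2" by (simp_all add: a_def)
	have "1 <= B\<^sup>2" using B by simp
	then have c1: "5 <= c" using B c by linarith
	have gM: "g * M <= a * \<bar>M\<bar>" unfolding a_def abs_mult[symmetric] by simp
	\<comment> \<open>Young's inequality; with \<theta> = 1 it uses up half of the energy, with
	  \<theta> = 2 all of it.\<close>
	have q: "B * a * s <= B\<^sup>2 * a\<^sup>2 / (2 * \<theta>) + \<theta> * s\<^sup>2 / 2" if "0 < \<theta>" for \<theta>
	proof -
		have "0 <= (B * a - \<theta> * s)\<^sup>2 / (2 * \<theta>)" using that by simp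
		also have "... = B\<^sup>2 * a\<^sup>2 / (2 * \<theta>) + \<theta> * s\<^sup>2 / 2 - B * a * s"
			using that by (simp add: power2_eq_square field_simps)
		finally show ?thesis by simp
	qed
	show ?thesis
	proof (cases "2 * B * a <= e")
		case True
		have "a * \<bar>M\<bar> <= a * (B * (s + E / e))" using M(1) a unfolding s_def by (intro mult_left_mono)
		also have "... = B * a * s + (B * a / e) * E" by (simp add: algebra_simps)
		also have "(B * a / e) * E <= 1 / 2 * E" using True e E by (intro mult_right_mono) (simp_all add: field_simps)
		finally have "g * M <= B * a * s + E / 2" using gM by simp
		moreover have "B * a * s <= B\<^sup>2 * a\<^sup>2 / 2 + s\<^sup>2 / 2" using q[of 1] by simp
		ultimately have "- (B\<^sup>2 * a\<^sup>2 / 2) <= E - g * M" using s by simp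
		moreover have "c * (- g\<^sup>2) <= - (B\<^sup>2 * a\<^sup>2 / 2)"
		proof -
			have "B\<^sup>2 / 2 * a\<^sup>2 <= c * a\<^sup>2" using B c by (intro mult_right_mono) simp_all
			then show ?thesis by (simp add: a)
		qed
		moreover have "c * min (- g\<^sup>2) (1 / c\<^sup>2 * e - \<bar>g\<bar>) <= c * (- g\<^sup>2)" using c1 by (intro mult_left_mono) auto
		ultimately show ?thesis by linarith
	next
		case False
		have "a * \<bar>M\<bar> <= a * (B * (1 + s))" using M(2) a unfolding s_def by (intro mult_left_mono)
		also have "... = B * a + B * a * s" by (simp add: algebra_simps)
		finally have "g * M <= B * a + (B\<^sup>2 * a\<^sup>2 / 4 + s\<^sup>2)" using gM q[of 2] by simp
		then have low: "- (B * a) - B\<^sup>2 * a\<^sup>2 / 4 <= E - g * M" using s by simp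
		have Ba: "0 <= B * a" "0 <= B\<^sup>2 * a" "0 <= B\<^sup>2 * a\<^sup>2" using B a by simp_all
		show ?thesis
		proof (cases "a <= 1")
			case True
			have "a\<^sup>2 <= a" using True a by (simp add: power2_eq_square mult_left_le)
			then have "B\<^sup>2 * a\<^sup>2 <= B\<^sup>2 * a" by (intro mult_left_mono) simp_all
			moreover have "c * (1 / c\<^sup>2 * e - \<bar>g\<bar>) <= - (B * a) - B\<^sup>2 * a / 4"
			proof -
				have "c * (1 / c\<^sup>2 * e - \<bar>g\<bar>) = e / c - c * a" using c1 by (simp add: a_def power2_eq_square field_simps)
				moreover have "e / c <= e" using c1 e by (simp add: divide_le_eq mult_le_cancel_left1)
				moreover have "c * a = 4 * (B * a) + B\<^sup>2 * a" unfolding c by (simp add: algebra_simps)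
				moreover have "e <= 2 * (B * a)" using False by simp
				ultimately show ?thesis using Ba by linarith
			qed
			moreover have "c * min (- g\<^sup>2) (1 / c\<^sup>2 * e - \<bar>g\<bar>) <= c * (1 / c\<^sup>2 * e - \<bar>g\<bar>)" using c1 by (intro mult_left_mono) auto
			ultimately show ?thesis using low by linarith
		next
			case False
			then have "a <= a\<^sup>2" by (simp add: power2_eq_square)
			then have "B * a <= B * a\<^sup>2" using B by (intro mult_left_mono) simp_all
			moreover have "c * (- g\<^sup>2) = - (4 * (B * a\<^sup>2)) - B\<^sup>2 * a\<^sup>2" unfolding c a by (simp add: algebra_simps)
			moreover have "0 <= B * a\<^sup>2" using B by simp
			moreover have "c * min (- g\<^sup>2) (1 / c\<^sup>2 * e - \<bar>g\<bar>) <= c * (- g\<^sup>2)" using c1 by (intro mult_left_mono) auto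
			ultimately show ?thesis using low Ba by linarith
		qed
	qed
qed

lemma infimum_lower:
	"\<exists>C\<ge>1. \<forall>c\<ge>C. \<forall>\<epsilon> \<gamma>. 0 < \<epsilon> \<and> \<epsilon> <= 1 \<longrightarrow>
		ereal (c * min (- \<gamma>\<^sup>2) (1 / c\<^sup>2 * \<epsilon> powr (2 / 3) - \<bar>\<gamma>\<bar>))
			<= (INF u \<in> (W12_vec Omega :: (real ^ 3 \<Rightarrow> real ^ 3) set). enn2ereal (total_energy \<epsilon> u) - ereal (\<gamma> * M' u))"
proof -
	obtain B where B: "1 <= B" and est: "\<forall>\<epsilon> u E. 0 < \<epsilon> \<and> \<epsilon> <= 1 \<and> u \<in> W12_vec Omega \<and> 0 <= E \<and> total_energy \<epsilon> u <= ennreal E \<longrightarrow>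
		\<bar>M' u\<bar> <= B * (sqrt E + E / \<epsilon> powr (2 / 3)) \<and> \<bar>M' u\<bar> <= B * (1 + sqrt E)"
		using energy_lower by (elim exE conjE)
	show ?thesis
	proof (intro exI[of _ "4 * B + B\<^sup>2"] conjI allI impI)
		show "1 <= 4 * B + B\<^sup>2" using B by (simp add: add_increasing2)
		fix c \<epsilon> \<gamma> :: real
		assume c: "4 * B + B\<^sup>2 <= c" and \<epsilon>: "0 < \<epsilon> \<and> \<epsilon> <= 1"
		\<comment> \<open>The solution of c = 4 B' + B'^2. Any c above the threshold thus amounts to using
		  the estimates with a larger constant.\<close>
		define B' where "B' = sqrt (4 + c) - 2"
		have cp: "0 <= c" using B c by (smt (verit) zero_le_power2)
		have BB: "B <= B'"
		proof -
			have "(B + 2)\<^sup>2 <= 4 + c" using c by (simp add: power2_eq_square algebra_simps)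
			then have "B + 2 <= sqrt (4 + c)" by (rule real_le_rsqrt)
			then show ?thesis by (simp add: B'_def)
		qed
		have cB: "c = 4 * B' + B'\<^sup>2"
		proof -
			have "(B' + 2)\<^sup>2 = 4 + c" using cp by (simp add: B'_def)
			then show ?thesis by (simp add: power2_eq_square algebra_simps)
		qed
		show "ereal (c * min (- \<gamma>\<^sup>2) (1 / c\<^sup>2 * \<epsilon> powr (2 / 3) - \<bar>\<gamma>\<bar>))
			<= (INF u \<in> W12_vec Omega. enn2ereal (total_energy \<epsilon> u) - ereal (\<gamma> * M' u))"
		proof (rule INF_greatest)
			fix u :: "real ^ 3 \<Rightarrow> real ^ 3" assume u: "u \<in> W12_vec Omega"
			show "ereal (c * min (- \<gamma>\<^sup>2) (1 / c\<^sup>2 * \<epsilon> powr (2 / 3) - \<bar>\<gamma>\<bar>)) <= enn2ereal (total_energy \<epsilon> u) - ereal (\<gamma> * M' u)"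
			proof (cases "total_energy \<epsilon> u")
				case (real E)
				have M: "\<bar>M' u\<bar> <= B * (sqrt E + E / \<epsilon> powr (2 / 3))" "\<bar>M' u\<bar> <= B * (1 + sqrt E)"
					using est[rule_format, of \<epsilon> u E] \<epsilon> u real by simp_all
				have "0 <= sqrt E + E / \<epsilon> powr (2 / 3)" "0 <= 1 + sqrt E" using real by simp_all
				then have M': "\<bar>M' u\<bar> <= B' * (sqrt E + E / \<epsilon> powr (2 / 3))" "\<bar>M' u\<bar> <= B' * (1 + sqrt E)"
					using order_trans[OF M(1) mult_right_mono[OF BB]] order_trans[OF M(2) mult_right_mono[OF BB]] by blast+
				have "c * min (- \<gamma>\<^sup>2) (1 / c\<^sup>2 * \<epsilon> powr (2 / 3) - \<bar>\<gamma>\<bar>) <= E - \<gamma> * M' u"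
					by (rule lower_scalar[OF order_trans[OF B BB] cB _ _ M']) (use \<epsilon> real in simp_all)
				then show ?thesis using real by (simp add: enn2ereal_ennreal)
			qed simp
		qed
	qed
qed

lemma infimum_upper:
	"\<exists>C\<ge>1. \<forall>c\<ge>C. \<forall>\<epsilon> \<gamma>. 0 < \<epsilon> \<and> \<epsilon> <= 1 \<longrightarrow>
		(INF u \<in> (W12_vec Omega :: (real ^ 3 \<Rightarrow> real ^ 3) set). enn2ereal (total_energy \<epsilon> u) - ereal (\<gamma> * M' u))
			<= ereal (1 / c * min (- \<gamma>\<^sup>2) (c\<^sup>2 * \<epsilon> powr (2 / 3) - \<bar>\<gamma>\<bar>))"
proof -
	let ?F = "measure Qf face"
	\<comment> \<open>The summand 4 + 48 F covers the laminate energy, 32 / m2^2 the quadratic gain of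
	  the elastic competitor, and 2 / m2 the linear gain of the laminate.\<close>
	define C where "C = 4 + 48 * ?F + 32 / m2\<^sup>2 + 2 / m2"
	have C4: "4 <= C" and CF: "4 + 48 * ?F <= C" and Cm: "32 / m2\<^sup>2 <= C" "2 / m2 <= C"
		using m2_pos by (simp_all add: C_def add_nonneg_nonneg)
	show ?thesis
	proof (intro exI[of _ C] conjI allI impI)
		show "1 <= C" using C4 by simp
		fix c \<epsilon> \<gamma> :: real
		assume c: "C <= c" and a: "0 < \<epsilon> \<and> \<epsilon> <= 1"
		then have \<epsilon>: "0 < \<epsilon>" "\<epsilon> <= 1" by auto
		have c0: "0 < c" using c C4 by simp
		define e where "e = \<epsilon> powr (2 / 3)"
		have e0: "0 < e" using \<epsilon> by (simp add: e_def)
		let ?INF = "INF u \<in> (W12_vec Omega :: (real ^ 3 \<Rightarrow> real ^ 3) set). enn2ereal (total_energy \<epsilon> u) - ereal (\<gamma> * M' u)"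
		have 1: "?INF <= ereal (1 / c * (- \<gamma>\<^sup>2))"
		proof -
			\<comment> \<open>t = m2 \<gamma> / 16 minimises 8 t^2 - \<gamma> m2 t.\<close>
			obtain u where u: "u \<in> W12_vec Omega" "total_energy \<epsilon> u <= ennreal (8 * (m2 * \<gamma> / 16)\<^sup>2)" "M' u = m2 * \<gamma> / 16 * m2"
				using elastic_test[of \<epsilon> "m2 * \<gamma> / 16"] \<epsilon> by auto
			have "?INF <= enn2ereal (total_energy \<epsilon> u) - ereal (\<gamma> * M' u)" by (rule INF_lower[OF u(1)])
			also have "... <= ereal (8 * (m2 * \<gamma> / 16)\<^sup>2 - \<gamma> * M' u)" by (rule enn2ereal_minus_le[OF u(2)]) simp
			also have "8 * (m2 * \<gamma> / 16)\<^sup>2 - \<gamma> * M' u = - (m2\<^sup>2 / 32 * \<gamma>\<^sup>2)" unfolding u(3) by (simp add: power2_eq_square)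
			also have "ereal (- (m2\<^sup>2 / 32 * \<gamma>\<^sup>2)) <= ereal (1 / c * (- \<gamma>\<^sup>2))"
			proof -
				have "32 <= c * m2\<^sup>2" using Cm(1) c m2_pos by (simp add: divide_le_eq order_trans[OF _ mult_right_mono[OF c]])
				then have "1 / c <= m2\<^sup>2 / 32" using c0 by (simp add: field_simps)
				then have "1 / c * \<gamma>\<^sup>2 <= m2\<^sup>2 / 32 * \<gamma>\<^sup>2" by (rule mult_right_mono) simp
				then show ?thesis by simp
			qed
			finally show ?thesis .
		qed
		have 2: "?INF <= ereal (1 / c * (c\<^sup>2 * e - \<bar>\<gamma>\<bar>))"
		proof -
			define r where "r = \<epsilon> powr (- (1 / 3))"
			\<comment> \<open>Of order \<epsilon>^(-1/3), which balances the elastic cost 1 / N^2 with the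
			  surface cost \<epsilon> N. Rounding up at most doubles \<open>r\<close>, because r >=
			  1.\<close>
			define N where "N = nat \<lceil>r\<rceil>"
			have r1: "1 <= r" using \<epsilon> powr_mono2'[of "- (1 / 3)" \<epsilon> 1] by (simp add: r_def)
			have N: "r <= real N" "real N <= 2 * r" "N \<noteq> 0" using r1 unfolding N_def by linarith+
			define \<sigma> :: real where "\<sigma> = (if 0 <= \<gamma> then 1 else - 1)"
			have \<sigma>: "\<sigma> = 1 \<or> \<sigma> = - 1" "\<gamma> * \<sigma> = \<bar>\<gamma>\<bar>" by (auto simp: \<sigma>_def)
			let ?E = "4 / (real N)\<^sup>2 + \<epsilon> * (24 * real N * ?F)"
			obtain u where u: "u \<in> W12_vec Omega" "total_energy \<epsilon> u <= ennreal ?E" "M' u = \<sigma> * m2 / 2"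
				using laminate_test[OF less_imp_le[OF \<epsilon>(1)] N(3) \<sigma>(1)] by blast
			have re: "1 / r\<^sup>2 = e" "\<epsilon> * r = e"
				using \<epsilon> by (simp_all add: r_def e_def powr_minus powr_add[symmetric] power2_eq_square field_simps)
			have "r\<^sup>2 <= (real N)\<^sup>2" using N(1) r1 by (intro power_mono) simp_all
			then have "4 / (real N)\<^sup>2 <= 4 / r\<^sup>2" using r1 by (intro divide_left_mono) simp_all
			also have "... = 4 * e" using re(1) by simp
			finally have E1: "4 / (real N)\<^sup>2 <= 4 * e" .
			have "\<epsilon> * (24 * real N * ?F) <= \<epsilon> * (24 * (2 * r) * ?F)" using N(2) \<epsilon> by (intro mult_left_mono mult_right_mono) simp_all
			also have "... = 48 * ?F * e" unfolding re(2)[symmetric] by simp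
			finally have E2: "\<epsilon> * (24 * real N * ?F) <= 48 * ?F * e" .
			have "?E <= (4 + 48 * ?F) * e" unfolding distrib_right using E1 E2 by linarith
			also have "... <= c * e" using CF c e0 by (intro mult_right_mono) simp_all
			finally have E: "?E <= c * e" .
			have "?INF <= enn2ereal (total_energy \<epsilon> u) - ereal (\<gamma> * M' u)" by (rule INF_lower[OF u(1)])
			also have "... <= ereal (?E - \<gamma> * M' u)" by (rule enn2ereal_minus_le[OF u(2)]) (use \<epsilon> in simp)
			also have "... <= ereal (1 / c * (c\<^sup>2 * e - \<bar>\<gamma>\<bar>))"
			proof -
				have "2 <= c * m2" using Cm(2) c m2_pos by (simp add: divide_le_eq order_trans[OF _ mult_right_mono[OF c]])
				then have "1 / c <= m2 / 2" using c0 by (simp add: field_simps)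
				then have "1 / c * \<bar>\<gamma>\<bar> <= m2 / 2 * \<bar>\<gamma>\<bar>" by (rule mult_right_mono) simp
				moreover have "\<gamma> * M' u = m2 / 2 * \<bar>\<gamma>\<bar>" unfolding u(3) \<sigma>(2)[symmetric] by simp
				moreover have "1 / c * (c\<^sup>2 * e - \<bar>\<gamma>\<bar>) = c * e - 1 / c * \<bar>\<gamma>\<bar>" using c0 by (simp add: right_diff_distrib power2_eq_square)
				ultimately show ?thesis using E by simp
			qed
			finally show ?thesis .
		qed
		show "?INF <= ereal (1 / c * min (- \<gamma>\<^sup>2) (c\<^sup>2 * \<epsilon> powr (2 / 3) - \<bar>\<gamma>\<bar>))"
			using 1 2 unfolding e_def min_def by simp
	qed
qed

theorem theorem2p4:
  "\<exists>c :: real. c > 0 \<and>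
    (\<forall>\<epsilon> \<gamma> :: real. 0 < \<epsilon> \<and> \<epsilon> \<le> 1 \<longrightarrow>
      ereal (c * min (- \<gamma>\<^sup>2) (1 / c\<^sup>2 * \<epsilon> powr (2 / 3) - \<bar>\<gamma>\<bar>))
        \<le> (INF u \<in> (W12_vec Omega :: (real ^ 3 \<Rightarrow> real ^ 3) set).
              enn2ereal (total_energy \<epsilon> u) - ereal (\<gamma> * M' u)) \<and>
      (INF u \<in> (W12_vec Omega :: (real ^ 3 \<Rightarrow> real ^ 3) set).
              enn2ereal (total_energy \<epsilon> u) - ereal (\<gamma> * M' u))
        \<le> ereal (1 / c * min (- \<gamma>\<^sup>2) (c\<^sup>2 * \<epsilon> powr (2 / 3) - \<bar>\<gamma>\<bar>)))"
proof -
	obtain A where A: "1 <= A" "\<forall>c\<ge>A. \<forall>\<epsilon> \<gamma>. 0 < \<epsilon> \<and> \<epsilon> <= 1 \<longrightarrow>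
		ereal (c * min (- \<gamma>\<^sup>2) (1 / c\<^sup>2 * \<epsilon> powr (2 / 3) - \<bar>\<gamma>\<bar>))
			<= (INF u \<in> (W12_vec Omega :: (real ^ 3 \<Rightarrow> real ^ 3) set). enn2ereal (total_energy \<epsilon> u) - ereal (\<gamma> * M' u))"
		using infimum_lower by (elim exE conjE)
	obtain B where B: "1 <= B" "\<forall>c\<ge>B. \<forall>\<epsilon> \<gamma>. 0 < \<epsilon> \<and> \<epsilon> <= 1 \<longrightarrow>
		(INF u \<in> (W12_vec Omega :: (real ^ 3 \<Rightarrow> real ^ 3) set). enn2ereal (total_energy \<epsilon> u) - ereal (\<gamma> * M' u))
			<= ereal (1 / c * min (- \<gamma>\<^sup>2) (c\<^sup>2 * \<epsilon> powr (2 / 3) - \<bar>\<gamma>\<bar>))"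
		using infimum_upper by (elim exE conjE)
	show ?thesis
		by (rule exI[of _ "max A B"]) (use A B in \<open>auto simp: less_max_iff_disj\<close>)
qed

end
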